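(* Let $\mathcal T$ be a Gaussian quantum Markov semigroup on $B(\Gamma(\mathbb C^d))$ admitting a normal invariant state, and let $\widetilde{\mathcal T}\in[\mathcal T]$ be a representative in normal form, with associated $d_0$, $\phi_1,\dots,\phi_{d_0}$, $\widetilde Z_-,\widetilde C_-,\widetilde\zeta_-$. Then there exists a Weyl operator $W$ acting on the first $d_0$ modes, $W:\Gamma(\mathbb C^{d_0})\to\Gamma(\mathbb C^{d_0})$, such that every normal invariant state for $\widetilde{\mathcal T}$ is of the form $$W^*\omega W\otimes\rho_\infty,$$ where $\omega$ is a (normal) state on $B(\Gamma(\mathbb C^{d_0}))$ that commutes with $\hat H:=\sum_{j=1}^{d_0}\phi_j a_j^\dagger a_j$, and $\rho_\infty$ is the quantum Gaussian state on the modes $d_0+1,\dots,d$ with mean and covariance $$m_\infty=-\int_0^\infty e^{s\widetilde Z_-^\sharp}\widetilde\zeta_-\,ds,\qquad \Sigma_\infty=\int_0^\infty e^{s\widetilde Z_-^\sharp}\widetilde C_-e^{s\widetilde Z_-}\,ds .$$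
   Context: Fock space and Weyl operators. $\Gamma(\mathbb C^d)$ is the bosonic Fock space with exponential vectors $e_z=\sum_n z^{\otimes n}/\sqrt{n!}$ (inner products linear in the second argument), $a_j,a_j^\dagger$ annihilation/creation operators of mode $j$. Weyl operators are the unitaries with $W(z)e_w=e^{-\|z\|^2/2-\langle z,w\rangle}e_{z+w}$, so $W(z+w)=e^{i\sigma(z,w)}W(z)W(w)$, $\sigma(z,w)=\Im\langle z,w\rangle$. $\mathbb C^d$ is identified with $\mathbb R^{2d}$ by $x+iy\mapsto(x,y)^T$; $\langle z,w\rangle_{\mathbb R}=\Re\langle z,w\rangle$; a real linear $A$ on $\mathbb C^d$ corresponds to a real matrix $\mathbf A$, with spectrum $\mathrm{Sp}(\mathbf A)$ computed on $\mathbb C^{2d}$; $A^\sharp$ is the adjoint for $\langle\cdot,\cdot\rangle_{\mathbb R}$. $\mathbf J=\begin{pmatrix}O&I\\-I&O\end{pmatrix}$. GQMS. A quantum Markov semigroup is a w*-continuous semigroup of normal completely positive unital maps on $B(\Gamma(\mathbb C^d))$. It is Gaussian with parameters $(Z,C,\zeta)$ ($Z,C$ real linear on $\mathbb C^d$, $C$ symmetric, $\mathbf C+i(\mathbf Z^T\mathbf J+\mathbf J\mathbf Z)\ge0$, $\zeta\in\mathbb C^d$) if $\mathcal T_t(W(z))=\exp(-\frac12\int_0^t\langle e^{sZ}z,Ce^{sZ}z\rangle_{\mathbb R}ds+i\int_0^t\langle\zeta,e^{sZ}z\rangle_{\mathbb R}ds)W(e^{tZ}z)$. A normal invariant state is a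 density operator $\rho$ with $\mathrm{tr}(\rho\mathcal T_t(x))=\mathrm{tr}(\rho x)$ for all $t,x$. Gaussian states. $\rho$ is a quantum Gaussian state with mean $m$ and covariance $S$ if $\mathrm{tr}(\rho W(z))=e^{-i\langle m,z\rangle_{\mathbb R}-\frac12\langle z,Sz\rangle_{\mathbb R}}$ for all $z$. Normal form. For $M$ real linear preserving $\sigma$ (symplectic), $U(M)$ is a unitary with $U(M)W(z)U(M)^*=W(Mz)$, $\mathcal T^M_t(x)=U(M)\mathcal T_t(U(M)^*xU(M))U(M)^*$, and $[\mathcal T]=\{\mathcal T^M\}$. If $\mathcal T$ has a normal invariant state there are $0\le d_0\le d$, $\phi_1,\dots,\phi_{d_0}\in\mathbb R$ and $\widetilde{\mathcal T}\in[\mathcal T]$ "in normal form", meaning that, with respect to $\mathbb C^d=\widetilde V_0\oplus\widetilde V_-$, where $\widetilde V_0$ (resp. $\widetilde V_-$) is the span of the first $d_0$ (resp. last $d-d_0$) canonical basis vectors, its parameters are $\widetilde Z=\widetilde Z_0\oplus\widetilde Z_-$, $\widetilde C=0\oplus\widetilde C_-$, $\widetilde\zeta=(\widetilde\zeta_0,\widetilde\zeta_-)$, with $\widetilde{\mathbf Z}_0=\begin{pmatrix}O&-\Phi\\\Phi&O\end{pmatrix}$, $\Phi=\mathrm{diag}(\phi_j)$, $\mathrm{Sp}(\widetilde{\mathbf Z}_-)\subseteq\{\Re z<0\}$, and $\widetilde\zeta_0\in\ker(\widetilde{\mathbf Z}_0)^\perp$. One identifies $\Gamma(\mathbb C^d)=\Gamma(\widetilde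 V_0)\otimes\Gamma(\widetilde V_-)$, $\Gamma(\widetilde V_0)=\Gamma(\mathbb C^{d_0})$. A state commutes with $\hat H$ if its density operator commutes with $e^{it\hat H}$ for all $t\in\mathbb R$. *)

theory Defs
  imports "HOL-Analysis.Analysis"
begin

section \<open>Operators on the Hilbert spaces of square-summable functions\<close>

text \<open>
  Hilbert spaces are carriers \<open>ell2 I\<close> of square-summable functions supported on an index
  set \<open>I\<close>; an index set (and not an index type) is needed because the number of modes in a
  tensor factor is a variable of the statement and may be \<open>0\<close>.  A bounded operator is a
  function on all vectors that vanishes outside the carrier, so that equality of operators is
  equality in HOL and composition of operators is \<open>\<circ>\<close>.
\<close>

type_synonym 'a vect = "'a \<Rightarrow> complex"
type_synonym 'a oper = "'a vect \<Rightarrow> 'a vect"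

definition ell2 :: "'a set \<Rightarrow> 'a vect set" where
  "ell2 I = {\<psi>. (\<forall>n. n \<notin> I \<longrightarrow> \<psi> n = 0) \<and> (\<lambda>n. (cmod (\<psi> n))\<^sup>2) summable_on UNIV}"

definition cip :: "'a vect \<Rightarrow> 'a vect \<Rightarrow> complex" where
  "cip \<phi> \<psi> = (\<Sum>\<^sub>\<infinity>n. cnj (\<phi> n) * \<psi> n)"

definition l2norm :: "'a vect \<Rightarrow> real" where
  "l2norm \<psi> = sqrt (\<Sum>\<^sub>\<infinity>n. (cmod (\<psi> n))\<^sup>2)"

definition ket :: "'a \<Rightarrow> 'a vect" where
  "ket n = (\<lambda>m. if m = n then 1 else 0)"

definition bounded_ops :: "'a set \<Rightarrow> 'a oper set" where
  "bounded_ops I = {A.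
     (\<forall>\<psi>\<in>ell2 I. A \<psi> \<in> ell2 I) \<and>
     (\<forall>\<psi>. \<psi> \<notin> ell2 I \<longrightarrow> A \<psi> = (\<lambda>n. 0)) \<and>
     (\<forall>\<phi>\<in>ell2 I. \<forall>\<psi>\<in>ell2 I. A (\<lambda>n. \<phi> n + \<psi> n) = (\<lambda>n. A \<phi> n + A \<psi> n)) \<and>
     (\<forall>c. \<forall>\<psi>\<in>ell2 I. A (\<lambda>n. c * \<psi> n) = (\<lambda>n. c * A \<psi> n)) \<and>
     (\<exists>K. \<forall>\<psi>\<in>ell2 I. l2norm (A \<psi>) \<le> K * l2norm \<psi>)}"

definition id_op :: "'a set \<Rightarrow> 'a oper" where
  "id_op I = (\<lambda>\<psi>. if \<psi> \<in> ell2 I then \<psi> else (\<lambda>n. 0))"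

definition add_op :: "'a oper \<Rightarrow> 'a oper \<Rightarrow> 'a oper" where
  "add_op A B = (\<lambda>\<psi> n. A \<psi> n + B \<psi> n)"

definition scale_op :: "complex \<Rightarrow> 'a oper \<Rightarrow> 'a oper" where
  "scale_op c A = (\<lambda>\<psi> n. c * A \<psi> n)"

definition adj_op :: "'a set \<Rightarrow> 'a oper \<Rightarrow> 'a oper" where
  "adj_op I A = (THE B. B \<in> bounded_ops I \<and>
     (\<forall>\<phi>\<in>ell2 I. \<forall>\<psi>\<in>ell2 I. cip (A \<phi>) \<psi> = cip \<phi> (B \<psi>)))"

definition unitary_ops :: "'a set \<Rightarrow> 'a oper set" where
  "unitary_ops I = {U \<in> bounded_ops I. adj_op I U \<circ> U = id_op I \<and> U \<circ> adj_op I U = id_op I}"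

text \<open>The trace is computed in the canonical orthonormal basis; it is only applied to products
  of a density operator and a bounded operator, for which the sum converges absolutely.\<close>

definition tr :: "'a set \<Rightarrow> 'a oper \<Rightarrow> complex" where
  "tr I A = (\<Sum>\<^sub>\<infinity>n\<in>I. cip (ket n) (A (ket n)))"

definition density_ops :: "'a set \<Rightarrow> 'a oper set" where
  "density_ops I = {\<rho> \<in> bounded_ops I.
     (\<forall>\<psi>\<in>ell2 I. cip \<psi> (\<rho> \<psi>) \<in> \<real>\<^sub>\<ge>\<^sub>0) \<and>
     ((\<lambda>n. cip (ket n) (\<rho> (ket n))) has_sum 1) I}"

text \<open>The w*-topology on the bounded operators.  Every trace class operator is a linear
  combination of density operators, so the functionals \<open>x \<mapsto> tr (\<rho> x)\<close> with \<open>\<rho>\<close> a density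
  operator generate the same topology as the whole predual.\<close>

definition wstar :: "'a set \<Rightarrow> 'a oper topology" where
  "wstar I = topology_generated_by
     {{x \<in> bounded_ops I. tr I (\<rho> \<circ> x) \<in> V} | \<rho> V. \<rho> \<in> density_ops I \<and> open V}"

text \<open>Strongly continuous unitary group \<open>t \<mapsto> exp (i t H)\<close> of a self-adjoint operator \<open>H\<close> with
  domain \<open>{\<psi> \<in> ell2 I. H \<psi> \<in> ell2 I}\<close> (Stone's theorem).  Requiring that the generator
  extends \<open>i H\<close> suffices, since a self-adjoint operator has no proper self-adjoint extension.\<close>

definition unitary_group :: "'a set \<Rightarrow> 'a oper \<Rightarrow> real \<Rightarrow> 'a oper" where
  "unitary_group I H = (THE U.
     (\<forall>t. U t \<in> unitary_ops I) \<and> U 0 = id_op I \<and> (\<forall>s t. U (s + t) = U s \<circ> U t) \<and>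
     (\<forall>\<psi>\<in>ell2 I. ((\<lambda>t. l2norm (\<lambda>n. U t \<psi> n - \<psi> n)) \<longlongrightarrow> 0) (at 0)) \<and>
     (\<forall>\<psi>\<in>ell2 I. H \<psi> \<in> ell2 I \<longrightarrow>
        ((\<lambda>t. l2norm (\<lambda>n. (U t \<psi> n - \<psi> n) / complex_of_real t - \<i> * H \<psi> n)) \<longlongrightarrow> 0) (at 0)))"


section \<open>Quantum Markov semigroups\<close>

definition linear_map :: "'a set \<Rightarrow> ('a oper \<Rightarrow> 'a oper) \<Rightarrow> bool" where
  "linear_map I T \<longleftrightarrow>
     (\<forall>x\<in>bounded_ops I. T x \<in> bounded_ops I) \<and>
     (\<forall>x\<in>bounded_ops I. \<forall>y\<in>bounded_ops I. T (add_op x y) = add_op (T x) (T y)) \<and>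
     (\<forall>c. \<forall>x\<in>bounded_ops I. T (scale_op c x) = scale_op c (T x))"

text \<open>Positivity of a \<open>k \<times> k\<close> matrix of operators, as an operator on the \<open>k\<close>-fold direct sum.\<close>

definition pos_op_matrix :: "'a set \<Rightarrow> nat \<Rightarrow> (nat \<Rightarrow> nat \<Rightarrow> 'a oper) \<Rightarrow> bool" where
  "pos_op_matrix I k X \<longleftrightarrow>
     (\<forall>\<psi>. (\<forall>i<k. \<psi> i \<in> ell2 I) \<longrightarrow> (\<Sum>i<k. \<Sum>j<k. cip (\<psi> i) (X i j (\<psi> j))) \<in> \<real>\<^sub>\<ge>\<^sub>0)"

definition completely_positive :: "'a set \<Rightarrow> ('a oper \<Rightarrow> 'a oper) \<Rightarrow> bool" where
  "completely_positive I T \<longleftrightarrow>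
     (\<forall>k X. (\<forall>i<k. \<forall>j<k. X i j \<in> bounded_ops I) \<longrightarrow> pos_op_matrix I k X \<longrightarrow>
        pos_op_matrix I k (\<lambda>i j. T (X i j)))"

text \<open>Normality of a positive map is continuity for the w*-topology.  A semigroup is
  constrained only at times \<open>t \<ge> 0\<close> and on bounded operators.\<close>

definition qms :: "'a set \<Rightarrow> (real \<Rightarrow> 'a oper \<Rightarrow> 'a oper) \<Rightarrow> bool" where
  "qms I T \<longleftrightarrow>
     (\<forall>t\<ge>0. linear_map I (T t) \<and> completely_positive I (T t) \<and> T t (id_op I) = id_op I \<and>
        continuous_map (wstar I) (wstar I) (T t)) \<and>
     (\<forall>x\<in>bounded_ops I. T 0 x = x) \<and>
     (\<forall>s\<ge>0. \<forall>t\<ge>0. \<forall>x\<in>bounded_ops I. T (s + t) x = T s (T t x)) \<and>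
     (\<forall>x\<in>bounded_ops I. continuous_map (top_of_set {0..}) (wstar I) (\<lambda>t. T t x))"

definition normal_invariant_state ::
    "'a set \<Rightarrow> (real \<Rightarrow> 'a oper \<Rightarrow> 'a oper) \<Rightarrow> 'a oper \<Rightarrow> bool" where
  "normal_invariant_state I T \<rho> \<longleftrightarrow> \<rho> \<in> density_ops I \<and>
     (\<forall>t\<ge>0. \<forall>x\<in>bounded_ops I. tr I (\<rho> \<circ> T t x) = tr I (\<rho> \<circ> x))"


section \<open>Real linear maps on \<open>\<complex>\<^sup>d\<close>\<close>

text \<open>\<open>\<complex>\<^sup>d\<close> is \<open>'n cspace\<close> with \<open>d = CARD('n)\<close>.  The library's inner product there is
  \<open>Re \<langle>z,w\<rangle>\<close>, so the library's \<open>norm\<close>, \<open>linear\<close> and \<open>adjoint\<close> are the norm, real linearity and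
  the real adjoint.\<close>

type_synonym 'n cspace = "(complex, 'n) vec"

definition hprod :: "'n::finite cspace \<Rightarrow> 'n cspace \<Rightarrow> complex" where
  "hprod z w = (\<Sum>i\<in>UNIV. cnj (z $ i) * w $ i)"

definition to_real :: "'n::finite cspace \<Rightarrow> real ^ ('n + 'n)" where
  "to_real z = (\<chi> k. case k of Inl i \<Rightarrow> Re (z $ i) | Inr i \<Rightarrow> Im (z $ i))"

definition of_real_vec :: "real ^ ('n::finite + 'n) \<Rightarrow> 'n cspace" where
  "of_real_vec v = (\<chi> i. Complex (v $ Inl i) (v $ Inr i))"

definition real_matrix :: "('n::finite cspace \<Rightarrow> 'n cspace) \<Rightarrow> real ^ ('n + 'n) ^ ('n + 'n)" where
  "real_matrix A = matrix (to_real \<circ> A \<circ> of_real_vec)"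

definition block_matrix ::
    "real ^ 'n ^ 'n \<Rightarrow> real ^ 'n ^ 'n \<Rightarrow> real ^ 'n ^ 'n \<Rightarrow> real ^ 'n ^ 'n \<Rightarrow>
     real ^ ('n + 'n) ^ ('n + 'n)" where
  "block_matrix A B C D = (\<chi> k l.
     case k of
       Inl i \<Rightarrow> (case l of Inl j \<Rightarrow> A $ i $ j | Inr j \<Rightarrow> B $ i $ j)
     | Inr i \<Rightarrow> (case l of Inl j \<Rightarrow> C $ i $ j | Inr j \<Rightarrow> D $ i $ j))"

definition diag_matrix :: "('n \<Rightarrow> real) \<Rightarrow> real ^ 'n ^ 'n" where
  "diag_matrix \<phi> = (\<chi> i j. if i = j then \<phi> i else 0)"

definition J_matrix :: "real ^ ('n::finite + 'n) ^ ('n + 'n)" where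
  "J_matrix = block_matrix 0 (mat 1) (- mat 1) 0"

definition complex_matrix :: "real ^ 'm ^ 'm \<Rightarrow> complex ^ 'm ^ 'm" where
  "complex_matrix M = (\<chi> k l. complex_of_real (M $ k $ l))"

definition psd_matrix :: "complex ^ 'm ^ 'm \<Rightarrow> bool" where
  "psd_matrix M \<longleftrightarrow> (\<forall>v. hprod v (M *v v) \<in> \<real>\<^sub>\<ge>\<^sub>0)"

definition coord_space :: "'n::finite set \<Rightarrow> ('n cspace) set" where
  "coord_space J = {z. \<forall>i. i \<notin> J \<longrightarrow> z $ i = 0}"

definition coord_proj :: "'n::finite set \<Rightarrow> 'n cspace \<Rightarrow> 'n cspace" where
  "coord_proj J z = (\<chi> i. if i \<in> J then z $ i else 0)"

text \<open>The block of \<open>A\<close> on \<open>coord_space J\<close>, extended by \<open>0\<close> on the complementary modes.\<close>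

definition compress :: "'n::finite set \<Rightarrow> ('n cspace \<Rightarrow> 'n cspace) \<Rightarrow> 'n cspace \<Rightarrow> 'n cspace" where
  "compress J A z = coord_proj J (A (coord_proj J z))"

text \<open>Spectrum of the block of \<open>A\<close> on \<open>coord_space J\<close>, computed on the complexification
  \<open>\<complex>\<^sup>2\<^sup>|\<^sup>J\<^sup>|\<close>: the extension by \<open>0\<close> does not contribute since eigenvectors live on \<open>J\<close>.\<close>

definition spectrum_on :: "'n::finite set \<Rightarrow> ('n cspace \<Rightarrow> 'n cspace) \<Rightarrow> complex set" where
  "spectrum_on J A = {\<mu>. \<exists>v. v \<noteq> 0 \<and> (\<forall>i. i \<notin> J \<longrightarrow> v $ Inl i = 0 \<and> v $ Inr i = 0) \<and>
     complex_matrix (real_matrix (compress J A)) *v v = \<mu> *s v}"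

definition lin_exp :: "('n::finite cspace \<Rightarrow> 'n cspace) \<Rightarrow> real \<Rightarrow> 'n cspace \<Rightarrow> 'n cspace" where
  "lin_exp A t z = (\<Sum>k. (t ^ k / fact k) *\<^sub>R (A ^^ k) z)"

definition symplectic :: "('n::finite cspace \<Rightarrow> 'n cspace) \<Rightarrow> bool" where
  "symplectic M \<longleftrightarrow> linear M \<and> (\<forall>z w. Im (hprod (M z) (M w)) = Im (hprod z w))"

definition first_modes :: "nat \<Rightarrow> 'n::{finite,linorder} set" where
  "first_modes k = {i. card {j. j < i} < k}"


section \<open>Fock space\<close>

text \<open>Occupation number realization: \<open>\<Gamma>(\<complex>\<^sup>J)\<close> is \<open>ell2 (occ J)\<close>, where \<open>ket n\<close> is the normalized
  symmetrization of the elementary tensor containing the \<open>i\<close>-th canonical basis vector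
  \<open>n i\<close> times.  Its coefficient in \<open>z\<^sup>\<otimes>\<^sup>N\<close>, \<open>N = \<Sum>i. n i\<close>, is
  \<open>sqrt (N! / \<Prod>i. (n i)!) * (\<Prod>i. z\<^sub>i ^ n i)\<close>, whence the formula for exponential vectors.\<close>

definition occ :: "'n set \<Rightarrow> ('n \<Rightarrow> nat) set" where
  "occ J = {n. \<forall>i. i \<notin> J \<longrightarrow> n i = 0}"

definition exp_vec :: "'n::finite cspace \<Rightarrow> ('n \<Rightarrow> nat) vect" where
  "exp_vec z = (\<lambda>n. \<Prod>i\<in>UNIV. (z $ i) ^ n i / complex_of_real (sqrt (fact (n i))))"

text \<open>The unbounded operators below act formally on arbitrary functions; the domain of the
  Hamiltonian enters in \<open>unitary_group\<close>.\<close>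

definition annihilation :: "'n \<Rightarrow> ('n \<Rightarrow> nat) oper" where
  "annihilation j \<psi> = (\<lambda>n. complex_of_real (sqrt (real (n j + 1))) * \<psi> (n(j := n j + 1)))"

definition creation :: "'n \<Rightarrow> ('n \<Rightarrow> nat) oper" where
  "creation j \<psi> = (\<lambda>n. complex_of_real (sqrt (real (n j))) * \<psi> (n(j := n j - 1)))"

definition hamiltonian :: "'n set \<Rightarrow> ('n \<Rightarrow> real) \<Rightarrow> ('n \<Rightarrow> nat) oper" where
  "hamiltonian J \<phi> \<psi> = (\<lambda>n. \<Sum>j\<in>J. complex_of_real (\<phi> j) * creation j (annihilation j \<psi>) n)"

definition weyl :: "'n::finite set \<Rightarrow> 'n cspace \<Rightarrow> ('n \<Rightarrow> nat) oper" where
  "weyl J z = (THE W. W \<in> unitary_ops (occ J) \<and>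
     (\<forall>w\<in>coord_space J. W (exp_vec w) =
        (\<lambda>n. exp (- complex_of_real ((norm z)\<^sup>2 / 2) - hprod z w) * exp_vec (z + w) n)))"

text \<open>The identification of \<open>\<Gamma>(\<complex>\<^sup>d)\<close> with \<open>\<Gamma>(\<complex>\<^sup>J) \<otimes> \<Gamma>(\<complex>\<^sup>-\<^sup>J)\<close>, with
  \<open>exp_vec (z + w) = tensor_vec J (exp_vec z) (exp_vec w)\<close> for \<open>z\<close> in \<open>coord_space J\<close> and
  \<open>w\<close> in \<open>coord_space (- J)\<close>.\<close>

definition tensor_vec ::
    "'n set \<Rightarrow> ('n \<Rightarrow> nat) vect \<Rightarrow> ('n \<Rightarrow> nat) vect \<Rightarrow> ('n \<Rightarrow> nat) vect" where
  "tensor_vec J u v = (\<lambda>n. u (\<lambda>i. if i \<in> J then n i else 0) * v (\<lambda>i. if i \<in> J then 0 else n i))"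

definition tensor_op ::
    "'n set \<Rightarrow> ('n \<Rightarrow> nat) oper \<Rightarrow> ('n \<Rightarrow> nat) oper \<Rightarrow> ('n \<Rightarrow> nat) oper" where
  "tensor_op J A B = (THE X. X \<in> bounded_ops (occ UNIV) \<and>
     (\<forall>u\<in>ell2 (occ J). \<forall>v\<in>ell2 (occ (- J)).
        X (tensor_vec J u v) = tensor_vec J (A u) (B v)))"

definition gaussian_state ::
    "'n::finite set \<Rightarrow> 'n cspace \<Rightarrow> ('n cspace \<Rightarrow> 'n cspace) \<Rightarrow> ('n \<Rightarrow> nat) oper \<Rightarrow> bool" where
  "gaussian_state J m S \<rho> \<longleftrightarrow> \<rho> \<in> density_ops (occ J) \<and>
     (\<forall>z\<in>coord_space J. tr (occ J) (\<rho> \<circ> weyl J z) =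
        exp (- \<i> * complex_of_real (m \<bullet> z) - complex_of_real (z \<bullet> S z / 2)))"

definition commutes_with :: "'a set \<Rightarrow> 'a oper \<Rightarrow> 'a oper \<Rightarrow> bool" where
  "commutes_with I \<omega> H \<longleftrightarrow>
     (\<forall>t. \<omega> \<circ> unitary_group I H t = unitary_group I H t \<circ> \<omega>)"


section \<open>Gaussian quantum Markov semigroups\<close>

type_synonym 'n semigroup = "real \<Rightarrow> ('n \<Rightarrow> nat) oper \<Rightarrow> ('n \<Rightarrow> nat) oper"

definition gaussian_qms ::
    "'n::finite semigroup \<Rightarrow> ('n cspace \<Rightarrow> 'n cspace) \<Rightarrow> ('n cspace \<Rightarrow> 'n cspace) \<Rightarrow>
     'n cspace \<Rightarrow> bool" where
  "gaussian_qms T Z C \<zeta> \<longleftrightarrow>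
     qms (occ UNIV) T \<and> linear Z \<and> linear C \<and> adjoint C = C \<and>
     psd_matrix (\<chi> k l. complex_of_real (real_matrix C $ k $ l) +
       \<i> * complex_of_real ((transpose (real_matrix Z) ** J_matrix + J_matrix ** real_matrix Z) $ k $ l)) \<and>
     (\<forall>t\<ge>0. \<forall>z. T t (weyl UNIV z) =
        scale_op
          (exp (- complex_of_real (integral {0..t} (\<lambda>s. lin_exp Z s z \<bullet> C (lin_exp Z s z)) / 2)
             + \<i> * complex_of_real (integral {0..t} (\<lambda>s. \<zeta> \<bullet> lin_exp Z s z))))
          (weyl UNIV (lin_exp Z t z)))"

definition metaplectic ::
    "('n::finite cspace \<Rightarrow> 'n cspace) \<Rightarrow> ('n \<Rightarrow> nat) oper \<Rightarrow> bool" where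
  "metaplectic M U \<longleftrightarrow> U \<in> unitary_ops (occ UNIV) \<and>
     (\<forall>z. U \<circ> weyl UNIV z \<circ> adj_op (occ UNIV) U = weyl UNIV (M z))"

definition conj_class :: "'n::finite semigroup \<Rightarrow> 'n semigroup set" where
  "conj_class T = {T'. \<exists>M U. symplectic M \<and> metaplectic M U \<and>
     (\<forall>t\<ge>0. \<forall>x\<in>bounded_ops (occ UNIV).
        T' t x = U \<circ> T t (adj_op (occ UNIV) U \<circ> x \<circ> U) \<circ> adj_op (occ UNIV) U)}"

text \<open>Normal form with \<open>d\<^sub>0\<close> and \<open>\<phi>\<close>; only the values of \<open>\<phi>\<close> on the first \<open>d\<^sub>0\<close> modes matter.\<close>

definition normal_form ::
    "'n::{finite,linorder} semigroup \<Rightarrow> nat \<Rightarrow> ('n \<Rightarrow> real) \<Rightarrow> ('n cspace \<Rightarrow> 'n cspace) \<Rightarrow>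
     ('n cspace \<Rightarrow> 'n cspace) \<Rightarrow> 'n cspace \<Rightarrow> bool" where
  "normal_form T d0 \<phi> Z C \<zeta> \<longleftrightarrow>
     gaussian_qms T Z C \<zeta> \<and> d0 \<le> CARD('n) \<and>
     (let J0 = first_modes d0; J1 = - J0 in
       (\<forall>z. Z z = compress J0 Z z + compress J1 Z z) \<and>
       (\<forall>z. C z = compress J1 C z) \<and>
       (\<forall>z\<in>coord_space J0. to_real (Z z) =
          block_matrix 0 (- diag_matrix \<phi>) (diag_matrix \<phi>) 0 *v to_real z) \<and>
       (\<forall>\<mu>\<in>spectrum_on J1 Z. Re \<mu> < 0) \<and>
       (\<forall>z\<in>coord_space J0. Z z = 0 \<longrightarrow> coord_proj J0 \<zeta> \<bullet> z = 0))"

end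

theory Submission
  imports Defs "HOL-Probability.Characteristic_Functions"
    "HOL-Computational_Algebra.Fundamental_Theorem_Algebra"
begin

text \<open>
  The characteristic function \<open>\<chi> z = tr (\<rho> W(z))\<close> of an invariant state satisfies
  \<open>\<chi> z = c\<^sub>t(z) \<chi> (e\<^bsup>tZ\<^esup> z)\<close>.  After multiplication by the phase of a suitable displacement \<open>u\<close>
  the drift on the rotating modes disappears, so \<open>\<chi>\<close> is constant along the rotation there, while
  \<open>e\<^bsup>tZ\<^esup>\<close> contracts the remaining modes to \<open>0\<close>; letting \<open>t \<rightarrow> \<infinity>\<close> and using continuity of \<open>\<chi>\<close>,
  \<open>\<chi> (z + w) = \<chi> z \<gamma> w\<close> with the Gaussian \<open>\<gamma>\<close> of the statement.  Since \<open>\<chi>\<close> determines the state,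
  \<open>\<rho>\<close> is the tensor product of its partial traces, the second of which is Gaussian, and rotation
  invariance of the first one is commutation with the group generated by the Hamiltonian.

  Density operators are handled as countable mixtures \<open>\<Sum>k. |v\<^sub>k><v\<^sub>k|\<close>, which turns traces into sums of
  matrix elements.  Injectivity of \<open>\<rho> \<mapsto> \<chi>\<close> comes from writing the vacuum projection of a mode as a
  Gaussian average of Weyl operators, one mode at a time.
\<close>

section \<open>Square-summable functions\<close>

text \<open>Points of the rotating modes need not settle as time grows, so the characteristic
  function is not followed along the flow itself: its values at the rotated point with and without a
  vanishing summand are compared, and uniform continuity on a ball closes the gap. The displacement
  results from integrating the drift along the rotation, which gives \<open>\<zeta> $ i\<close>
  divided by twice \<open>\<phi> i\<close>; the 2 is the one that conjugation by a Weyl operator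
  produces. That the Gaussian function of the statement is the characteristic function of a state is
  not derived from positivity of a covariance: the state is the partial trace of one invariant
  state, carried over to the representative by the metaplectic unitary. Adjoints, Weyl operators,
  tensor products and unitary groups are definite descriptions, so each of them rests on an
  existence and a uniqueness argument; uniqueness is checked on total families, the occupation basis
  or the exponential vectors.\<close>

lemma ell2_outside: "\<psi> \<in> ell2 I \<Longrightarrow> n \<notin> I \<Longrightarrow> \<psi> n = 0"
  by (simp add: ell2_def)

lemma ell2_summable: "\<psi> \<in> ell2 I \<Longrightarrow> (\<lambda>n. (cmod (\<psi> n))\<^sup>2) summable_on UNIV"
  by (simp add: ell2_def)

lemma summable_on_nonneg_comparison:
  fixes f g :: "'a \<Rightarrow> real"
  assumes "g summable_on A" "\<And>x. x \<in> A \<Longrightarrow> 0 \<le> f x" "\<And>x. x \<in> A \<Longrightarrow> f x \<le> g x"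
  shows "f summable_on A"
  using summable_on_comparison_test[OF assms(1)] assms(2,3) by auto

lemma ell2_dominated:
  assumes "\<psi> \<in> ell2 J" "\<And>n. cmod (\<phi> n) \<le> cmod (\<psi> n)" "\<And>n. n \<notin> I \<Longrightarrow> \<phi> n = 0"
  shows "\<phi> \<in> ell2 I"
proof -
  have "(\<lambda>n. (cmod (\<phi> n))\<^sup>2) summable_on UNIV"
    by (rule summable_on_nonneg_comparison[OF ell2_summable[OF assms(1)]])
       (simp_all add: assms(2) power_mono)
  then show ?thesis using assms(3) by (auto simp: ell2_def)
qed

lemma ell2_zero [simp]: "(\<lambda>n. 0) \<in> ell2 I"
  by (simp add: ell2_def)

lemma ell2_scale: "\<psi> \<in> ell2 I \<Longrightarrow> (\<lambda>n. c * \<psi> n) \<in> ell2 I"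
  by (auto simp: ell2_def norm_mult power_mult_distrib intro: summable_on_cmult_right)

lemma ell2_add:
  assumes "\<phi> \<in> ell2 I" "\<psi> \<in> ell2 I"
  shows "(\<lambda>n. \<phi> n + \<psi> n) \<in> ell2 I"
proof -
  have "(cmod (\<phi> n + \<psi> n))\<^sup>2 \<le> 2 * (cmod (\<phi> n))\<^sup>2 + 2 * (cmod (\<psi> n))\<^sup>2" for n
  proof -
    have "(cmod (\<phi> n + \<psi> n))\<^sup>2 \<le> (cmod (\<phi> n) + cmod (\<psi> n))\<^sup>2"
      by (simp add: norm_triangle_ineq power_mono)
    also have "\<dots> \<le> 2 * (cmod (\<phi> n))\<^sup>2 + 2 * (cmod (\<psi> n))\<^sup>2"
      using zero_le_power2[of "cmod (\<phi> n) - cmod (\<psi> n)"] by (simp add: power2_eq_square algebra_simps)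
    finally show ?thesis .
  qed
  moreover have "(\<lambda>n. 2 * (cmod (\<phi> n))\<^sup>2 + 2 * (cmod (\<psi> n))\<^sup>2) summable_on UNIV"
    using assms by (intro summable_on_add summable_on_cmult_right) (auto intro: ell2_summable)
  ultimately have "(\<lambda>n. (cmod (\<phi> n + \<psi> n))\<^sup>2) summable_on UNIV"
    using summable_on_nonneg_comparison[of "\<lambda>n. 2 * (cmod (\<phi> n))\<^sup>2 + 2 * (cmod (\<psi> n))\<^sup>2" UNIV "\<lambda>n. (cmod (\<phi> n + \<psi> n))\<^sup>2"] by simp
  then show ?thesis using assms by (auto simp: ell2_def)
qed

lemma ell2_diff:
  assumes "\<phi> \<in> ell2 I" "\<psi> \<in> ell2 I"
  shows "(\<lambda>n. \<phi> n - \<psi> n) \<in> ell2 I"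
  using ell2_add[OF assms(1) ell2_scale[OF assms(2), of "-1"]] by simp

lemma ell2_sum:
  assumes "finite F" "\<And>k. k \<in> F \<Longrightarrow> f k \<in> ell2 I"
  shows "(\<lambda>n. \<Sum>k\<in>F. f k n) \<in> ell2 I"
  using assms by (induction F rule: finite_induct) (auto intro: ell2_add)

lemma ell2_ket [simp]: "n \<in> I \<Longrightarrow> ket n \<in> ell2 I"
proof -
  assume "n \<in> I"
  moreover have "(\<lambda>m. (cmod (if m = n then 1 else 0))\<^sup>2) summable_on (UNIV :: 'a set)"
    by (rule finite_nonzero_values_imp_summable_on, rule finite_subset[of _ "{n}"]) auto
  ultimately show ?thesis by (auto simp: ell2_def ket_def)
qed

lemma cip_abs_summable:
  assumes "\<phi> \<in> ell2 I" "\<psi> \<in> ell2 J"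
  shows "(\<lambda>n. cmod (\<phi> n) * cmod (\<psi> n)) summable_on UNIV"
proof (rule summable_on_nonneg_comparison)
  show "(\<lambda>n. (cmod (\<phi> n))\<^sup>2 + (cmod (\<psi> n))\<^sup>2) summable_on UNIV"
    by (intro summable_on_add ell2_summable[OF assms(1)] ell2_summable[OF assms(2)])
  show "cmod (\<phi> n) * cmod (\<psi> n) \<le> (cmod (\<phi> n))\<^sup>2 + (cmod (\<psi> n))\<^sup>2" for n
    using zero_le_power2[of "cmod (\<phi> n) - cmod (\<psi> n)"] zero_le_power2[of "cmod (\<phi> n)"] zero_le_power2[of "cmod (\<psi> n)"]
    unfolding power2_diff by linarith
qed auto

lemma cip_summable:
  assumes "\<phi> \<in> ell2 I" "\<psi> \<in> ell2 J"
  shows "(\<lambda>n. cnj (\<phi> n) * \<psi> n) summable_on UNIV"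
  by (rule abs_summable_summable) (use cip_abs_summable[OF assms] in \<open>simp add: norm_mult\<close>)

lemma cip_add_right:
  assumes "\<phi> \<in> ell2 I" "\<psi> \<in> ell2 I" "\<xi> \<in> ell2 I"
  shows "cip \<phi> (\<lambda>n. \<psi> n + \<xi> n) = cip \<phi> \<psi> + cip \<phi> \<xi>"
  unfolding cip_def by (simp add: ring_distribs infsum_add cip_summable[OF assms(1,2)] cip_summable[OF assms(1,3)])

lemma cip_scale_right: "cip \<phi> (\<lambda>n. c * \<psi> n) = c * cip \<phi> \<psi>"
  unfolding cip_def by (simp add: mult.left_commute infsum_cmult_right')

lemma cip_cnj: "cnj (cip \<phi> \<psi>) = cip \<psi> \<phi>"
  unfolding cip_def by (simp flip: infsum_cnj add: mult.commute)

lemma cip_scale_left: "cip (\<lambda>n. c * \<phi> n) \<psi> = cnj c * cip \<phi> \<psi>"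
  unfolding cip_def by (simp add: mult.assoc infsum_cmult_right')

lemma cip_add_left:
  assumes "\<phi> \<in> ell2 I" "\<psi> \<in> ell2 I" "\<xi> \<in> ell2 I"
  shows "cip (\<lambda>n. \<phi> n + \<psi> n) \<xi> = cip \<phi> \<xi> + cip \<psi> \<xi>"
  using arg_cong[OF cip_add_right[OF assms(3,1,2)], of cnj] by (simp add: cip_cnj)

lemma cip_diff_right:
  assumes "\<phi> \<in> ell2 I" "\<psi> \<in> ell2 I" "\<xi> \<in> ell2 I"
  shows "cip \<phi> (\<lambda>n. \<psi> n - \<xi> n) = cip \<phi> \<psi> - cip \<phi> \<xi>"
  using cip_add_right[OF assms(1,2) ell2_scale[OF assms(3), of "-1"]] cip_scale_right[of \<phi> "-1" \<xi>] by simp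

lemma cip_zero_left [simp]: "cip (\<lambda>n. 0) \<psi> = 0"
  and cip_zero_right [simp]: "cip \<psi> (\<lambda>n. 0) = 0"
  by (simp_all add: cip_def)

lemma cip_sum_right:
  assumes "finite F" "\<phi> \<in> ell2 I" "\<And>k. k \<in> F \<Longrightarrow> f k \<in> ell2 I"
  shows "cip \<phi> (\<lambda>n. \<Sum>k\<in>F. f k n) = (\<Sum>k\<in>F. cip \<phi> (f k))"
  using assms(1,3)
proof (induction F rule: finite_induct)
  case (insert k F)
  have "cip \<phi> (\<lambda>n. f k n + (\<Sum>j\<in>F. f j n)) = cip \<phi> (f k) + cip \<phi> (\<lambda>n. \<Sum>j\<in>F. f j n)"
    by (rule cip_add_right[OF assms(2)]) (use insert in \<open>auto intro: ell2_sum\<close>)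
  then show ?case using insert by simp
qed simp

lemma cip_ket_left [simp]: "cip (ket n) \<psi> = \<psi> n"
proof -
  have "cip (ket n) \<psi> = (\<Sum>\<^sub>\<infinity>m\<in>{n}. cnj (ket n m) * \<psi> m)"
    unfolding cip_def by (rule infsum_cong_neutral) (auto simp: ket_def)
  then show ?thesis by (simp add: ket_def)
qed

lemma cip_ket_right [simp]: "cip \<psi> (ket n) = cnj (\<psi> n)"
  by (metis cip_cnj cip_ket_left)

lemma l2norm_nonneg [simp]: "0 \<le> l2norm \<psi>"
  by (simp add: l2norm_def infsum_nonneg)

lemma l2norm_power2: "(l2norm \<psi>)\<^sup>2 = (\<Sum>\<^sub>\<infinity>n. (cmod (\<psi> n))\<^sup>2)"
  by (simp add: l2norm_def infsum_nonneg)

lemma l2norm_has_sum: "\<psi> \<in> ell2 I \<Longrightarrow> ((\<lambda>n. (cmod (\<psi> n))\<^sup>2) has_sum (l2norm \<psi>)\<^sup>2) UNIV"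
  by (simp add: l2norm_power2 ell2_summable)

lemma cip_self: "cip \<psi> \<psi> = complex_of_real ((l2norm \<psi>)\<^sup>2)"
proof -
  have "cip \<psi> \<psi> = (\<Sum>\<^sub>\<infinity>n. complex_of_real ((cmod (\<psi> n))\<^sup>2))"
    unfolding cip_def by (intro infsum_cong) (metis complex_norm_square mult.commute of_real_power)
  also have "\<dots> = complex_of_real (\<Sum>\<^sub>\<infinity>n. (cmod (\<psi> n))\<^sup>2)"
  proof (cases "(\<lambda>n. (cmod (\<psi> n))\<^sup>2) summable_on UNIV")
    case True then show ?thesis by (metis has_sum_infsum has_sum_of_real infsumI)
  next
    \<comment> \<open>Without summability both infinite sums take the default value 0, so the
      identity holds for every function and not only for vectors of a carrier.\<close>
    case False
    then have "\<not> (\<lambda>n. complex_of_real ((cmod (\<psi> n))\<^sup>2)) summable_on UNIV"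
      using summable_on_Re by fastforce
    then show ?thesis using False by (simp add: infsum_not_exists)
  qed
  finally show ?thesis by (simp add: l2norm_power2)
qed

text \<open>Cauchy-Schwarz for finite sums, with a bound independent of the finite set. The estimate
  is kept for absolute values, so that \<open>cip_CS\<close> follows from the triangle inequality
  for infinite sums.\<close>

lemma cip_summable_bound:
  assumes "\<phi> \<in> ell2 I" "\<psi> \<in> ell2 J"
  shows "(\<Sum>\<^sub>\<infinity>n. cmod (\<phi> n) * cmod (\<psi> n)) \<le> l2norm \<phi> * l2norm \<psi>"
proof (rule infsum_le_finite_sums[OF cip_abs_summable[OF assms]])
  fix F :: "'a set" assume F: "finite F"
  have *: "L2_set (\<lambda>n. cmod (\<xi> n)) F \<le> l2norm \<xi>" if "\<xi> \<in> ell2 K" for \<xi> :: "'a vect" and K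
    unfolding L2_set_def l2norm_def
    by (intro real_sqrt_le_mono finite_sum_le_infsum ell2_summable[OF that] F) auto
  have "(\<Sum>n\<in>F. cmod (\<phi> n) * cmod (\<psi> n)) \<le> L2_set (\<lambda>n. cmod (\<phi> n)) F * L2_set (\<lambda>n. cmod (\<psi> n)) F"
    using L2_set_mult_ineq[of "\<lambda>n. cmod (\<phi> n)" "\<lambda>n. cmod (\<psi> n)" F] by simp
  also have "\<dots> \<le> l2norm \<phi> * l2norm \<psi>"
    by (intro mult_mono *[OF assms(1)] *[OF assms(2)]) (simp_all add: L2_set_nonneg)
  finally show "(\<Sum>n\<in>F. cmod (\<phi> n) * cmod (\<psi> n)) \<le> l2norm \<phi> * l2norm \<psi>" .
qed

lemma cip_CS:
  assumes "\<phi> \<in> ell2 I" "\<psi> \<in> ell2 J"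
  shows "cmod (cip \<phi> \<psi>) \<le> l2norm \<phi> * l2norm \<psi>"
proof -
  have "cmod (cip \<phi> \<psi>) \<le> (\<Sum>\<^sub>\<infinity>n. cmod (cnj (\<phi> n) * \<psi> n))"
    unfolding cip_def by (rule norm_infsum_bound) (use cip_abs_summable[OF assms] in \<open>simp add: norm_mult\<close>)
  also have "\<dots> \<le> l2norm \<phi> * l2norm \<psi>"
    using cip_summable_bound[OF assms] by (simp add: norm_mult)
  finally show ?thesis .
qed

lemma l2norm_zero [simp]: "l2norm (\<lambda>n. 0) = 0"
  by (simp add: l2norm_def)

lemma l2norm_ket [simp]: "l2norm (ket n) = 1"
proof -
  have "complex_of_real ((l2norm (ket n))\<^sup>2) = 1" unfolding cip_self[symmetric] cip_ket_left by (simp add: ket_def)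
  then have "(l2norm (ket n))\<^sup>2 = 1" using of_real_eq_1_iff by blast
  then show ?thesis using l2norm_nonneg[of "ket n"] by (simp add: power2_eq_1_iff)
qed

lemma l2norm_scale: "l2norm (\<lambda>n. c * \<psi> n) = cmod c * l2norm \<psi>"
  by (simp add: l2norm_def norm_mult power_mult_distrib infsum_cmult_right' real_sqrt_mult)

lemma l2norm_minus_commute: "l2norm (\<lambda>n. \<phi> n - \<psi> n) = l2norm (\<lambda>n. \<psi> n - \<phi> n)"
  by (simp add: l2norm_def norm_minus_commute)

lemma l2norm_triangle:
  assumes "\<phi> \<in> ell2 I" "\<psi> \<in> ell2 I"
  shows "l2norm (\<lambda>n. \<phi> n + \<psi> n) \<le> l2norm \<phi> + l2norm \<psi>"
proof (rule power2_le_imp_le)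
  have "complex_of_real ((l2norm (\<lambda>n. \<phi> n + \<psi> n))\<^sup>2) = cip \<phi> \<phi> + cip \<phi> \<psi> + (cip \<psi> \<phi> + cip \<psi> \<psi>)"
    unfolding cip_self[symmetric]
    by (simp add: cip_add_left[OF assms ell2_add[OF assms]] cip_add_right[OF assms(1) assms] cip_add_right[OF assms(2) assms])
  also have "\<dots> = complex_of_real ((l2norm \<phi>)\<^sup>2 + (l2norm \<psi>)\<^sup>2 + 2 * Re (cip \<phi> \<psi>))"
    using complex_add_cnj[of "cip \<phi> \<psi>"] by (simp add: cip_self cip_cnj algebra_simps)
  finally have "(l2norm (\<lambda>n. \<phi> n + \<psi> n))\<^sup>2 = (l2norm \<phi>)\<^sup>2 + (l2norm \<psi>)\<^sup>2 + 2 * Re (cip \<phi> \<psi>)"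
    using of_real_eq_iff by blast
  moreover have "Re (cip \<phi> \<psi>) \<le> l2norm \<phi> * l2norm \<psi>"
    using cip_CS[OF assms] complex_Re_le_cmod order_trans by blast
  ultimately show "(l2norm (\<lambda>n. \<phi> n + \<psi> n))\<^sup>2 \<le> (l2norm \<phi> + l2norm \<psi>)\<^sup>2"
    by (simp add: power2_sum)
qed simp

lemma l2norm_triangle_diff:
  assumes "\<phi> \<in> ell2 I" "\<psi> \<in> ell2 I" "\<xi> \<in> ell2 I"
  shows "l2norm (\<lambda>n. \<phi> n - \<xi> n) \<le> l2norm (\<lambda>n. \<phi> n - \<psi> n) + l2norm (\<lambda>n. \<psi> n - \<xi> n)"
  using l2norm_triangle[OF ell2_diff[OF assms(1,2)] ell2_diff[OF assms(2,3)]] by simp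

lemma l2norm_component_le:
  assumes "\<psi> \<in> ell2 I"
  shows "cmod (\<psi> n) \<le> l2norm \<psi>"
  using cip_CS[OF _ assms, of "ket n" "{n}"] by simp

lemma l2norm_eq_0:
  assumes "\<psi> \<in> ell2 I" "l2norm \<psi> = 0"
  shows "\<psi> = (\<lambda>n. 0)"
  using l2norm_component_le[OF assms(1)] assms(2) by force

lemma ell2_eqI:
  assumes "\<phi> \<in> ell2 I" "\<psi> \<in> ell2 I" "\<And>e. e > 0 \<Longrightarrow> l2norm (\<lambda>n. \<phi> n - \<psi> n) \<le> e"
  shows "\<phi> = \<psi>"
proof -
  have "l2norm (\<lambda>n. \<phi> n - \<psi> n) \<le> 0" using field_le_epsilon[of "l2norm (\<lambda>n. \<phi> n - \<psi> n)" 0] assms(3) by simp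
  then have "(\<lambda>n. \<phi> n - \<psi> n) = (\<lambda>n. 0)"
    using l2norm_eq_0[OF ell2_diff[OF assms(1,2)]] l2norm_nonneg[of "\<lambda>n. \<phi> n - \<psi> n"] by (auto intro: order_antisym)
  then show ?thesis by (metis eq_iff_diff_eq_0 ext)
qed

text \<open>Closedness is stated by approximation within every \<open>e\<close>, as these functions
  carry no norm through their type. The notion serves density arguments: the vectors satisfying an
  identity form such a set, which is all of \<open>ell2 I\<close> once it contains a total
  family.\<close>

definition closed_subspace :: "'a set \<Rightarrow> 'a vect set \<Rightarrow> bool" where
  "closed_subspace I S \<longleftrightarrow> S \<subseteq> ell2 I \<and> (\<lambda>n. 0) \<in> S \<and>
     (\<forall>\<phi>\<in>S. \<forall>\<psi>\<in>S. (\<lambda>n. \<phi> n + \<psi> n) \<in> S) \<and> (\<forall>c. \<forall>\<psi>\<in>S. (\<lambda>n. c * \<psi> n) \<in> S) \<and>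
     (\<forall>\<psi>\<in>ell2 I. (\<forall>e>0. \<exists>\<phi>\<in>S. l2norm (\<lambda>n. \<psi> n - \<phi> n) < e) \<longrightarrow> \<psi> \<in> S)"

lemma closed_subspaceI:
  assumes "S \<subseteq> ell2 I" "(\<lambda>n. 0) \<in> S"
    "\<And>\<phi> \<psi>. \<phi> \<in> S \<Longrightarrow> \<psi> \<in> S \<Longrightarrow> (\<lambda>n. \<phi> n + \<psi> n) \<in> S"
    "\<And>c \<psi>. \<psi> \<in> S \<Longrightarrow> (\<lambda>n. c * \<psi> n) \<in> S"
    "\<And>\<psi>. \<psi> \<in> ell2 I \<Longrightarrow> (\<And>e. e > 0 \<Longrightarrow> \<exists>\<phi>\<in>S. l2norm (\<lambda>n. \<psi> n - \<phi> n) < e) \<Longrightarrow> \<psi> \<in> S"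
  shows "closed_subspace I S"
  unfolding closed_subspace_def using assms by auto

lemma closed_subspace_sub: "closed_subspace I S \<Longrightarrow> \<psi> \<in> S \<Longrightarrow> \<psi> \<in> ell2 I"
  and closed_subspace_zero: "closed_subspace I S \<Longrightarrow> (\<lambda>n. 0) \<in> S"
  and closed_subspace_add: "closed_subspace I S \<Longrightarrow> \<phi> \<in> S \<Longrightarrow> \<psi> \<in> S \<Longrightarrow> (\<lambda>n. \<phi> n + \<psi> n) \<in> S"
  and closed_subspace_scale: "closed_subspace I S \<Longrightarrow> \<psi> \<in> S \<Longrightarrow> (\<lambda>n. c * \<psi> n) \<in> S"
  and closed_subspace_limit: "closed_subspace I S \<Longrightarrow> \<psi> \<in> ell2 I \<Longrightarrow>
    (\<And>e. e > 0 \<Longrightarrow> \<exists>\<phi>\<in>S. l2norm (\<lambda>n. \<psi> n - \<phi> n) < e) \<Longrightarrow> \<psi> \<in> S"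
  unfolding closed_subspace_def by blast+

lemma closed_subspace_diff:
  assumes "closed_subspace I S" "\<phi> \<in> S" "\<psi> \<in> S"
  shows "(\<lambda>n. \<phi> n - \<psi> n) \<in> S"
  using closed_subspace_add[OF assms(1,2) closed_subspace_scale[OF assms(1,3), of "-1"]] by simp

lemma closed_subspace_sum:
  assumes "closed_subspace I S" "finite F" "\<And>k. k \<in> F \<Longrightarrow> f k \<in> S"
  shows "(\<lambda>n. \<Sum>k\<in>F. f k n) \<in> S"
  using assms(2,3) by (induction F rule: finite_induct)
    (auto intro: closed_subspace_add[OF assms(1)] closed_subspace_zero[OF assms(1)])

lemma ell2_truncate:
  assumes "\<psi> \<in> ell2 I" "e > 0"
  shows "\<exists>F. finite F \<and> F \<subseteq> I \<and> l2norm (\<lambda>n. \<psi> n - (if n \<in> F then \<psi> n else 0)) < e"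
proof -
  \<comment> \<open>The bound \<open>e\<^sup>2 / 2\<close> leaves room for the strict inequality
    wanted at the end.\<close>
  obtain F where F: "finite F" "dist (\<Sum>n\<in>F. (cmod (\<psi> n))\<^sup>2) (\<Sum>\<^sub>\<infinity>n. (cmod (\<psi> n))\<^sup>2) \<le> e\<^sup>2 / 2"
    using infsum_finite_approximation[OF ell2_summable[OF assms(1)], of "e\<^sup>2/2"] assms(2) by auto
  define G where "G = F \<inter> I"
  have "(\<Sum>n\<in>G. (cmod (\<psi> n))\<^sup>2) = (\<Sum>n\<in>F. (cmod (\<psi> n))\<^sup>2)"
    unfolding G_def by (rule sum.mono_neutral_left) (use F ell2_outside[OF assms(1)] in auto)
  then have G: "finite G" "G \<subseteq> I" "dist (\<Sum>n\<in>G. (cmod (\<psi> n))\<^sup>2) (\<Sum>\<^sub>\<infinity>n. (cmod (\<psi> n))\<^sup>2) \<le> e\<^sup>2 / 2"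
    using F by (auto simp: G_def)
  have "(\<Sum>\<^sub>\<infinity>n. (cmod (\<psi> n))\<^sup>2) = (\<Sum>n\<in>G. (cmod (\<psi> n))\<^sup>2) + (\<Sum>\<^sub>\<infinity>n\<in>-G. (cmod (\<psi> n))\<^sup>2)"
    using infsum_Un_disjoint[of "\<lambda>n. (cmod (\<psi> n))\<^sup>2" G "-G"] G(1)
      summable_on_subset_banach[OF ell2_summable[OF assms(1)], of "-G"] by (simp add: Un_commute)
  moreover have "(\<Sum>\<^sub>\<infinity>n\<in>-G. (cmod (\<psi> n))\<^sup>2) = (\<Sum>\<^sub>\<infinity>n. (cmod (\<psi> n - (if n \<in> G then \<psi> n else 0)))\<^sup>2)"
    by (rule infsum_cong_neutral) auto
  ultimately have "(l2norm (\<lambda>n. \<psi> n - (if n \<in> G then \<psi> n else 0)))\<^sup>2 \<le> e\<^sup>2 / 2"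
    using G(3) by (simp add: l2norm_power2 dist_real_def)
  also have "\<dots> < e\<^sup>2" using assms(2) by simp
  finally show ?thesis using G assms(2) by (meson power2_less_imp_less less_imp_le)
qed

lemma closed_subspace_kets:
  assumes S: "closed_subspace I S" and k: "\<And>n. n \<in> I \<Longrightarrow> ket n \<in> S"
  shows "S = ell2 I"
proof
  show "S \<subseteq> ell2 I" using closed_subspace_sub[OF S] by blast
  show "ell2 I \<subseteq> S"
  proof
    fix \<psi> assume \<psi>: "\<psi> \<in> ell2 I"
    show "\<psi> \<in> S"
    proof (rule closed_subspace_limit[OF S \<psi>])
      fix e :: real assume "e > 0"
      then obtain F where F: "finite F" "F \<subseteq> I" "l2norm (\<lambda>n. \<psi> n - (if n \<in> F then \<psi> n else 0)) < e"
        using ell2_truncate[OF \<psi>] by blast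
      have "(\<lambda>n. \<Sum>k\<in>F. \<psi> k * ket k n) \<in> S"
        by (rule closed_subspace_sum[OF S F(1)]) (use F k in \<open>auto intro: closed_subspace_scale[OF S]\<close>)
      moreover have "(\<Sum>k\<in>F. \<psi> k * ket k n) = (if n \<in> F then \<psi> n else 0)" for n
        using F(1) by (simp add: ket_def if_distrib sum.delta' cong: if_cong)
      ultimately show "\<exists>\<phi>\<in>S. l2norm (\<lambda>n. \<psi> n - \<phi> n) < e" using F(3) by auto
    qed
  qed
qed

text \<open>The limit is formed in each component; the Cauchy estimate is inherited by the finite
  partial sums, which bound the infinite one.\<close>

lemma ell2_complete:
  assumes X: "\<And>k::nat. X k \<in> ell2 I"
    and cauchy: "\<And>e. e > 0 \<Longrightarrow> \<exists>N. \<forall>j\<ge>N. \<forall>k\<ge>N. l2norm (\<lambda>n. X j n - X k n) < e"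
  shows "\<exists>x\<in>ell2 I. \<forall>e>0. \<exists>N. \<forall>k\<ge>N. l2norm (\<lambda>n. X k n - x n) \<le> e"
proof -
  have "Cauchy (\<lambda>k. X k n)" for n
  proof (rule metric_CauchyI)
    fix e :: real assume "e > 0"
    then obtain N where "\<forall>j\<ge>N. \<forall>k\<ge>N. l2norm (\<lambda>n. X j n - X k n) < e" using cauchy by blast
    then show "\<exists>M. \<forall>m\<ge>M. \<forall>k\<ge>M. dist (X m n) (X k n) < e"
      using l2norm_component_le[OF ell2_diff[OF X X]] unfolding dist_norm by (meson le_less_trans)
  qed
  then have "\<forall>n. \<exists>l. (\<lambda>k. X k n) \<longlonglongrightarrow> l" using Cauchy_convergent convergent_def by blast
  then obtain x where x: "\<And>n. (\<lambda>k. X k n) \<longlonglongrightarrow> x n" by metis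
  \<comment> \<open>Only a finite sum can be passed to the limit in \<open>j\<close>. The resulting
    bound does not depend on \<open>F\<close> and therefore controls summability and norm of the
    difference at once.\<close>
  have fin: "(\<Sum>n\<in>F. (cmod (X k n - x n))\<^sup>2) \<le> e\<^sup>2"
    if N: "\<forall>j\<ge>N. \<forall>k\<ge>N. l2norm (\<lambda>n. X j n - X k n) < e" and "k \<ge> N" "finite F" for F k N e
  proof (rule tendsto_upperbound)
    show "(\<lambda>j. \<Sum>n\<in>F. (cmod (X k n - X j n))\<^sup>2) \<longlonglongrightarrow> (\<Sum>n\<in>F. (cmod (X k n - x n))\<^sup>2)"
      by (intro tendsto_intros x)
    have "(\<Sum>n\<in>F. (cmod (X k n - X j n))\<^sup>2) \<le> e\<^sup>2" if "j \<ge> N" for j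
    proof -
      have "(\<Sum>n\<in>F. (cmod (X k n - X j n))\<^sup>2) \<le> (l2norm (\<lambda>n. X k n - X j n))\<^sup>2"
        unfolding l2norm_power2
        by (rule finite_sum_le_infsum) (use ell2_summable[OF ell2_diff[OF X X]] \<open>finite F\<close> in auto)
      also have "\<dots> \<le> e\<^sup>2" using N \<open>k \<ge> N\<close> that by (intro power_mono) (auto intro: less_imp_le)
      finally show ?thesis .
    qed
    then show "\<forall>\<^sub>F j in sequentially. (\<Sum>n\<in>F. (cmod (X k n - X j n))\<^sup>2) \<le> e\<^sup>2"
      using eventually_sequentially by blast
  qed simp
  have mem: "(\<lambda>n. X k n - x n) \<in> ell2 I" and bd: "l2norm (\<lambda>n. X k n - x n) \<le> e"
    if N: "\<forall>j\<ge>N. \<forall>k\<ge>N. l2norm (\<lambda>n. X j n - X k n) < e" and "k \<ge> N" for k N e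
  proof -
    have e: "e > 0" using N that by (meson le_less_trans l2norm_nonneg)
    have s: "(\<lambda>n. (cmod (X k n - x n))\<^sup>2) summable_on UNIV"
    proof (rule nonneg_bdd_above_summable_on)
      show "bdd_above (sum (\<lambda>n. (cmod (X k n - x n))\<^sup>2) ` {F. F \<subseteq> UNIV \<and> finite F})"
        by (rule bdd_aboveI2[where M="e\<^sup>2"]) (use fin[OF that] in auto)
    qed simp
    have "x n = 0" if "n \<notin> I" for n
      using x[of n] ell2_outside[OF X that] by (simp add: LIMSEQ_const_iff)
    then show "(\<lambda>n. X k n - x n) \<in> ell2 I" using s ell2_outside[OF X] by (auto simp: ell2_def)
    have "(l2norm (\<lambda>n. X k n - x n))\<^sup>2 \<le> e\<^sup>2"
      unfolding l2norm_power2 by (rule infsum_le_finite_sums[OF s]) (use fin[OF that] in auto)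
    then show "l2norm (\<lambda>n. X k n - x n) \<le> e" by (rule power2_le_imp_le) (use e in simp)
  qed
  obtain N where "\<forall>j\<ge>N. \<forall>k\<ge>N. l2norm (\<lambda>n. X j n - X k n) < 1" using cauchy[of 1] by auto
  then have "(\<lambda>n. X N n - x n) \<in> ell2 I" using mem by blast
  then have "x \<in> ell2 I" using ell2_diff[OF X[of N], of "\<lambda>n. X N n - x n"] by simp
  moreover have "\<exists>N. \<forall>k\<ge>N. l2norm (\<lambda>n. X k n - x n) \<le> e" if "e > 0" for e
    using cauchy[OF that] bd by blast
  ultimately show ?thesis by blast
qed

section \<open>Bounded operators and adjoints\<close>

definition bfun :: "'a set \<Rightarrow> ('a vect \<Rightarrow> complex) \<Rightarrow> bool" where
  "bfun I f \<longleftrightarrow>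
     (\<forall>\<phi>\<in>ell2 I. \<forall>\<psi>\<in>ell2 I. f (\<lambda>n. \<phi> n + \<psi> n) = f \<phi> + f \<psi>) \<and>
     (\<forall>c. \<forall>\<psi>\<in>ell2 I. f (\<lambda>n. c * \<psi> n) = c * f \<psi>) \<and>
     (\<exists>K. \<forall>\<psi>\<in>ell2 I. cmod (f \<psi>) \<le> K * l2norm \<psi>)"

text \<open>Unlike for \<open>bounded_ops\<close>, source and target carriers may differ and nothing
  is required outside the source. Slices, tensoring with a fixed vector and operators written as
  lambda terms are of this kind.\<close>

definition blin :: "'a set \<Rightarrow> 'b set \<Rightarrow> ('a vect \<Rightarrow> 'b vect) \<Rightarrow> bool" where
  "blin I J A \<longleftrightarrow> (\<forall>\<psi>\<in>ell2 I. A \<psi> \<in> ell2 J) \<and>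
     (\<forall>\<phi>\<in>ell2 I. \<forall>\<psi>\<in>ell2 I. A (\<lambda>n. \<phi> n + \<psi> n) = (\<lambda>n. A \<phi> n + A \<psi> n)) \<and>
     (\<forall>c. \<forall>\<psi>\<in>ell2 I. A (\<lambda>n. c * \<psi> n) = (\<lambda>n. c * A \<psi> n)) \<and>
     (\<exists>K. \<forall>\<psi>\<in>ell2 I. l2norm (A \<psi>) \<le> K * l2norm \<psi>)"

lemma blin_mem: "blin I J A \<Longrightarrow> \<psi> \<in> ell2 I \<Longrightarrow> A \<psi> \<in> ell2 J"
  and blin_add: "blin I J A \<Longrightarrow> \<phi> \<in> ell2 I \<Longrightarrow> \<psi> \<in> ell2 I \<Longrightarrow> A (\<lambda>n. \<phi> n + \<psi> n) = (\<lambda>n. A \<phi> n + A \<psi> n)"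
  and blin_scale: "blin I J A \<Longrightarrow> \<psi> \<in> ell2 I \<Longrightarrow> A (\<lambda>n. c * \<psi> n) = (\<lambda>n. c * A \<psi> n)"
  unfolding blin_def by blast+

lemma blin_bound:
  assumes "blin I J A"
  obtains K where "K \<ge> 0" "\<And>\<psi>. \<psi> \<in> ell2 I \<Longrightarrow> l2norm (A \<psi>) \<le> K * l2norm \<psi>"
proof -
  obtain K where K: "\<And>\<psi>. \<psi> \<in> ell2 I \<Longrightarrow> l2norm (A \<psi>) \<le> K * l2norm \<psi>"
    using assms unfolding blin_def by blast
  have "l2norm (A \<psi>) \<le> \<bar>K\<bar> * l2norm \<psi>" if "\<psi> \<in> ell2 I" for \<psi>
    using K[OF that] by (meson abs_ge_self l2norm_nonneg mult_right_mono order_trans)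
  then show ?thesis using that[of "\<bar>K\<bar>"] by simp
qed

lemma blin_zero: "blin I J A \<Longrightarrow> A (\<lambda>n. 0) = (\<lambda>n. 0)"
  using blin_scale[of I J A "\<lambda>n. 0" 0] by simp

lemma blin_diff: "blin I J A \<Longrightarrow> \<phi> \<in> ell2 I \<Longrightarrow> \<psi> \<in> ell2 I \<Longrightarrow> A (\<lambda>n. \<phi> n - \<psi> n) = (\<lambda>n. A \<phi> n - A \<psi> n)"
  using blin_add[of I J A \<phi> "\<lambda>n. - 1 * \<psi> n"] blin_scale[of I J A \<psi> "- 1"] ell2_scale[of \<psi> I "- 1"] by simp

lemma blin_sum:
  assumes "blin I J A" "finite F" "\<And>k. k \<in> F \<Longrightarrow> f k \<in> ell2 I"
  shows "A (\<lambda>n. \<Sum>k\<in>F. f k n) = (\<lambda>n. \<Sum>k\<in>F. A (f k) n)"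
  using assms(2,3)
proof (induction F rule: finite_induct)
  case (insert k F)
  then show ?case using blin_add[OF assms(1), of "f k" "\<lambda>n. \<Sum>k\<in>F. f k n"] ell2_sum[of F f I] by simp
qed (simp add: blin_zero[OF assms(1)])

lemma blinI:
  assumes "\<And>\<psi>. \<psi> \<in> ell2 I \<Longrightarrow> A \<psi> \<in> ell2 J"
    "\<And>\<phi> \<psi>. \<phi> \<in> ell2 I \<Longrightarrow> \<psi> \<in> ell2 I \<Longrightarrow> A (\<lambda>n. \<phi> n + \<psi> n) = (\<lambda>n. A \<phi> n + A \<psi> n)"
    "\<And>c \<psi>. \<psi> \<in> ell2 I \<Longrightarrow> A (\<lambda>n. c * \<psi> n) = (\<lambda>n. c * A \<psi> n)"
    "\<And>\<psi>. \<psi> \<in> ell2 I \<Longrightarrow> l2norm (A \<psi>) \<le> K * l2norm \<psi>"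
  shows "blin I J A"
  unfolding blin_def using assms by blast

lemma bounded_ops_iff: "A \<in> bounded_ops I \<longleftrightarrow> blin I I A \<and> (\<forall>\<psi>. \<psi> \<notin> ell2 I \<longrightarrow> A \<psi> = (\<lambda>n. 0))"
  unfolding bounded_ops_def blin_def by auto

lemma blin_comp:
  assumes A: "blin I J A" and B: "blin J L B"
  shows "blin I L (\<lambda>\<psi>. B (A \<psi>))"
proof -
  obtain K where K: "K \<ge> 0" "\<And>\<psi>. \<psi> \<in> ell2 I \<Longrightarrow> l2norm (A \<psi>) \<le> K * l2norm \<psi>" using blin_bound[OF A] by blast
  obtain M where M: "M \<ge> 0" "\<And>\<psi>. \<psi> \<in> ell2 J \<Longrightarrow> l2norm (B \<psi>) \<le> M * l2norm \<psi>" using blin_bound[OF B] by blast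
  show ?thesis
  proof (rule blinI)
    show "l2norm (B (A \<psi>)) \<le> (M * K) * l2norm \<psi>" if "\<psi> \<in> ell2 I" for \<psi>
      using M(2)[OF blin_mem[OF A that]] mult_left_mono[OF K(2)[OF that] M(1)] by (simp add: mult.assoc)
  qed (simp_all add: blin_mem[OF A] blin_mem[OF B] blin_add[OF A] blin_add[OF B] blin_scale[OF A] blin_scale[OF B])
qed

lemma bounded_ops_comp:
  assumes "A \<in> bounded_ops I" "B \<in> bounded_ops I"
  shows "A \<circ> B \<in> bounded_ops I"
  using assms blin_comp[of I I B I A] blin_zero[of I I A] by (auto simp: bounded_ops_iff o_def)

lemma id_op_bounded [simp]: "id_op I \<in> bounded_ops I"
  unfolding bounded_ops_iff
  by (auto simp: id_op_def ell2_add ell2_scale intro!: blinI[where K=1])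

lemma id_op_apply: "\<psi> \<in> ell2 I \<Longrightarrow> id_op I \<psi> = \<psi>"
  by (simp add: id_op_def)

lemma bfun_cip_blin:
  assumes A: "blin I J A" and \<phi>: "\<phi> \<in> ell2 J"
  shows "bfun I (\<lambda>\<psi>. cip \<phi> (A \<psi>))"
proof -
  obtain K where K: "K \<ge> 0" "\<And>\<psi>. \<psi> \<in> ell2 I \<Longrightarrow> l2norm (A \<psi>) \<le> K * l2norm \<psi>" using blin_bound[OF A] by blast
  have "cmod (cip \<phi> (A \<psi>)) \<le> (l2norm \<phi> * K) * l2norm \<psi>" if "\<psi> \<in> ell2 I" for \<psi>
    using cip_CS[OF \<phi> blin_mem[OF A that]] mult_left_mono[OF K(2)[OF that] l2norm_nonneg[of \<phi>]] by (simp add: mult.assoc)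
  then show ?thesis unfolding bfun_def
    by (auto simp: blin_add[OF A] blin_scale[OF A] cip_scale_right cip_add_right[OF \<phi> blin_mem[OF A] blin_mem[OF A]])
qed

lemma bfun_cip:
  assumes "\<phi> \<in> ell2 I"
  shows "bfun I (cip \<phi>)"
proof -
  have "blin I I (\<lambda>\<psi>. \<psi>)" by (rule blinI[where K=1]) auto
  from bfun_cip_blin[OF this assms] show ?thesis .
qed

lemma bfun_component:
  assumes A: "blin I J A"
  shows "bfun I (\<lambda>\<psi>. A \<psi> n)"
proof (cases "n \<in> J")
  case True then show ?thesis using bfun_cip_blin[OF A, of "ket n"] by simp
next
  case False
  then have "A \<psi> n = 0" if "\<psi> \<in> ell2 I" for \<psi> using ell2_outside[OF blin_mem[OF A that]] by blast
  then show ?thesis unfolding bfun_def by (auto simp: ell2_add ell2_scale intro!: exI[of _ 0])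
qed

text \<open>Every extension of an identity from a total family rests on this: at a limit point, the
  difference of the functionals is bounded by a constant times the distance to points where they
  agree.\<close>

lemma bfun_eq_closed_subspace:
  assumes f: "bfun I f" and g: "bfun I g"
  shows "closed_subspace I {\<psi> \<in> ell2 I. f \<psi> = g \<psi>}"
proof -
  have add: "\<And>\<phi> \<psi>. \<phi> \<in> ell2 I \<Longrightarrow> \<psi> \<in> ell2 I \<Longrightarrow> f (\<lambda>n. \<phi> n + \<psi> n) = f \<phi> + f \<psi>"
    "\<And>\<phi> \<psi>. \<phi> \<in> ell2 I \<Longrightarrow> \<psi> \<in> ell2 I \<Longrightarrow> g (\<lambda>n. \<phi> n + \<psi> n) = g \<phi> + g \<psi>"
    and scale: "\<And>c \<psi>. \<psi> \<in> ell2 I \<Longrightarrow> f (\<lambda>n. c * \<psi> n) = c * f \<psi>"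
    "\<And>c \<psi>. \<psi> \<in> ell2 I \<Longrightarrow> g (\<lambda>n. c * \<psi> n) = c * g \<psi>"
    using f g unfolding bfun_def by blast+
  have diff: "f (\<lambda>n. \<phi> n - \<psi> n) = f \<phi> - f \<psi>" "g (\<lambda>n. \<phi> n - \<psi> n) = g \<phi> - g \<psi>"
    if "\<phi> \<in> ell2 I" "\<psi> \<in> ell2 I" for \<phi> \<psi>
    using add[OF that(1) ell2_scale[OF that(2), of "-1"]] scale[OF that(2), of "-1"] by simp_all
  obtain K L where K: "\<And>\<psi>. \<psi> \<in> ell2 I \<Longrightarrow> cmod (f \<psi>) \<le> K * l2norm \<psi>"
    and L: "\<And>\<psi>. \<psi> \<in> ell2 I \<Longrightarrow> cmod (g \<psi>) \<le> L * l2norm \<psi>"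
    using f g unfolding bfun_def by metis
  \<comment> \<open>The summand 1 keeps \<open>M\<close> positive, so that \<open>e / M\<close> is a
    positive accuracy even for zero functionals.\<close>
  define M where "M = \<bar>K\<bar> + \<bar>L\<bar> + 1"
  have M: "M > 0" by (simp add: M_def add_nonneg_pos)
  show ?thesis
  proof (rule closed_subspaceI)
    fix \<psi> assume \<psi>: "\<psi> \<in> ell2 I"
      and lim: "\<And>e. e > 0 \<Longrightarrow> \<exists>\<phi>\<in>{\<psi> \<in> ell2 I. f \<psi> = g \<psi>}. l2norm (\<lambda>n. \<psi> n - \<phi> n) < e"
    have "cmod (f \<psi> - g \<psi>) \<le> e" if "e > 0" for e
    proof -
      obtain \<phi> where \<phi>: "\<phi> \<in> ell2 I" "f \<phi> = g \<phi>" "l2norm (\<lambda>n. \<psi> n - \<phi> n) < e / M"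
        using lim[OF divide_pos_pos[OF \<open>e > 0\<close> M]] by auto
      define x where "x = (\<lambda>n. \<psi> n - \<phi> n)"
      have x: "x \<in> ell2 I" unfolding x_def by (rule ell2_diff[OF \<psi> \<phi>(1)])
      have "f \<psi> - g \<psi> = f x - g x" unfolding x_def diff[OF \<psi> \<phi>(1)] using \<phi>(2) by simp
      then have "cmod (f \<psi> - g \<psi>) \<le> K * l2norm x + L * l2norm x"
        using K[OF x] L[OF x] norm_triangle_ineq4[of "f x" "g x"] by simp
      also have "\<dots> = (K + L) * l2norm x" by (simp add: distrib_right)
      also have "\<dots> \<le> M * l2norm x" by (rule mult_right_mono) (auto simp: M_def)
      also have "\<dots> \<le> M * (e / M)" using \<phi>(3) M by (intro mult_left_mono) (auto simp: x_def)
      finally show ?thesis using M by simp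
    qed
    then have "f \<psi> = g \<psi>" using field_le_epsilon[of "cmod (f \<psi> - g \<psi>)" 0] by simp
    then show "\<psi> \<in> {\<psi> \<in> ell2 I. f \<psi> = g \<psi>}" using \<psi> by simp
  next
    show "(\<lambda>n. 0) \<in> {\<psi> \<in> ell2 I. f \<psi> = g \<psi>}"
      using scale[OF ell2_zero, of 0] by simp
  qed (auto simp: ell2_add ell2_scale add scale)
qed

lemma closed_subspace_Inter:
  assumes "\<And>i. i \<in> X \<Longrightarrow> closed_subspace I {\<psi> \<in> ell2 I. P i \<psi>}"
  shows "closed_subspace I {\<psi> \<in> ell2 I. \<forall>i\<in>X. P i \<psi>}"
proof (rule closed_subspaceI)
  fix \<psi> assume \<psi>: "\<psi> \<in> ell2 I"
    and lim: "\<And>e. e > 0 \<Longrightarrow> \<exists>\<phi>\<in>{\<psi> \<in> ell2 I. \<forall>i\<in>X. P i \<psi>}. l2norm (\<lambda>n. \<psi> n - \<phi> n) < e"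
  have "P i \<psi>" if "i \<in> X" for i
    using closed_subspace_limit[OF assms[OF that] \<psi>] lim that by fast
  then show "\<psi> \<in> {\<psi> \<in> ell2 I. \<forall>i\<in>X. P i \<psi>}" using \<psi> by simp
next
  show "(\<lambda>n. 0) \<in> {\<psi> \<in> ell2 I. \<forall>i\<in>X. P i \<psi>}"
    using closed_subspace_zero[OF assms] by simp
next
  fix \<phi> \<psi> assume *: "\<phi> \<in> {\<psi> \<in> ell2 I. \<forall>i\<in>X. P i \<psi>}" "\<psi> \<in> {\<psi> \<in> ell2 I. \<forall>i\<in>X. P i \<psi>}"
  have "P i (\<lambda>n. \<phi> n + \<psi> n)" if "i \<in> X" for i
    using closed_subspace_add[OF assms[OF that], of \<phi> \<psi>] * that by simp
  then show "(\<lambda>n. \<phi> n + \<psi> n) \<in> {\<psi> \<in> ell2 I. \<forall>i\<in>X. P i \<psi>}" using * by (simp add: ell2_add)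
next
  fix c \<psi> assume *: "\<psi> \<in> {\<psi> \<in> ell2 I. \<forall>i\<in>X. P i \<psi>}"
  have "P i (\<lambda>n. c * \<psi> n)" if "i \<in> X" for i
    using closed_subspace_scale[OF assms[OF that], of \<psi> c] * that by simp
  then show "(\<lambda>n. c * \<psi> n) \<in> {\<psi> \<in> ell2 I. \<forall>i\<in>X. P i \<psi>}" using * by (simp add: ell2_scale)
qed auto

lemma blin_eq_closed_subspace:
  assumes "blin I J A" "blin I J B"
  shows "closed_subspace I {\<psi> \<in> ell2 I. A \<psi> = B \<psi>}"
proof -
  have "closed_subspace I {\<psi> \<in> ell2 I. \<forall>n\<in>UNIV. A \<psi> n = B \<psi> n}"
    by (intro closed_subspace_Inter bfun_eq_closed_subspace bfun_component[OF assms(1)] bfun_component[OF assms(2)])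
  then show ?thesis by (simp add: fun_eq_iff)
qed

lemma blin_eqI_kets:
  assumes "blin I J A" "blin I J B" "\<And>n. n \<in> I \<Longrightarrow> A (ket n) = B (ket n)" "\<psi> \<in> ell2 I"
  shows "A \<psi> = B \<psi>"
  using closed_subspace_kets[OF blin_eq_closed_subspace[OF assms(1,2)]] assms(3,4) by auto

lemma bounded_ops_eqI:
  assumes "A \<in> bounded_ops I" "B \<in> bounded_ops I" "\<And>\<psi>. \<psi> \<in> ell2 I \<Longrightarrow> A \<psi> = B \<psi>"
  shows "A = B"
  using assms by (metis bounded_ops_iff ext)

lemma bounded_ops_eqI_kets:
  assumes "A \<in> bounded_ops I" "B \<in> bounded_ops I" "\<And>n. n \<in> I \<Longrightarrow> A (ket n) = B (ket n)"
  shows "A = B"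
  by (rule bounded_ops_eqI[OF assms(1,2)], rule blin_eqI_kets[of I I]) (use assms in \<open>auto simp: bounded_ops_iff\<close>)

lemma finite_support_l2norm:
  assumes "finite F" "\<And>n. n \<notin> F \<Longrightarrow> x n = 0"
  shows "(l2norm x)\<^sup>2 = (\<Sum>n\<in>F. (cmod (x n))\<^sup>2)"
proof -
  have "(\<Sum>\<^sub>\<infinity>n. (cmod (x n))\<^sup>2) = (\<Sum>\<^sub>\<infinity>n\<in>F. (cmod (x n))\<^sup>2)"
    by (rule infsum_cong_neutral) (use assms in auto)
  then show ?thesis using assms(1) by (simp add: l2norm_power2)
qed

definition adj_fun :: "'a set \<Rightarrow> ('a vect \<Rightarrow> 'b vect) \<Rightarrow> 'b vect \<Rightarrow> 'a vect" where
  "adj_fun I A \<psi> = (\<lambda>n. if n \<in> I then cip (A (ket n)) \<psi> else 0)"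

text \<open>The adjoint is defined by its coordinates, and its bound comes from testing with a
  truncation \<open>x\<close> of itself: \<open>cip \<psi> (A x)\<close> equals the squared norm of
  \<open>x\<close>, which is thus at most \<open>K * l2norm \<psi> * l2norm x\<close>. The adjoint
  relation is then extended from kets.\<close>

lemma adj_fun:
  assumes A: "blin I J A"
  shows adj_fun_blin: "blin J I (adj_fun I A)"
    and adj_fun_cip: "\<And>\<phi> \<psi>. \<phi> \<in> ell2 I \<Longrightarrow> \<psi> \<in> ell2 J \<Longrightarrow> cip (A \<phi>) \<psi> = cip \<phi> (adj_fun I A \<psi>)"
proof -
  obtain K where K: "K \<ge> 0" "\<And>\<psi>. \<psi> \<in> ell2 I \<Longrightarrow> l2norm (A \<psi>) \<le> K * l2norm \<psi>" using blin_bound[OF A] by blast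
  have fin: "(\<Sum>n\<in>F. (cmod (adj_fun I A \<psi> n))\<^sup>2) \<le> (K * l2norm \<psi>)\<^sup>2"
    if \<psi>: "\<psi> \<in> ell2 J" and F: "finite F" for \<psi> F
  proof -
    define a where "a = adj_fun I A \<psi>"
    define G where "G = F \<inter> I"
    have G: "finite G" "G \<subseteq> I" using F by (auto simp: G_def)
    define S where "S = (\<Sum>n\<in>G. (cmod (a n))\<^sup>2)"
    have SF: "(\<Sum>n\<in>F. (cmod (a n))\<^sup>2) = S" unfolding S_def G_def
      by (rule sum.mono_neutral_right) (use F in \<open>auto simp: a_def adj_fun_def\<close>)
    have S0: "S \<ge> 0" unfolding S_def by (simp add: sum_nonneg)
    define x where "x = (\<lambda>n. \<Sum>k\<in>G. a k * ket k n)"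
    have kI: "(\<lambda>n. a k * ket k n) \<in> ell2 I" if "k \<in> G" for k using ell2_scale[OF ell2_ket, of k I "a k"] that G(2) by auto
    have xe: "x \<in> ell2 I" unfolding x_def by (rule ell2_sum[OF G(1) kI])
    have xn: "x n = (if n \<in> G then a n else 0)" for n
      unfolding x_def using G(1) by (simp add: ket_def if_distrib sum.delta' cong: if_cong)
    have nx: "(l2norm x)\<^sup>2 = S"
      by (subst finite_support_l2norm[OF G(1)]) (auto simp: xn S_def)
    have "A x = (\<lambda>n. \<Sum>k\<in>G. A (\<lambda>n. a k * ket k n) n)"
      unfolding x_def by (rule blin_sum[OF A G(1) kI])
    also have "\<dots> = (\<lambda>n. \<Sum>k\<in>G. a k * A (ket k) n)"
      by (intro ext sum.cong refl) (use G in \<open>simp add: blin_scale[OF A] subset_iff\<close>)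
    finally have Ax: "A x = (\<lambda>n. \<Sum>k\<in>G. a k * A (ket k) n)" .
    have "cip \<psi> (A x) = (\<Sum>k\<in>G. cip \<psi> (\<lambda>n. a k * A (ket k) n))"
      unfolding Ax by (rule cip_sum_right[OF G(1) \<psi>]) (use G in \<open>auto intro!: ell2_scale blin_mem[OF A]\<close>)
    also have "\<dots> = (\<Sum>k\<in>G. of_real ((cmod (a k))\<^sup>2))"
    proof (rule sum.cong[OF refl])
      fix k assume "k \<in> G"
      then have "a k = cip (A (ket k)) \<psi>" using G by (auto simp: a_def adj_fun_def)
      then have "cip \<psi> (A (ket k)) = cnj (a k)" by (simp add: cip_cnj)
      then show "cip \<psi> (\<lambda>n. a k * A (ket k) n) = of_real ((cmod (a k))\<^sup>2)"
        using complex_norm_square[of "a k"] by (simp add: cip_scale_right)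
    qed
    finally have "cip \<psi> (A x) = of_real S" by (simp add: S_def)
    then have "S \<le> l2norm \<psi> * l2norm (A x)"
      using cip_CS[OF \<psi> blin_mem[OF A xe]] S0 by simp
    also have "\<dots> \<le> l2norm \<psi> * (K * l2norm x)" by (intro mult_left_mono K(2) xe) simp
    finally have *: "(l2norm x)\<^sup>2 \<le> (K * l2norm \<psi>) * l2norm x" using nx by (simp add: mult_ac)
    have "l2norm x \<le> K * l2norm \<psi>"
    proof (cases "l2norm x = 0")
      case True then show ?thesis using K(1) by simp
    next
      case False
      then have "l2norm x > 0" using l2norm_nonneg[of x] by linarith
      then show ?thesis using * by (simp add: power2_eq_square)
    qed
    then have "(l2norm x)\<^sup>2 \<le> (K * l2norm \<psi>)\<^sup>2" by (rule power_mono) simp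
    then show ?thesis using nx SF by (simp add: a_def)
  qed
  have mem: "adj_fun I A \<psi> \<in> ell2 I" and bd: "l2norm (adj_fun I A \<psi>) \<le> K * l2norm \<psi>" if \<psi>: "\<psi> \<in> ell2 J" for \<psi>
  proof -
    have s: "(\<lambda>n. (cmod (adj_fun I A \<psi> n))\<^sup>2) summable_on UNIV"
    proof (rule nonneg_bdd_above_summable_on)
      show "bdd_above (sum (\<lambda>n. (cmod (adj_fun I A \<psi> n))\<^sup>2) ` {F. F \<subseteq> UNIV \<and> finite F})"
        by (rule bdd_aboveI2[where M="(K * l2norm \<psi>)\<^sup>2"]) (use fin[OF \<psi>] in auto)
    qed simp
    then show "adj_fun I A \<psi> \<in> ell2 I" by (auto simp: ell2_def adj_fun_def)
    show "l2norm (adj_fun I A \<psi>) \<le> K * l2norm \<psi>"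
    proof (rule power2_le_imp_le)
      show "(l2norm (adj_fun I A \<psi>))\<^sup>2 \<le> (K * l2norm \<psi>)\<^sup>2"
        unfolding l2norm_power2 by (rule infsum_le_finite_sums[OF s]) (use fin[OF \<psi>] in auto)
    qed (simp add: K(1))
  qed
  show "blin J I (adj_fun I A)"
    by (rule blinI[OF mem _ _ bd])
       (auto simp: adj_fun_def fun_eq_iff cip_scale_right intro!: cip_add_right[OF blin_mem[OF A]])
  fix \<phi> \<psi> assume \<phi>: "\<phi> \<in> ell2 I" and \<psi>: "\<psi> \<in> ell2 J"
  have "{\<phi> \<in> ell2 I. cip \<psi> (A \<phi>) = cip (adj_fun I A \<psi>) \<phi>} = ell2 I"
  proof (rule closed_subspace_kets)
    show "closed_subspace I {\<phi> \<in> ell2 I. cip \<psi> (A \<phi>) = cip (adj_fun I A \<psi>) \<phi>}"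
      by (intro bfun_eq_closed_subspace bfun_cip_blin[OF A \<psi>] bfun_cip mem \<psi>)
  qed (auto simp: adj_fun_def cip_cnj)
  then have "cip \<psi> (A \<phi>) = cip (adj_fun I A \<psi>) \<phi>" using \<phi> by auto
  then show "cip (A \<phi>) \<psi> = cip \<phi> (adj_fun I A \<psi>)" by (metis cip_cnj)
qed

lemma adj_op_eqI:
  assumes "B \<in> bounded_ops I" "\<And>\<phi> \<psi>. \<phi> \<in> ell2 I \<Longrightarrow> \<psi> \<in> ell2 I \<Longrightarrow> cip (A \<phi>) \<psi> = cip \<phi> (B \<psi>)"
  shows "adj_op I A = B"
  unfolding adj_op_def
proof (rule the_equality)
  fix C assume C: "C \<in> bounded_ops I \<and> (\<forall>\<phi>\<in>ell2 I. \<forall>\<psi>\<in>ell2 I. cip (A \<phi>) \<psi> = cip \<phi> (C \<psi>))"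
  show "C = B"
  proof (rule bounded_ops_eqI)
    fix \<psi> assume \<psi>: "\<psi> \<in> ell2 I"
    show "C \<psi> = B \<psi>"
    proof
      fix n
      show "C \<psi> n = B \<psi> n"
      proof (cases "n \<in> I")
        case True
        then have "cip (ket n) (C \<psi>) = cip (ket n) (B \<psi>)" using C assms(2)[OF ell2_ket[OF True] \<psi>] \<psi> by auto
        then show ?thesis by simp
      next
        case False
        then show ?thesis using C assms(1) \<psi> by (metis bounded_ops_iff blin_mem ell2_outside)
      qed
    qed
  qed (use C assms in auto)
qed (use assms in auto)

lemma adj_op:
  assumes "A \<in> bounded_ops I"
  shows adj_op_bounded: "adj_op I A \<in> bounded_ops I"
    and adj_op_cip: "\<And>\<phi> \<psi>. \<phi> \<in> ell2 I \<Longrightarrow> \<psi> \<in> ell2 I \<Longrightarrow> cip (A \<phi>) \<psi> = cip \<phi> (adj_op I A \<psi>)"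
proof -
  have A: "blin I I A" using assms by (simp add: bounded_ops_iff)
  define B where "B = (\<lambda>\<psi>. if \<psi> \<in> ell2 I then adj_fun I A \<psi> else (\<lambda>n. 0))"
  have "blin I I B"
    using adj_fun_blin[OF A] unfolding blin_def B_def by (simp add: ell2_add ell2_scale)
  then have B: "B \<in> bounded_ops I" by (simp add: bounded_ops_iff B_def)
  have c: "cip (A \<phi>) \<psi> = cip \<phi> (B \<psi>)" if "\<phi> \<in> ell2 I" "\<psi> \<in> ell2 I" for \<phi> \<psi>
    using adj_fun_cip[OF A that] that by (simp add: B_def)
  have "adj_op I A = B" by (rule adj_op_eqI[OF B c])
  then show "adj_op I A \<in> bounded_ops I" "\<And>\<phi> \<psi>. \<phi> \<in> ell2 I \<Longrightarrow> \<psi> \<in> ell2 I \<Longrightarrow> cip (A \<phi>) \<psi> = cip \<phi> (adj_op I A \<psi>)"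
    using B c by simp_all
qed

lemma unitary_opsI:
  assumes "U \<in> bounded_ops I" "V \<in> bounded_ops I"
    "\<And>\<phi> \<psi>. \<phi> \<in> ell2 I \<Longrightarrow> \<psi> \<in> ell2 I \<Longrightarrow> cip (U \<phi>) \<psi> = cip \<phi> (V \<psi>)"
    "\<And>\<psi>. \<psi> \<in> ell2 I \<Longrightarrow> U (V \<psi>) = \<psi>" "\<And>\<psi>. \<psi> \<in> ell2 I \<Longrightarrow> V (U \<psi>) = \<psi>"
  shows "U \<in> unitary_ops I" "adj_op I U = V"
proof -
  show V: "adj_op I U = V" by (rule adj_op_eqI[OF assms(2,3)])
  have "V \<circ> U = id_op I"
    by (rule bounded_ops_eqI) (use assms in \<open>auto simp: id_op_apply intro: bounded_ops_comp\<close>)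
  moreover have "U \<circ> V = id_op I"
    by (rule bounded_ops_eqI) (use assms in \<open>auto simp: id_op_apply intro: bounded_ops_comp\<close>)
  ultimately show "U \<in> unitary_ops I" using assms(1) V by (simp add: unitary_ops_def)
qed

lemma unitary_ops_bounded: "U \<in> unitary_ops I \<Longrightarrow> U \<in> bounded_ops I"
  and unitary_ops_blin: "U \<in> unitary_ops I \<Longrightarrow> blin I I U"
  by (auto simp: unitary_ops_def bounded_ops_iff)

lemma unitary_ops_inverse:
  assumes "U \<in> unitary_ops I" "\<psi> \<in> ell2 I"
  shows "U (adj_op I U \<psi>) = \<psi>" "adj_op I U (U \<psi>) = \<psi>"
  using assms id_op_apply[OF assms(2)] unfolding unitary_ops_def by (metis (mono_tags, lifting) mem_Collect_eq o_apply)+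

lemma unitary_ops_cip:
  assumes "U \<in> unitary_ops I" "\<phi> \<in> ell2 I" "\<psi> \<in> ell2 I"
  shows "cip (U \<phi>) (U \<psi>) = cip \<phi> \<psi>"
  using adj_op_cip[OF unitary_ops_bounded[OF assms(1)] assms(2) blin_mem[OF unitary_ops_blin[OF assms(1)] assms(3)]]
    unitary_ops_inverse[OF assms(1,3)] by simp

lemma unitary_ops_l2norm:
  assumes "U \<in> unitary_ops I" "\<psi> \<in> ell2 I"
  shows "l2norm (U \<psi>) = l2norm \<psi>"
proof -
  have "complex_of_real ((l2norm (U \<psi>))\<^sup>2) = complex_of_real ((l2norm \<psi>)\<^sup>2)"
    using unitary_ops_cip[OF assms assms(2)] by (simp only: cip_self)
  then have "(l2norm (U \<psi>))\<^sup>2 = (l2norm \<psi>)\<^sup>2" using of_real_eq_iff by blast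
  then show ?thesis by simp
qed

section \<open>Density operators as mixtures of vector states\<close>

text \<open>The weights of the convex combination are absorbed in the lengths of the vectors. The
  index type is free because partial traces and tensor products produce mixtures indexed by
  pairs.\<close>

definition mixture :: "'a set \<Rightarrow> ('k \<Rightarrow> 'a vect) \<Rightarrow> bool" where
  "mixture I v \<longleftrightarrow> (\<forall>k. v k \<in> ell2 I) \<and> ((\<lambda>k. (l2norm (v k))\<^sup>2) has_sum 1) UNIV"

definition mix_op :: "'a set \<Rightarrow> ('k \<Rightarrow> 'a vect) \<Rightarrow> 'a oper" where
  "mix_op I v = (\<lambda>\<psi>. if \<psi> \<in> ell2 I then (\<lambda>n. \<Sum>\<^sub>\<infinity>k. cip (v k) \<psi> * v k n) else (\<lambda>n. 0))"

text \<open>The trace of the mixture times \<open>x\<close>. The argument may be a lambda term that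
  is not cut off outside the carrier, so products of operators can be inserted without composing
  elements of \<open>bounded_ops\<close>.\<close>

definition mix_tr :: "('k \<Rightarrow> 'a vect) \<Rightarrow> 'a oper \<Rightarrow> complex" where
  "mix_tr v x = (\<Sum>\<^sub>\<infinity>k. cip (v k) (x (v k)))"

lemma mixture_mem: "mixture I v \<Longrightarrow> v k \<in> ell2 I"
  and mixture_has_sum: "mixture I v \<Longrightarrow> ((\<lambda>k. (l2norm (v k))\<^sup>2) has_sum 1) UNIV"
  by (auto simp: mixture_def)

lemma mixture_summable: "mixture I v \<Longrightarrow> (\<lambda>k. (l2norm (v k))\<^sup>2) summable_on UNIV"
  using mixture_has_sum has_sum_imp_summable by blast

section \<open>Interchange of infinite sums\<close>

lemma double_summable:
  fixes f :: "'k \<Rightarrow> 'a \<Rightarrow> complex"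
  assumes "\<And>k. ((\<lambda>n. g k n) has_sum h k) A" "h summable_on B" "\<And>k n. cmod (f k n) \<le> g k n"
  shows "(\<lambda>(k,n). f k n) summable_on (B \<times> A)"
proof (rule abs_summable_summable)
  have pos: "0 \<le> g k n" for k n using assms(3)[of k n] norm_ge_zero[of "f k n"] by linarith
  have "(\<lambda>(k,n). g k n) summable_on (B \<times> A)"
    by (rule summable_on_SigmaI[where g=h]) (use assms(1,2) pos in auto)
  then show "(\<lambda>x. norm ((\<lambda>(k,n). f k n) x)) summable_on (B \<times> A)"
    by (rule summable_on_nonneg_comparison) (use assms(3) in \<open>auto simp: case_prod_unfold\<close>)
qed

lemma double_has_sum:
  fixes f :: "'k \<Rightarrow> 'a \<Rightarrow> complex"
  assumes s: "(\<lambda>(k,n). f k n) summable_on (B \<times> A)"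
  shows "((\<lambda>n. \<Sum>\<^sub>\<infinity>k\<in>B. f k n) has_sum (\<Sum>\<^sub>\<infinity>k\<in>B. \<Sum>\<^sub>\<infinity>n\<in>A. f k n)) A"
    and "((\<lambda>k. \<Sum>\<^sub>\<infinity>n\<in>A. f k n) has_sum (\<Sum>\<^sub>\<infinity>k\<in>B. \<Sum>\<^sub>\<infinity>n\<in>A. f k n)) B"
proof -
  have s': "(\<lambda>(n,k). f k n) summable_on (A \<times> B)"
    using s by (subst summable_on_swap) (simp add: case_prod_unfold)
  show "((\<lambda>k. \<Sum>\<^sub>\<infinity>n\<in>A. f k n) has_sum (\<Sum>\<^sub>\<infinity>k\<in>B. \<Sum>\<^sub>\<infinity>n\<in>A. f k n)) B"
    using summable_on_Sigma_banach[OF s] by simp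
  show "((\<lambda>n. \<Sum>\<^sub>\<infinity>k\<in>B. f k n) has_sum (\<Sum>\<^sub>\<infinity>k\<in>B. \<Sum>\<^sub>\<infinity>n\<in>A. f k n)) A"
    unfolding infsum_swap_banach[OF s] using summable_on_Sigma_banach[OF s'] by simp
qed

lemma double_has_sum_real:
  fixes f :: "'k \<Rightarrow> 'a \<Rightarrow> real"
  assumes "\<And>k. ((\<lambda>n. f k n) has_sum h k) UNIV" "(h has_sum s) UNIV" "\<And>k n. f k n \<ge> 0"
  shows "(\<lambda>k. f k n) summable_on UNIV" "((\<lambda>n. \<Sum>\<^sub>\<infinity>k. f k n) has_sum s) UNIV"
proof -
  have s: "(\<lambda>(k,n). f k n) summable_on (UNIV \<times> UNIV)"
    by (rule summable_on_SigmaI[where g=h]) (use assms has_sum_imp_summable in auto)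
  have hs: "((\<lambda>(k,n). f k n) has_sum s) (UNIV \<times> UNIV)"
    by (rule has_sum_SigmaI[where g=h]) (use assms s in auto)
  then have hs': "((\<lambda>(n,k). f k n) has_sum s) (UNIV \<times> UNIV)"
    by (subst has_sum_swap) (simp add: case_prod_unfold)
  have col: "(\<lambda>k. f k n) summable_on UNIV" for n
    using summable_on_SigmaD1[of "\<lambda>n k. f k n" UNIV "\<lambda>_. UNIV" n] has_sum_imp_summable[OF hs'] by simp
  then show "(\<lambda>k. f k n) summable_on UNIV" .
  show "((\<lambda>n. \<Sum>\<^sub>\<infinity>k. f k n) has_sum s) UNIV"
    by (rule has_sum_SigmaD[OF hs']) (use col in auto)
qed

text \<open>On \<open>I\<close> the squared norms of the columns are the diagonal entries of
  \<open>mix_op I v\<close>, so their total is the trace; Tonelli exchanges the two sums of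
  squares.\<close>

lemma mixture_column:
  assumes "mixture I v"
  shows "(\<lambda>k. v k n) \<in> ell2 UNIV"
    and "((\<lambda>n. (l2norm (\<lambda>k. v k n))\<^sup>2) has_sum 1) UNIV"
proof -
  note * = double_has_sum_real[of "\<lambda>k n. (cmod (v k n))\<^sup>2", OF l2norm_has_sum[OF mixture_mem[OF assms]] mixture_has_sum[OF assms]]
  show "(\<lambda>k. v k n) \<in> ell2 UNIV" using *(1) by (simp add: ell2_def)
  show "((\<lambda>n. (l2norm (\<lambda>k. v k n))\<^sup>2) has_sum 1) UNIV" using *(2) by (simp add: l2norm_power2)
qed

lemma mixture_coeffs:
  assumes v: "mixture I v" and \<psi>: "\<psi> \<in> ell2 I"
  shows "(\<lambda>k. cip (v k) \<psi>) \<in> ell2 UNIV" "l2norm (\<lambda>k. cip (v k) \<psi>) \<le> l2norm \<psi>"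
proof -
  have bd: "(cmod (cip (v k) \<psi>))\<^sup>2 \<le> (l2norm (v k))\<^sup>2 * (l2norm \<psi>)\<^sup>2" for k
    using power_mono[OF cip_CS[OF mixture_mem[OF v, of k] \<psi>], where n=2] by (simp add: power_mult_distrib)
  have hs: "((\<lambda>k. (l2norm (v k))\<^sup>2 * (l2norm \<psi>)\<^sup>2) has_sum 1 * (l2norm \<psi>)\<^sup>2) UNIV"
    by (intro has_sum_cmult_left mixture_has_sum[OF v])
  have s: "(\<lambda>k. (cmod (cip (v k) \<psi>))\<^sup>2) summable_on UNIV"
    by (rule summable_on_nonneg_comparison[OF has_sum_imp_summable[OF hs]]) (use bd in auto)
  then show "(\<lambda>k. cip (v k) \<psi>) \<in> ell2 UNIV" by (simp add: ell2_def)
  have "(l2norm (\<lambda>k. cip (v k) \<psi>))\<^sup>2 \<le> 1 * (l2norm \<psi>)\<^sup>2"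
    unfolding l2norm_power2[of "\<lambda>k. cip (v k) \<psi>"] by (rule has_sum_mono[OF has_sum_infsum[OF s] hs]) (use bd in auto)
  then show "l2norm (\<lambda>k. cip (v k) \<psi>) \<le> l2norm \<psi>" by (simp add: power2_le_iff_abs_le)
qed

text \<open>Cauchy-Schwarz in the index \<open>k\<close>, between the coefficients
  \<open>cip (v k) \<psi>\<close> and the \<open>n\<close>-th column, both of which are square
  summable. Hence \<open>cip\<close> and \<open>l2norm\<close> occur here for functions of
  \<open>k\<close>.\<close>

lemma mix_op_summable:
  assumes v: "mixture I v" and \<psi>: "\<psi> \<in> ell2 I"
  shows "(\<lambda>k. cip (v k) \<psi> * v k n) summable_on UNIV"
    and "cmod (\<Sum>\<^sub>\<infinity>k. cip (v k) \<psi> * v k n) \<le> l2norm \<psi> * l2norm (\<lambda>k. v k n)"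
proof -
  define c where "c = (\<lambda>k. cnj (cip (v k) \<psi>))"
  have c: "c \<in> ell2 UNIV" "l2norm c \<le> l2norm \<psi>"
    using mixture_coeffs[OF v \<psi>] by (auto simp: c_def ell2_def l2norm_def)
  have e: "cip c (\<lambda>k. v k n) = (\<Sum>\<^sub>\<infinity>k. cip (v k) \<psi> * v k n)" unfolding cip_def[of c] by (simp add: c_def)
  show "(\<lambda>k. cip (v k) \<psi> * v k n) summable_on UNIV"
    using cip_summable[OF c(1) mixture_column(1)[OF v, of n]] by (simp add: c_def)
  have "cmod (cip c (\<lambda>k. v k n)) \<le> l2norm c * l2norm (\<lambda>k. v k n)"
    by (rule cip_CS[OF c(1) mixture_column(1)[OF v]])
  also have "\<dots> \<le> l2norm \<psi> * l2norm (\<lambda>k. v k n)" by (intro mult_right_mono c(2)) simp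
  finally show "cmod (\<Sum>\<^sub>\<infinity>k. cip (v k) \<psi> * v k n) \<le> l2norm \<psi> * l2norm (\<lambda>k. v k n)" using e by simp
qed

lemma mix_op_bounded:
  assumes v: "mixture I v"
  shows "mix_op I v \<in> bounded_ops I"
proof -
  have mem: "mix_op I v \<psi> \<in> ell2 I" and bd: "l2norm (mix_op I v \<psi>) \<le> 1 * l2norm \<psi>" if \<psi>: "\<psi> \<in> ell2 I" for \<psi>
  proof -
    have b: "(cmod (mix_op I v \<psi> n))\<^sup>2 \<le> (l2norm \<psi>)\<^sup>2 * (l2norm (\<lambda>k. v k n))\<^sup>2" for n
      using power_mono[OF mix_op_summable(2)[OF v \<psi>, of n], where n=2] \<psi> by (simp add: mix_op_def power_mult_distrib)
    have hs: "((\<lambda>n. (l2norm \<psi>)\<^sup>2 * (l2norm (\<lambda>k. v k n))\<^sup>2) has_sum (l2norm \<psi>)\<^sup>2 * 1) UNIV"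
      by (intro has_sum_cmult_right mixture_column[OF v])
    have s: "(\<lambda>n. (cmod (mix_op I v \<psi> n))\<^sup>2) summable_on UNIV"
      by (rule summable_on_nonneg_comparison[OF has_sum_imp_summable[OF hs]]) (use b in auto)
    have "mix_op I v \<psi> n = 0" if "n \<notin> I" for n
      using ell2_outside[OF mixture_mem[OF v] that] \<psi> by (simp add: mix_op_def)
    then show "mix_op I v \<psi> \<in> ell2 I" using s by (auto simp: ell2_def)
    have "(l2norm (mix_op I v \<psi>))\<^sup>2 \<le> (l2norm \<psi>)\<^sup>2 * 1"
      unfolding l2norm_power2[of "mix_op I v \<psi>"] by (rule has_sum_mono[OF has_sum_infsum[OF s] hs]) (use b in auto)
    then show "l2norm (mix_op I v \<psi>) \<le> 1 * l2norm \<psi>" by (simp add: power2_le_iff_abs_le)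
  qed
  have "blin I I (mix_op I v)"
  proof (rule blinI[OF mem _ _ bd])
    fix \<phi> \<psi> assume *: "\<phi> \<in> ell2 I" "\<psi> \<in> ell2 I"
    show "mix_op I v (\<lambda>n. \<phi> n + \<psi> n) = (\<lambda>n. mix_op I v \<phi> n + mix_op I v \<psi> n)"
      using * by (simp add: mix_op_def ell2_add cip_add_right[OF mixture_mem[OF v]] distrib_right
          infsum_add mix_op_summable(1)[OF v])
  next
    fix c \<psi> assume *: "\<psi> \<in> ell2 I"
    show "mix_op I v (\<lambda>n. c * \<psi> n) = (\<lambda>n. c * mix_op I v \<psi> n)"
      using * by (simp add: mix_op_def ell2_scale cip_scale_right mult.assoc infsum_cmult_right')
  qed
  then show ?thesis by (simp add: bounded_ops_iff mix_op_def)
qed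

lemma cip_mix_op:
  assumes v: "mixture I v" and \<phi>: "\<phi> \<in> ell2 I" and \<psi>: "\<psi> \<in> ell2 I"
  shows "((\<lambda>k. cip \<phi> (v k) * cip (v k) \<psi>) has_sum cip \<phi> (mix_op I v \<psi>)) UNIV"
proof -
  define f where "f = (\<lambda>k n. cnj (\<phi> n) * (cip (v k) \<psi> * v k n))"
  have inner: "((\<lambda>n. f k n) has_sum cip \<phi> (v k) * cip (v k) \<psi>) UNIV" for k
    using has_sum_cmult_right[OF has_sum_infsum[OF cip_summable[OF \<phi> mixture_mem[OF v, of k]]], of "cip (v k) \<psi>"]
    by (simp add: f_def cip_def[of \<phi>] mult_ac)
  have "(\<lambda>(k,n). f k n) summable_on (UNIV \<times> UNIV)"
  \<comment> \<open>Domination by \<open>a * b \<le> a\<^sup>2 + b\<^sup>2\<close>, with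
    \<open>a\<close> the modulus of the coefficient times that of \<open>\<phi> n\<close>, and
    \<open>b\<close> the modulus of \<open>v k n\<close>. The row sums are summable because
    coefficients and norms are square summable in \<open>k\<close>.\<close>
  proof (rule double_summable[where g="\<lambda>k n. (cmod (cip (v k) \<psi>))\<^sup>2 * (cmod (\<phi> n))\<^sup>2 + (cmod (v k n))\<^sup>2"])
    show "((\<lambda>n. (cmod (cip (v k) \<psi>))\<^sup>2 * (cmod (\<phi> n))\<^sup>2 + (cmod (v k n))\<^sup>2) has_sum
        (cmod (cip (v k) \<psi>))\<^sup>2 * (l2norm \<phi>)\<^sup>2 + (l2norm (v k))\<^sup>2) UNIV" for k
      by (intro has_sum_add has_sum_cmult_right l2norm_has_sum[OF \<phi>] l2norm_has_sum[OF mixture_mem[OF v]])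
    show "(\<lambda>k. (cmod (cip (v k) \<psi>))\<^sup>2 * (l2norm \<phi>)\<^sup>2 + (l2norm (v k))\<^sup>2) summable_on UNIV"
      by (intro summable_on_add summable_on_cmult_left mixture_summable[OF v] ell2_summable[OF mixture_coeffs(1)[OF v \<psi>]])
    show "cmod (f k n) \<le> (cmod (cip (v k) \<psi>))\<^sup>2 * (cmod (\<phi> n))\<^sup>2 + (cmod (v k n))\<^sup>2" for k n
    proof -
      have "0 \<le> (cmod (cip (v k) \<psi>) * cmod (\<phi> n) - cmod (v k n))\<^sup>2 + (cmod (cip (v k) \<psi>) * cmod (\<phi> n))\<^sup>2 + (cmod (v k n))\<^sup>2" by simp
      then show ?thesis by (simp add: f_def norm_mult power2_diff power_mult_distrib mult_ac)
    qed
  qed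
  note * = double_has_sum[OF this]
  have "(\<Sum>\<^sub>\<infinity>n. \<Sum>\<^sub>\<infinity>k. f k n) = cip \<phi> (mix_op I v \<psi>)"
    unfolding cip_def[of \<phi> "mix_op I v \<psi>"] using \<psi> by (simp add: f_def infsum_cmult_right' mix_op_def)
  moreover have "(\<Sum>\<^sub>\<infinity>n. f k n) = cip \<phi> (v k) * cip (v k) \<psi>" for k using inner infsumI by blast
  ultimately show ?thesis using *(2) infsumI[OF *(1)] by simp
qed

lemma mix_tr_summable:
  assumes v: "mixture I v" and x: "blin I I x"
  shows "(\<lambda>k. cip (v k) (x (v k))) summable_on UNIV"
proof -
  obtain K where K: "K \<ge> 0" "\<And>\<psi>. \<psi> \<in> ell2 I \<Longrightarrow> l2norm (x \<psi>) \<le> K * l2norm \<psi>" using blin_bound[OF x] by blast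
  show ?thesis
  proof (rule abs_summable_summable, rule summable_on_nonneg_comparison)
    show "(\<lambda>k. K * (l2norm (v k))\<^sup>2) summable_on UNIV"
      by (intro summable_on_cmult_right mixture_summable[OF v])
    show "cmod (cip (v k) (x (v k))) \<le> K * (l2norm (v k))\<^sup>2" for k
      using cip_CS[OF mixture_mem[OF v, of k] blin_mem[OF x mixture_mem[OF v, of k]]]
        mult_left_mono[OF K(2)[OF mixture_mem[OF v, of k]] l2norm_nonneg[of "v k"]]
      by (simp add: power2_eq_square mult_ac)
  qed auto
qed

text \<open>The operator is shifted to the other side: with \<open>y k\<close> its adjoint applied
  to \<open>v k\<close>, the trace is an absolutely convergent double sum of
  \<open>cnj (y k n) * v k n\<close>, and summing over \<open>n\<close> before \<open>k\<close>
  gives the matrix elements of \<open>x\<close>.\<close>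

lemma mix_op_trace:
  assumes v: "mixture I v" and x: "x \<in> bounded_ops I"
  shows "((\<lambda>n. cip (ket n) ((mix_op I v \<circ> x) (ket n))) has_sum mix_tr v x) I"
proof -
  have xb: "blin I I x" using x by (simp add: bounded_ops_iff)
  obtain K where K: "K \<ge> 0" "\<And>\<psi>. \<psi> \<in> ell2 I \<Longrightarrow> l2norm (adj_fun I x \<psi>) \<le> K * l2norm \<psi>"
    using blin_bound[OF adj_fun_blin[OF xb]] by blast
  define y where "y = (\<lambda>k. adj_fun I x (v k))"
  have y: "y k \<in> ell2 I" for k unfolding y_def by (rule blin_mem[OF adj_fun_blin[OF xb] mixture_mem[OF v]])
  define f where "f = (\<lambda>k n. cnj (y k n) * v k n)"
  have "(\<lambda>(k,n). f k n) summable_on (UNIV \<times> UNIV)"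
  proof (rule double_summable[where g="\<lambda>k n. (cmod (y k n))\<^sup>2 + (cmod (v k n))\<^sup>2"])
    show "((\<lambda>n. (cmod (y k n))\<^sup>2 + (cmod (v k n))\<^sup>2) has_sum (l2norm (y k))\<^sup>2 + (l2norm (v k))\<^sup>2) UNIV" for k
      by (intro has_sum_add l2norm_has_sum[OF y] l2norm_has_sum[OF mixture_mem[OF v]])
    have "(\<lambda>k. (l2norm (y k))\<^sup>2) summable_on UNIV"
    proof (rule summable_on_nonneg_comparison)
      show "(\<lambda>k. K\<^sup>2 * (l2norm (v k))\<^sup>2) summable_on UNIV"
        by (intro summable_on_cmult_right mixture_summable[OF v])
      show "(l2norm (y k))\<^sup>2 \<le> K\<^sup>2 * (l2norm (v k))\<^sup>2" for k
        using power_mono[OF K(2)[OF mixture_mem[OF v, of k]], where n=2] by (simp add: y_def power_mult_distrib)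
    qed auto
    then show "(\<lambda>k. (l2norm (y k))\<^sup>2 + (l2norm (v k))\<^sup>2) summable_on UNIV"
      by (intro summable_on_add mixture_summable[OF v])
    show "cmod (f k n) \<le> (cmod (y k n))\<^sup>2 + (cmod (v k n))\<^sup>2" for k n
    proof -
      have "0 \<le> (cmod (y k n) - cmod (v k n))\<^sup>2 + (cmod (y k n))\<^sup>2 + (cmod (v k n))\<^sup>2" by simp
      then show ?thesis by (simp add: f_def norm_mult power2_diff)
    qed
  qed
  note * = double_has_sum[OF this]
  have "(\<Sum>\<^sub>\<infinity>n. f k n) = cip (v k) (x (v k))" for k
    using adj_fun_cip[OF xb mixture_mem[OF v, of k] mixture_mem[OF v, of k]]
    unfolding f_def cip_def[symmetric] y_def by (metis cip_cnj)
  then have **: "((\<lambda>n. \<Sum>\<^sub>\<infinity>k. f k n) has_sum mix_tr v x) UNIV" using *(1) by (simp add: mix_tr_def)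
  have "(\<Sum>\<^sub>\<infinity>k. f k n) = cip (ket n) ((mix_op I v \<circ> x) (ket n))" if "n \<in> I" for n
  proof -
    have "y k n = cip (x (ket n)) (v k)" for k using that by (simp add: y_def adj_fun_def)
    then show ?thesis using blin_mem[OF xb ell2_ket[OF that]] by (simp add: mix_op_def f_def cip_cnj)
  qed
  moreover have "(\<Sum>\<^sub>\<infinity>k. f k n) = 0" if "n \<notin> I" for n
    using ell2_outside[OF mixture_mem[OF v] that] by (simp add: f_def)
  ultimately show ?thesis using ** by (subst has_sum_cong_neutral[where g="\<lambda>n. \<Sum>\<^sub>\<infinity>k. f k n" and T=UNIV]) auto
qed

lemma tr_mix_op:
  assumes "mixture I v" "x \<in> bounded_ops I"
  shows "tr I (mix_op I v \<circ> x) = mix_tr v x"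
  unfolding tr_def by (rule infsumI[OF mix_op_trace[OF assms]])

lemma mix_op_density:
  assumes v: "mixture I v"
  shows "mix_op I v \<in> density_ops I"
proof -
  have "cip \<psi> (mix_op I v \<psi>) \<in> \<real>\<^sub>\<ge>\<^sub>0" if \<psi>: "\<psi> \<in> ell2 I" for \<psi>
  proof -
    have e: "cip \<psi> (v k) * cip (v k) \<psi> = complex_of_real ((cmod (cip (v k) \<psi>))\<^sup>2)" for k
      by (metis cip_cnj complex_norm_square mult.commute)
    have "((\<lambda>k. (cmod (cip (v k) \<psi>))\<^sup>2) has_sum (l2norm (\<lambda>k. cip (v k) \<psi>))\<^sup>2) UNIV"
      by (rule l2norm_has_sum[OF mixture_coeffs(1)[OF v \<psi>]])
    then have "cip \<psi> (mix_op I v \<psi>) = complex_of_real ((l2norm (\<lambda>k. cip (v k) \<psi>))\<^sup>2)"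
      using has_sum_unique[OF cip_mix_op[OF v \<psi> \<psi>, unfolded e] has_sum_of_real] by blast
    then show ?thesis by simp
  qed
  moreover have "mix_tr v (id_op I) = 1"
  proof -
    have "cip (v k) (id_op I (v k)) = complex_of_real ((l2norm (v k))\<^sup>2)" for k
      by (simp add: id_op_apply[OF mixture_mem[OF v]] cip_self)
    moreover have "((\<lambda>k. complex_of_real ((l2norm (v k))\<^sup>2)) has_sum complex_of_real 1) UNIV"
      by (rule has_sum_of_real[OF mixture_has_sum[OF v]])
    ultimately show ?thesis unfolding mix_tr_def by (simp add: infsumI)
  qed
  then have "((\<lambda>n. cip (ket n) (mix_op I v (ket n))) has_sum 1) I"
    using mix_op_trace[OF v id_op_bounded] by (subst has_sum_cong[where g="\<lambda>n. cip (ket n) ((mix_op I v \<circ> id_op I) (ket n))"]) (auto simp: id_op_apply)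
  ultimately show ?thesis using mix_op_bounded[OF v] by (auto simp: density_ops_def)
qed


section \<open>Cholesky decomposition of density operators\<close>

text \<open>A positive form is decomposed by the Cholesky algorithm along an enumeration of the basis:
  step \<open>k\<close> subtracts the rank one operator that clears row and column \<open>k\<close>.\<close>

definition pos_form :: "'a set \<Rightarrow> ('a vect \<Rightarrow> 'a vect) \<Rightarrow> bool" where
  "pos_form I A \<longleftrightarrow> (\<forall>\<psi>\<in>ell2 I. A \<psi> \<in> ell2 I) \<and>
     (\<forall>\<phi>\<in>ell2 I. \<forall>\<psi>\<in>ell2 I. A (\<lambda>n. \<phi> n + \<psi> n) = (\<lambda>n. A \<phi> n + A \<psi> n)) \<and>
     (\<forall>c. \<forall>\<psi>\<in>ell2 I. A (\<lambda>n. c * \<psi> n) = (\<lambda>n. c * A \<psi> n)) \<and>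
     (\<forall>\<phi>\<in>ell2 I. \<forall>\<psi>\<in>ell2 I. cip \<psi> (A \<phi>) = cnj (cip \<phi> (A \<psi>))) \<and>
     (\<forall>\<psi>\<in>ell2 I. 0 \<le> Re (cip \<psi> (A \<psi>)))"

lemma pos_form_mem: "pos_form I A \<Longrightarrow> \<psi> \<in> ell2 I \<Longrightarrow> A \<psi> \<in> ell2 I"
  and pos_form_nonneg: "pos_form I A \<Longrightarrow> \<psi> \<in> ell2 I \<Longrightarrow> 0 \<le> Re (cip \<psi> (A \<psi>))"
  and pos_form_cnj: "pos_form I A \<Longrightarrow> \<phi> \<in> ell2 I \<Longrightarrow> \<psi> \<in> ell2 I \<Longrightarrow> cip \<psi> (A \<phi>) = cnj (cip \<phi> (A \<psi>))"
  unfolding pos_form_def by blast+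

lemma pos_form_real:
  assumes "pos_form I A" "\<psi> \<in> ell2 I"
  shows "cip \<psi> (A \<psi>) = complex_of_real (Re (cip \<psi> (A \<psi>)))"
  using pos_form_cnj[OF assms assms(2)] by (metis Reals_cnj_iff of_real_Re)

text \<open>The form is evaluated on \<open>t * \<phi> + \<psi>\<close>, where \<open>t\<close> is a
  real multiple \<open>r\<close> of \<open>cip \<phi> (A \<psi>)\<close>: this choice of phase makes
  the cross terms real and leaves a nonnegative quadratic polynomial in \<open>r\<close>.\<close>

lemma pos_form_CS:
  assumes A: "pos_form I A" and \<phi>: "\<phi> \<in> ell2 I" and \<psi>: "\<psi> \<in> ell2 I"
  shows "(cmod (cip \<phi> (A \<psi>)))\<^sup>2 \<le> Re (cip \<phi> (A \<phi>)) * Re (cip \<psi> (A \<psi>))"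
proof -
  have mem: "\<And>\<psi>. \<psi> \<in> ell2 I \<Longrightarrow> A \<psi> \<in> ell2 I"
    and add: "\<And>\<phi> \<psi>. \<phi> \<in> ell2 I \<Longrightarrow> \<psi> \<in> ell2 I \<Longrightarrow> A (\<lambda>n. \<phi> n + \<psi> n) = (\<lambda>n. A \<phi> n + A \<psi> n)"
    and scale: "\<And>c \<psi>. \<psi> \<in> ell2 I \<Longrightarrow> A (\<lambda>n. c * \<psi> n) = (\<lambda>n. c * A \<psi> n)"
    and herm: "\<And>\<phi> \<psi>. \<phi> \<in> ell2 I \<Longrightarrow> \<psi> \<in> ell2 I \<Longrightarrow> cip \<psi> (A \<phi>) = cnj (cip \<phi> (A \<psi>))"
    and pos: "\<And>\<psi>. \<psi> \<in> ell2 I \<Longrightarrow> 0 \<le> Re (cip \<psi> (A \<psi>))"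
    using A unfolding pos_form_def by blast+
  define s a b where "s = cip \<phi> (A \<psi>)" and "a = Re (cip \<phi> (A \<phi>))" and "b = Re (cip \<psi> (A \<psi>))"
  have q: "0 \<le> b + 2 * r * (cmod s)\<^sup>2 + r\<^sup>2 * (cmod s)\<^sup>2 * a" for r :: real
  proof -
    define t where "t = complex_of_real r * s"
    define x where "x = (\<lambda>n. t * \<phi> n + \<psi> n)"
    have x: "x \<in> ell2 I" unfolding x_def by (intro ell2_add ell2_scale \<phi> \<psi>)
    have Ax: "A x = (\<lambda>n. t * A \<phi> n + A \<psi> n)"
      unfolding x_def using add[OF ell2_scale[OF \<phi>] \<psi>] scale[OF \<phi>] by simp
    have r: "cip \<xi> (A x) = t * cip \<xi> (A \<phi>) + cip \<xi> (A \<psi>)" if "\<xi> \<in> ell2 I" for \<xi>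
      unfolding Ax using cip_add_right[OF that ell2_scale[OF mem[OF \<phi>]] mem[OF \<psi>]] by (simp add: cip_scale_right)
    have "cip x (A x) = cnj t * cip \<phi> (A x) + cip \<psi> (A x)"
      using cip_add_left[OF ell2_scale[OF \<phi>, of t] \<psi> mem[OF x]] by (simp add: x_def[symmetric] cip_scale_left)
    also have "\<dots> = cnj t * t * of_real a + cnj t * s + t * cnj s + of_real b"
      using herm[OF \<phi> \<psi>] pos_form_real[OF A \<phi>] pos_form_real[OF A \<psi>]
      by (simp add: r[OF \<phi>] r[OF \<psi>] s_def a_def b_def algebra_simps)
    also have "\<dots> = of_real (r\<^sup>2 * (cmod s)\<^sup>2 * a + 2 * r * (cmod s)\<^sup>2 + b)"
      using complex_norm_square[of s] by (simp add: t_def power2_eq_square algebra_simps)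
    finally show ?thesis using pos[OF x] by (simp add: algebra_simps)
  qed
  have a0: "0 \<le> a" using pos[OF \<phi>] by (simp add: a_def)
  show ?thesis
  proof (cases "a = 0")
    case True
    have "cmod s = 0"
    proof (rule ccontr)
      assume "cmod s \<noteq> 0"
      then have "(cmod s)\<^sup>2 > 0" by simp
      \<comment> \<open>For \<open>a = 0\<close> the polynomial is affine in \<open>r\<close>, and
        this value of \<open>r\<close> makes it equal to -1.\<close>
      then show False using q[of "- (b + 1) / (2 * (cmod s)\<^sup>2)"] True by (simp add: field_simps)
    qed
    then show ?thesis using True by (simp add: s_def a_def)
  next
    case False
    then have "a > 0" using a0 by simp
    then have "(cmod s)\<^sup>2 \<le> a * b" using q[of "- 1 / a"] by (simp add: field_simps power2_eq_square)
    then show ?thesis by (simp add: s_def a_def b_def)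
  qed
qed

text \<open>If the form vanishes at \<open>e\<close>, the factor \<open>1 / sqrt 0\<close> is 0 and
  a step subtracts nothing; by Cauchy-Schwarz the row of \<open>e\<close> is then zero
  already.\<close>

definition chol_vec :: "'a vect \<Rightarrow> ('a vect \<Rightarrow> 'a vect) \<Rightarrow> 'a vect" where
  "chol_vec e A = (\<lambda>n. complex_of_real (1 / sqrt (Re (cip e (A e)))) * A e n)"

definition chol_step :: "'a vect \<Rightarrow> ('a vect \<Rightarrow> 'a vect) \<Rightarrow> 'a vect \<Rightarrow> 'a vect" where
  "chol_step e A \<psi> = (\<lambda>n. A \<psi> n - cip (chol_vec e A) \<psi> * chol_vec e A n)"

lemma chol_vec_mem: "pos_form I A \<Longrightarrow> e \<in> ell2 I \<Longrightarrow> chol_vec e A \<in> ell2 I"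
  unfolding chol_vec_def by (rule ell2_scale, rule pos_form_mem)

text \<open>A step is the Schur complement at \<open>e\<close>. The identity
  \<open>1 / sqrt a * (1 / sqrt a) = 1 / a\<close> also covers \<open>a = 0\<close>, where both
  sides are 0.\<close>

lemma chol_step_cip:
  assumes A: "pos_form I A" and e: "e \<in> ell2 I" and \<phi>: "\<phi> \<in> ell2 I" and \<psi>: "\<psi> \<in> ell2 I"
  shows "cip \<phi> (chol_step e A \<psi>) =
    cip \<phi> (A \<psi>) - cip \<phi> (A e) * cip e (A \<psi>) / complex_of_real (Re (cip e (A e)))"
proof -
  define a where "a = Re (cip e (A e))"
  have a0: "0 \<le> a" using pos_form_nonneg[OF A e] by (simp add: a_def)
  note v = chol_vec_mem[OF A e]
  have h: "cip (A e) \<psi> = cip e (A \<psi>)"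
    using pos_form_cnj[OF A e \<psi>] pos_form_cnj[OF A \<psi> e] by (metis cip_cnj)
  have "cip \<phi> (chol_step e A \<psi>) = cip \<phi> (A \<psi>) - cip (chol_vec e A) \<psi> * cip \<phi> (chol_vec e A)"
    unfolding chol_step_def using cip_diff_right[OF \<phi> pos_form_mem[OF A \<psi>] ell2_scale[OF v]]
    by (simp add: cip_scale_right)
  also have "cip (chol_vec e A) \<psi> * cip \<phi> (chol_vec e A) = cip \<phi> (A e) * cip e (A \<psi>) * complex_of_real (1 / sqrt a * (1 / sqrt a))"
    unfolding chol_vec_def cip_scale_left cip_scale_right h a_def by (simp add: mult.commute flip: of_real_mult)
  also have "1 / sqrt a * (1 / sqrt a) = 1 / a" using a0 by simp
  finally show ?thesis by (simp add: a_def)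
qed

text \<open>Positivity of the Schur complement is exactly the inequality \<open>pos_form_CS\<close>
  for \<open>e\<close> and the vector in question.\<close>

lemma chol_step_pos_form:
  assumes A: "pos_form I A" and e: "e \<in> ell2 I"
  shows "pos_form I (chol_step e A)"
proof -
  have mem: "\<And>\<psi>. \<psi> \<in> ell2 I \<Longrightarrow> A \<psi> \<in> ell2 I"
    and add: "\<And>\<phi> \<psi>. \<phi> \<in> ell2 I \<Longrightarrow> \<psi> \<in> ell2 I \<Longrightarrow> A (\<lambda>n. \<phi> n + \<psi> n) = (\<lambda>n. A \<phi> n + A \<psi> n)"
    and scale: "\<And>c \<psi>. \<psi> \<in> ell2 I \<Longrightarrow> A (\<lambda>n. c * \<psi> n) = (\<lambda>n. c * A \<psi> n)"
    and herm: "\<And>\<phi> \<psi>. \<phi> \<in> ell2 I \<Longrightarrow> \<psi> \<in> ell2 I \<Longrightarrow> cip \<psi> (A \<phi>) = cnj (cip \<phi> (A \<psi>))"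
    and pos: "\<And>\<psi>. \<psi> \<in> ell2 I \<Longrightarrow> 0 \<le> Re (cip \<psi> (A \<psi>))"
    using A unfolding pos_form_def by blast+
  note v = chol_vec_mem[OF A e]
  have "chol_step e A \<psi> \<in> ell2 I" if "\<psi> \<in> ell2 I" for \<psi>
    unfolding chol_step_def by (intro ell2_diff ell2_scale mem that v)
  moreover have "chol_step e A (\<lambda>n. \<phi> n + \<psi> n) = (\<lambda>n. chol_step e A \<phi> n + chol_step e A \<psi> n)"
    if "\<phi> \<in> ell2 I" "\<psi> \<in> ell2 I" for \<phi> \<psi>
    unfolding chol_step_def by (simp add: add[OF that] cip_add_right[OF v that] algebra_simps)
  moreover have "chol_step e A (\<lambda>n. c * \<psi> n) = (\<lambda>n. c * chol_step e A \<psi> n)" if "\<psi> \<in> ell2 I" for c \<psi>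
    unfolding chol_step_def by (simp add: scale[OF that] cip_scale_right algebra_simps)
  moreover have "cip \<psi> (chol_step e A \<phi>) = cnj (cip \<phi> (chol_step e A \<psi>))" if "\<phi> \<in> ell2 I" "\<psi> \<in> ell2 I" for \<phi> \<psi>
    using herm[OF that] herm[OF e that(1)] herm[OF that(2) e]
    by (simp add: chol_step_cip[OF A e that] chol_step_cip[OF A e that(2,1)] mult_ac)
  moreover have "0 \<le> Re (cip \<psi> (chol_step e A \<psi>))" if \<psi>: "\<psi> \<in> ell2 I" for \<psi>
  proof -
    define a where "a = Re (cip e (A e))"
    have "cip \<psi> (A e) * cip e (A \<psi>) = complex_of_real ((cmod (cip e (A \<psi>)))\<^sup>2)"
      unfolding herm[OF e \<psi>] by (metis complex_norm_square mult.commute)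
    then have "Re (cip \<psi> (chol_step e A \<psi>)) = Re (cip \<psi> (A \<psi>)) - (cmod (cip e (A \<psi>)))\<^sup>2 / a"
      unfolding chol_step_cip[OF A e \<psi> \<psi>] a_def by (simp only: minus_complex.sel flip: of_real_divide) simp
    moreover have "(cmod (cip e (A \<psi>)))\<^sup>2 \<le> a * Re (cip \<psi> (A \<psi>))" using pos_form_CS[OF A e \<psi>] by (simp add: a_def)
    moreover have "0 \<le> a" "0 \<le> Re (cip \<psi> (A \<psi>))" using pos[OF e] pos[OF \<psi>] by (auto simp: a_def)
    moreover have "c / a \<le> b" if "c \<le> a * b" "0 \<le> a" "0 \<le> b" for b c :: real
      using that by (cases "a = 0") (auto simp: field_simps)
    ultimately show ?thesis by simp
  qed
  ultimately show ?thesis unfolding pos_form_def by blast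
qed

lemma chol_step_clears:
  assumes A: "pos_form I A" and e: "e \<in> ell2 I" and \<phi>: "\<phi> \<in> ell2 I"
  shows "cip \<phi> (chol_step e A e) = 0"
proof -
  define a where "a = Re (cip e (A e))"
  have r: "cip e (A e) = complex_of_real a" unfolding a_def by (rule pos_form_real[OF A e])
  show ?thesis
  proof (cases "a = 0")
    case True
    then have "cip \<phi> (A e) = 0" using pos_form_CS[OF A \<phi> e] by (simp add: a_def)
    then show ?thesis by (simp add: chol_step_cip[OF A e \<phi> e])
  next
    case False
    then show ?thesis unfolding chol_step_cip[OF A e \<phi> e] a_def[symmetric] r by simp
  qed
qed

text \<open>Polarization: a form with real diagonal values is Hermitian, as seen by evaluating it on
  \<open>t * \<phi> + \<psi>\<close> for \<open>t = 1\<close> and \<open>t = \<i>\<close>.\<close>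

lemma density_pos_form:
  assumes \<rho>: "\<rho> \<in> density_ops I"
  shows "pos_form I \<rho>"
proof -
  have b: "blin I I \<rho>" using \<rho> by (simp add: density_ops_def bounded_ops_iff)
  have real: "cip \<psi> (\<rho> \<psi>) \<in> \<real>" "0 \<le> Re (cip \<psi> (\<rho> \<psi>))" if "\<psi> \<in> ell2 I" for \<psi>
    using \<rho> that by (auto simp: density_ops_def complex_nonneg_Reals_iff complex_is_Real_iff)
  have "cip \<psi> (\<rho> \<phi>) = cnj (cip \<phi> (\<rho> \<psi>))" if \<phi>: "\<phi> \<in> ell2 I" and \<psi>: "\<psi> \<in> ell2 I" for \<phi> \<psi>
  proof -
    have x: "cnj t * cip \<phi> (\<rho> \<psi>) + t * cip \<psi> (\<rho> \<phi>) \<in> \<real>" for t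
    proof -
      define x where "x = (\<lambda>n. t * \<phi> n + \<psi> n)"
      have x: "x \<in> ell2 I" unfolding x_def by (intro ell2_add ell2_scale \<phi> \<psi>)
      have Ax: "\<rho> x = (\<lambda>n. t * \<rho> \<phi> n + \<rho> \<psi> n)"
        unfolding x_def using blin_add[OF b ell2_scale[OF \<phi>] \<psi>] blin_scale[OF b \<phi>] by simp
      have r: "cip \<xi> (\<rho> x) = t * cip \<xi> (\<rho> \<phi>) + cip \<xi> (\<rho> \<psi>)" if "\<xi> \<in> ell2 I" for \<xi>
        unfolding Ax using cip_add_right[OF that ell2_scale[OF blin_mem[OF b \<phi>]] blin_mem[OF b \<psi>]] by (simp add: cip_scale_right)
      have "cip x (\<rho> x) = cnj t * cip \<phi> (\<rho> x) + cip \<psi> (\<rho> x)"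
        using cip_add_left[OF ell2_scale[OF \<phi>, of t] \<psi> blin_mem[OF b x]] by (simp add: x_def[symmetric] cip_scale_left)
      then have "cnj t * cip \<phi> (\<rho> \<psi>) + t * cip \<psi> (\<rho> \<phi>) = cip x (\<rho> x) - (cnj t * t) * cip \<phi> (\<rho> \<phi>) - cip \<psi> (\<rho> \<psi>)"
        by (simp add: r[OF \<phi>] r[OF \<psi>] algebra_simps)
      moreover have "cnj t * t \<in> \<real>" by (metis Reals_of_real complex_norm_square mult.commute of_real_power)
      ultimately show ?thesis using real(1)[OF x] real(1)[OF \<phi>] real(1)[OF \<psi>] by simp
    qed
    show ?thesis using x[of 1] x[of \<i>] by (auto simp: complex_is_Real_iff complex_eq_iff)
  qed
  then show ?thesis using b real(2) unfolding pos_form_def blin_def by blast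
qed

primrec chol_rest :: "(nat \<Rightarrow> 'a vect) \<Rightarrow> ('a vect \<Rightarrow> 'a vect) \<Rightarrow> nat \<Rightarrow> 'a vect \<Rightarrow> 'a vect" where
  "chol_rest e A 0 = A"
| "chol_rest e A (Suc k) = chol_step (e k) (chol_rest e A k)"

text \<open>A decomposition without spectral theory. Countability enumerates the basis; the row of
  \<open>n\<close> is cleared after finitely many steps, so each matrix entry of \<rho> is a finite
  sum over the vectors \<open>v k\<close>, and trace 1 becomes the normalization of the
  mixture.\<close>

lemma density_mixture:
  fixes I :: "'a::countable set"
  assumes \<rho>: "\<rho> \<in> density_ops I"
  shows "\<exists>v :: nat \<Rightarrow> 'a vect. mixture I v \<and> \<rho> = mix_op I v"
proof -
  \<comment> \<open>Numbers that code no element of \<open>I\<close> get the zero vector, for which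
    a step changes nothing.\<close>
  define e :: "nat \<Rightarrow> 'a vect" where "e k = (if k \<in> to_nat ` I then ket (from_nat k) else (\<lambda>n. 0))" for k
  have e: "e k \<in> ell2 I" for k by (auto simp: e_def)
  have e_ket: "e (to_nat n) = ket n" if "n \<in> I" for n using that by (simp add: e_def)
  define R where "R = chol_rest e \<rho>"
  define v where "v k = chol_vec (e k) (R k)" for k
  have R: "pos_form I (R k)" for k
    unfolding R_def by (induction k) (auto intro: density_pos_form[OF \<rho>] chol_step_pos_form e)
  have v: "v k \<in> ell2 I" for k unfolding v_def by (rule chol_vec_mem[OF R e])
  have RSuc: "R (Suc k) \<psi> = (\<lambda>n. R k \<psi> n - cip (v k) \<psi> * v k n)" for k \<psi>
    by (simp add: R_def v_def chol_step_def)
  \<comment> \<open>A cleared row stays cleared: a later step subtracts a multiple of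
    \<open>cip (e k) (R k (ket n))\<close>, which is 0 already.\<close>
  have cleared: "cip \<phi> (R k (ket n)) = 0" if "n \<in> I" "to_nat n < k" "\<phi> \<in> ell2 I" for n k \<phi>
    using that(2,3)
  proof (induction k arbitrary: \<phi>)
    case (Suc k)
    have s: "R (Suc k) = chol_step (e k) (R k)" by (simp add: R_def)
    show ?case
    proof (cases "to_nat n = k")
      case True
      then have "e k = ket n" using e_ket[OF \<open>n \<in> I\<close>] by simp
      then show ?thesis unfolding s using chol_step_clears[OF R e Suc.prems(2), of k] by metis
    next
      case False
      then have lt: "to_nat n < k" using Suc.prems by simp
      show ?thesis unfolding s chol_step_cip[OF R e Suc.prems(2) ell2_ket[OF \<open>n \<in> I\<close>]]
        using Suc.IH[OF lt Suc.prems(2)] Suc.IH[OF lt e] by simp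
    qed
  qed simp
  have herm: "cip \<psi> (R k \<phi>) = cnj (cip \<phi> (R k \<psi>))" if "\<phi> \<in> ell2 I" "\<psi> \<in> ell2 I" for \<phi> \<psi> k
    using R[of k] that unfolding pos_form_def by blast
  \<comment> \<open>By symmetry column \<open>n\<close> is cleared together with row
    \<open>n\<close>, so the vectors \<open>v k\<close> with \<open>k > to_nat n\<close> vanish at
    \<open>n\<close>.\<close>
  have v0: "v k n = 0" if "n \<in> I" "to_nat n < k" for n k
  proof -
    have "cip (ket n) (R k (e k)) = cnj (cip (e k) (R k (ket n)))" by (rule herm[OF e ell2_ket[OF that(1)]])
    also have "\<dots> = 0" using cleared[OF that e] by simp
    finally show ?thesis by (simp add: v_def chol_vec_def)
  qed
  have sumR: "R k \<psi> m = \<rho> \<psi> m - (\<Sum>j<k. cip (v j) \<psi> * v j m)" for k \<psi> m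
    by (induction k) (simp_all add: RSuc, simp add: R_def)
  have entry: "((\<lambda>k. cip (v k) (ket n) * v k m) has_sum \<rho> (ket n) m) UNIV" if n: "n \<in> I" and m: "m \<in> I" for n m
  proof (rule has_sum_finite_neutralI)
    show "finite {..<Suc (to_nat n)}" by simp
    have "R (Suc (to_nat n)) (ket n) m = 0"
      using cleared[OF n _ ell2_ket[OF m], of "Suc (to_nat n)"] by simp
    then show "\<rho> (ket n) m = (\<Sum>k<Suc (to_nat n). cip (v k) (ket n) * v k m)" using sumR by simp
    show "cip (v k) (ket n) * v k m = 0" if "k \<in> UNIV - {..<Suc (to_nat n)}" for k
      using v0[OF n, of k] that by simp
  qed auto
  have "((\<lambda>k. (cmod (v k n))\<^sup>2) has_sum Re (\<rho> (ket n) n)) UNIV" if "n \<in> I" for n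
  proof -
    have "cip (v k) (ket n) * v k n = complex_of_real ((cmod (v k n))\<^sup>2)" for k
      using complex_norm_square[of "v k n"] by (simp add: mult.commute)
    then show ?thesis using has_sum_Re[OF entry[OF that that]] by simp
  qed
  moreover have "((\<lambda>k. (cmod (v k n))\<^sup>2) has_sum 0) UNIV" if "n \<notin> I" for n
    using ell2_outside[OF v that] by simp
  ultimately have col: "((\<lambda>k. (cmod (v k n))\<^sup>2) has_sum (if n \<in> I then Re (\<rho> (ket n) n) else 0)) UNIV" for n by auto
  have "((\<lambda>n. cip (ket n) (\<rho> (ket n))) has_sum 1) I" using \<rho> by (simp add: density_ops_def)
  then have "((\<lambda>n. Re (\<rho> (ket n) n)) has_sum 1) I" using has_sum_Re by fastforce
  then have "((\<lambda>n. if n \<in> I then Re (\<rho> (ket n) n) else 0) has_sum 1) UNIV"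
    by (subst has_sum_cong_neutral[where g="\<lambda>n. Re (\<rho> (ket n) n)" and T=I]) auto
  \<comment> \<open>Tonelli: the squared norms summed over \<open>k\<close> give the diagonal
    entries summed over \<open>n\<close>, that is, the trace.\<close>
  from double_has_sum_real(2)[OF col this]
  have "((\<lambda>k. (l2norm (v k))\<^sup>2) has_sum 1) UNIV" by (simp add: l2norm_power2)
  then have mv: "mixture I v" using v by (simp add: mixture_def)
  have "\<rho> = mix_op I v"
  proof (rule bounded_ops_eqI_kets)
    show \<rho>b: "\<rho> \<in> bounded_ops I" using \<rho> by (simp add: density_ops_def)
    fix n assume n: "n \<in> I"
    show "\<rho> (ket n) = mix_op I v (ket n)"
    proof
      fix m
      show "\<rho> (ket n) m = mix_op I v (ket n) m"
      proof (cases "m \<in> I")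
        case True
        then show ?thesis using infsumI[OF entry[OF n True]] n by (simp add: mix_op_def)
      next
        case False
        have "\<rho> (ket n) \<in> ell2 I" using \<rho>b n by (meson bounded_ops_iff blin_mem ell2_ket)
        then show ?thesis using False ell2_outside[OF v False] n ell2_outside by (simp add: mix_op_def)
      qed
    qed
  qed (rule mix_op_bounded[OF mv])
  then show ?thesis using mv by blast
qed

section \<open>Exponential vectors\<close>

lemma hprod_add_left: "hprod (x + y) z = hprod x z + hprod y z"
  and hprod_add_right: "hprod z (x + y) = hprod z x + hprod z y"
  and hprod_minus_left: "hprod (- x) z = - hprod x z"
  and hprod_minus_right: "hprod z (- x) = - hprod z x"
  by (simp_all add: hprod_def algebra_simps sum.distrib sum_negf)

lemma hprod_cnj: "cnj (hprod x y) = hprod y x"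
  by (simp add: hprod_def mult.commute)

lemma hprod_self: "hprod z z = complex_of_real ((norm z)\<^sup>2)"
proof -
  have "hprod z z = (\<Sum>i\<in>UNIV. complex_of_real ((cmod (z $ i))\<^sup>2))"
    unfolding hprod_def by (intro sum.cong refl) (metis complex_norm_square mult.commute)
  also have "\<dots> = complex_of_real ((norm z)\<^sup>2)"
    by (simp add: norm_vec_def L2_set_def sum_nonneg)
  finally show ?thesis .
qed

lemma hprod_zero [simp]: "hprod 0 z = 0" "hprod z 0 = 0"
  by (simp_all add: hprod_def)

lemma coord_space_add [intro]: "x \<in> coord_space J \<Longrightarrow> y \<in> coord_space J \<Longrightarrow> x + y \<in> coord_space J"
  and coord_space_minus [intro]: "x \<in> coord_space J \<Longrightarrow> - x \<in> coord_space J"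
  and coord_space_zero [simp]: "0 \<in> coord_space J"
  and coord_space_UNIV [simp]: "z \<in> coord_space UNIV"
  by (simp_all add: coord_space_def)

lemma occ_UNIV [simp]: "occ UNIV = UNIV"
  by (auto simp: occ_def)

lemma PiE_UNIV_UNIV: "PiE UNIV (\<lambda>_. UNIV) = UNIV"
  by (auto simp: PiE_UNIV_domain)

lemma multi_exp_summable:
  fixes x :: "'n::finite \<Rightarrow> complex"
  shows "(\<lambda>n::'n \<Rightarrow> nat. norm (\<Prod>i\<in>UNIV. x i ^ n i / fact (n i))) summable_on UNIV"
    and "(\<Sum>\<^sub>\<infinity>n::'n \<Rightarrow> nat. \<Prod>i\<in>UNIV. x i ^ n i / fact (n i)) = exp (\<Sum>i\<in>UNIV. x i)"
proof -
  have as: "(\<lambda>k. norm (y ^ k / fact k)) summable_on UNIV" and val: "(\<Sum>\<^sub>\<infinity>k. y ^ k / fact k) = exp y"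
    for y :: "'b::{real_normed_field,banach}"
  proof -
    have sm: "summable (\<lambda>k. norm (y ^ k / fact k))"
      using summable_norm_exp[of y] by (simp add: divide_inverse mult.commute scaleR_conv_of_real norm_mult norm_inverse)
    then show "(\<lambda>k. norm (y ^ k / fact k)) summable_on UNIV" by (intro summable_nonneg_imp_summable_on) auto
    have "(\<lambda>k. y ^ k / fact k) sums exp y"
      using exp_converges[of y] by (simp add: divide_inverse mult.commute scaleR_conv_of_real)
    then show "(\<Sum>\<^sub>\<infinity>k. y ^ k / fact k) = exp y" by (intro infsumI norm_summable_imp_has_sum sm)
  qed
  have prod_val: "(\<Sum>\<^sub>\<infinity>n::'n \<Rightarrow> nat. \<Prod>i\<in>UNIV. y i ^ n i / fact (n i)) = exp (\<Sum>i\<in>UNIV. y i)"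
    for y :: "'n \<Rightarrow> 'b::{real_normed_field,banach}"
    using infsum_prod_PiE_abs[of UNIV "\<lambda>i k. y i ^ k / fact k" "\<lambda>_. UNIV", OF finite as]
    by (simp add: PiE_UNIV_UNIV val exp_sum)
  show "(\<Sum>\<^sub>\<infinity>n::'n \<Rightarrow> nat. \<Prod>i\<in>UNIV. x i ^ n i / fact (n i)) = exp (\<Sum>i\<in>UNIV. x i)" by (rule prod_val)
  have e: "norm (\<Prod>i\<in>UNIV. x i ^ n i / fact (n i)) = (\<Prod>i\<in>UNIV. cmod (x i) ^ n i / fact (n i))" for n :: "'n \<Rightarrow> nat"
    by (simp add: prod_norm[symmetric] norm_divide norm_power)
  \<comment> \<open>A divergent sum would have the default value 0, whereas an exponential is
    nonzero: summability is read off from the value.\<close>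
  have "(\<Sum>\<^sub>\<infinity>n::'n \<Rightarrow> nat. \<Prod>i\<in>UNIV. cmod (x i) ^ n i / fact (n i)) \<noteq> 0" unfolding prod_val by simp
  then show "(\<lambda>n::'n \<Rightarrow> nat. norm (\<Prod>i\<in>UNIV. x i ^ n i / fact (n i))) summable_on UNIV"
    unfolding e using infsum_not_exists by blast
qed

lemma exp_vec_cip_term:
  "cnj (exp_vec z n) * exp_vec w n = (\<Prod>i\<in>UNIV. (cnj (z $ i) * w $ i) ^ n i / fact (n i))"
proof -
  have "cnj (a ^ k / complex_of_real (sqrt (fact k))) * (b ^ k / complex_of_real (sqrt (fact k))) = (cnj a * b) ^ k / fact k"
    for a b k
  proof -
    have "complex_of_real (sqrt (fact k)) * complex_of_real (sqrt (fact k)) = fact k"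
      by (simp flip: of_real_mult)
    then show ?thesis by (simp add: power_mult_distrib)
  qed
  then show ?thesis unfolding exp_vec_def cnj_prod prod.distrib[symmetric] by simp
qed

lemma exp_vec_mem:
  assumes "w \<in> coord_space J"
  shows "exp_vec w \<in> ell2 (occ J)"
proof -
  have "(\<lambda>n. (cmod (exp_vec w n))\<^sup>2) = (\<lambda>n. norm (cnj (exp_vec w n) * exp_vec w n))"
    by (simp add: fun_eq_iff norm_mult power2_eq_square)
  then have s: "(\<lambda>n. (cmod (exp_vec w n))\<^sup>2) summable_on UNIV"
    using multi_exp_summable(1)[of "\<lambda>i. cnj (w $ i) * w $ i"] by (simp add: exp_vec_cip_term)
  have "exp_vec w n = 0" if "n \<notin> occ J" for n
  proof -
    obtain i where i: "i \<notin> J" "n i \<noteq> 0" using \<open>n \<notin> occ J\<close> unfolding occ_def by blast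
    then have "w $ i ^ n i / complex_of_real (sqrt (fact (n i))) = 0"
      using assms by (simp add: coord_space_def)
    then show ?thesis unfolding exp_vec_def by (intro prod_zero bexI[of _ i]) auto
  qed
  then show ?thesis using s by (auto simp: ell2_def)
qed

lemma cip_exp_vec: "cip (exp_vec z) (exp_vec w) = exp (hprod z w)"
  unfolding cip_def exp_vec_cip_term multi_exp_summable(2) by (simp add: hprod_def)

section \<open>Totality of the exponential vectors\<close>

lemma l2norm_dominated:
  assumes "\<psi> \<in> ell2 J" "\<And>n. cmod (\<phi> n) \<le> c * cmod (\<psi> n)" "0 \<le> c"
  shows "l2norm \<phi> \<le> c * l2norm \<psi>"
proof -
  have s: "((\<lambda>n. c\<^sup>2 * (cmod (\<psi> n))\<^sup>2) has_sum c\<^sup>2 * (l2norm \<psi>)\<^sup>2) UNIV"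
    by (intro has_sum_cmult_right l2norm_has_sum[OF assms(1)])
  have b: "(cmod (\<phi> n))\<^sup>2 \<le> c\<^sup>2 * (cmod (\<psi> n))\<^sup>2" for n
    using power_mono[OF assms(2)[of n], where n=2] by (simp add: power_mult_distrib)
  have s': "(\<lambda>n. (cmod (\<phi> n))\<^sup>2) summable_on UNIV"
    by (rule summable_on_nonneg_comparison[OF has_sum_imp_summable[OF s]]) (use b in auto)
  have "(l2norm \<phi>)\<^sup>2 \<le> (c * l2norm \<psi>)\<^sup>2"
    unfolding l2norm_power2[of \<phi>] power_mult_distrib
    by (rule has_sum_mono[OF has_sum_infsum[OF s'] s]) (use b in auto)
  then show ?thesis using assms(3) by (simp add: power2_le_iff_abs_le)
qed

text \<open>Occupation numbers are prescribed by \<open>n\<close> in the modes of \<open>F\<close>,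
  and the vector is exponential in the others. This interpolates between \<open>exp_vec w\<close>
  for empty \<open>F\<close> and \<open>ket n\<close> for \<open>F = J\<close>, \<open>w = 0\<close>
  and \<open>n\<close> in \<open>occ J\<close>.\<close>

definition part_vec :: "'n::finite set \<Rightarrow> ('n \<Rightarrow> nat) \<Rightarrow> 'n cspace \<Rightarrow> ('n \<Rightarrow> nat) vect" where
  "part_vec F n w = (\<lambda>m. \<Prod>i\<in>UNIV. if i \<in> F then (if m i = n i then 1 else 0)
     else (w $ i) ^ m i / complex_of_real (sqrt (fact (m i))))"

text \<open>The factor of all modes other than \<open>j\<close>, shared by the vectors that are
  compared when \<open>j\<close> is added to \<open>F\<close>.\<close>

definition part_rest :: "'n::finite set \<Rightarrow> ('n \<Rightarrow> nat) \<Rightarrow> 'n cspace \<Rightarrow> 'n \<Rightarrow> ('n \<Rightarrow> nat) vect" where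
  "part_rest F n w j = (\<lambda>m. \<Prod>i\<in>UNIV - {j}. if i \<in> F then (if m i = n i then 1 else 0)
     else (w $ i) ^ m i / complex_of_real (sqrt (fact (m i))))"

lemma part_vec_split:
  assumes "j \<notin> F"
  shows "part_vec F n (\<chi> i. if i = j then c else w $ i) m =
      part_rest F n w j m * (c ^ m j / complex_of_real (sqrt (fact (m j))))"
    and "part_vec (insert j F) (n(j := k)) w m = part_rest F n w j m * (if m j = k then 1 else 0)"
proof -
  have "(\<Prod>i\<in>UNIV - {j}. if i \<in> F then (if m i = n i then 1 else 0)
      else ((\<chi> i. if i = j then c else w $ i) $ i) ^ m i / complex_of_real (sqrt (fact (m i)))) = part_rest F n w j m"
    unfolding part_rest_def by (rule prod.cong) auto
  then show "part_vec F n (\<chi> i. if i = j then c else w $ i) m =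
      part_rest F n w j m * (c ^ m j / complex_of_real (sqrt (fact (m j))))"
    unfolding part_vec_def prod.remove[OF finite UNIV_I[of j]] using assms by simp
  have "(\<Prod>i\<in>UNIV - {j}. if i \<in> insert j F then (if m i = (n(j := k)) i then 1 else 0)
      else (w $ i) ^ m i / complex_of_real (sqrt (fact (m i)))) = part_rest F n w j m"
    unfolding part_rest_def by (rule prod.cong) auto
  then show "part_vec (insert j F) (n(j := k)) w m = part_rest F n w j m * (if m j = k then 1 else 0)"
    unfolding part_vec_def prod.remove[OF finite UNIV_I[of j]] by simp
qed

lemma part_vec_empty: "part_vec {} n w = exp_vec w"
  by (simp add: part_vec_def exp_vec_def)

lemma part_vec_ket:
  assumes "n \<in> occ J"
  shows "part_vec J n 0 = ket n"
proof
  fix m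
  show "part_vec J n 0 m = ket n m"
  proof (cases "m = n")
    case True
    have "part_vec J n 0 n = 1"
      unfolding part_vec_def by (rule prod.neutral) (use assms in \<open>auto simp: occ_def\<close>)
    then show ?thesis using True by (simp add: ket_def)
  next
    case False
    then obtain i where i: "m i \<noteq> n i" by auto
    then have "(if i \<in> J then (if m i = n i then 1 else 0) else (0 $ i) ^ m i / complex_of_real (sqrt (fact (m i)))) = 0"
      using assms by (auto simp: occ_def)
    then have "part_vec J n 0 m = 0" unfolding part_vec_def by (intro prod_zero bexI[of _ i]) auto
    then show ?thesis using False by (simp add: ket_def)
  qed
qed

text \<open>The coefficients \<open>x\<^sub>0, x\<^sub>1, \<dots>\<close> of the exponential series \<open>g\<close> in one mode are reached one after the
  other: up to a factor, \<open>x\<^sub>k\<close> is the limit of \<open>(g c - (\<Sum>l<k. c\<^sup>l x\<^sub>l)) / c\<^sup>k\<close> as \<open>c\<close> tends to \<open>0\<close>.\<close>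

lemma part_vec_mem:
  assumes S: "closed_subspace (occ J) S" and e: "\<And>w. w \<in> coord_space J \<Longrightarrow> exp_vec w \<in> S"
    and "F \<subseteq> J" "w \<in> coord_space J"
  shows "part_vec F n w \<in> S"
  using finite[of F] assms(3,4)
proof (induction F arbitrary: n w rule: finite_induct)
  case empty then show ?case using e by (simp add: part_vec_empty)
next
  case (insert j F)
  define R where "R = part_rest F n w j"
  note R = part_vec_split[OF insert(2), of n _ w, folded R_def]
  define g where "g c = part_vec F n (\<chi> i. if i = j then c else w $ i)" for c
  define x where "x k = part_vec (insert j F) (n(j := k)) w" for k
  have g: "g c \<in> S" for c
    unfolding g_def by (rule insert.IH) (use insert.prems in \<open>auto simp: coord_space_def\<close>)
  have g1: "g 1 \<in> ell2 (occ J)" using closed_subspace_sub[OF S g] .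
  have xle: "cmod (x k m) \<le> sqrt (fact k) * cmod (g 1 m)" for k m
    unfolding x_def g_def R by (simp add: norm_mult norm_divide)
  have xe: "x k \<in> ell2 (occ J)" for k
  proof (rule ell2_dominated[OF ell2_scale[OF g1, of "complex_of_real (sqrt (fact k))"]])
    show "cmod (x k m) \<le> cmod (complex_of_real (sqrt (fact k)) * g 1 m)" for m
      using xle[of k m] by (simp add: norm_mult)
    show "x k m = 0" if "m \<notin> occ J" for m
      using xle[of k m] ell2_outside[OF g1 that] by simp
  qed
  have x: "x k \<in> S" for k
  proof (induction k rule: less_induct)
    case (less k)
    \<comment> \<open>The factor \<open>sqrt (fact k) / c ^ k\<close> undoes the weight with which
      \<open>x k\<close> occurs in the exponential series of mode \<open>j\<close>, after the terms
      of lower occupation have been removed.\<close>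
    define T where "T c = (\<lambda>m. complex_of_real (sqrt (fact k) / c ^ k) *
      (g (complex_of_real c) m - (\<Sum>l<k. complex_of_real (c ^ l / sqrt (fact l)) * x l m)))" for c :: real
    have T: "T c \<in> S" for c
      unfolding T_def
    proof (rule closed_subspace_scale[OF S], rule closed_subspace_diff[OF S g], rule closed_subspace_sum[OF S])
      show "(\<lambda>m. complex_of_real (c ^ l / sqrt (fact l)) * x l m) \<in> S" if "l \<in> {..<k}" for l
        by (rule closed_subspace_scale[OF S less]) (use that in simp)
    qed simp
    \<comment> \<open>Below occupation \<open>k\<close> both terms vanish, at \<open>k\<close> they
      coincide, and above \<open>k\<close> a power \<open>c ^ (m j - k) \<le> c\<close> remains. The
      error is thus dominated by \<open>g 1\<close> with a factor that tends to 0 with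
      \<open>c\<close>.\<close>
    have bd: "cmod (x k m - T c m) \<le> (c * sqrt (fact k)) * cmod (g 1 m)" if c: "0 < c" "c \<le> 1" for c m
    proof -
      have sm: "(\<Sum>l<k. complex_of_real (c ^ l / sqrt (fact l)) * x l m) =
        (if m j < k then R m * complex_of_real (c ^ m j / sqrt (fact (m j))) else 0)"
        unfolding x_def R by (simp add: if_distrib sum.delta cong: if_cong)
      consider "m j < k" | "m j = k" | "m j > k" by linarith
      then show ?thesis
      proof cases
        case 1
        then have "x k m - T c m = 0" unfolding T_def sm by (simp add: g_def x_def R)
        then show ?thesis using c by simp
      next
        case 2
        then have "x k m - T c m = 0" unfolding T_def sm using c by (simp add: g_def x_def R)
        then show ?thesis using c by simp
      next
        case 3
        have "x k m - T c m = - (complex_of_real (sqrt (fact k) / c ^ k * (c ^ m j / sqrt (fact (m j)))) * R m)"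
          unfolding T_def sm using 3 c by (simp add: g_def x_def R)
        then have "cmod (x k m - T c m) = sqrt (fact k) * (c ^ m j / c ^ k) / sqrt (fact (m j)) * cmod (R m)"
          using c by (simp add: norm_mult norm_divide norm_power)
        also have "c ^ m j / c ^ k = c ^ (m j - k)" using 3 c by (simp add: power_diff)
        also have "sqrt (fact k) * c ^ (m j - k) / sqrt (fact (m j)) * cmod (R m) \<le> sqrt (fact k) * c / sqrt (fact (m j)) * cmod (R m)"
          using power_decreasing[of 1 "m j - k" c] 3 c by (intro mult_right_mono divide_right_mono mult_left_mono) auto
        also have "\<dots> = (c * sqrt (fact k)) * cmod (g 1 m)"
          by (simp add: g_def R norm_mult norm_divide)
        finally show ?thesis .
      qed
    qed
    show ?case
    proof (rule closed_subspace_limit[OF S xe])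
      fix e :: real assume e: "e > 0"
      define M where "M = sqrt (fact k) * l2norm (g 1) + 1"
      have M: "M > 0" by (simp add: M_def add_nonneg_pos)
      define c where "c = min 1 (e / (2 * M))"
      have c: "0 < c" "c \<le> 1" "c \<le> e / (2 * M)" using e M by (auto simp: c_def)
      have "l2norm (\<lambda>m. x k m - T c m) \<le> (c * sqrt (fact k)) * l2norm (g 1)"
        by (rule l2norm_dominated[OF g1 bd]) (use c in auto)
      also have "\<dots> \<le> c * M" using c by (simp add: M_def mult.assoc)
      also have "\<dots> \<le> e / (2 * M) * M" using c M by (intro mult_right_mono) auto
      also have "\<dots> < e" using e M by simp
      finally show "\<exists>\<phi>\<in>S. l2norm (\<lambda>m. x k m - \<phi> m) < e" using T by blast
    qed
  qed
  have "part_vec (insert j F) n w = x (n j)" by (simp add: x_def)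
  then show ?case using x by simp
qed

lemma closed_subspace_exp_vecs:
  assumes S: "closed_subspace (occ J) S" and e: "\<And>w. w \<in> coord_space J \<Longrightarrow> exp_vec w \<in> S"
  shows "S = ell2 (occ J)"
proof (rule closed_subspace_kets[OF S])
  fix n assume "n \<in> occ J"
  then show "ket n \<in> S" using part_vec_mem[OF S e, of J 0 n] by (simp add: part_vec_ket)
qed

lemma bfun_eqI_exp_vecs:
  assumes "bfun (occ J) f" "bfun (occ J) g" "\<And>w. w \<in> coord_space J \<Longrightarrow> f (exp_vec w) = g (exp_vec w)"
    "\<psi> \<in> ell2 (occ J)"
  shows "f \<psi> = g \<psi>"
  using closed_subspace_exp_vecs[OF bfun_eq_closed_subspace[OF assms(1,2)]] assms(3,4) exp_vec_mem by blast

lemma blin_eqI_exp_vecs: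
  assumes "blin (occ J) K A" "blin (occ J) K B" "\<And>w. w \<in> coord_space J \<Longrightarrow> A (exp_vec w) = B (exp_vec w)"
    "\<psi> \<in> ell2 (occ J)"
  shows "A \<psi> = B \<psi>"
  using closed_subspace_exp_vecs[OF blin_eq_closed_subspace[OF assms(1,2)]] assms(3,4) exp_vec_mem by blast

lemma bounded_ops_eqI_exp_vecs:
  assumes "A \<in> bounded_ops (occ J)" "B \<in> bounded_ops (occ J)"
    "\<And>w. w \<in> coord_space J \<Longrightarrow> A (exp_vec w) = B (exp_vec w)"
  shows "A = B"
  by (rule bounded_ops_eqI[OF assms(1,2)], rule blin_eqI_exp_vecs[of J "occ J"])
     (use assms in \<open>auto simp: bounded_ops_iff\<close>)

text \<open>The closed linear span of \<open>G\<close> as a relation. It is the candidate for the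
  graph of an isometry; that it is single-valued follows only later, from preservation of inner
  products.\<close>

inductive iso_graph :: "'a set \<Rightarrow> ('a vect \<times> 'a vect) set \<Rightarrow> 'a vect \<Rightarrow> 'a vect \<Rightarrow> bool" for I G where
  base: "(s, g) \<in> G \<Longrightarrow> iso_graph I G s g"
| zero: "iso_graph I G (\<lambda>n. 0) (\<lambda>n. 0)"
| add: "iso_graph I G \<phi> x \<Longrightarrow> iso_graph I G \<psi> y \<Longrightarrow> iso_graph I G (\<lambda>n. \<phi> n + \<psi> n) (\<lambda>n. x n + y n)"
| scale: "iso_graph I G \<phi> x \<Longrightarrow> iso_graph I G (\<lambda>n. c * \<phi> n) (\<lambda>n. c * x n)"
| limit: "\<psi> \<in> ell2 I \<Longrightarrow> x \<in> ell2 I \<Longrightarrow>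
    (\<And>e. e > 0 \<Longrightarrow> \<exists>\<phi> y. iso_graph I G \<phi> y \<and> l2norm (\<lambda>n. \<psi> n - \<phi> n) < e \<and> l2norm (\<lambda>n. x n - y n) < e) \<Longrightarrow>
    iso_graph I G \<psi> x"

lemma iso_graph_mem:
  assumes "iso_graph I G \<psi> x" "G \<subseteq> ell2 I \<times> ell2 I"
  shows "\<psi> \<in> ell2 I \<and> x \<in> ell2 I"
  using assms(1) by induction (use assms(2) in \<open>auto intro: ell2_add ell2_scale\<close>)

text \<open>Induction along one side with the other pair fixed. \<open>iso_graph_cip\<close> uses it
  twice: first with the fixed pair in \<open>G\<close>, then with the fixed pair in the whole
  relation.\<close>

lemma iso_graph_cip_step:
  assumes G: "G \<subseteq> ell2 I \<times> ell2 I" and s: "s \<in> ell2 I" and g: "g \<in> ell2 I"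
    and eq: "\<And>s' g'. (s', g') \<in> G \<Longrightarrow> cip g g' = cip s s'"
    and "iso_graph I G \<psi> x"
  shows "cip g x = cip s \<psi>"
  using assms(5)
proof induction
  case (add \<phi> x \<psi> y)
  then show ?case using iso_graph_mem[OF _ G] cip_add_right[OF g] cip_add_right[OF s] by metis
next
  case (limit \<psi> x)
  have "cmod (cip g x - cip s \<psi>) \<le> e" if "e > 0" for e
  proof -
    define M where "M = l2norm g + l2norm s + 1"
    have M: "M > 0" by (simp add: M_def add_nonneg_pos)
    have "e / M > 0" using that M by simp
    then obtain \<phi> y where y: "iso_graph I G \<phi> y" "cip g y = cip s \<phi>"
      "l2norm (\<lambda>n. \<psi> n - \<phi> n) < e / M" "l2norm (\<lambda>n. x n - y n) < e / M" using limit(3) by blast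
    note m = iso_graph_mem[OF y(1) G]
    have "cip g x - cip s \<psi> = cip g (\<lambda>n. x n - y n) - cip s (\<lambda>n. \<psi> n - \<phi> n)"
      using cip_diff_right[OF g limit(2)] cip_diff_right[OF s limit(1)] m y(2) by simp
    then have "cmod (cip g x - cip s \<psi>) \<le> l2norm g * l2norm (\<lambda>n. x n - y n) + l2norm s * l2norm (\<lambda>n. \<psi> n - \<phi> n)"
      using cip_CS[OF g ell2_diff[OF limit(2)], of y] cip_CS[OF s ell2_diff[OF limit(1)], of \<phi>] m
        norm_triangle_ineq4[of "cip g (\<lambda>n. x n - y n)" "cip s (\<lambda>n. \<psi> n - \<phi> n)"] by auto
    also have "\<dots> \<le> l2norm g * (e / M) + l2norm s * (e / M)"
      using y by (intro add_mono mult_left_mono) auto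
    also have "\<dots> = (l2norm g + l2norm s) * (e / M)" by (simp only: distrib_right)
    also have "\<dots> \<le> M * (e / M)" using that M by (intro mult_right_mono) (auto simp: M_def)
    finally show ?thesis using M by simp
  qed
  then show ?case using field_le_epsilon[of "cmod (cip g x - cip s \<psi>)" 0] by simp
qed (use eq in \<open>auto simp: cip_scale_right\<close>)

lemma iso_graph_cip:
  assumes G: "G \<subseteq> ell2 I \<times> ell2 I"
    and eq: "\<And>s g s' g'. (s, g) \<in> G \<Longrightarrow> (s', g') \<in> G \<Longrightarrow> cip g g' = cip s s'"
    and \<phi>: "iso_graph I G \<phi> x" and \<psi>: "iso_graph I G \<psi> y"
  shows "cip x y = cip \<phi> \<psi>"
proof -
  have "cip x g = cip \<phi> s" if "(s, g) \<in> G" for s g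
    using iso_graph_cip_step[OF G _ _ eq[OF that] \<phi>] G that by (metis cip_cnj mem_Sigma_iff subsetD)
  then show ?thesis using iso_graph_cip_step[OF G _ _ _ \<psi>, of \<phi> x] iso_graph_mem[OF \<phi> G] by blast
qed

text \<open>The hypothesis \<open>total\<close> speaks of closed subspaces, the form in which
  totality of a family is available. Preserved inner products give preserved distances, hence
  single-valuedness of the relation and closedness of its domain.\<close>

lemma isometry_extension:
  assumes G: "G \<subseteq> ell2 I \<times> ell2 I"
    and eq: "\<And>s g s' g'. (s, g) \<in> G \<Longrightarrow> (s', g') \<in> G \<Longrightarrow> cip g g' = cip s s'"
    and total: "\<And>S. closed_subspace I S \<Longrightarrow> fst ` G \<subseteq> S \<Longrightarrow> S = ell2 I"
  shows "\<exists>W\<in>bounded_ops I. (\<forall>\<phi>\<in>ell2 I. \<forall>\<psi>\<in>ell2 I. cip (W \<phi>) (W \<psi>) = cip \<phi> \<psi>) \<and> (\<forall>(s, g)\<in>G. W s = g)"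
proof -
  have cip: "cip x y = cip \<phi> \<psi>" if "iso_graph I G \<phi> x" "iso_graph I G \<psi> y" for \<phi> \<psi> x y
    by (rule iso_graph_cip[OF G _ that]) (use eq in blast)
  note mem = iso_graph_mem[OF _ G]
  have dist: "l2norm (\<lambda>n. x n - y n) = l2norm (\<lambda>n. \<phi> n - \<psi> n)" if "iso_graph I G \<phi> x" "iso_graph I G \<psi> y" for \<phi> \<psi> x y
  proof -
    have "iso_graph I G (\<lambda>n. \<phi> n - \<psi> n) (\<lambda>n. x n - y n)"
      using iso_graph.add[OF that(1) iso_graph.scale[OF that(2), of "-1"]] by simp
    from cip[OF this this]
    have "(l2norm (\<lambda>n. x n - y n))\<^sup>2 = (l2norm (\<lambda>n. \<phi> n - \<psi> n))\<^sup>2" unfolding cip_self of_real_eq_iff .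
    then show ?thesis by simp
  qed
  have uniq: "x = y" if "iso_graph I G \<psi> x" "iso_graph I G \<psi> y" for \<psi> x y
    by (rule ell2_eqI[of _ I]) (use dist[OF that] mem[OF that(1)] mem[OF that(2)] in auto)
  have "{\<psi>. \<exists>x. iso_graph I G \<psi> x} = ell2 I"
  proof (rule total)
    show "closed_subspace I {\<psi>. \<exists>x. iso_graph I G \<psi> x}"
    proof (rule closed_subspaceI)
      fix \<psi> assume \<psi>: "\<psi> \<in> ell2 I"
        and lim: "\<And>e. e > 0 \<Longrightarrow> \<exists>\<phi>\<in>{\<psi>. \<exists>x. iso_graph I G \<psi> x}. l2norm (\<lambda>n. \<psi> n - \<phi> n) < e"
      have "\<forall>k::nat. \<exists>\<phi> x. iso_graph I G \<phi> x \<and> l2norm (\<lambda>n. \<psi> n - \<phi> n) < 1 / (real k + 1)"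
        using lim[of "1 / (real k + 1)" for k] by fastforce
      then obtain \<phi> x where \<phi>: "\<And>k. iso_graph I G (\<phi> k) (x k)"
        "\<And>k::nat. l2norm (\<lambda>n. \<psi> n - \<phi> k n) < 1 / (real k + 1)" by metis
      have small: "\<exists>N. \<forall>k\<ge>N. l2norm (\<lambda>n. \<psi> n - \<phi> k n) < e" if "e > 0" for e
      proof -
        obtain N :: nat where N: "1 / e < real N" using reals_Archimedean2 by blast
        have "l2norm (\<lambda>n. \<psi> n - \<phi> k n) < e" if "k \<ge> N" for k
        proof -
          have "1 / e < real k + 1" using N that by simp
          then have "1 / (real k + 1) < e" using \<open>e > 0\<close> by (simp add: field_simps)
          then show ?thesis using \<phi>(2)[of k] by linarith
        qed
        then show ?thesis by blast
      qed
      have pm: "\<phi> k \<in> ell2 I" "x k \<in> ell2 I" for k using mem[OF \<phi>(1)] by auto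
      \<comment> \<open>Distances agree on both sides of the relation, so the images
        \<open>x k\<close> are Cauchy, and completeness supplies the image of the limit
        vector.\<close>
      have "\<exists>N. \<forall>j\<ge>N. \<forall>k\<ge>N. l2norm (\<lambda>n. x j n - x k n) < e" if e: "e > 0" for e
      proof -
        obtain N where N: "\<And>k. k \<ge> N \<Longrightarrow> l2norm (\<lambda>n. \<psi> n - \<phi> k n) < e / 2" using small[of "e/2"] e by auto
        have "l2norm (\<lambda>n. x j n - x k n) < e" if "j \<ge> N" "k \<ge> N" for j k
        proof -
          have "l2norm (\<lambda>n. x j n - x k n) \<le> l2norm (\<lambda>n. \<phi> j n - \<psi> n) + l2norm (\<lambda>n. \<psi> n - \<phi> k n)"
            unfolding dist[OF \<phi>(1) \<phi>(1)] by (rule l2norm_triangle_diff[OF pm(1) \<psi> pm(1)])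
          then show ?thesis using N[OF that(1)] N[OF that(2)] l2norm_minus_commute[of \<psi> "\<phi> j"] by linarith
        qed
        then show ?thesis by blast
      qed
      from ell2_complete[of x, OF pm(2) this] obtain y where y: "y \<in> ell2 I"
        "\<And>e. e > 0 \<Longrightarrow> \<exists>N. \<forall>k\<ge>N. l2norm (\<lambda>n. x k n - y n) \<le> e" by blast
      have "iso_graph I G \<psi> y"
      proof (rule iso_graph.limit[OF \<psi> y(1)])
        fix e :: real assume e: "e > 0"
        obtain N where N: "\<And>k. k \<ge> N \<Longrightarrow> l2norm (\<lambda>n. \<psi> n - \<phi> k n) < e" using small[OF e] by auto
        obtain M where M: "\<And>k. k \<ge> M \<Longrightarrow> l2norm (\<lambda>n. x k n - y n) \<le> e / 2" using y(2)[of "e/2"] e by auto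
        have "l2norm (\<lambda>n. y n - x (max M N) n) < e"
          using M[of "max M N"] e l2norm_minus_commute[of y "x (max M N)"] by simp
        then show "\<exists>\<phi> z. iso_graph I G \<phi> z \<and> l2norm (\<lambda>n. \<psi> n - \<phi> n) < e \<and> l2norm (\<lambda>n. y n - z n) < e"
          using \<phi>(1)[of "max M N"] N[of "max M N"] by auto
      qed
      then show "\<psi> \<in> {\<psi>. \<exists>x. iso_graph I G \<psi> x}" by blast
    qed (use mem in \<open>auto intro: iso_graph.zero iso_graph.add iso_graph.scale\<close>)
    show "fst ` G \<subseteq> {\<psi>. \<exists>x. iso_graph I G \<psi> x}" using iso_graph.base[of _ _ G I] by fastforce
  qed
  then have "\<forall>\<psi>\<in>ell2 I. \<exists>x. iso_graph I G \<psi> x" by blast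
  then obtain w where w: "\<And>\<psi>. \<psi> \<in> ell2 I \<Longrightarrow> iso_graph I G \<psi> (w \<psi>)" by metis
  define W where "W = (\<lambda>\<psi>. if \<psi> \<in> ell2 I then w \<psi> else (\<lambda>n. 0))"
  have W: "iso_graph I G \<psi> (W \<psi>)" if "\<psi> \<in> ell2 I" for \<psi> using w that by (simp add: W_def)
  have "blin I I W"
  proof (rule blinI[where K=1])
    fix \<psi> assume \<psi>: "\<psi> \<in> ell2 I"
    show "W \<psi> \<in> ell2 I" using mem[OF W[OF \<psi>]] by blast
    show "l2norm (W \<psi>) \<le> 1 * l2norm \<psi>" using dist[OF W[OF \<psi>] iso_graph.zero] by simp
    show "W (\<lambda>n. c * \<psi> n) = (\<lambda>n. c * W \<psi> n)" for c
      using uniq[OF W[OF ell2_scale[OF \<psi>]] iso_graph.scale[OF W[OF \<psi>]]] .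
  next
    fix \<phi> \<psi> assume "\<phi> \<in> ell2 I" "\<psi> \<in> ell2 I"
    then show "W (\<lambda>n. \<phi> n + \<psi> n) = (\<lambda>n. W \<phi> n + W \<psi> n)"
      using uniq[OF W[OF ell2_add] iso_graph.add[OF W W]] by blast
  qed
  then have "W \<in> bounded_ops I" by (simp add: bounded_ops_iff W_def)
  moreover have "W s = g" if "(s, g) \<in> G" for s g
    using uniq[OF W iso_graph.base[OF that]] G that by blast
  moreover have "cip (W \<phi>) (W \<psi>) = cip \<phi> \<psi>" if "\<phi> \<in> ell2 I" "\<psi> \<in> ell2 I" for \<phi> \<psi>
    by (rule cip[OF W[OF that(1)] W[OF that(2)]])
  ultimately show ?thesis by blast
qed

section \<open>Weyl operators\<close>

definition weyl_exp :: "'n::finite cspace \<Rightarrow> 'n cspace \<Rightarrow> ('n \<Rightarrow> nat) vect" where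
  "weyl_exp z w = (\<lambda>n. exp (- complex_of_real ((norm z)\<^sup>2 / 2) - hprod z w) * exp_vec (z + w) n)"

lemma weyl_exp_mem: "z \<in> coord_space J \<Longrightarrow> w \<in> coord_space J \<Longrightarrow> weyl_exp z w \<in> ell2 (occ J)"
  unfolding weyl_exp_def by (rule ell2_scale, rule exp_vec_mem) auto

text \<open>The Gaussian prefactors cancel all terms of \<open>hprod (z + v) (z + w)\<close> other
  than \<open>hprod v w\<close>, so the prescribed action on exponential vectors is
  isometric.\<close>

lemma cip_weyl_exp: "cip (weyl_exp z v) (weyl_exp z w) = cip (exp_vec v) (exp_vec w)"
proof -
  have c: "cnj (exp (- complex_of_real ((norm z)\<^sup>2 / 2) - hprod z v)) = exp (- complex_of_real ((norm z)\<^sup>2 / 2) - hprod v z)"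
    unfolding exp_cnj by (simp add: hprod_cnj)
  have "hprod v w = (- complex_of_real ((norm z)\<^sup>2 / 2) - hprod v z) + (- complex_of_real ((norm z)\<^sup>2 / 2) - hprod z w) + hprod (z + v) (z + w)"
    by (simp add: hprod_add_left hprod_add_right hprod_self)
  then show ?thesis
    unfolding weyl_exp_def cip_scale_left cip_scale_right cip_exp_vec c by (simp only: exp_add mult_ac)
qed

lemma weyl_isometry:
  assumes z: "z \<in> coord_space J"
  shows "\<exists>W\<in>bounded_ops (occ J).
    (\<forall>\<phi>\<in>ell2 (occ J). \<forall>\<psi>\<in>ell2 (occ J). cip (W \<phi>) (W \<psi>) = cip \<phi> \<psi>) \<and>
    (\<forall>w\<in>coord_space J. W (exp_vec w) = weyl_exp z w)"
proof -
  define G where "G = (\<lambda>w. (exp_vec w, weyl_exp z w)) ` coord_space J"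
  have "\<exists>W\<in>bounded_ops (occ J). (\<forall>\<phi>\<in>ell2 (occ J). \<forall>\<psi>\<in>ell2 (occ J). cip (W \<phi>) (W \<psi>) = cip \<phi> \<psi>) \<and> (\<forall>(s, g)\<in>G. W s = g)"
  proof (rule isometry_extension)
    show "G \<subseteq> ell2 (occ J) \<times> ell2 (occ J)"
      using z by (auto simp: G_def exp_vec_mem weyl_exp_mem)
    show "S = ell2 (occ J)" if "closed_subspace (occ J) S" "fst ` G \<subseteq> S" for S
      by (rule closed_subspace_exp_vecs[OF that(1)]) (use that(2) in \<open>auto simp: G_def image_image\<close>)
  qed (auto simp: G_def cip_weyl_exp)
  then show ?thesis by (auto simp: G_def)
qed

text \<open>The canonical commutation relations on exponential vectors, for any operator with the
  prescribed action, since they enter the proof that \<open>weyl\<close> is well defined. The real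
  part of \<open>hprod z y\<close> is absorbed in the norm of \<open>z + y\<close>; only the
  imaginary part is left as a phase.\<close>

lemma blin_weyl_exp:
  assumes "blin (occ J) (occ J) W" "\<And>w. w \<in> coord_space J \<Longrightarrow> W (exp_vec w) = weyl_exp z w" "y \<in> coord_space J" "w \<in> coord_space J"
  shows "W (weyl_exp y w) = (\<lambda>n. exp (- \<i> * complex_of_real (Im (hprod z y))) * weyl_exp (z + y) w n)"
proof -
  have yw: "y + w \<in> coord_space J" using assms by auto
  have "W (weyl_exp y w) = (\<lambda>n. exp (- complex_of_real ((norm y)\<^sup>2 / 2) - hprod y w) * weyl_exp z (y + w) n)"
    unfolding weyl_exp_def[of y] blin_scale[OF assms(1) exp_vec_mem[OF yw]] assms(2)[OF yw] ..
  also have "\<dots> = (\<lambda>n. exp (- complex_of_real ((norm y)\<^sup>2 / 2) - hprod y w - complex_of_real ((norm z)\<^sup>2 / 2) - hprod z (y + w)) * exp_vec (z + y + w) n)"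
  proof -
    have e: "exp (a - b) * (exp (- c - d) * x) = exp (a - b - c - d) * x" for a b c d x :: complex
    proof -
      have "a - b - c - d = (a - b) + (- c - d)" by simp
      then show ?thesis by (simp only: exp_add mult.assoc)
    qed
    show ?thesis unfolding weyl_exp_def add.assoc e ..
  qed
  also have "- complex_of_real ((norm y)\<^sup>2 / 2) - hprod y w - complex_of_real ((norm z)\<^sup>2 / 2) - hprod z (y + w) =
    - \<i> * complex_of_real (Im (hprod z y)) + (- complex_of_real ((norm (z + y))\<^sup>2 / 2) - hprod (z + y) w)"
  proof -
    have d: "hprod y z = hprod z y - 2 * \<i> * complex_of_real (Im (hprod z y))"
      using hprod_cnj[of z y] by (auto simp: complex_eq_iff)
    have "complex_of_real ((norm (z + y))\<^sup>2) = complex_of_real ((norm z)\<^sup>2) + complex_of_real ((norm y)\<^sup>2) +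
        (2 * hprod z y - 2 * \<i> * complex_of_real (Im (hprod z y)))"
      unfolding hprod_self[symmetric] by (simp add: hprod_add_left hprod_add_right d)
    then have "complex_of_real ((norm (z + y))\<^sup>2 / 2) = complex_of_real ((norm z)\<^sup>2 / 2) + complex_of_real ((norm y)\<^sup>2 / 2) +
        (hprod z y - \<i> * complex_of_real (Im (hprod z y)))"
      unfolding of_real_divide by (simp only: of_real_numeral) (simp add: add_divide_distrib diff_divide_distrib)
    then show ?thesis unfolding hprod_add_left hprod_add_right by (simp add: add_divide_distrib diff_divide_distrib)
  qed
  also have "(\<lambda>n. exp (- \<i> * complex_of_real (Im (hprod z y)) + (- complex_of_real ((norm (z + y))\<^sup>2 / 2) - hprod (z + y) w)) * exp_vec (z + y + w) n)
    = (\<lambda>n. exp (- \<i> * complex_of_real (Im (hprod z y))) * weyl_exp (z + y) w n)"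
    unfolding weyl_exp_def exp_add by (simp add: mult.assoc)
  finally show ?thesis .
qed

lemma weyl_exp_zero: "weyl_exp 0 w = exp_vec w"
  by (simp add: weyl_exp_def)

text \<open>The isometry for \<open>- z\<close> inverts the one for \<open>z\<close> because the
  phase \<open>Im (hprod z z)\<close> vanishes, and the inverse of a surjective isometry is its
  adjoint.\<close>

lemma weyl_exists:
  assumes z: "z \<in> coord_space J"
  shows "\<exists>W V. W \<in> unitary_ops (occ J) \<and> adj_op (occ J) W = V \<and> V \<in> bounded_ops (occ J) \<and>
    (\<forall>w\<in>coord_space J. W (exp_vec w) = weyl_exp z w) \<and> (\<forall>w\<in>coord_space J. V (exp_vec w) = weyl_exp (- z) w)"
proof -
  obtain W where W: "W \<in> bounded_ops (occ J)" "\<And>\<phi> \<psi>. \<phi> \<in> ell2 (occ J) \<Longrightarrow> \<psi> \<in> ell2 (occ J) \<Longrightarrow> cip (W \<phi>) (W \<psi>) = cip \<phi> \<psi>"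
    "\<And>w. w \<in> coord_space J \<Longrightarrow> W (exp_vec w) = weyl_exp z w"
    using weyl_isometry[OF z] by blast
  obtain V where V: "V \<in> bounded_ops (occ J)"
    "\<And>w. w \<in> coord_space J \<Longrightarrow> V (exp_vec w) = weyl_exp (- z) w"
    using weyl_isometry[OF coord_space_minus[OF z]] by blast
  have Wb: "blin (occ J) (occ J) W" and Vb: "blin (occ J) (occ J) V" using W V by (simp_all add: bounded_ops_iff)
  have im: "Im (hprod z z) = 0" by (simp add: hprod_self)
  have idb: "blin (occ J) (occ J) (\<lambda>\<psi>. \<psi>)" by (rule blinI[where K=1]) auto
  have WV: "W (V \<psi>) = \<psi>" if "\<psi> \<in> ell2 (occ J)" for \<psi>
    by (rule blin_eqI_exp_vecs[OF blin_comp[OF Vb Wb] idb _ that])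
       (simp add: V(2) blin_weyl_exp[OF Wb W(3) coord_space_minus[OF z]] hprod_minus_right im weyl_exp_zero)
  have VW: "V (W \<psi>) = \<psi>" if "\<psi> \<in> ell2 (occ J)" for \<psi>
    by (rule blin_eqI_exp_vecs[OF blin_comp[OF Wb Vb] idb _ that])
       (simp add: W(3) blin_weyl_exp[OF Vb V(2) z] hprod_minus_left im weyl_exp_zero)
  have adj: "cip (W \<phi>) \<psi> = cip \<phi> (V \<psi>)" if "\<phi> \<in> ell2 (occ J)" "\<psi> \<in> ell2 (occ J)" for \<phi> \<psi>
    using W(2)[OF that(1) blin_mem[OF Vb that(2)]] WV[OF that(2)] by simp
  note u = unitary_opsI[OF W(1) V(1) adj WV VW]
  show ?thesis using u W(3) V by blast
qed

lemma weyl_eqI: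
  assumes "W \<in> unitary_ops (occ J)" "\<And>w. w \<in> coord_space J \<Longrightarrow> W (exp_vec w) = weyl_exp z w"
  shows "weyl J z = W"
  unfolding weyl_def
proof (rule the_equality)
  show "W \<in> unitary_ops (occ J) \<and> (\<forall>w\<in>coord_space J. W (exp_vec w) =
        (\<lambda>n. exp (- complex_of_real ((norm z)\<^sup>2 / 2) - hprod z w) * exp_vec (z + w) n))"
    using assms by (simp add: weyl_exp_def)
  fix X assume X: "X \<in> unitary_ops (occ J) \<and> (\<forall>w\<in>coord_space J. X (exp_vec w) =
        (\<lambda>n. exp (- complex_of_real ((norm z)\<^sup>2 / 2) - hprod z w) * exp_vec (z + w) n))"
  show "X = W"
    by (rule bounded_ops_eqI_exp_vecs[of _ J]) (use X assms in \<open>auto simp: weyl_exp_def unitary_ops_bounded\<close>)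
qed

lemma weyl:
  assumes z: "z \<in> coord_space J"
  shows weyl_unitary: "weyl J z \<in> unitary_ops (occ J)"
    and weyl_exp_vec: "\<And>w. w \<in> coord_space J \<Longrightarrow> weyl J z (exp_vec w) = weyl_exp z w"
    and weyl_adj: "adj_op (occ J) (weyl J z) = weyl J (- z)"
proof -
  obtain W V where W: "W \<in> unitary_ops (occ J)" "adj_op (occ J) W = V" "V \<in> bounded_ops (occ J)"
    "\<And>w. w \<in> coord_space J \<Longrightarrow> W (exp_vec w) = weyl_exp z w"
    "\<And>w. w \<in> coord_space J \<Longrightarrow> V (exp_vec w) = weyl_exp (- z) w"
    using weyl_exists[OF z] by blast
  have e: "weyl J z = W" by (rule weyl_eqI[OF W(1,4)])
  obtain W' where W': "W' \<in> unitary_ops (occ J)" "\<And>w. w \<in> coord_space J \<Longrightarrow> W' (exp_vec w) = weyl_exp (- z) w"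
    using weyl_exists[OF coord_space_minus[OF z]] by blast
  have "V = W'"
    by (rule bounded_ops_eqI_exp_vecs[of _ J]) (use W W' in \<open>auto simp: unitary_ops_bounded\<close>)
  moreover have "weyl J (- z) = W'" by (rule weyl_eqI[OF W'])
  ultimately show "adj_op (occ J) (weyl J z) = weyl J (- z)" using e W by simp
  show "weyl J z \<in> unitary_ops (occ J)" "\<And>w. w \<in> coord_space J \<Longrightarrow> weyl J z (exp_vec w) = weyl_exp z w"
    using e W by simp_all
qed

lemma weyl_bounded: "z \<in> coord_space J \<Longrightarrow> weyl J z \<in> bounded_ops (occ J)"
  and weyl_blin: "z \<in> coord_space J \<Longrightarrow> blin (occ J) (occ J) (weyl J z)"
  by (auto dest: weyl_unitary intro: unitary_ops_bounded unitary_ops_blin)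

lemma weyl_cip_left:
  assumes "z \<in> coord_space J" "\<phi> \<in> ell2 (occ J)" "\<psi> \<in> ell2 (occ J)"
  shows "cip (weyl J z \<phi>) \<psi> = cip \<phi> (weyl J (- z) \<psi>)"
  using adj_op_cip[OF weyl_bounded[OF assms(1)] assms(2,3)] weyl_adj[OF assms(1)] by simp

lemma blin_scaling: "blin I I (\<lambda>\<psi> n. c * \<psi> n)"
  by (rule blinI[where K="cmod c"]) (auto simp: ell2_scale l2norm_scale distrib_left mult.left_commute)

lemma weyl_comp:
  assumes z: "z \<in> coord_space J" and w: "w \<in> coord_space J" and \<psi>: "\<psi> \<in> ell2 (occ J)"
  shows "weyl J z (weyl J w \<psi>) = (\<lambda>n. exp (- \<i> * complex_of_real (Im (hprod z w))) * weyl J (z + w) \<psi> n)"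
proof (rule blin_eqI_exp_vecs[OF blin_comp[OF weyl_blin[OF w] weyl_blin[OF z]] _ _ \<psi>])
  have zw: "z + w \<in> coord_space J" using z w by auto
  from blin_comp[OF weyl_blin[OF zw] blin_scaling]
  show "blin (occ J) (occ J) (\<lambda>\<psi> n. exp (- \<i> * complex_of_real (Im (hprod z w))) * weyl J (z + w) \<psi> n)" .
  fix v assume v: "v \<in> coord_space J"
  show "weyl J z (weyl J w (exp_vec v)) = (\<lambda>n. exp (- \<i> * complex_of_real (Im (hprod z w))) * weyl J (z + w) (exp_vec v) n)"
    unfolding weyl_exp_vec[OF w v] weyl_exp_vec[OF zw v]
    by (rule blin_weyl_exp[OF weyl_blin[OF z] weyl_exp_vec[OF z] w v])
qed

text \<open>A uniform limit of continuous functions is continuous: the common bound \<open>K\<close>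
  makes the approximation of the vector uniform in \<open>z\<close>.\<close>

lemma continuous_closed_subspace:
  fixes F :: "'z::metric_space \<Rightarrow> 'a vect \<Rightarrow> complex"
  assumes F: "\<And>z. z \<in> D \<Longrightarrow> bfun I (F z)" and K: "\<And>z \<psi>. z \<in> D \<Longrightarrow> \<psi> \<in> ell2 I \<Longrightarrow> cmod (F z \<psi>) \<le> K * l2norm \<psi>"
  shows "closed_subspace I {\<psi> \<in> ell2 I. continuous_on D (\<lambda>z. F z \<psi>)}"
proof -
  have add: "F z (\<lambda>n. \<phi> n + \<psi> n) = F z \<phi> + F z \<psi>" if "z \<in> D" "\<phi> \<in> ell2 I" "\<psi> \<in> ell2 I" for z \<phi> \<psi>
    using F[OF that(1)] that by (simp add: bfun_def)
  have scale: "F z (\<lambda>n. c * \<psi> n) = c * F z \<psi>" if "z \<in> D" "\<psi> \<in> ell2 I" for z c \<psi>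
    using F[OF that(1)] that by (simp add: bfun_def)
  show ?thesis
  proof (rule closed_subspaceI)
    have "F z (\<lambda>n. 0) = 0" if "z \<in> D" for z using scale[OF that ell2_zero, of 0] by simp
    then show "(\<lambda>n. 0) \<in> {\<psi> \<in> ell2 I. continuous_on D (\<lambda>z. F z \<psi>)}"
      by (simp cong: continuous_on_cong)
  next
    fix \<phi> \<psi> assume *: "\<phi> \<in> {\<psi> \<in> ell2 I. continuous_on D (\<lambda>z. F z \<psi>)}" "\<psi> \<in> {\<psi> \<in> ell2 I. continuous_on D (\<lambda>z. F z \<psi>)}"
    then have "continuous_on D (\<lambda>z. F z \<phi> + F z \<psi>)" by (auto intro: continuous_on_add)
    then show "(\<lambda>n. \<phi> n + \<psi> n) \<in> {\<psi> \<in> ell2 I. continuous_on D (\<lambda>z. F z \<psi>)}"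
      using * by (simp add: ell2_add add cong: continuous_on_cong)
  next
    fix c \<psi> assume *: "\<psi> \<in> {\<psi> \<in> ell2 I. continuous_on D (\<lambda>z. F z \<psi>)}"
    then have "continuous_on D (\<lambda>z. c * F z \<psi>)" by (auto intro: continuous_on_mult_left)
    then show "(\<lambda>n. c * \<psi> n) \<in> {\<psi> \<in> ell2 I. continuous_on D (\<lambda>z. F z \<psi>)}"
      using * by (simp add: ell2_scale scale cong: continuous_on_cong)
  next
    fix \<psi> assume \<psi>: "\<psi> \<in> ell2 I"
      and lim: "\<And>e. e > 0 \<Longrightarrow> \<exists>\<phi>\<in>{\<psi> \<in> ell2 I. continuous_on D (\<lambda>z. F z \<psi>)}. l2norm (\<lambda>n. \<psi> n - \<phi> n) < e"
    have "continuous_on D (\<lambda>z. F z \<psi>)"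
      unfolding continuous_on_iff
    proof (intro ballI allI impI)
      fix z and e :: real assume z: "z \<in> D" and e: "e > 0"
      define M where "M = \<bar>K\<bar> + 1"
      have M: "M > 0" by (simp add: M_def add_nonneg_pos)
      have "e / (3 * M) > 0" using e M by simp
      from lim[OF this] obtain \<phi> where \<phi>: "\<phi> \<in> ell2 I" "continuous_on D (\<lambda>z. F z \<phi>)" "l2norm (\<lambda>n. \<psi> n - \<phi> n) < e / (3 * M)"
        by auto
      have close: "dist (F x \<psi>) (F x \<phi>) \<le> e / 3" if "x \<in> D" for x
      proof -
        have "F x \<psi> - F x \<phi> = F x (\<lambda>n. \<psi> n - \<phi> n)"
          using add[OF that \<psi> ell2_scale[OF \<phi>(1), of "-1"]] scale[OF that \<phi>(1), of "-1"] by simp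
        then have "dist (F x \<psi>) (F x \<phi>) \<le> K * l2norm (\<lambda>n. \<psi> n - \<phi> n)"
          using K[OF that ell2_diff[OF \<psi> \<phi>(1)]] by (simp add: dist_norm)
        also have "\<dots> \<le> M * l2norm (\<lambda>n. \<psi> n - \<phi> n)" by (rule mult_right_mono) (auto simp: M_def)
        also have "\<dots> \<le> M * (e / (3 * M))" using \<phi>(3) M by (intro mult_left_mono) auto
        finally show ?thesis using M by simp
      qed
      obtain d where d: "d > 0" "\<And>x. x \<in> D \<Longrightarrow> dist x z < d \<Longrightarrow> dist (F x \<phi>) (F z \<phi>) < e / 3"
        using \<phi>(2) z e unfolding continuous_on_iff by (metis divide_pos_pos zero_less_numeral)
      have "dist (F x \<psi>) (F z \<psi>) < e" if "x \<in> D" "dist x z < d" for x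
      proof -
        have "dist (F x \<psi>) (F z \<psi>) \<le> dist (F x \<psi>) (F x \<phi>) + dist (F x \<phi>) (F z \<phi>) + dist (F z \<psi>) (F z \<phi>)"
          by (metis (no_types, lifting) add.commute add_mono_thms_linordered_semiring(3) dist_commute dist_triangle dist_triangle_le order_refl)
        then show ?thesis using close[OF that(1)] close[OF z] d(2)[OF that] by linarith
      qed
      then show "\<exists>d>0. \<forall>x\<in>D. dist x z < d \<longrightarrow> dist (F x \<psi>) (F z \<psi>) < e" using d(1) by blast
    qed
    then show "\<psi> \<in> {\<psi> \<in> ell2 I. continuous_on D (\<lambda>z. F z \<psi>)}" using \<psi> by simp
  qed auto
qed

lemma weyl_cip_bound:
  assumes "z \<in> coord_space J" "\<phi> \<in> ell2 (occ J)" "\<psi> \<in> ell2 (occ J)"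
  shows "cmod (cip \<phi> (weyl J z \<psi>)) \<le> l2norm \<phi> * l2norm \<psi>"
  using cip_CS[OF assms(2) blin_mem[OF weyl_blin[OF assms(1)] assms(3)]]
    unitary_ops_l2norm[OF weyl_unitary[OF assms(1)] assms(3)] by simp

lemma cip_exp_weyl_exp:
  assumes "z \<in> coord_space J" "b \<in> coord_space J"
  shows "cip (exp_vec a) (weyl J z (exp_vec b)) =
    exp (- complex_of_real ((norm z)\<^sup>2 / 2) - hprod z b + hprod a (z + b))"
  unfolding weyl_exp_vec[OF assms] weyl_exp_def cip_scale_right cip_exp_vec exp_add ..

text \<open>Density is used in one argument after the other. The second pass is phrased with
  \<open>cip (weyl J z \<psi>) \<phi>\<close>, which is linear in \<phi>, and conjugated at the
  end.\<close>

lemma weyl_continuous: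
  assumes \<phi>: "\<phi> \<in> ell2 (occ J)" and \<psi>: "\<psi> \<in> ell2 (occ J)"
  shows "continuous_on (coord_space J) (\<lambda>z. cip \<phi> (weyl J z \<psi>))"
proof -
  have 1: "continuous_on (coord_space J) (\<lambda>z. cip (exp_vec a) (weyl J z \<psi>))" if a: "a \<in> coord_space J" for a
  proof -
    have "{\<psi> \<in> ell2 (occ J). continuous_on (coord_space J) (\<lambda>z. cip (exp_vec a) (weyl J z \<psi>))} = ell2 (occ J)"
    proof (rule closed_subspace_exp_vecs)
      show "closed_subspace (occ J) {\<psi> \<in> ell2 (occ J). continuous_on (coord_space J) (\<lambda>z. cip (exp_vec a) (weyl J z \<psi>))}"
        by (rule continuous_closed_subspace[where K="l2norm (exp_vec a)"])
           (use a in \<open>auto intro: bfun_cip_blin[OF weyl_blin exp_vec_mem] weyl_cip_bound exp_vec_mem\<close>)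
      fix b :: "'a cspace" assume b: "b \<in> coord_space J"
      have "continuous_on (coord_space J) (\<lambda>z. exp (- complex_of_real ((norm z)\<^sup>2 / 2) - hprod z b + hprod a (z + b)))"
        unfolding hprod_def by (intro continuous_intros) auto
      then have "continuous_on (coord_space J) (\<lambda>z. cip (exp_vec a) (weyl J z (exp_vec b)))"
        using b by (simp add: cip_exp_weyl_exp cong: continuous_on_cong)
      then show "exp_vec b \<in> {\<psi> \<in> ell2 (occ J). continuous_on (coord_space J) (\<lambda>z. cip (exp_vec a) (weyl J z \<psi>))}"
        using b by (simp add: exp_vec_mem)
    qed
    then show ?thesis using \<psi> by auto
  qed
  have "{\<phi> \<in> ell2 (occ J). continuous_on (coord_space J) (\<lambda>z. cip (weyl J z \<psi>) \<phi>)} = ell2 (occ J)"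
  proof (rule closed_subspace_exp_vecs)
    show "closed_subspace (occ J) {\<phi> \<in> ell2 (occ J). continuous_on (coord_space J) (\<lambda>z. cip (weyl J z \<psi>) \<phi>)}"
    proof (rule continuous_closed_subspace[where K="l2norm \<psi>"])
      fix z \<phi> assume "z \<in> coord_space J" "\<phi> \<in> ell2 (occ J)"
      then show "cmod (cip (weyl J z \<psi>) \<phi>) \<le> l2norm \<psi> * l2norm \<phi>"
        using weyl_cip_bound[of z J \<phi> \<psi>] \<psi> by (metis cip_cnj complex_mod_cnj mult.commute)
    qed (auto intro: bfun_cip blin_mem[OF weyl_blin \<psi>])
    fix a :: "'a cspace" assume a: "a \<in> coord_space J"
    have "continuous_on (coord_space J) (\<lambda>z. cnj (cip (exp_vec a) (weyl J z \<psi>)))"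
      by (intro continuous_intros 1 a)
    then show "exp_vec a \<in> {\<phi> \<in> ell2 (occ J). continuous_on (coord_space J) (\<lambda>z. cip (weyl J z \<psi>) \<phi>)}"
      using a by (simp add: cip_cnj exp_vec_mem)
  qed
  then have "continuous_on (coord_space J) (\<lambda>z. cnj (cip (weyl J z \<psi>) \<phi>))" using \<phi> by (intro continuous_intros) auto
  then show ?thesis by (simp add: cip_cnj)
qed

text \<open>The squared norms of the vectors \<open>v k\<close> are summable and bound the summands
  for all \<open>z\<close>, so the series converges uniformly.\<close>

lemma mix_tr_weyl_continuous:
  assumes v: "mixture (occ J) v"
  shows "continuous_on (coord_space J) (\<lambda>z. mix_tr v (weyl J z))"
proof -
  have "uniform_limit (coord_space J) (\<lambda>X z. \<Sum>k\<in>X. cip (v k) (weyl J z (v k))) (\<lambda>z. \<Sum>\<^sub>\<infinity>k. cip (v k) (weyl J z (v k))) (finite_subsets_at_top UNIV)"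
    by (rule Weierstrass_m_test_general[OF _ mixture_summable[OF v]])
       (metis weyl_cip_bound mixture_mem[OF v] power2_eq_square)
  moreover have "continuous_on (coord_space J) (\<lambda>z. \<Sum>k\<in>X. cip (v k) (weyl J z (v k)))" for X
    by (intro continuous_on_sum weyl_continuous mixture_mem[OF v])
  ultimately show ?thesis unfolding mix_tr_def
    by (intro uniform_limit_theorem[OF _ _ finite_subsets_at_top_neq_bot]) auto
qed

section \<open>The characteristic function determines the state\<close>

text \<open>The characteristic function of the standard normal distribution after the substitution
  \<open>t + sqrt 2 * x\<close>: the shift absorbs the real part of \<alpha> by completing the
  square, the frequency \<open>s\<close> carries the imaginary part.\<close>

lemma gaussian_integral_complex:
  fixes \<alpha> :: complex
  shows "has_bochner_integral lborel (\<lambda>x::real. exp (- complex_of_real (x\<^sup>2) + \<alpha> * complex_of_real x))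
    (complex_of_real (sqrt pi) * exp (\<alpha>\<^sup>2 / 4))"
proof -
  define p q where "p = Re \<alpha>" and "q = Im \<alpha>"
  have \<alpha>: "\<alpha> = complex_of_real p + \<i> * complex_of_real q" by (simp add: p_def q_def complex_eq)
  define s where "s = q / sqrt 2"
  have int: "integrable lborel (\<lambda>y. std_normal_density y *\<^sub>R iexp (s * y))"
    by (rule Bochner_Integration.integrable_bound[of _ std_normal_density]) auto
  have "(LINT y|lborel. std_normal_density y *\<^sub>R iexp (s * y)) = char std_normal_distribution s"
    unfolding char_def by (subst integral_density) auto
  also have "\<dots> = complex_of_real (exp (- (s\<^sup>2) / 2))" by (simp add: char_std_normal_distribution)
  finally have A: "has_bochner_integral lborel (\<lambda>y. std_normal_density y *\<^sub>R iexp (s * y)) (complex_of_real (exp (- (s\<^sup>2) / 2)))"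
    using int by (simp add: has_bochner_integral_iff)
  define t where "t = - p / sqrt 2"
  have B: "has_bochner_integral lborel (\<lambda>x. std_normal_density (t + sqrt 2 * x) *\<^sub>R iexp (s * (t + sqrt 2 * x)))
    (complex_of_real (exp (- (s\<^sup>2) / 2)) /\<^sub>R \<bar>sqrt 2\<bar>)"
    using A by (subst (asm) lborel_has_bochner_integral_real_affine_iff[where c="sqrt 2" and t=t]) auto
  \<comment> \<open>\<open>K\<close> restores the normalization \<open>sqrt (2 * pi)\<close> and
    compensates the constants \<open>p\<^sup>2 / 4\<close> and \<open>p * q / 2\<close> left over by
    the shift.\<close>
  define K where "K = complex_of_real (sqrt (2 * pi)) * exp (complex_of_real (p\<^sup>2 / 4) + \<i> * complex_of_real (p * q / 2))"
  have e1: "(t + sqrt 2 * x)\<^sup>2 / 2 = x\<^sup>2 - p * x + p\<^sup>2 / 4" for x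
    by (simp add: t_def power2_eq_square field_simps)
  have e2: "s * (t + sqrt 2 * x) = q * x - p * q / 2" for x
    by (simp add: t_def s_def field_simps)
  have fun_eq: "K * (std_normal_density (t + sqrt 2 * x) *\<^sub>R iexp (s * (t + sqrt 2 * x))) = exp (- complex_of_real (x\<^sup>2) + \<alpha> * complex_of_real x)" for x
  proof -
    have "K * (std_normal_density (t + sqrt 2 * x) *\<^sub>R iexp (s * (t + sqrt 2 * x))) =
      exp (complex_of_real (p\<^sup>2 / 4) + \<i> * complex_of_real (p * q / 2)) * (exp (complex_of_real (- (x\<^sup>2 - p * x + p\<^sup>2 / 4))) * iexp (q * x - p * q / 2))"
      unfolding std_normal_density_def minus_divide_left[symmetric] e1 e2 by (simp add: K_def scaleR_conv_of_real flip: exp_of_real)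
    also have "\<dots> = exp ((complex_of_real (p\<^sup>2 / 4) + \<i> * complex_of_real (p * q / 2)) + (complex_of_real (- (x\<^sup>2 - p * x + p\<^sup>2 / 4)) + \<i> * complex_of_real (q * x - p * q / 2)))"
      by (simp only: exp_add)
    also have "(complex_of_real (p\<^sup>2 / 4) + \<i> * complex_of_real (p * q / 2)) + (complex_of_real (- (x\<^sup>2 - p * x + p\<^sup>2 / 4)) + \<i> * complex_of_real (q * x - p * q / 2)) =
      - complex_of_real (x\<^sup>2) + \<alpha> * complex_of_real x"
      by (simp add: \<alpha> algebra_simps)
    finally show ?thesis .
  qed
  have val_eq: "K * (complex_of_real (exp (- (s\<^sup>2) / 2)) /\<^sub>R \<bar>sqrt 2\<bar>) = complex_of_real (sqrt pi) * exp (\<alpha>\<^sup>2 / 4)"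
  proof -
    have "K * (complex_of_real (exp (- (s\<^sup>2) / 2)) /\<^sub>R \<bar>sqrt 2\<bar>) =
      complex_of_real (sqrt pi) * (exp (complex_of_real (p\<^sup>2 / 4) + \<i> * complex_of_real (p * q / 2)) * exp (complex_of_real (- (s\<^sup>2) / 2)))"
      unfolding exp_of_real[symmetric] K_def by (simp only: real_sqrt_mult of_real_mult scaleR_conv_of_real) (simp add: field_simps)
    also have "\<dots> = complex_of_real (sqrt pi) * exp ((complex_of_real (p\<^sup>2 / 4) + \<i> * complex_of_real (p * q / 2)) + complex_of_real (- (s\<^sup>2) / 2))"
      by (simp only: exp_add)
    also have "(complex_of_real (p\<^sup>2 / 4) + \<i> * complex_of_real (p * q / 2)) + complex_of_real (- (s\<^sup>2) / 2) = \<alpha>\<^sup>2 / 4"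
      by (simp add: \<alpha> s_def power2_eq_square algebra_simps add_divide_distrib)
    finally show ?thesis .
  qed
  show ?thesis using has_bochner_integral_mult_right[OF B, of K] unfolding fun_eq val_eq .
qed

lemma has_bochner_integral_prod_mult:
  fixes f g :: "real \<Rightarrow> 'a::{real_normed_field, banach, second_countable_topology}"
  assumes f: "has_bochner_integral lborel f a" and g: "has_bochner_integral lborel g b"
  shows "has_bochner_integral lborel (\<lambda>p::real \<times> real. f (fst p) * g (snd p)) (a * b)"
proof -
  have fi: "integrable lborel f" "integral\<^sup>L lborel f = a" and gi: "integrable lborel g" "integral\<^sup>L lborel g = b"
    using f g by (auto simp: has_bochner_integral_iff)
  have i: "integrable (lborel \<Otimes>\<^sub>M lborel) (\<lambda>p::real \<times> real. f (fst p) * g (snd p))"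
  proof (rule lborel_pair.Fubini_integrable)
    show "(\<lambda>p. f (fst p) * g (snd p)) \<in> borel_measurable (lborel \<Otimes>\<^sub>M lborel)"
      using borel_measurable_integrable[OF fi(1)] borel_measurable_integrable[OF gi(1)] by measurable
    show "integrable lborel (\<lambda>x. LINT y|lborel. norm (f (fst (x, y)) * g (snd (x, y))))"
      using integrable_norm[OF fi(1)] by (simp add: norm_mult)
    show "AE x in lborel. integrable lborel (\<lambda>y. f (fst (x, y)) * g (snd (x, y)))"
      using gi(1) by simp
  qed
  have "(LINT p|(lborel \<Otimes>\<^sub>M lborel). f (fst p) * g (snd p)) = a * b"
    using lborel_pair.integral_fst'[OF i] fi gi by simp
  then show ?thesis using i by (simp add: has_bochner_integral_iff lborel_prod)
qed

text \<open>Matrix elements of Weyl operators between exponential vectors contain the same Gaussian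
  factor. In the product the exponent is minus the squared modulus, whose exponential has integral
  pi over the plane.\<close>

definition gauss_weight :: "real \<times> real \<Rightarrow> real" where
  "gauss_weight p = exp (- ((fst p)\<^sup>2 + (snd p)\<^sup>2) / 2)"

lemma gauss_weight_integrable: "integrable lborel gauss_weight"
proof -
  have "integrable lborel (\<lambda>x::real. sqrt (2 * pi) * std_normal_density x)"
    by simp
  then have i: "integrable lborel (\<lambda>x::real. exp (- x\<^sup>2 / 2))" by (simp add: std_normal_density_def)
  have "integrable lborel (\<lambda>p::real \<times> real. exp (- (fst p)\<^sup>2 / 2) * exp (- (snd p)\<^sup>2 / 2))"
    by (rule integrable.intros[OF has_bochner_integral_prod_mult]) (rule has_bochner_integral_integrable[OF i])+
  then show ?thesis unfolding gauss_weight_def exp_add[symmetric] by (simp add: add_divide_distrib diff_divide_distrib)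
qed

section \<open>Averaging Weyl operators over one mode\<close>

definition mode_vec :: "'n::finite \<Rightarrow> real \<times> real \<Rightarrow> 'n cspace" where
  "mode_vec j p = axis j (Complex (fst p) (snd p))"

lemma mode_vec_mem: "j \<in> J \<Longrightarrow> mode_vec j p \<in> coord_space J"
  by (auto simp: mode_vec_def coord_space_def axis_def)

lemma hprod_mode_vec: "hprod (mode_vec j p) b = cnj (Complex (fst p) (snd p)) * b $ j"
  "hprod a (mode_vec j p) = cnj (a $ j) * Complex (fst p) (snd p)"
  unfolding hprod_def mode_vec_def axis_def by (simp_all add: if_distrib if_distribR sum.delta cong: if_cong)

lemma norm_mode_vec: "(norm (mode_vec j p))\<^sup>2 = (fst p)\<^sup>2 + (snd p)\<^sup>2"
proof -
  have "complex_of_real ((norm (mode_vec j p))\<^sup>2) = cnj (Complex (fst p) (snd p)) * Complex (fst p) (snd p)"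
    unfolding hprod_self[symmetric] hprod_mode_vec by (simp add: mode_vec_def axis_def)
  also have "\<dots> = complex_of_real ((fst p)\<^sup>2 + (snd p)\<^sup>2)"
    by (simp add: complex_eq_iff power2_eq_square)
  finally show ?thesis using of_real_eq_iff by blast
qed

lemma continuous_mode_vec: "continuous_on UNIV (mode_vec j)"
proof -
  have "continuous_on UNIV (\<lambda>p. Complex (fst p) (snd p))"
    unfolding Complex_eq by (intro continuous_intros)
  then have "continuous_on UNIV (\<lambda>p. if i = j then Complex (fst p) (snd p) else 0)" for i
    by (cases "i = j") (auto simp: continuous_on_const)
  then show ?thesis unfolding mode_vec_def axis_def by (rule continuous_on_vec_lambda)
qed

definition vac_proj :: "'n set \<Rightarrow> ('n \<Rightarrow> nat) oper" where
  "vac_proj F \<psi> = (\<lambda>n. if \<forall>i\<in>F. n i = 0 then \<psi> n else 0)"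

lemma vac_proj_blin: "blin I I (vac_proj F)"
proof (rule blinI[where K=1])
  fix \<psi> :: "('a \<Rightarrow> nat) vect" assume \<psi>: "\<psi> \<in> ell2 I"
  show "vac_proj F \<psi> \<in> ell2 I"
    by (rule ell2_dominated[OF \<psi>]) (auto simp: vac_proj_def ell2_outside[OF \<psi>])
  show "l2norm (vac_proj F \<psi>) \<le> 1 * l2norm \<psi>"
    by (rule l2norm_dominated[OF \<psi>]) (auto simp: vac_proj_def)
qed (auto simp: vac_proj_def fun_eq_iff)

lemma vac_proj_cip: "cip (vac_proj F \<phi>) \<psi> = cip \<phi> (vac_proj F \<psi>)"
  unfolding cip_def by (rule infsum_cong) (simp add: vac_proj_def)

lemma vac_proj_insert: "vac_proj F (vac_proj {j} \<psi>) = vac_proj (insert j F) \<psi>"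
  by (auto simp: vac_proj_def fun_eq_iff)

lemma vac_proj_exp_vec: "vac_proj {j} (exp_vec b) = exp_vec (\<chi> i. if i = j then 0 else b $ i)"
proof
  fix n
  show "vac_proj {j} (exp_vec b) n = exp_vec (\<chi> i. if i = j then 0 else b $ i) n"
  proof (cases "n j = 0")
    case True
    then show ?thesis unfolding vac_proj_def exp_vec_def by (auto intro!: prod.cong)
  next
    case False
    then have "exp_vec (\<chi> i. if i = j then 0 else b $ i) n = 0"
      unfolding exp_vec_def by (intro prod_zero bexI[of _ j]) auto
    then show ?thesis using False by (simp add: vac_proj_def)
  qed
qed

text \<open>The plane integral splits into two Gaussian integrals on the line. Together they
  contribute \<open>\<alpha>\<^sup>2 / 4 + \<beta>\<^sup>2 / 4 = - cnj (a $ j) * b $ j\<close> to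
  the exponent, which removes mode \<open>j\<close> from \<open>hprod a b\<close>, just as the
  vacuum projection does.\<close>

lemma vac_integral_exp_vec:
  assumes j: "j \<in> J" and b: "b \<in> coord_space J"
  shows "has_bochner_integral lborel
    (\<lambda>p. complex_of_real (gauss_weight p) * cip (exp_vec a) (weyl J (mode_vec j p) (exp_vec b)))
    (complex_of_real pi * cip (exp_vec a) (vac_proj {j} (exp_vec b)))"
proof -
  \<comment> \<open>The coefficients of the real and of the imaginary part of the displacement in
    the exponent of the matrix element.\<close>
  define \<alpha> \<beta> where "\<alpha> = cnj (a $ j) - b $ j" and "\<beta> = \<i> * (cnj (a $ j) + b $ j)"
  have *: "has_bochner_integral lborel (\<lambda>p. exp (hprod a b) *
      (exp (- complex_of_real ((fst p)\<^sup>2) + \<alpha> * complex_of_real (fst p)) * exp (- complex_of_real ((snd p)\<^sup>2) + \<beta> * complex_of_real (snd p))))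
    (exp (hprod a b) * ((complex_of_real (sqrt pi) * exp (\<alpha>\<^sup>2 / 4)) * (complex_of_real (sqrt pi) * exp (\<beta>\<^sup>2 / 4))))"
    by (intro has_bochner_integral_mult_right has_bochner_integral_prod_mult gaussian_integral_complex)
  have f: "exp (hprod a b) * (exp (- complex_of_real ((fst p)\<^sup>2) + \<alpha> * complex_of_real (fst p)) * exp (- complex_of_real ((snd p)\<^sup>2) + \<beta> * complex_of_real (snd p)))
    = complex_of_real (gauss_weight p) * cip (exp_vec a) (weyl J (mode_vec j p) (exp_vec b))" for p
  proof -
    have "hprod a b + ((- complex_of_real ((fst p)\<^sup>2) + \<alpha> * complex_of_real (fst p)) + (- complex_of_real ((snd p)\<^sup>2) + \<beta> * complex_of_real (snd p)))
      = complex_of_real (- ((fst p)\<^sup>2 + (snd p)\<^sup>2) / 2) +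
        (- complex_of_real ((norm (mode_vec j p))\<^sup>2 / 2) - hprod (mode_vec j p) b + hprod a (mode_vec j p + b))"
      unfolding norm_mode_vec hprod_add_right hprod_mode_vec \<alpha>_def \<beta>_def Complex_eq
      by (simp add: field_simps)
    then show ?thesis
      unfolding cip_exp_weyl_exp[OF mode_vec_mem[OF j] b] gauss_weight_def exp_of_real[symmetric]
      by (simp only: exp_add[symmetric])
  qed
  have "hprod a (\<chi> i. if i = j then 0 else b $ i) = hprod a b - cnj (a $ j) * b $ j"
      proof -
    have "(\<Sum>i\<in>UNIV - {j}. cnj (a $ i) * (\<chi> i. if i = j then 0 else b $ i) $ i) = (\<Sum>i\<in>UNIV - {j}. cnj (a $ i) * b $ i)"
      by (rule sum.cong) auto
    then show ?thesis unfolding hprod_def sum.remove[OF finite UNIV_I[of j]] by simp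
  qed
  then have c: "cip (exp_vec a) (vac_proj {j} (exp_vec b)) = exp (hprod a b - cnj (a $ j) * b $ j)"
    by (simp add: vac_proj_exp_vec cip_exp_vec)
  have "exp (hprod a b) * ((complex_of_real (sqrt pi) * exp (\<alpha>\<^sup>2 / 4)) * (complex_of_real (sqrt pi) * exp (\<beta>\<^sup>2 / 4)))
    = (complex_of_real (sqrt pi) * complex_of_real (sqrt pi)) * exp (hprod a b + (\<alpha>\<^sup>2 / 4 + \<beta>\<^sup>2 / 4))"
    by (simp only: exp_add mult_ac)
  also have "complex_of_real (sqrt pi) * complex_of_real (sqrt pi) = complex_of_real pi"
    by (simp flip: of_real_mult)
  also have "hprod a b + (\<alpha>\<^sup>2 / 4 + \<beta>\<^sup>2 / 4) = hprod a b - cnj (a $ j) * b $ j"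
      proof -
    have "(x - y)\<^sup>2 / 4 + (\<i> * (x + y))\<^sup>2 / 4 = - (x * y)" for x y :: complex
      by (simp add: power2_eq_square algebra_simps add_divide_distrib diff_divide_distrib)
    then show ?thesis by (simp add: \<alpha>_def \<beta>_def)
  qed
  finally show ?thesis using * unfolding f c by simp
qed

lemma weyl_mode_integrable:
  assumes j: "j \<in> J" and u: "u \<in> ell2 (occ J)" and v: "v \<in> ell2 (occ J)"
  shows "integrable lborel (\<lambda>p. complex_of_real (gauss_weight p) * cip v (weyl J (mode_vec j p) u))"
proof (rule Bochner_Integration.integrable_bound)
  show "integrable lborel (\<lambda>p. gauss_weight p * (l2norm v * l2norm u))"
    by (intro integrable_mult_left gauss_weight_integrable)
  have "continuous_on UNIV (\<lambda>p. cip v (weyl J (mode_vec j p) u))"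
    by (rule continuous_on_compose2[OF weyl_continuous[OF v u] continuous_mode_vec]) (use mode_vec_mem[OF j] in auto)
  moreover have "continuous_on UNIV gauss_weight"
    unfolding gauss_weight_def by (intro continuous_intros) auto
  ultimately have "continuous_on UNIV (\<lambda>p. complex_of_real (gauss_weight p) * cip v (weyl J (mode_vec j p) u))"
    by (intro continuous_intros)
  then show "(\<lambda>p. complex_of_real (gauss_weight p) * cip v (weyl J (mode_vec j p) u)) \<in> borel_measurable lborel"
    by (simp add: borel_measurable_continuous_onI)
  have "norm (complex_of_real (gauss_weight p) * cip v (weyl J (mode_vec j p) u)) \<le> norm (gauss_weight p * (l2norm v * l2norm u))" for p
    using weyl_cip_bound[OF mode_vec_mem[OF j] v u, of p]
    by (simp add: norm_mult gauss_weight_def)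
  then show "AE p in lborel. norm (complex_of_real (gauss_weight p) * cip v (weyl J (mode_vec j p) u)) \<le> norm (gauss_weight p * (l2norm v * l2norm u))"
    by simp
qed

definition weyl_mode_int :: "'n::finite set \<Rightarrow> 'n \<Rightarrow> ('n \<Rightarrow> nat) vect \<Rightarrow> ('n \<Rightarrow> nat) vect \<Rightarrow> complex" where
  "weyl_mode_int J j v u = (LINT p|lborel. complex_of_real (gauss_weight p) * cip v (weyl J (mode_vec j p) u))"

lemma weyl_mode_int_bound:
  assumes j: "j \<in> J" and u: "u \<in> ell2 (occ J)" and v: "v \<in> ell2 (occ J)"
  shows "cmod (weyl_mode_int J j v u) \<le> (LINT p|lborel. gauss_weight p) * l2norm v * l2norm u"
proof -
  have "cmod (weyl_mode_int J j v u) \<le> (LINT p|lborel. norm (complex_of_real (gauss_weight p) * cip v (weyl J (mode_vec j p) u)))"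
    unfolding weyl_mode_int_def by (rule integral_norm_bound)
  also have "\<dots> \<le> (LINT p|lborel. gauss_weight p * (l2norm v * l2norm u))"
    by (rule integral_mono[OF integrable_norm[OF weyl_mode_integrable[OF assms]] integrable_mult_left[OF gauss_weight_integrable]])
       (use weyl_cip_bound[OF mode_vec_mem[OF j] v u] in \<open>simp add: norm_mult gauss_weight_def\<close>)
  finally show ?thesis by (simp add: mult.assoc)
qed

text \<open>Weakly, the Gaussian average of the Weyl operators of mode \<open>j\<close> is pi times
  its vacuum projection. Both sides are bounded in each argument, so exponential vectors suffice;
  conjugation makes the dependence on \<open>v\<close> linear.\<close>

lemma weyl_mode_int_eq:
  assumes j: "j \<in> J" and u: "u \<in> ell2 (occ J)" and v: "v \<in> ell2 (occ J)"
  shows "weyl_mode_int J j v u = complex_of_real pi * cip v (vac_proj {j} u)"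
proof -
  note int = weyl_mode_integrable[OF j]
  note wb = weyl_blin[OF mode_vec_mem[OF j]]
  note wm = blin_mem[OF wb]
  have pm: "vac_proj {j} x \<in> ell2 (occ J)" if "x \<in> ell2 (occ J)" for x by (rule blin_mem[OF vac_proj_blin that])
  have 1: "weyl_mode_int J j (exp_vec a) x = complex_of_real pi * cip (exp_vec a) (vac_proj {j} x)"
    if a: "a \<in> coord_space J" and x: "x \<in> ell2 (occ J)" for a x
  proof (rule bfun_eqI_exp_vecs[OF _ _ _ x])
    have ae: "exp_vec a \<in> ell2 (occ J)" by (rule exp_vec_mem[OF a])
    show "bfun (occ J) (weyl_mode_int J j (exp_vec a))"
      unfolding bfun_def
    proof (intro conjI ballI allI exI)
      fix \<phi> \<psi> :: "('a \<Rightarrow> nat) vect" assume p: "\<phi> \<in> ell2 (occ J)" "\<psi> \<in> ell2 (occ J)"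
      show "weyl_mode_int J j (exp_vec a) (\<lambda>n. \<phi> n + \<psi> n) = weyl_mode_int J j (exp_vec a) \<phi> + weyl_mode_int J j (exp_vec a) \<psi>"
        unfolding weyl_mode_int_def blin_add[OF wb p] cip_add_right[OF ae wm[OF p(1)] wm[OF p(2)]] distrib_left
        by (rule Bochner_Integration.integral_add[OF int[OF p(1) ae] int[OF p(2) ae]])
    next
      fix c \<psi> assume p: "\<psi> \<in> ell2 (occ J)"
      show "weyl_mode_int J j (exp_vec a) (\<lambda>n. c * \<psi> n) = c * weyl_mode_int J j (exp_vec a) \<psi>"
        unfolding weyl_mode_int_def blin_scale[OF wb p] cip_scale_right mult.left_commute[of _ c] by simp
    next
      fix \<psi> assume p: "\<psi> \<in> ell2 (occ J)"
      show "cmod (weyl_mode_int J j (exp_vec a) \<psi>) \<le> (LINT p|lborel. gauss_weight p) * l2norm (exp_vec a) * l2norm \<psi>"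
        by (rule weyl_mode_int_bound[OF j p ae])
    qed
    show "bfun (occ J) (\<lambda>x. complex_of_real pi * cip (exp_vec a) (vac_proj {j} x))"
      using bfun_cip_blin[OF blin_comp[OF vac_proj_blin blin_scaling[of "occ J" "complex_of_real pi"]] ae] by (simp add: cip_scale_right)
    show "weyl_mode_int J j (exp_vec a) (exp_vec w) = complex_of_real pi * cip (exp_vec a) (vac_proj {j} (exp_vec w))"
      if "w \<in> coord_space J" for w
      unfolding weyl_mode_int_def by (rule has_bochner_integral_integral_eq[OF vac_integral_exp_vec[OF j that]])
  qed
  have "cnj (weyl_mode_int J j v u) = complex_of_real pi * cip (vac_proj {j} u) v"
  proof (rule bfun_eqI_exp_vecs[OF _ _ _ v])
    show "bfun (occ J) (\<lambda>v. cnj (weyl_mode_int J j v u))"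
      unfolding bfun_def
    proof (intro conjI ballI allI exI)
      fix \<phi> \<psi> :: "('a \<Rightarrow> nat) vect" assume p: "\<phi> \<in> ell2 (occ J)" "\<psi> \<in> ell2 (occ J)"
      show "cnj (weyl_mode_int J j (\<lambda>n. \<phi> n + \<psi> n) u) = cnj (weyl_mode_int J j \<phi> u) + cnj (weyl_mode_int J j \<psi> u)"
        unfolding weyl_mode_int_def cip_add_left[OF p wm[OF u]] distrib_left complex_cnj_add[symmetric]
        by (subst Bochner_Integration.integral_add[OF int[OF u p(1)] int[OF u p(2)]]) simp
    next
      fix c \<psi> assume p: "\<psi> \<in> ell2 (occ J)"
      show "cnj (weyl_mode_int J j (\<lambda>n. c * \<psi> n) u) = c * cnj (weyl_mode_int J j \<psi> u)"
        unfolding weyl_mode_int_def cip_scale_left mult.left_commute[of _ "cnj c"] by simp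
    next
      fix \<psi> assume p: "\<psi> \<in> ell2 (occ J)"
      show "cmod (cnj (weyl_mode_int J j \<psi> u)) \<le> ((LINT p|lborel. gauss_weight p) * l2norm u) * l2norm \<psi>"
        using weyl_mode_int_bound[OF j u p] by (simp add: mult_ac)
    qed
    have "bfun (occ J) (cip (\<lambda>n. complex_of_real pi * vac_proj {j} u n))"
      by (rule bfun_cip[OF ell2_scale[OF pm[OF u]]])
    then show "bfun (occ J) (\<lambda>v. complex_of_real pi * cip (vac_proj {j} u) v)"
      by (simp add: cip_scale_left[abs_def])
    show "cnj (weyl_mode_int J j (exp_vec w) u) = complex_of_real pi * cip (vac_proj {j} u) (exp_vec w)"
      if "w \<in> coord_space J" for w
      unfolding 1[OF that u] by (simp add: cip_cnj)
  qed
  then have "cnj (cnj (weyl_mode_int J j v u)) = cnj (complex_of_real pi * cip (vac_proj {j} u) v)" by simp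
  then show ?thesis by (simp add: cip_cnj)
qed


text \<open>The trace of the density operator with W(z) P W(w), where P is the vacuum projection of
  the modes in \<open>F\<close>. Up to explicit factors it is a value of the characteristic function
  for empty \<open>F\<close>, and a matrix element of the density operator for
  \<open>F = J\<close>.\<close>

definition weyl_form :: "'n::finite set \<Rightarrow> (nat \<Rightarrow> ('n \<Rightarrow> nat) vect) \<Rightarrow> 'n set \<Rightarrow> 'n cspace \<Rightarrow> 'n cspace \<Rightarrow> complex" where
  "weyl_form J v F z w = mix_tr v (\<lambda>\<psi>. weyl J z (vac_proj F (weyl J w \<psi>)))"

lemma weyl_form_empty:
  assumes v: "mixture (occ J) v" and z: "z \<in> coord_space J" and w: "w \<in> coord_space J"
  shows "weyl_form J v {} z w = exp (- \<i> * complex_of_real (Im (hprod z w))) * mix_tr v (weyl J (z + w))"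
proof -
  have "cip (v k) (weyl J z (vac_proj {} (weyl J w (v k)))) =
    exp (- \<i> * complex_of_real (Im (hprod z w))) * cip (v k) (weyl J (z + w) (v k))" for k
    using weyl_comp[OF z w mixture_mem[OF v]] by (simp add: vac_proj_def cip_scale_right)
  then show ?thesis by (simp add: weyl_form_def mix_tr_def infsum_cmult_right')
qed

text \<open>The projection of one more mode is replaced by its Gaussian average, so the new form is
  an integral of forms for \<open>F\<close>. The phase comes from composing the averaged Weyl
  operator with that of \<open>w\<close>.\<close>

lemma weyl_form_insert:
  assumes v: "mixture (occ J) v" and z: "z \<in> coord_space J" and w: "w \<in> coord_space J" and j: "j \<in> J"
  shows "complex_of_real pi * weyl_form J v (insert j F) z w =
    (LINT p|lborel. complex_of_real (gauss_weight p) * (exp (- \<i> * complex_of_real (Im (hprod (mode_vec j p) w))) *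
      weyl_form J v F z (mode_vec j p + w)))"
proof -
  \<comment> \<open>W(z) and the projection are moved to the left of the inner product, so that
    \<open>weyl_mode_int_eq\<close> applies to \<open>a k\<close> and \<open>b k\<close>.\<close>
  define a where "a k = vac_proj F (weyl J (- z) (v k))" for k
  define b where "b k = weyl J w (v k)" for k
  have mz: "- z \<in> coord_space J" using z by auto
  have a: "a k \<in> ell2 (occ J)" and b: "b k \<in> ell2 (occ J)" for k
    unfolding a_def b_def
    by (rule blin_mem[OF vac_proj_blin blin_mem[OF weyl_blin[OF mz] mixture_mem[OF v]]],
        rule blin_mem[OF weyl_blin[OF w] mixture_mem[OF v]])
  have na: "l2norm (a k) \<le> l2norm (v k)" and nb: "l2norm (b k) = l2norm (v k)" for k
  proof -
    have "l2norm (a k) \<le> 1 * l2norm (weyl J (- z) (v k))"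
      unfolding a_def by (rule l2norm_dominated[OF blin_mem[OF weyl_blin[OF mz] mixture_mem[OF v]]]) (auto simp: vac_proj_def)
    then show "l2norm (a k) \<le> l2norm (v k)"
      using unitary_ops_l2norm[OF weyl_unitary[OF mz] mixture_mem[OF v]] by simp
    show "l2norm (b k) = l2norm (v k)"
      unfolding b_def by (rule unitary_ops_l2norm[OF weyl_unitary[OF w] mixture_mem[OF v]])
  qed
  have move: "cip (v k) (weyl J z (vac_proj F x)) = cip (a k) x" if "x \<in> ell2 (occ J)" for k x
    unfolding a_def vac_proj_cip
    using weyl_cip_left[OF mz mixture_mem[OF v] blin_mem[OF vac_proj_blin that]] by simp
  define f where "f k p = complex_of_real (gauss_weight p) * cip (a k) (weyl J (mode_vec j p) (b k))" for k p
  have fint: "integrable lborel (f k)" for k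
    unfolding f_def by (rule weyl_mode_integrable[OF j b a])
  \<comment> \<open>This bound is integrable in \<open>p\<close> and summable in \<open>k\<close>,
    which justifies exchanging the sum over \<open>k\<close> with the integral.\<close>
  have fbd: "norm (f k p) \<le> gauss_weight p * (l2norm (v k))\<^sup>2" for k p
  proof -
    have "cmod (cip (a k) (weyl J (mode_vec j p) (b k))) \<le> l2norm (a k) * l2norm (b k)"
      by (rule weyl_cip_bound[OF mode_vec_mem[OF j] a b])
    also have "\<dots> \<le> l2norm (v k) * l2norm (v k)" by (intro mult_mono) (simp_all add: na nb)
    finally show ?thesis by (simp add: f_def norm_mult gauss_weight_def power2_eq_square)
  qed
  have sv: "summable (\<lambda>k. (l2norm (v k))\<^sup>2)" by (rule summable_on_imp_summable[OF mixture_summable[OF v]])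
  have s1: "AE p in lborel. summable (\<lambda>k. norm (f k p))"
    by (intro AE_I2 summable_comparison_test'[OF summable_mult[OF sv], of 0]) (use fbd in simp)
  have s2: "summable (\<lambda>k. LINT p|lborel. norm (f k p))"
  proof (rule summable_comparison_test'[OF summable_mult[OF sv, of "LINT p|lborel. gauss_weight p"], of 0])
    fix k
    have "(LINT p|lborel. norm (f k p)) \<le> (LINT p|lborel. gauss_weight p * (l2norm (v k))\<^sup>2)"
      by (rule integral_mono[OF integrable_norm[OF fint] integrable_mult_left[OF gauss_weight_integrable] fbd])
    then show "norm (LINT p|lborel. norm (f k p)) \<le> (LINT p|lborel. gauss_weight p) * (l2norm (v k))\<^sup>2" by simp
  qed
  have int_sum: "(\<lambda>k. integral\<^sup>L lborel (f k)) sums (LINT p|lborel. (\<Sum>k. f k p))"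
    by (rule sums_integral[OF fint s1 s2])
  have lhs: "integral\<^sup>L lborel (f k) = complex_of_real pi * cip (v k) (weyl J z (vac_proj (insert j F) (weyl J w (v k))))" for k
  proof -
    have "integral\<^sup>L lborel (f k) = complex_of_real pi * cip (a k) (vac_proj {j} (b k))"
      using weyl_mode_int_eq[OF j b a] by (simp add: f_def[abs_def] weyl_mode_int_def)
    also have "cip (a k) (vac_proj {j} (b k)) = cip (v k) (weyl J z (vac_proj F (vac_proj {j} (b k))))"
      by (rule move[symmetric, OF blin_mem[OF vac_proj_blin b]])
    finally show ?thesis by (simp add: vac_proj_insert b_def)
  qed
  have xb: "blin (occ J) (occ J) (\<lambda>\<psi>. weyl J z (vac_proj F (weyl J w \<psi>)))" if "w \<in> coord_space J" for w F
    by (rule blin_comp[OF blin_comp[OF weyl_blin[OF that] vac_proj_blin] weyl_blin[OF z]])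
  have "(\<lambda>k. complex_of_real pi * cip (v k) (weyl J z (vac_proj (insert j F) (weyl J w (v k))))) sums
      (complex_of_real pi * weyl_form J v (insert j F) z w)"
    unfolding weyl_form_def mix_tr_def
    by (intro sums_mult has_sum_imp_sums has_sum_infsum mix_tr_summable[OF v xb[OF w]])
  then have "complex_of_real pi * weyl_form J v (insert j F) z w = (LINT p|lborel. (\<Sum>k. f k p))"
    using int_sum unfolding lhs by (rule sums_unique2)
  also have "\<dots> = (LINT p|lborel. complex_of_real (gauss_weight p) * (exp (- \<i> * complex_of_real (Im (hprod (mode_vec j p) w))) *
      weyl_form J v F z (mode_vec j p + w)))"
  proof (rule Bochner_Integration.integral_cong[OF refl])
  fix p
  show "(\<Sum>k. f k p) = complex_of_real (gauss_weight p) * (exp (- \<i> * complex_of_real (Im (hprod (mode_vec j p) w))) *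
      weyl_form J v F z (mode_vec j p + w))"
  proof -
    define c where "c = exp (- \<i> * complex_of_real (Im (hprod (mode_vec j p) w)))"
    have mw: "mode_vec j p + w \<in> coord_space J" by (rule coord_space_add[OF mode_vec_mem[OF j] w])
    have "cip (a k) (weyl J (mode_vec j p) (b k)) = c * cip (v k) (weyl J z (vac_proj F (weyl J (mode_vec j p + w) (v k))))" for k
      unfolding b_def weyl_comp[OF mode_vec_mem[OF j] w mixture_mem[OF v]] cip_scale_right
      using move[OF blin_mem[OF weyl_blin[OF mw] mixture_mem[OF v]]] by (simp add: c_def)
    then have "f k p = complex_of_real (gauss_weight p) * (c * cip (v k) (weyl J z (vac_proj F (weyl J (mode_vec j p + w) (v k)))))" for k
      by (simp add: f_def)
    moreover have "(\<lambda>k. complex_of_real (gauss_weight p) * (c * cip (v k) (weyl J z (vac_proj F (weyl J (mode_vec j p + w) (v k)))))) sums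
      (complex_of_real (gauss_weight p) * (c * weyl_form J v F z (mode_vec j p + w)))"
      unfolding weyl_form_def mix_tr_def
      by (intro sums_mult has_sum_imp_sums has_sum_infsum mix_tr_summable[OF v xb[OF mw]])
    ultimately show ?thesis by (simp add: sums_iff c_def)
  qed
  qed
  finally show ?thesis .
qed

text \<open>With all modes of \<open>J\<close> projected, the projection has rank one onto the
  vacuum, which Weyl operators map to multiples of exponential vectors. The sign of \<open>w\<close>
  comes from the adjoint.\<close>

lemma weyl_form_vacuum:
  assumes v: "mixture (occ J) v" and z: "z \<in> coord_space J" and w: "w \<in> coord_space J"
  shows "weyl_form J v J z w = exp (- complex_of_real (((norm z)\<^sup>2 + (norm w)\<^sup>2) / 2)) *
    cip (exp_vec (- w)) (mix_op (occ J) v (exp_vec z))"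
proof -
  have mw: "- w \<in> coord_space J" using w by auto
  have e0: "exp_vec (0 :: 'a cspace) = ket (\<lambda>i. 0)"
    using part_vec_ket[of "\<lambda>i::'a. 0" "{}"] part_vec_empty[of "\<lambda>i::'a. 0" 0] by (simp add: occ_def)
  have p: "vac_proj J \<psi> = (\<lambda>n. cip (exp_vec 0) \<psi> * exp_vec 0 n)" if \<psi>: "\<psi> \<in> ell2 (occ J)" for \<psi>
  proof
    fix n
    show "vac_proj J \<psi> n = cip (exp_vec 0) \<psi> * exp_vec 0 n"
    proof (cases "n = (\<lambda>i. 0)")
      case True then show ?thesis by (simp add: vac_proj_def e0) (simp add: ket_def)
    next
      case False
      then obtain i where i: "n i \<noteq> 0" by auto
      have "vac_proj J \<psi> n = 0"
      proof (cases "i \<in> J")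
        case True then show ?thesis using i by (auto simp: vac_proj_def)
      next
        case False
        then have "n \<notin> occ J" using i by (auto simp: occ_def)
        then show ?thesis using ell2_outside[OF \<psi>] by (simp add: vac_proj_def)
      qed
      then show ?thesis using False unfolding e0 by (simp add: ket_def)
    qed
  qed
  have we: "weyl J y (exp_vec 0) = (\<lambda>n. exp (- complex_of_real ((norm y)\<^sup>2 / 2)) * exp_vec y n)" if "y \<in> coord_space J" for y
    using weyl_exp_vec[OF that coord_space_zero] by (simp add: weyl_exp_def)
  define cz cw where "cz = exp (- complex_of_real ((norm z)\<^sup>2 / 2))" and "cw = exp (- complex_of_real ((norm w)\<^sup>2 / 2))"
  have ccw: "cnj cw = cw" unfolding cw_def exp_cnj by simp
  have e0m: "exp_vec 0 \<in> ell2 (occ J)" by (rule exp_vec_mem) simp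
  have summand: "cip (v k) (weyl J z (vac_proj J (weyl J w (v k)))) = (cz * cw) * (cip (exp_vec (- w)) (v k) * cip (v k) (exp_vec z))" for k
  proof -
    have "cip (exp_vec 0) (weyl J w (v k)) = cip (weyl J (- w) (exp_vec 0)) (v k)"
      using weyl_cip_left[OF mw e0m mixture_mem[OF v]] by simp
    also have "\<dots> = cw * cip (exp_vec (- w)) (v k)"
      using ccw unfolding we[OF mw] cip_scale_left cw_def norm_minus_cancel by (simp only:)
    finally show ?thesis
      unfolding p[OF blin_mem[OF weyl_blin[OF w] mixture_mem[OF v]]] blin_scale[OF weyl_blin[OF z] e0m] cip_scale_right we[OF z]
      by (simp add: cz_def)
  qed
  have "(\<Sum>\<^sub>\<infinity>k. cip (exp_vec (- w)) (v k) * cip (v k) (exp_vec z)) = cip (exp_vec (- w)) (mix_op (occ J) v (exp_vec z))"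
    by (rule infsumI[OF cip_mix_op[OF v exp_vec_mem[OF mw] exp_vec_mem[OF z]]])
  then have "weyl_form J v J z w = (cz * cw) * cip (exp_vec (- w)) (mix_op (occ J) v (exp_vec z))"
    unfolding weyl_form_def mix_tr_def summand by (simp add: infsum_cmult_right')
  moreover have "cz * cw = exp (- complex_of_real (((norm z)\<^sup>2 + (norm w)\<^sup>2) / 2))"
    unfolding cz_def cw_def exp_add[symmetric] by (simp add: add_divide_distrib)
  ultimately show ?thesis by simp
qed

text \<open>Equal characteristic functions mean equal forms without projection; adding the modes of
  \<open>J\<close> one at a time leads to equal matrix elements between exponential vectors, which
  are total.\<close>

theorem density_eqI_weyl:
  fixes \<rho> \<rho>' :: "('n::finite \<Rightarrow> nat) oper"
  assumes \<rho>: "\<rho> \<in> density_ops (occ J)" and \<rho>': "\<rho>' \<in> density_ops (occ J)"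
    and eq: "\<And>z. z \<in> coord_space J \<Longrightarrow> tr (occ J) (\<rho> \<circ> weyl J z) = tr (occ J) (\<rho>' \<circ> weyl J z)"
  shows "\<rho> = \<rho>'"
proof -
  obtain v :: "nat \<Rightarrow> ('n \<Rightarrow> nat) vect" where v: "mixture (occ J) v" "\<rho> = mix_op (occ J) v" using density_mixture[OF \<rho>] by blast
  obtain v' :: "nat \<Rightarrow> ('n \<Rightarrow> nat) vect" where v': "mixture (occ J) v'" "\<rho>' = mix_op (occ J) v'" using density_mixture[OF \<rho>'] by blast
  have tr: "mix_tr v (weyl J z) = mix_tr v' (weyl J z)" if "z \<in> coord_space J" for z
    using eq[OF that] tr_mix_op[OF v(1) weyl_bounded[OF that]] tr_mix_op[OF v'(1) weyl_bounded[OF that]] v(2) v'(2) by simp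
  have form: "weyl_form J v F z w = weyl_form J v' F z w"
    if "F \<subseteq> J" "z \<in> coord_space J" "w \<in> coord_space J" for F z w
    using finite[of F] that
  proof (induction F arbitrary: z w rule: finite_induct)
    case empty
    then show ?case using tr by (simp add: weyl_form_empty[OF v(1)] weyl_form_empty[OF v'(1)] coord_space_add)
  next
    case (insert j F)
    have j: "j \<in> J" using insert.prems by simp
    have "complex_of_real pi * weyl_form J v (insert j F) z w = complex_of_real pi * weyl_form J v' (insert j F) z w"
      unfolding weyl_form_insert[OF v(1) insert.prems(2,3) j] weyl_form_insert[OF v'(1) insert.prems(2,3) j]
      using insert.IH[of z] insert.prems mode_vec_mem[OF j] by (simp add: coord_space_add)
    then show ?case by simp
  qed
  show ?thesis
  proof (rule bounded_ops_eqI_exp_vecs)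
    show \<rho>b: "\<rho> \<in> bounded_ops (occ J)" "\<rho>' \<in> bounded_ops (occ J)" using \<rho> \<rho>' by (auto simp: density_ops_def)
    fix z :: "'n cspace" assume z: "z \<in> coord_space J"
    have mem: "\<rho> (exp_vec z) \<in> ell2 (occ J)" "\<rho>' (exp_vec z) \<in> ell2 (occ J)"
      using \<rho>b blin_mem exp_vec_mem[OF z] by (auto simp: bounded_ops_iff)
    have "cip (\<rho> (exp_vec z)) \<psi> = cip (\<rho>' (exp_vec z)) \<psi>" if \<psi>: "\<psi> \<in> ell2 (occ J)" for \<psi>
    proof (rule bfun_eqI_exp_vecs[OF bfun_cip[OF mem(1)] bfun_cip[OF mem(2)] _ \<psi>])
      fix w :: "'n cspace" assume w: "w \<in> coord_space J"
      have "weyl_form J v J z (- w) = weyl_form J v' J z (- w)" by (rule form) (use z w in auto)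
      then have "cip (exp_vec w) (\<rho> (exp_vec z)) = cip (exp_vec w) (\<rho>' (exp_vec z))"
        unfolding weyl_form_vacuum[OF v(1) z coord_space_minus[OF w]] weyl_form_vacuum[OF v'(1) z coord_space_minus[OF w]] v(2)[symmetric] v'(2)[symmetric]
        by simp
      then show "cip (\<rho> (exp_vec z)) (exp_vec w) = cip (\<rho>' (exp_vec z)) (exp_vec w)" by (metis cip_cnj)
    qed
    then have "\<rho> (exp_vec z) n = \<rho>' (exp_vec z) n" if "n \<in> occ J" for n
      using ell2_ket[OF that] by (metis cip_ket_right complex_cnj_cancel_iff)
    then show "\<rho> (exp_vec z) = \<rho>' (exp_vec z)" using ell2_outside[OF mem(1)] ell2_outside[OF mem(2)] by (metis ext)
  qed
qed

section \<open>Partial traces and tensor products\<close>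

definition glue :: "'n set \<Rightarrow> ('n \<Rightarrow> nat) \<Rightarrow> ('n \<Rightarrow> nat) \<Rightarrow> 'n \<Rightarrow> nat" where
  "glue J m m' = (\<lambda>i. if i \<in> J then m i else m' i)"

lemma glue_bij: "bij_betw (\<lambda>(m', m). glue J m m') (occ (- J) \<times> occ J) UNIV"
  by (rule bij_betwI[where g="\<lambda>n. (glue J (\<lambda>i. 0) n, glue J n (\<lambda>i. 0))"])
     (auto simp: glue_def occ_def fun_eq_iff)

lemma glue_has_sum:
  "((\<lambda>(m', m). f (glue J m m')) has_sum s) (occ (- J) \<times> occ J) \<longleftrightarrow> (f has_sum s) UNIV"
  using has_sum_reindex_bij_betw[OF glue_bij[of J], of f s] by (simp add: case_prod_unfold)

text \<open>The partial trace of \<open>\<Sum>k. |v\<^sub>k><v\<^sub>k|\<close> over the modes outside \<open>J\<close> is the mixture of all slices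
  of the \<open>v\<^sub>k\<close> at occupation numbers \<open>m'\<close> of these modes.\<close>

definition slice :: "'n set \<Rightarrow> ('n \<Rightarrow> nat) \<Rightarrow> ('n \<Rightarrow> nat) vect \<Rightarrow> ('n \<Rightarrow> nat) vect" where
  "slice J m' \<psi> = (\<lambda>m. if m \<in> occ J \<and> m' \<in> occ (- J) then \<psi> (glue J m m') else 0)"

text \<open>Fubini for occupation numbers split into those of \<open>J\<close> and those of its
  complement. The value type is general because norms use it over the reals and inner products over
  the complex numbers.\<close>

lemma slice_has_sum:
  fixes f :: "('n \<Rightarrow> nat) \<Rightarrow> 'b::{t3_space,ab_group_add,complete_uniform_space,topological_comm_monoid_add,uniform_topological_group_add}"
  assumes f: "(f has_sum s) UNIV"
  shows "\<And>m'. m' \<in> occ (- J) \<Longrightarrow> (\<lambda>m. f (glue J m m')) summable_on occ J"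
    and "((\<lambda>m'. \<Sum>\<^sub>\<infinity>m\<in>occ J. f (glue J m m')) has_sum s) (occ (- J))"
proof -
  have g: "((\<lambda>(m', m). f (glue J m m')) has_sum s) (occ (- J) \<times> occ J)" using f by (simp add: glue_has_sum)
  show i: "(\<lambda>m. f (glue J m m')) summable_on occ J" if "m' \<in> occ (- J)" for m'
    using summable_on_SigmaD1[of "\<lambda>m' m. f (glue J m m')"] has_sum_imp_summable[OF g] that by blast
  show "((\<lambda>m'. \<Sum>\<^sub>\<infinity>m\<in>occ J. f (glue J m m')) has_sum s) (occ (- J))"
    by (rule has_sum_SigmaD[OF g]) (use i in auto)
qed

lemma slice_norm_sum:
  assumes \<psi>: "\<psi> \<in> ell2 UNIV"
  shows "slice J m' \<psi> \<in> ell2 (occ J)"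
    and "((\<lambda>m'. (l2norm (slice J m' \<psi>))\<^sup>2) has_sum (l2norm \<psi>)\<^sup>2) UNIV"
proof -
  note h = slice_has_sum[where J=J, OF l2norm_has_sum[OF \<psi>]]
  have e: "(\<Sum>\<^sub>\<infinity>m\<in>occ J. (cmod (\<psi> (glue J m m')))\<^sup>2) = (l2norm (slice J m' \<psi>))\<^sup>2"
    if "m' \<in> occ (- J)" for m'
    unfolding l2norm_power2 by (rule infsum_cong_neutral) (use that in \<open>auto simp: slice_def\<close>)
  show "slice J m' \<psi> \<in> ell2 (occ J)"
  proof (cases "m' \<in> occ (- J)")
    case True
    have "(\<lambda>m. (cmod (slice J m' \<psi> m))\<^sup>2) summable_on UNIV \<longleftrightarrow> (\<lambda>m. (cmod (\<psi> (glue J m m')))\<^sup>2) summable_on occ J"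
      by (rule summable_on_cong_neutral) (use True in \<open>auto simp: slice_def\<close>)
    then show ?thesis using h(1)[OF True] by (simp add: ell2_def slice_def)
  next
    case False then show ?thesis by (simp add: slice_def)
  qed
  have "((\<lambda>m'. (l2norm (slice J m' \<psi>))\<^sup>2) has_sum (l2norm \<psi>)\<^sup>2) (occ (- J))"
    using h(2) by (subst has_sum_cong[OF e[symmetric]]) auto
  moreover have "l2norm (slice J m' \<psi>) = 0" if "m' \<notin> occ (- J)" for m' using that by (simp add: slice_def)
  ultimately show "((\<lambda>m'. (l2norm (slice J m' \<psi>))\<^sup>2) has_sum (l2norm \<psi>)\<^sup>2) UNIV"
    by (subst has_sum_cong_neutral[where T="occ (- J)" and g="\<lambda>m'. (l2norm (slice J m' \<psi>))\<^sup>2"]) auto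
qed

lemma slice_blin: "blin UNIV (occ J) (slice J m')"
proof (rule blinI[where K=1])
  fix \<psi> :: "('a \<Rightarrow> nat) vect" assume \<psi>: "\<psi> \<in> ell2 UNIV"
  show "slice J m' \<psi> \<in> ell2 (occ J)" by (rule slice_norm_sum(1)[OF \<psi>])
  have "(\<Sum>m'\<in>{m'}. (l2norm (slice J m' \<psi>))\<^sup>2) \<le> (l2norm \<psi>)\<^sup>2"
    by (rule finite_sum_le_has_sum[OF slice_norm_sum(2)[OF \<psi>]]) auto
  then show "l2norm (slice J m' \<psi>) \<le> 1 * l2norm \<psi>" by (simp add: power2_le_iff_abs_le)
qed (auto simp: slice_def fun_eq_iff)

lemma slice_cip:
  assumes \<phi>: "\<phi> \<in> ell2 UNIV" and \<psi>: "\<psi> \<in> ell2 UNIV"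
  shows "((\<lambda>m'. cip (slice J m' \<phi>) (slice J m' \<psi>)) has_sum cip \<phi> \<psi>) UNIV"
proof -
  have s: "((\<lambda>n. cnj (\<phi> n) * \<psi> n) has_sum cip \<phi> \<psi>) UNIV"
    unfolding cip_def by (rule has_sum_infsum[OF cip_summable[OF \<phi> \<psi>]])
  have e: "(\<Sum>\<^sub>\<infinity>m\<in>occ J. cnj (\<phi> (glue J m m')) * \<psi> (glue J m m')) = cip (slice J m' \<phi>) (slice J m' \<psi>)"
    if "m' \<in> occ (- J)" for m'
    unfolding cip_def by (rule infsum_cong_neutral) (use that in \<open>auto simp: slice_def\<close>)
  have "((\<lambda>m'. cip (slice J m' \<phi>) (slice J m' \<psi>)) has_sum cip \<phi> \<psi>) (occ (- J))"
    using slice_has_sum(2)[OF s, of J] by (subst has_sum_cong[OF e[symmetric]]) auto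
  moreover have "cip (slice J m' \<phi>) (slice J m' \<psi>) = 0" if "m' \<notin> occ (- J)" for m' using that by (simp add: slice_def)
  ultimately show ?thesis
    by (subst has_sum_cong_neutral[where T="occ (- J)" and g="\<lambda>m'. cip (slice J m' \<phi>) (slice J m' \<psi>)"]) auto
qed

lemma coord_proj_mem [simp]: "coord_proj J z \<in> coord_space J"
  by (simp add: coord_proj_def coord_space_def)

lemma coord_proj_id: "z \<in> coord_space J \<Longrightarrow> coord_proj J z = z"
  and coord_proj_compl: "z \<in> coord_space J \<Longrightarrow> coord_proj (- J) z = 0"
  by (auto simp: coord_proj_def coord_space_def vec_eq_iff)

lemma coord_proj_compl': "z \<in> coord_space (- J) \<Longrightarrow> coord_proj J z = 0"
  by (auto simp: coord_proj_def coord_space_def vec_eq_iff)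

lemma coord_proj_add: "coord_proj J (x + y) = coord_proj J x + coord_proj J y"
  by (auto simp: coord_proj_def vec_eq_iff)

lemma coord_proj_sum: "coord_proj J z + coord_proj (- J) z = z"
  by (auto simp: coord_proj_def vec_eq_iff)

lemma hprod_coord_proj: "z \<in> coord_space J \<Longrightarrow> hprod z (coord_proj J w) = hprod z w"
  unfolding hprod_def coord_proj_def coord_space_def by (intro sum.cong refl) auto

lemma hprod_coord_compl: "z \<in> coord_space J \<Longrightarrow> w \<in> coord_space (- J) \<Longrightarrow> hprod z w = 0"
  unfolding hprod_def coord_space_def by (intro sum.neutral) auto

lemma exp_vec_glue:
  assumes "m \<in> occ J" "m' \<in> occ (- J)"
  shows "exp_vec z (glue J m m') = exp_vec (coord_proj J z) m * exp_vec (coord_proj (- J) z) m'"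
  unfolding exp_vec_def prod.distrib[symmetric]
  by (rule prod.cong) (use assms in \<open>auto simp: glue_def coord_proj_def occ_def\<close>)

lemma slice_exp_vec:
  "slice J m' (exp_vec z) = (\<lambda>m. exp_vec (coord_proj (- J) z) m' * exp_vec (coord_proj J z) m)"
proof
  fix m
  have "m \<notin> occ J \<Longrightarrow> exp_vec (coord_proj J z) m = 0" "m' \<notin> occ (- J) \<Longrightarrow> exp_vec (coord_proj (- J) z) m' = 0"
    by (rule ell2_outside[OF exp_vec_mem[OF coord_proj_mem]], assumption)+
  then show "slice J m' (exp_vec z) m = exp_vec (coord_proj (- J) z) m' * exp_vec (coord_proj J z) m"
    by (auto simp: slice_def exp_vec_glue)
qed

text \<open>The Weyl operator acts on the modes of \<open>J\<close> only, and a slice freezes the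
  others. On exponential vectors a slice is a scalar times an exponential vector, so the claim is
  explicit there; the rest is density.\<close>

lemma slice_weyl:
  assumes z: "z \<in> coord_space J" and \<psi>: "\<psi> \<in> ell2 UNIV"
  shows "slice J m' (weyl UNIV z \<psi>) = weyl J z (slice J m' \<psi>)"
proof -
  have zU: "z \<in> coord_space UNIV" by simp
  have wU: "blin UNIV UNIV (weyl UNIV z)" using weyl_blin[OF zU] by simp
  show ?thesis
  proof (rule blin_eqI_exp_vecs[where J=UNIV and K="occ J" and \<psi>=\<psi>])
    show "blin (occ UNIV) (occ J) (\<lambda>\<psi>. slice J m' (weyl UNIV z \<psi>))" using blin_comp[OF wU slice_blin] by simp
    show "blin (occ UNIV) (occ J) (\<lambda>\<psi>. weyl J z (slice J m' \<psi>))" using blin_comp[OF slice_blin weyl_blin[OF z]] by simp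
    show "\<psi> \<in> ell2 (occ UNIV)" using \<psi> by simp
    fix w :: "'a cspace"
    have "slice J m' (weyl UNIV z (exp_vec w)) = slice J m' (\<lambda>n. exp (- complex_of_real ((norm z)\<^sup>2 / 2) - hprod z w) * exp_vec (z + w) n)"
      using weyl_exp_vec[OF zU, of w] by (simp add: weyl_exp_def)
    also have "\<dots> = (\<lambda>m. exp (- complex_of_real ((norm z)\<^sup>2 / 2) - hprod z w) * slice J m' (exp_vec (z + w)) m)"
      by (simp add: slice_def fun_eq_iff)
    also have "\<dots> = (\<lambda>m. exp_vec (coord_proj (- J) w) m' * weyl_exp z (coord_proj J w) m)"
      unfolding slice_exp_vec weyl_exp_def
      by (simp add: coord_proj_add coord_proj_id[OF z] coord_proj_compl[OF z] hprod_coord_proj[OF z] mult.left_commute)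
    also have "\<dots> = weyl J z (slice J m' (exp_vec w))"
      unfolding slice_exp_vec blin_scale[OF weyl_blin[OF z] exp_vec_mem[OF coord_proj_mem]] weyl_exp_vec[OF z coord_proj_mem] ..
    finally show "slice J m' (weyl UNIV z (exp_vec w)) = weyl J z (slice J m' (exp_vec w))" .
  qed
qed

lemma slice_mixture:
  assumes v: "mixture UNIV v"
  shows "mixture (occ J) (\<lambda>(k, m'). slice J m' (v k))"
proof -
  note vm = mixture_mem[OF v]
  have "((\<lambda>(k, m'). (l2norm (slice J m' (v k)))\<^sup>2) has_sum 1) (UNIV \<times> UNIV)"
  proof (rule has_sum_SigmaI)
    show "(\<lambda>(k, m'). (l2norm (slice J m' (v k)))\<^sup>2) summable_on UNIV \<times> UNIV"
      by (rule summable_on_SigmaI[OF _ mixture_summable[OF v]]) (use slice_norm_sum(2)[OF vm] in auto)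
    show "((\<lambda>k. (l2norm (v k))\<^sup>2) has_sum 1) UNIV" by (rule mixture_has_sum[OF v])
  qed (use slice_norm_sum(2)[OF vm] in auto)
  then show ?thesis using slice_norm_sum(1)[OF vm] by (simp add: mixture_def case_prod_unfold)
qed

lemma slice_mix_tr:
  assumes v: "mixture UNIV v" and z: "z \<in> coord_space J"
  shows "mix_tr (\<lambda>(k, m'). slice J m' (v k)) (weyl J z) = mix_tr v (weyl UNIV z)"
proof -
  note vm = mixture_mem[OF v]
  have zU: "z \<in> coord_space UNIV" by simp
  have wU: "blin UNIV UNIV (weyl UNIV z)" using weyl_blin[OF zU] by simp
  have s: "(\<lambda>p. cip (slice J (snd p) (v (fst p))) (weyl J z (slice J (snd p) (v (fst p))))) summable_on (UNIV \<times> UNIV)"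
    using mix_tr_summable[OF slice_mixture[OF v] weyl_blin[OF z]] by (simp add: case_prod_unfold)
  have "mix_tr (\<lambda>(k, m'). slice J m' (v k)) (weyl J z) =
    (\<Sum>\<^sub>\<infinity>p\<in>UNIV \<times> UNIV. cip (slice J (snd p) (v (fst p))) (weyl J z (slice J (snd p) (v (fst p)))))"
    by (simp add: mix_tr_def case_prod_unfold)
  also have "\<dots> = (\<Sum>\<^sub>\<infinity>k. \<Sum>\<^sub>\<infinity>m'. cip (slice J m' (v k)) (weyl J z (slice J m' (v k))))"
    using infsum_Sigma_banach[OF s] by simp
  also have "\<dots> = mix_tr v (weyl UNIV z)"
    unfolding mix_tr_def slice_weyl[OF z vm, symmetric]
    by (rule infsum_cong) (rule infsumI[OF slice_cip[OF vm blin_mem[OF wU vm]]])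
  finally show ?thesis .
qed

text \<open>The partial trace is described by its characteristic function alone, which determines it
  by \<open>density_eqI_weyl\<close> and is the form in which states are factorized later.\<close>

lemma partial_trace:
  fixes \<rho> :: "('n::finite \<Rightarrow> nat) oper"
  assumes \<rho>: "\<rho> \<in> density_ops UNIV"
  shows "\<exists>\<sigma>\<in>density_ops (occ J). \<forall>z\<in>coord_space J. tr (occ J) (\<sigma> \<circ> weyl J z) = tr UNIV (\<rho> \<circ> weyl UNIV z)"
proof -
  obtain v :: "nat \<Rightarrow> ('n \<Rightarrow> nat) vect" where v: "mixture UNIV v" "\<rho> = mix_op UNIV v" using density_mixture[OF \<rho>] by blast
  note m = slice_mixture[OF v(1), of J]
  have "tr (occ J) (mix_op (occ J) (\<lambda>(k, m'). slice J m' (v k)) \<circ> weyl J z) = tr UNIV (\<rho> \<circ> weyl UNIV z)"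
    if z: "z \<in> coord_space J" for z
  proof -
    have "weyl UNIV z \<in> bounded_ops UNIV" using weyl_bounded[of z UNIV] by simp
    then show ?thesis
      unfolding tr_mix_op[OF m weyl_bounded[OF z]] v(2) slice_mix_tr[OF v(1) z] by (simp add: tr_mix_op[OF v(1)])
  qed
  then show ?thesis using mix_op_density[OF m] by blast
qed

section \<open>Product vectors and tensor products of mixtures\<close>

lemma tensor_vec_glue:
  assumes "m \<in> occ J" "m' \<in> occ (- J)"
  shows "tensor_vec J u v (glue J m m') = u m * v m'"
proof -
  have "(\<lambda>i. if i \<in> J then glue J m m' i else 0) = m" "(\<lambda>i. if i \<in> J then 0 else glue J m m' i) = m'"
    using assms by (auto simp: glue_def occ_def fun_eq_iff)
  then show ?thesis by (simp add: tensor_vec_def)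
qed

lemma tensor_vec_norm:
  assumes u: "u \<in> ell2 (occ J)" and v: "v \<in> ell2 (occ (- J))"
  shows "tensor_vec J u v \<in> ell2 UNIV" and "(l2norm (tensor_vec J u v))\<^sup>2 = (l2norm u)\<^sup>2 * (l2norm v)\<^sup>2"
proof -
  have restrict: "((\<lambda>m. (cmod (u m))\<^sup>2) has_sum (l2norm u)\<^sup>2) (occ J)" "((\<lambda>m'. (cmod (v m'))\<^sup>2) has_sum (l2norm v)\<^sup>2) (occ (- J))"
    using l2norm_has_sum[OF u] l2norm_has_sum[OF v] ell2_outside[OF u] ell2_outside[OF v]
    by (auto elim!: has_sum_cong_neutral[THEN iffD1, rotated -1])
  have in': "((\<lambda>m. (cmod (u m) * cmod (v m'))\<^sup>2) has_sum (l2norm u)\<^sup>2 * (cmod (v m'))\<^sup>2) (occ J)" for m'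
    unfolding power_mult_distrib by (rule has_sum_cmult_left[OF restrict(1)])
  have out: "((\<lambda>m'. (l2norm u)\<^sup>2 * (cmod (v m'))\<^sup>2) has_sum (l2norm u)\<^sup>2 * (l2norm v)\<^sup>2) (occ (- J))"
    by (rule has_sum_cmult_right[OF restrict(2)])
  have "((\<lambda>(m', m). (cmod (u m) * cmod (v m'))\<^sup>2) has_sum (l2norm u)\<^sup>2 * (l2norm v)\<^sup>2) (occ (- J) \<times> occ J)"
  proof (rule has_sum_SigmaI)
    show "(\<lambda>(m', m). (cmod (u m) * cmod (v m'))\<^sup>2) summable_on occ (- J) \<times> occ J"
      by (rule summable_on_SigmaI[OF _ has_sum_imp_summable[OF out]]) (use in' in auto)
  qed (use in' out in auto)
  then have "((\<lambda>(m', m). (cmod (tensor_vec J u v (glue J m m')))\<^sup>2) has_sum (l2norm u)\<^sup>2 * (l2norm v)\<^sup>2) (occ (- J) \<times> occ J)"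
    by (subst has_sum_cong[where g="\<lambda>(m', m). (cmod (u m) * cmod (v m'))\<^sup>2"]) (auto simp: tensor_vec_glue norm_mult)
  then have s: "((\<lambda>n. (cmod (tensor_vec J u v n))\<^sup>2) has_sum (l2norm u)\<^sup>2 * (l2norm v)\<^sup>2) UNIV"
    using glue_has_sum[of "\<lambda>n. (cmod (tensor_vec J u v n))\<^sup>2" J] by simp
  then show "tensor_vec J u v \<in> ell2 UNIV" using has_sum_imp_summable by (auto simp: ell2_def)
  show "(l2norm (tensor_vec J u v))\<^sup>2 = (l2norm u)\<^sup>2 * (l2norm v)\<^sup>2" unfolding l2norm_power2[of "tensor_vec J u v"] by (rule infsumI[OF s])
qed

lemma slice_tensor_vec:
  assumes u: "u \<in> ell2 (occ J)" and v: "v \<in> ell2 (occ (- J))"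
  shows "slice J m' (tensor_vec J u v) = (\<lambda>m. v m' * u m)"
  by (auto simp: slice_def tensor_vec_glue fun_eq_iff ell2_outside[OF u] ell2_outside[OF v])

lemma cip_tensor_vec:
  assumes u: "u \<in> ell2 (occ J)" and v: "v \<in> ell2 (occ (- J))" and a: "a \<in> ell2 (occ J)" and b: "b \<in> ell2 (occ (- J))"
  shows "cip (tensor_vec J u v) (tensor_vec J a b) = cip u a * cip v b"
proof -
  have "((\<lambda>m'. cip (slice J m' (tensor_vec J u v)) (slice J m' (tensor_vec J a b))) has_sum cip (tensor_vec J u v) (tensor_vec J a b)) UNIV"
    by (rule slice_cip[OF tensor_vec_norm(1)[OF u v] tensor_vec_norm(1)[OF a b]])
  then have "((\<lambda>m'. cip u a * (cnj (v m') * b m')) has_sum cip (tensor_vec J u v) (tensor_vec J a b)) UNIV"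
    unfolding slice_tensor_vec[OF u v] slice_tensor_vec[OF a b] cip_scale_left cip_scale_right by (simp add: mult_ac)
  moreover have "((\<lambda>m'. cip u a * (cnj (v m') * b m')) has_sum cip u a * cip v b) UNIV"
    unfolding cip_def[of v] by (rule has_sum_cmult_right[OF has_sum_infsum[OF cip_summable[OF v b]]])
  ultimately show ?thesis by (rule has_sum_unique)
qed

lemma tensor_vec_blin_left:
  assumes v: "v \<in> ell2 (occ (- J))"
  shows "blin (occ J) UNIV (\<lambda>u. tensor_vec J u v)"
proof (rule blinI[where K="l2norm v"])
  fix u :: "('a \<Rightarrow> nat) vect" assume u: "u \<in> ell2 (occ J)"
  show "tensor_vec J u v \<in> ell2 UNIV" by (rule tensor_vec_norm(1)[OF u v])
  have "(l2norm (tensor_vec J u v))\<^sup>2 = (l2norm v * l2norm u)\<^sup>2"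
    using tensor_vec_norm(2)[OF u v] by (simp add: power_mult_distrib)
  then show "l2norm (tensor_vec J u v) \<le> l2norm v * l2norm u" by simp
qed (auto simp: tensor_vec_def fun_eq_iff distrib_right)

lemma tensor_vec_blin_right:
  assumes u: "u \<in> ell2 (occ J)"
  shows "blin (occ (- J)) UNIV (tensor_vec J u)"
proof (rule blinI[where K="l2norm u"])
  fix v :: "('a \<Rightarrow> nat) vect" assume v: "v \<in> ell2 (occ (- J))"
  show "tensor_vec J u v \<in> ell2 UNIV" by (rule tensor_vec_norm(1)[OF u v])
  have "(l2norm (tensor_vec J u v))\<^sup>2 = (l2norm u * l2norm v)\<^sup>2"
    using tensor_vec_norm(2)[OF u v] by (simp add: power_mult_distrib)
  then show "l2norm (tensor_vec J u v) \<le> l2norm u * l2norm v" by simp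
qed (auto simp: tensor_vec_def fun_eq_iff distrib_left)

text \<open>Every basis vector is a product vector, so the defining equation of
  \<open>tensor_op\<close> is satisfied by at most one operator.\<close>

lemma tensor_vec_ket: "ket n = tensor_vec J (ket (glue J n (\<lambda>i. 0))) (ket (glue J (\<lambda>i. 0) n))"
proof
  fix m
  have "(glue J m (\<lambda>i. 0) = glue J n (\<lambda>i. 0) \<and> glue J (\<lambda>i. 0) m = glue J (\<lambda>i. 0) n) \<longleftrightarrow> m = n"
    by (auto simp: glue_def fun_eq_iff)
  then show "ket n m = tensor_vec J (ket (glue J n (\<lambda>i. 0))) (ket (glue J (\<lambda>i. 0) n)) m"
    unfolding tensor_vec_def ket_def glue_def by (auto split: if_splits)
qed

lemma tensor_op_eqI:
  assumes X: "X \<in> bounded_ops UNIV"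
    and eq: "\<And>u v. u \<in> ell2 (occ J) \<Longrightarrow> v \<in> ell2 (occ (- J)) \<Longrightarrow> X (tensor_vec J u v) = tensor_vec J (A u) (B v)"
  shows "tensor_op J A B = X"
  unfolding tensor_op_def
proof (rule the_equality)
  show "X \<in> bounded_ops (occ UNIV) \<and> (\<forall>u\<in>ell2 (occ J). \<forall>v\<in>ell2 (occ (- J)). X (tensor_vec J u v) = tensor_vec J (A u) (B v))"
    using X eq by simp
  fix Y assume Y: "Y \<in> bounded_ops (occ UNIV) \<and> (\<forall>u\<in>ell2 (occ J). \<forall>v\<in>ell2 (occ (- J)). Y (tensor_vec J u v) = tensor_vec J (A u) (B v))"
  show "Y = X"
  proof (rule bounded_ops_eqI_kets)
    show "Y \<in> bounded_ops UNIV" using Y by simp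
    fix n :: "'a \<Rightarrow> nat"
    have "ket (glue J n (\<lambda>i. 0)) \<in> ell2 (occ J)" "ket (glue J (\<lambda>i. 0) n) \<in> ell2 (occ (- J))"
      by (auto simp: glue_def occ_def)
    then show "Y (ket n) = X (ket n)" unfolding tensor_vec_ket[of n J] using Y eq by simp
  qed (rule X)
qed

lemma tensor_mixture:
  assumes u: "mixture (occ J) u" and v: "mixture (occ (- J)) v"
  shows "mixture UNIV (\<lambda>(k, l). tensor_vec J (u k) (v l))"
proof -
  note n = tensor_vec_norm[OF mixture_mem[OF u] mixture_mem[OF v]]
  have i: "((\<lambda>l. (l2norm (tensor_vec J (u k) (v l)))\<^sup>2) has_sum (l2norm (u k))\<^sup>2 * 1) UNIV" for k
    unfolding n(2) by (rule has_sum_cmult_right[OF mixture_has_sum[OF v]])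
  have "((\<lambda>(k, l). (l2norm (tensor_vec J (u k) (v l)))\<^sup>2) has_sum 1) (UNIV \<times> UNIV)"
  proof (rule has_sum_SigmaI)
    show "(\<lambda>(k, l). (l2norm (tensor_vec J (u k) (v l)))\<^sup>2) summable_on UNIV \<times> UNIV"
      by (rule summable_on_SigmaI[OF _ mixture_summable[OF u]]) (use i in auto)
    show "((\<lambda>k. (l2norm (u k))\<^sup>2) has_sum 1) UNIV" by (rule mixture_has_sum[OF u])
  qed (use i in auto)
  then show ?thesis using n(1) by (simp add: mixture_def case_prod_unfold)
qed

lemma infsum_product_form:
  fixes f :: "'k \<Rightarrow> complex" and g :: "'l \<Rightarrow> complex"
  assumes "(\<lambda>(k, l). f k * g l) summable_on UNIV"
  shows "(\<Sum>\<^sub>\<infinity>(k, l). f k * g l) = (\<Sum>\<^sub>\<infinity>k. f k) * (\<Sum>\<^sub>\<infinity>l. g l)"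
proof -
  have "(\<Sum>\<^sub>\<infinity>k. \<Sum>\<^sub>\<infinity>l. f k * g l) = (\<Sum>\<^sub>\<infinity>(k, l)\<in>UNIV \<times> UNIV. f k * g l)"
    by (rule infsum_Sigma'_banach) (use assms in simp)
  then show ?thesis by (simp add: infsum_cmult_right' infsum_cmult_left')
qed

text \<open>For density operators the operator described by \<open>tensor_op\<close> is explicit,
  namely the mixture of all product vectors; this settles existence.\<close>

lemma tensor_op_mix_op:
  assumes u: "mixture (occ J) u" and v: "mixture (occ (- J)) v"
  shows "tensor_op J (mix_op (occ J) u) (mix_op (occ (- J)) v) = mix_op UNIV (\<lambda>(k, l). tensor_vec J (u k) (v l))"
proof (rule tensor_op_eqI)
  note t = tensor_mixture[OF u v]
  show "mix_op UNIV (\<lambda>(k, l). tensor_vec J (u k) (v l)) \<in> bounded_ops UNIV" by (rule mix_op_bounded[OF t])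
  fix a b assume a: "a \<in> ell2 (occ J)" and b: "b \<in> ell2 (occ (- J))"
  note ab = tensor_vec_norm(1)[OF a b]
  show "mix_op UNIV (\<lambda>(k, l). tensor_vec J (u k) (v l)) (tensor_vec J a b) =
    tensor_vec J (mix_op (occ J) u a) (mix_op (occ (- J)) v b)"
  proof
    fix n :: "'a \<Rightarrow> nat"
    define n1 n2 where "n1 = (\<lambda>i. if i \<in> J then n i else 0)" and "n2 = (\<lambda>i. if i \<in> J then 0 else n i)"
    have summand: "cip (tensor_vec J (u k) (v l)) (tensor_vec J a b) * tensor_vec J (u k) (v l) n = (cip (u k) a * u k n1) * (cip (v l) b * v l n2)" for k l
      unfolding cip_tensor_vec[OF mixture_mem[OF u] mixture_mem[OF v] a b] by (simp add: tensor_vec_def n1_def n2_def)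
    have s: "(\<lambda>(k, l). (cip (u k) a * u k n1) * (cip (v l) b * v l n2)) summable_on UNIV"
      using mix_op_summable(1)[OF t ab, of n] by (simp add: case_prod_unfold summand)
    have "mix_op UNIV (\<lambda>(k, l). tensor_vec J (u k) (v l)) (tensor_vec J a b) n = (\<Sum>\<^sub>\<infinity>(k, l). (cip (u k) a * u k n1) * (cip (v l) b * v l n2))"
      using ab by (simp add: mix_op_def case_prod_unfold summand)
    also have "\<dots> = (\<Sum>\<^sub>\<infinity>k. cip (u k) a * u k n1) * (\<Sum>\<^sub>\<infinity>l. cip (v l) b * v l n2)"
      by (rule infsum_product_form[OF s])
    finally show "mix_op UNIV (\<lambda>(k, l). tensor_vec J (u k) (v l)) (tensor_vec J a b) n =
      tensor_vec J (mix_op (occ J) u a) (mix_op (occ (- J)) v b) n"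
      using a b by (simp add: tensor_vec_def mix_op_def n1_def n2_def)
  qed
qed

lemma exp_vec_tensor:
  assumes "x \<in> coord_space J" "y \<in> coord_space (- J)"
  shows "exp_vec (x + y) = tensor_vec J (exp_vec x) (exp_vec y)"
proof
  fix n :: "'a \<Rightarrow> nat"
  define m m' where "m = (\<lambda>i. if i \<in> J then n i else 0)" and "m' = (\<lambda>i. if i \<in> J then 0 else n i)"
  have g: "n = glue J m m'" "m \<in> occ J" "m' \<in> occ (- J)" by (auto simp: glue_def m_def m'_def occ_def)
  show "exp_vec (x + y) n = tensor_vec J (exp_vec x) (exp_vec y) n"
    unfolding g(1) exp_vec_glue[OF g(2,3)] tensor_vec_glue[OF g(2,3)]
    using assms by (simp add: coord_proj_add coord_proj_id coord_proj_compl coord_proj_compl')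
qed

lemma weyl_exp_tensor:
  assumes z: "z \<in> coord_space J" and w: "w \<in> coord_space (- J)" and x: "x \<in> coord_space J" and y: "y \<in> coord_space (- J)"
  shows "weyl_exp (z + w) (x + y) = tensor_vec J (weyl_exp z x) (weyl_exp w y)"
proof -
  have sw: "hprod b a = 0" if "a \<in> coord_space J" "b \<in> coord_space (- J)" for a b :: "'a cspace"
    using hprod_coord_compl[OF that] hprod_cnj[of a b] by simp
  have "complex_of_real ((norm (z + w))\<^sup>2) = complex_of_real ((norm z)\<^sup>2) + complex_of_real ((norm w)\<^sup>2)"
    unfolding hprod_self[symmetric] by (simp add: hprod_add_left hprod_add_right hprod_coord_compl[OF z w] sw[OF z w])
  then have "- complex_of_real ((norm (z + w))\<^sup>2 / 2) - hprod (z + w) (x + y) =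
    (- complex_of_real ((norm z)\<^sup>2 / 2) - hprod z x) + (- complex_of_real ((norm w)\<^sup>2 / 2) - hprod w y)"
    by (simp add: hprod_add_left hprod_add_right hprod_coord_compl[OF z y] sw[OF x w] add_divide_distrib)
  moreover have "exp_vec (z + w + (x + y)) = tensor_vec J (exp_vec (z + x)) (exp_vec (w + y))"
    using exp_vec_tensor[of "z + x" J "w + y"] assms by (simp add: coord_space_add add_ac)
  ultimately show ?thesis unfolding weyl_exp_def by (simp add: exp_add tensor_vec_def mult_ac)
qed

text \<open>Density is applied in each tensor factor separately, with the vector of the other factor
  fixed.\<close>

lemma weyl_tensor:
  assumes z: "z \<in> coord_space J" and w: "w \<in> coord_space (- J)" and a: "a \<in> ell2 (occ J)" and b: "b \<in> ell2 (occ (- J))"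
  shows "weyl UNIV (z + w) (tensor_vec J a b) = tensor_vec J (weyl J z a) (weyl (- J) w b)"
proof -
  have U: "blin UNIV UNIV (weyl UNIV (z + w))" using weyl_blin[of "z + w" UNIV] by simp
  have 1: "weyl UNIV (z + w) (tensor_vec J (exp_vec x) b) = tensor_vec J (weyl J z (exp_vec x)) (weyl (- J) w b)"
    if x: "x \<in> coord_space J" for x
  proof (rule blin_eqI_exp_vecs[OF _ _ _ b])
    show "blin (occ (- J)) UNIV (\<lambda>b. weyl UNIV (z + w) (tensor_vec J (exp_vec x) b))"
      by (rule blin_comp[OF tensor_vec_blin_right[OF exp_vec_mem[OF x]] U])
    show "blin (occ (- J)) UNIV (\<lambda>b. tensor_vec J (weyl J z (exp_vec x)) (weyl (- J) w b))"
      by (rule blin_comp[OF weyl_blin[OF w] tensor_vec_blin_right[OF blin_mem[OF weyl_blin[OF z] exp_vec_mem[OF x]]]])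
    fix y :: "'a cspace" assume y: "y \<in> coord_space (- J)"
    show "weyl UNIV (z + w) (tensor_vec J (exp_vec x) (exp_vec y)) = tensor_vec J (weyl J z (exp_vec x)) (weyl (- J) w (exp_vec y))"
      unfolding exp_vec_tensor[OF x y, symmetric] weyl_exp_vec[OF z x] weyl_exp_vec[OF w y]
      using weyl_exp_vec[of "z + w" UNIV "x + y"] weyl_exp_tensor[OF z w x y] by simp
  qed
  show ?thesis
  proof (rule blin_eqI_exp_vecs[OF _ _ _ a])
    show "weyl UNIV (z + w) (tensor_vec J (exp_vec x) b) = tensor_vec J (weyl J z (exp_vec x)) (weyl (- J) w b)"
      if "x \<in> coord_space J" for x by (rule 1[OF that])
    show "blin (occ J) UNIV (\<lambda>a. weyl UNIV (z + w) (tensor_vec J a b))"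
      by (rule blin_comp[OF tensor_vec_blin_left[OF b] U])
    show "blin (occ J) UNIV (\<lambda>a. tensor_vec J (weyl J z a) (weyl (- J) w b))"
      by (rule blin_comp[OF weyl_blin[OF z] tensor_vec_blin_left[OF blin_mem[OF weyl_blin[OF w] b]]])
  qed
qed

lemma mix_tr_tensor:
  assumes u: "mixture (occ J) u" and v: "mixture (occ (- J)) v" and z: "z \<in> coord_space J" and w: "w \<in> coord_space (- J)"
  shows "mix_tr (\<lambda>(k, l). tensor_vec J (u k) (v l)) (weyl UNIV (z + w)) = mix_tr u (weyl J z) * mix_tr v (weyl (- J) w)"
proof -
  note um = mixture_mem[OF u] and vm = mixture_mem[OF v]
  have U: "blin UNIV UNIV (weyl UNIV (z + w))" using weyl_blin[of "z + w" UNIV] by simp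
  have summand: "cip (tensor_vec J (u k) (v l)) (weyl UNIV (z + w) (tensor_vec J (u k) (v l))) = cip (u k) (weyl J z (u k)) * cip (v l) (weyl (- J) w (v l))" for k l
    unfolding weyl_tensor[OF z w um vm]
    by (rule cip_tensor_vec[OF um vm blin_mem[OF weyl_blin[OF z] um] blin_mem[OF weyl_blin[OF w] vm]])
  have "(\<lambda>(k, l). cip (u k) (weyl J z (u k)) * cip (v l) (weyl (- J) w (v l))) summable_on UNIV"
    using mix_tr_summable[OF tensor_mixture[OF u v] U] by (simp add: case_prod_unfold summand)
  from infsum_product_form[OF this] show ?thesis by (simp add: mix_tr_def case_prod_unfold summand)
qed

lemma density_eq_tensor_op:
  fixes \<rho> \<sigma> \<tau> :: "('n::finite \<Rightarrow> nat) oper"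
  assumes \<rho>: "\<rho> \<in> density_ops UNIV" and \<sigma>: "\<sigma> \<in> density_ops (occ J)" and \<tau>: "\<tau> \<in> density_ops (occ (- J))"
    and eq: "\<And>z w. z \<in> coord_space J \<Longrightarrow> w \<in> coord_space (- J) \<Longrightarrow>
      tr UNIV (\<rho> \<circ> weyl UNIV (z + w)) = tr (occ J) (\<sigma> \<circ> weyl J z) * tr (occ (- J)) (\<tau> \<circ> weyl (- J) w)"
  shows "\<rho> = tensor_op J \<sigma> \<tau>"
proof -
  obtain u :: "nat \<Rightarrow> ('n \<Rightarrow> nat) vect" where u: "mixture (occ J) u" "\<sigma> = mix_op (occ J) u" using density_mixture[OF \<sigma>] by blast
  obtain v :: "nat \<Rightarrow> ('n \<Rightarrow> nat) vect" where v: "mixture (occ (- J)) v" "\<tau> = mix_op (occ (- J)) v" using density_mixture[OF \<tau>] by blast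
  note t = tensor_mixture[OF u(1) v(1)]
  have X: "tensor_op J \<sigma> \<tau> = mix_op UNIV (\<lambda>(k, l). tensor_vec J (u k) (v l))"
    unfolding u(2) v(2) by (rule tensor_op_mix_op[OF u(1) v(1)])
  show ?thesis
  proof (rule density_eqI_weyl[where J=UNIV])
    show "\<rho> \<in> density_ops (occ UNIV)" using \<rho> by simp
    show "tensor_op J \<sigma> \<tau> \<in> density_ops (occ UNIV)" unfolding X using mix_op_density[OF t] by simp
    fix x :: "'n cspace"
    define z w where "z = coord_proj J x" and "w = coord_proj (- J) x"
    have zw: "z \<in> coord_space J" "w \<in> coord_space (- J)" "x = z + w" by (simp_all add: z_def w_def coord_proj_sum)
    have b: "weyl UNIV (z + w) \<in> bounded_ops UNIV" using weyl_bounded[of "z + w" UNIV] by simp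
    have "tr UNIV (\<rho> \<circ> weyl UNIV (z + w)) = mix_tr u (weyl J z) * mix_tr v (weyl (- J) w)"
      unfolding eq[OF zw(1,2)] u(2) v(2) tr_mix_op[OF u(1) weyl_bounded[OF zw(1)]] tr_mix_op[OF v(1) weyl_bounded[OF zw(2)]] ..
    also have "\<dots> = tr UNIV (tensor_op J \<sigma> \<tau> \<circ> weyl UNIV (z + w))"
      unfolding X tr_mix_op[OF t b] mix_tr_tensor[OF u(1) v(1) zw(1,2)] ..
    finally show "tr (occ UNIV) (\<rho> \<circ> weyl UNIV x) = tr (occ UNIV) (tensor_op J \<sigma> \<tau> \<circ> weyl UNIV x)" by (simp add: zw(3))
  qed
qed

section \<open>Unitary conjugation and the free Hamiltonian\<close>

lemma bounded_ops_mem: "A \<in> bounded_ops I \<Longrightarrow> \<psi> \<in> ell2 I \<Longrightarrow> A \<psi> \<in> ell2 I"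
  unfolding bounded_ops_iff by (blast intro: blin_mem)

text \<open>Conjugation by a unitary merely moves the vectors of a mixture. Rotations, displacements
  and the passage to a representative of the conjugacy class are all treated in this way.\<close>

lemma unitary_mixture:
  assumes U: "U \<in> unitary_ops I" and v: "mixture I v"
  shows "mixture I (\<lambda>k. U (v k))"
    and "mix_op I (\<lambda>k. U (v k)) = U \<circ> mix_op I v \<circ> adj_op I U"
    and "\<And>x. blin I I x \<Longrightarrow> mix_tr (\<lambda>k. U (v k)) x = mix_tr v (\<lambda>\<psi>. adj_op I U (x (U \<psi>)))"
proof -
  note vm = mixture_mem[OF v]
  note Ub = unitary_ops_blin[OF U]
  have Ab: "adj_op I U \<in> bounded_ops I" by (rule adj_op_bounded[OF unitary_ops_bounded[OF U]])
  then have Abl: "blin I I (adj_op I U)" by (simp add: bounded_ops_iff)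
  note adj = adj_op_cip[OF unitary_ops_bounded[OF U]]
  have adj': "cip \<phi> (U \<psi>) = cip (adj_op I U \<phi>) \<psi>" if "\<phi> \<in> ell2 I" "\<psi> \<in> ell2 I" for \<phi> \<psi>
    using adj[OF that(2,1)] by (metis cip_cnj)
  show m: "mixture I (\<lambda>k. U (v k))"
    using v unfolding mixture_def by (simp add: blin_mem[OF Ub] unitary_ops_l2norm[OF U])
  show "mix_op I (\<lambda>k. U (v k)) = U \<circ> mix_op I v \<circ> adj_op I U"
  proof (rule bounded_ops_eqI)
    show "mix_op I (\<lambda>k. U (v k)) \<in> bounded_ops I" by (rule mix_op_bounded[OF m])
    show "U \<circ> mix_op I v \<circ> adj_op I U \<in> bounded_ops I"
      by (intro bounded_ops_comp unitary_ops_bounded[OF U] mix_op_bounded[OF v] Ab)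
    fix \<psi> assume \<psi>: "\<psi> \<in> ell2 I"
    have mvb: "blin I I (mix_op I v)" using mix_op_bounded[OF v] by (simp add: bounded_ops_iff)
    have mub: "blin I I (mix_op I (\<lambda>k. U (v k)))" using mix_op_bounded[OF m] by (simp add: bounded_ops_iff)
    note A\<psi> = blin_mem[OF Abl \<psi>]
    note r = blin_mem[OF Ub blin_mem[OF mvb A\<psi>]]
    have "cip \<phi> (mix_op I (\<lambda>k. U (v k)) \<psi>) = cip \<phi> (U (mix_op I v (adj_op I U \<psi>)))" if \<phi>: "\<phi> \<in> ell2 I" for \<phi>
    proof -
      have "((\<lambda>k. cip (adj_op I U \<phi>) (v k) * cip (v k) (adj_op I U \<psi>)) has_sum cip (adj_op I U \<phi>) (mix_op I v (adj_op I U \<psi>))) UNIV"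
        by (rule cip_mix_op[OF v blin_mem[OF Abl \<phi>] A\<psi>])
      then have "((\<lambda>k. cip \<phi> (U (v k)) * cip (U (v k)) \<psi>) has_sum cip \<phi> (U (mix_op I v (adj_op I U \<psi>)))) UNIV"
        unfolding adj'[OF \<phi> vm] adj[OF vm \<psi>] adj'[OF \<phi> blin_mem[OF mvb A\<psi>]] .
      then show ?thesis using has_sum_unique[OF cip_mix_op[OF m \<phi> \<psi>]] by blast
    qed
    then have e: "mix_op I (\<lambda>k. U (v k)) \<psi> n = U (mix_op I v (adj_op I U \<psi>)) n" if "n \<in> I" for n
      using ell2_ket[OF that] by (metis cip_ket_left)
    show "mix_op I (\<lambda>k. U (v k)) \<psi> = (U \<circ> mix_op I v \<circ> adj_op I U) \<psi>"
    proof
      fix n show "mix_op I (\<lambda>k. U (v k)) \<psi> n = (U \<circ> mix_op I v \<circ> adj_op I U) \<psi> n"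
        using e[of n] ell2_outside[OF r, of n] ell2_outside[OF blin_mem[OF mub \<psi>], of n] by (cases "n \<in> I") auto
    qed
  qed
  show "mix_tr (\<lambda>k. U (v k)) x = mix_tr v (\<lambda>\<psi>. adj_op I U (x (U \<psi>)))" if "blin I I x" for x
    unfolding mix_tr_def using adj[OF vm blin_mem[OF that blin_mem[OF Ub vm]]] by simp
qed

section \<open>Diagonal unitary groups and their generators\<close>

definition phase_op :: "'a set \<Rightarrow> ('a \<Rightarrow> real) \<Rightarrow> real \<Rightarrow> 'a oper" where
  "phase_op I E t = (\<lambda>\<psi>. if \<psi> \<in> ell2 I then (\<lambda>n. exp (\<i> * complex_of_real (t * E n)) * \<psi> n) else (\<lambda>n. 0))"

lemma phase_op_bounded: "phase_op I E t \<in> bounded_ops I"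
proof -
  have mem: "(\<lambda>n. exp (\<i> * complex_of_real (t * E n)) * \<psi> n) \<in> ell2 I" if "\<psi> \<in> ell2 I" for \<psi>
    by (rule ell2_dominated[OF that]) (auto simp: norm_mult ell2_outside[OF that])
  have "blin I I (phase_op I E t)"
  proof (rule blinI[where K=1])
    show "l2norm (phase_op I E t \<psi>) \<le> 1 * l2norm \<psi>" if "\<psi> \<in> ell2 I" for \<psi>
      by (rule l2norm_dominated[OF that]) (use that in \<open>auto simp: phase_op_def norm_mult\<close>)
  qed (auto simp: phase_op_def mem ell2_add ell2_scale distrib_left simp del: of_real_mult)
  then show ?thesis by (simp add: bounded_ops_iff phase_op_def)
qed

lemma phase_op_comp:
  assumes "\<psi> \<in> ell2 I"
  shows "phase_op I E s (phase_op I E t \<psi>) = phase_op I E (s + t) \<psi>"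
proof -
  have "phase_op I E t \<psi> \<in> ell2 I" by (rule bounded_ops_mem[OF phase_op_bounded assms])
  then show ?thesis using assms
    by (simp add: phase_op_def distrib_right distrib_left exp_add mult.assoc)
qed

lemma phase_op_zero: "\<psi> \<in> ell2 I \<Longrightarrow> phase_op I E 0 \<psi> = \<psi>"
  by (simp add: phase_op_def)

lemma phase_op_unitary: "phase_op I E t \<in> unitary_ops I" "adj_op I (phase_op I E t) = phase_op I E (- t)"
proof -
  have c: "cip (phase_op I E t \<phi>) \<psi> = cip \<phi> (phase_op I E (- t) \<psi>)" if "\<phi> \<in> ell2 I" "\<psi> \<in> ell2 I" for \<phi> \<psi>
    unfolding cip_def by (rule infsum_cong) (use that in \<open>simp add: phase_op_def exp_cnj mult_ac\<close>)
  show "phase_op I E t \<in> unitary_ops I" "adj_op I (phase_op I E t) = phase_op I E (- t)"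
    by (rule unitary_opsI[OF phase_op_bounded phase_op_bounded c];
        simp add: phase_op_comp phase_op_zero)+
qed

text \<open>Dominated convergence in \<open>ell2\<close>: the pointwise limit takes care of a
  truncation of \<psi> to finitely many components, and the uniform bound \<open>C\<close> controls
  the remainder.\<close>

lemma ell2_multiplier_tendsto_0:
  assumes \<psi>: "\<psi> \<in> ell2 I" and bd: "\<And>t n. cmod (g t n) \<le> C" and lim: "\<And>n. ((\<lambda>t. g t n) \<longlongrightarrow> 0) F"
  shows "((\<lambda>t. l2norm (\<lambda>n. g t n * \<psi> n)) \<longlongrightarrow> 0) F"
proof (rule tendstoI)
  fix e :: real assume e: "e > 0"
  have C: "C \<ge> 0" using bd norm_ge_zero order_trans by blast
  have "e / (2 * (C + 1)) > 0" using e C by simp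
  then obtain X where X: "finite X" "l2norm (\<lambda>n. \<psi> n - (if n \<in> X then \<psi> n else 0)) < e / (2 * (C + 1))"
    using ell2_truncate[OF \<psi>] by blast
  define a where "a = (\<lambda>n. if n \<in> X then \<psi> n else 0)"
  have a: "a \<in> ell2 I" by (rule ell2_dominated[OF \<psi>]) (auto simp: a_def ell2_outside[OF \<psi>])
  have r: "(\<lambda>n. \<psi> n - a n) \<in> ell2 I" by (rule ell2_diff[OF \<psi> a])
  have gm: "(\<lambda>n. g t n * x n) \<in> ell2 I" if "x \<in> ell2 I" for t x
    by (rule ell2_dominated[OF ell2_scale[OF that, of "complex_of_real C"]])
       (use bd C in \<open>auto simp: norm_mult ell2_outside[OF that] intro: mult_right_mono\<close>)
  have "((\<lambda>t. \<Sum>n\<in>X. (cmod (g t n * \<psi> n))\<^sup>2) \<longlongrightarrow> (\<Sum>n\<in>X. (cmod (0 * \<psi> n))\<^sup>2)) F"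
    by (intro tendsto_intros lim)
  then have "((\<lambda>t. sqrt (\<Sum>n\<in>X. (cmod (g t n * \<psi> n))\<^sup>2)) \<longlongrightarrow> sqrt 0) F"
    by (intro tendsto_real_sqrt) simp
  moreover have "sqrt (\<Sum>n\<in>X. (cmod (g t n * \<psi> n))\<^sup>2) = l2norm (\<lambda>n. g t n * a n)" for t
  proof -
    have "(l2norm (\<lambda>n. g t n * a n))\<^sup>2 = (\<Sum>n\<in>X. (cmod (g t n * a n))\<^sup>2)"
      by (rule finite_support_l2norm[OF X(1)]) (simp add: a_def)
    also have "\<dots> = (\<Sum>n\<in>X. (cmod (g t n * \<psi> n))\<^sup>2)" by (rule sum.cong) (auto simp: a_def)
    finally show ?thesis by (metis l2norm_nonneg real_sqrt_abs abs_of_nonneg)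
  qed
  ultimately have "((\<lambda>t. l2norm (\<lambda>n. g t n * a n)) \<longlongrightarrow> 0) F" by simp
  then have "\<forall>\<^sub>F t in F. dist (l2norm (\<lambda>n. g t n * a n)) 0 < e / 2" using e by (intro tendstoD) auto
  then show "\<forall>\<^sub>F t in F. dist (l2norm (\<lambda>n. g t n * \<psi> n)) 0 < e"
  proof (rule eventually_mono)
    fix t assume t: "dist (l2norm (\<lambda>n. g t n * a n)) 0 < e / 2"
    have "l2norm (\<lambda>n. g t n * \<psi> n) = l2norm (\<lambda>n. g t n * a n + g t n * (\<psi> n - a n))" by (simp add: algebra_simps)
    also have "\<dots> \<le> l2norm (\<lambda>n. g t n * a n) + l2norm (\<lambda>n. g t n * (\<psi> n - a n))"
      by (rule l2norm_triangle[OF gm[OF a] gm[OF r]])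
    also have "l2norm (\<lambda>n. g t n * (\<psi> n - a n)) \<le> C * l2norm (\<lambda>n. \<psi> n - a n)"
      by (rule l2norm_dominated[OF r]) (use bd C in \<open>auto simp: norm_mult intro: mult_right_mono\<close>)
    also have "\<dots> \<le> (C + 1) * l2norm (\<lambda>n. \<psi> n - a n)" by (rule mult_right_mono) auto
    also have "\<dots> \<le> (C + 1) * (e / (2 * (C + 1)))"
      using X(2) C by (intro mult_left_mono) (auto simp: a_def)
    also have "\<dots> = e / 2" using C by (simp add: field_simps)
    finally show "dist (l2norm (\<lambda>n. g t n * \<psi> n)) 0 < e" using t by simp
  qed
qed

text \<open>For uniqueness, a group with the required generator is differentiated on the eigenvectors
  \<open>ket n\<close>, which all lie in the domain.\<close>

lemma unitary_group_diagonal: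
  assumes H: "\<And>\<psi>. H \<psi> = (\<lambda>n. complex_of_real (E n) * \<psi> n)"
  shows "unitary_group I H = phase_op I E"
  unfolding unitary_group_def
proof (rule the_equality)
  have cont: "((\<lambda>t. l2norm (\<lambda>n. phase_op I E t \<psi> n - \<psi> n)) \<longlongrightarrow> 0) (at 0)" if \<psi>: "\<psi> \<in> ell2 I" for \<psi>
  proof -
    have e: "(\<lambda>n. phase_op I E t \<psi> n - \<psi> n) = (\<lambda>n. (exp (\<i> * complex_of_real (t * E n)) - 1) * \<psi> n)" for t
      using \<psi> by (simp add: phase_op_def algebra_simps)
    show ?thesis unfolding e
    proof (rule ell2_multiplier_tendsto_0[OF \<psi>, where C=2])
      show "cmod (exp (\<i> * complex_of_real (t * E n)) - 1) \<le> 2" for t n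
        using norm_triangle_ineq4[of "exp (\<i> * complex_of_real (t * E n))" 1] by simp
      have "((\<lambda>t. exp (\<i> * complex_of_real (t * E n)) - 1) \<longlongrightarrow> exp (\<i> * complex_of_real (0 * E n)) - 1) (at 0)" for n
        by (intro tendsto_intros)
      then show "((\<lambda>t. exp (\<i> * complex_of_real (t * E n)) - 1) \<longlongrightarrow> 0) (at 0)" for n by simp
    qed
  qed
  have deriv: "((\<lambda>t. l2norm (\<lambda>n. (phase_op I E t \<psi> n - \<psi> n) / complex_of_real t - \<i> * H \<psi> n)) \<longlongrightarrow> 0) (at 0)"
    if \<psi>: "\<psi> \<in> ell2 I" and H\<psi>: "H \<psi> \<in> ell2 I" for \<psi>
  proof -
    \<comment> \<open>The error of the difference quotient is written as a multiple of
      \<open>H \<psi>\<close> and not of \<psi>: divided by the energy it is bounded by 2, whatever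
      the size of \<open>E n\<close>. Where \<open>E n = 0\<close> the quotient is 0 by default, and
      so is \<open>H \<psi> n\<close>.\<close>
    define g where "g t n = ((exp (\<i> * complex_of_real (t * E n)) - 1) / complex_of_real t - \<i> * complex_of_real (E n)) / complex_of_real (E n)" for t n
    have e: "(\<lambda>n. (phase_op I E t \<psi> n - \<psi> n) / complex_of_real t - \<i> * H \<psi> n) = (\<lambda>n. g t n * H \<psi> n)" for t
    proof
      fix n
      show "(phase_op I E t \<psi> n - \<psi> n) / complex_of_real t - \<i> * H \<psi> n = g t n * H \<psi> n"
      proof -
        have "g t n * H \<psi> n = ((exp (\<i> * complex_of_real (t * E n)) - 1) / complex_of_real t - \<i> * complex_of_real (E n)) * \<psi> n"
          by (cases "E n = 0") (simp_all add: g_def H)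
        then show ?thesis using \<psi>
          by (simp add: phase_op_def H left_diff_distrib diff_divide_distrib mult.assoc)
      qed
    qed
    show ?thesis unfolding e
    proof (rule ell2_multiplier_tendsto_0[OF H\<psi>, where C=2])
      show "cmod (g t n) \<le> 2" for t n
      proof -
        have "cmod (exp (\<i> * complex_of_real (t * E n)) - 1) \<le> \<bar>t * E n\<bar>"
          using iexp_approx1[of "t * E n" 0] by simp
        then have "cmod ((exp (\<i> * complex_of_real (t * E n)) - 1) / complex_of_real t) \<le> \<bar>E n\<bar>"
          by (cases "t = 0") (auto simp: norm_divide abs_mult field_simps)
        then have "cmod ((exp (\<i> * complex_of_real (t * E n)) - 1) / complex_of_real t - \<i> * complex_of_real (E n)) \<le> \<bar>E n\<bar> + \<bar>E n\<bar>"
          using norm_triangle_ineq4[of "(exp (\<i> * complex_of_real (t * E n)) - 1) / complex_of_real t" "\<i> * complex_of_real (E n)"]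
          by (simp add: norm_mult)
        then show ?thesis unfolding g_def by (cases "E n = 0") (simp_all add: norm_divide divide_le_eq)
      qed
      show "((\<lambda>t. g t n) \<longlongrightarrow> 0) (at 0)" for n
      proof -
        define c where "c = \<i> * complex_of_real (E n)"
        have "((\<lambda>z. exp (c * z)) has_field_derivative c) (at 0)"
          by (auto intro!: derivative_eq_intros)
        then have "((\<lambda>z. (exp (c * z) - 1) / z) \<longlongrightarrow> c) (at 0)"
          by (simp add: has_field_derivative_iff)
        moreover have "filterlim complex_of_real (at 0) (at 0)"
          by (rule filterlim_atI) (auto intro: tendsto_eq_intros simp: eventually_at_filter)
        ultimately have "((\<lambda>t. (exp (c * complex_of_real t) - 1) / complex_of_real t) \<longlongrightarrow> c) (at 0)"
          by (rule filterlim_compose)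
        then have "((\<lambda>t. ((exp (c * complex_of_real t) - 1) / complex_of_real t - c) / complex_of_real (E n)) \<longlongrightarrow> (c - c) / complex_of_real (E n)) (at 0)"
          by (cases "E n = 0") (simp, intro tendsto_intros, simp_all)
        then show ?thesis by (simp add: g_def c_def mult_ac)
      qed
    qed
  qed
  show "(\<forall>t. phase_op I E t \<in> unitary_ops I) \<and> phase_op I E 0 = id_op I \<and>
    (\<forall>s t. phase_op I E (s + t) = phase_op I E s \<circ> phase_op I E t) \<and>
    (\<forall>\<psi>\<in>ell2 I. ((\<lambda>t. l2norm (\<lambda>n. phase_op I E t \<psi> n - \<psi> n)) \<longlongrightarrow> 0) (at 0)) \<and>
    (\<forall>\<psi>\<in>ell2 I. H \<psi> \<in> ell2 I \<longrightarrow>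
        ((\<lambda>t. l2norm (\<lambda>n. (phase_op I E t \<psi> n - \<psi> n) / complex_of_real t - \<i> * H \<psi> n)) \<longlongrightarrow> 0) (at 0))"
  proof (intro conjI allI ballI impI phase_op_unitary cont deriv)
    show "phase_op I E 0 = id_op I" by (simp add: phase_op_def id_op_def fun_eq_iff)
    show "phase_op I E (s + t) = phase_op I E s \<circ> phase_op I E t" for s t
      by (rule bounded_ops_eqI[OF phase_op_bounded bounded_ops_comp[OF phase_op_bounded phase_op_bounded]])
         (simp add: phase_op_comp)
  qed
  fix U :: "real \<Rightarrow> 'a oper"
  assume U: "(\<forall>t. U t \<in> unitary_ops I) \<and> U 0 = id_op I \<and> (\<forall>s t. U (s + t) = U s \<circ> U t) \<and>
     (\<forall>\<psi>\<in>ell2 I. ((\<lambda>t. l2norm (\<lambda>n. U t \<psi> n - \<psi> n)) \<longlongrightarrow> 0) (at 0)) \<and>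
     (\<forall>\<psi>\<in>ell2 I. H \<psi> \<in> ell2 I \<longrightarrow>
        ((\<lambda>t. l2norm (\<lambda>n. (U t \<psi> n - \<psi> n) / complex_of_real t - \<i> * H \<psi> n)) \<longlongrightarrow> 0) (at 0))"
  then have Uu: "\<And>t. U t \<in> unitary_ops I" and U0: "U 0 = id_op I" and Ua: "\<And>s t. U (s + t) = U s \<circ> U t"
    and Ud: "\<And>\<psi>. \<psi> \<in> ell2 I \<Longrightarrow> H \<psi> \<in> ell2 I \<Longrightarrow>
        ((\<lambda>t. l2norm (\<lambda>n. (U t \<psi> n - \<psi> n) / complex_of_real t - \<i> * H \<psi> n)) \<longlongrightarrow> 0) (at 0)"
    by blast+
  show "U = phase_op I E"
  proof
    fix t
    show "U t = phase_op I E t"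
    proof (rule bounded_ops_eqI_kets[OF unitary_ops_bounded[OF Uu] phase_op_bounded])
      fix n assume n: "n \<in> I"
      have kn: "ket n \<in> ell2 I" using n by simp
      have Hk: "H (ket n) = (\<lambda>m. complex_of_real (E n) * ket n m)" by (auto simp: H ket_def)
      have lim: "((\<lambda>h. l2norm (\<lambda>m. (U h (ket n) m - ket n m) / complex_of_real h - \<i> * H (ket n) m)) \<longlongrightarrow> 0) (at 0)"
        by (rule Ud[OF kn]) (simp add: Hk ell2_scale kn)
      \<comment> \<open>The generator gives the derivative at time 0 only. The group law transports
        it to time \<open>s\<close>; the isometry \<open>U s\<close> keeps the norm of the error,
        which in turn bounds its component \<open>m\<close>.\<close>
      have der: "((\<lambda>t. U t (ket n) m) has_vector_derivative \<i> * complex_of_real (E n) * U s (ket n) m) (at s)" for s m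
        unfolding has_vector_derivative_def has_derivative_at
      proof (intro conjI)
        show "bounded_linear (\<lambda>x. x *\<^sub>R (\<i> * complex_of_real (E n) * U s (ket n) m))" by (rule bounded_linear_scaleR_left)
        show "(\<lambda>h. norm (U (s + h) (ket n) m - U s (ket n) m - h *\<^sub>R (\<i> * complex_of_real (E n) * U s (ket n) m)) / norm h) \<midarrow>0\<rightarrow> 0"
        proof (rule Lim_null_comparison[OF _ lim])
          show "\<forall>\<^sub>F h in at 0. norm (norm (U (s + h) (ket n) m - U s (ket n) m - h *\<^sub>R (\<i> * complex_of_real (E n) * U s (ket n) m)) / norm h)
            \<le> l2norm (\<lambda>m. (U h (ket n) m - ket n m) / complex_of_real h - \<i> * H (ket n) m)"
            unfolding eventually_at_filter
          proof (intro always_eventually allI impI)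
            fix h :: real assume h: "h \<noteq> 0"
            define x where "x = (\<lambda>m. 1 / complex_of_real h * (U h (ket n) m - ket n m) - \<i> * complex_of_real (E n) * ket n m)"
            note Us = unitary_ops_blin[OF Uu, of s]
            note Uh = blin_mem[OF unitary_ops_blin[OF Uu, of h] kn]
            have x: "x \<in> ell2 I" unfolding x_def by (intro ell2_diff ell2_scale Uh kn)
            have "U s x = (\<lambda>m. 1 / complex_of_real h * (U s (U h (ket n)) m - U s (ket n) m) - \<i> * complex_of_real (E n) * U s (ket n) m)"
              unfolding x_def blin_diff[OF Us ell2_scale[OF ell2_diff[OF Uh kn]] ell2_scale[OF kn]]
                blin_scale[OF Us ell2_diff[OF Uh kn]] blin_scale[OF Us kn] blin_diff[OF Us Uh kn] ..
            moreover have "U s (U h (ket n)) = U (s + h) (ket n)" by (simp add: Ua)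
            ultimately have "complex_of_real h * U s x m = U (s + h) (ket n) m - U s (ket n) m - h *\<^sub>R (\<i> * complex_of_real (E n) * U s (ket n) m)"
              using h by (simp add: scaleR_conv_of_real field_simps)
            then have "norm (U (s + h) (ket n) m - U s (ket n) m - h *\<^sub>R (\<i> * complex_of_real (E n) * U s (ket n) m)) / norm h = cmod (U s x m)"
              using h by (metis nonzero_mult_div_cancel_left norm_eq_zero norm_mult norm_of_real of_real_eq_0_iff real_norm_def)
            also have "\<dots> \<le> l2norm (U s x)" by (rule l2norm_component_le[OF blin_mem[OF Us x]])
            also have "\<dots> = l2norm x" by (rule unitary_ops_l2norm[OF Uu x])
            finally show "norm (norm (U (s + h) (ket n) m - U s (ket n) m - h *\<^sub>R (\<i> * complex_of_real (E n) * U s (ket n) m)) / norm h)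
              \<le> l2norm (\<lambda>m. (U h (ket n) m - ket n m) / complex_of_real h - \<i> * H (ket n) m)"
              by (simp add: x_def Hk mult.assoc)
          qed
        qed
      qed
      show "U t (ket n) = phase_op I E t (ket n)"
      proof
        fix m
        \<comment> \<open>Multiplication by the inverse phase makes the derivative vanish, so each
          component of the product keeps its value at time 0.\<close>
        have "((\<lambda>t. exp (- (\<i> * complex_of_real (E n)) * complex_of_real t) * U t (ket n) m) has_vector_derivative 0) (at s within UNIV)" for s
        proof -
          define c where "c = \<i> * complex_of_real (E n)"
          have "((\<lambda>z. exp (- c * z)) has_field_derivative - c * exp (- c * complex_of_real s)) (at (complex_of_real s))"
            by (auto intro!: derivative_eq_intros)
          then have "((\<lambda>t. exp (- c * complex_of_real t)) has_vector_derivative - c * exp (- c * complex_of_real s)) (at s)"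
            by (rule has_vector_derivative_real_field)
          from has_vector_derivative_mult[OF this der[of m s, folded c_def]] show ?thesis by (simp add: c_def)
        qed
        from has_vector_derivative_zero_constant[OF convex_UNIV this]
        obtain c where "\<And>s. exp (- (\<i> * complex_of_real (E n)) * complex_of_real s) * U s (ket n) m = c" by auto
        from this[of t] this[of 0] have "exp (- (\<i> * complex_of_real (E n)) * complex_of_real t) * U t (ket n) m = ket n m"
          by (simp add: U0 id_op_apply kn)
        then have "U t (ket n) m = exp (\<i> * complex_of_real (E n) * complex_of_real t) * ket n m"
          by (simp add: exp_minus field_simps)
        also have "\<dots> = phase_op I E t (ket n) m"
          using kn by (auto simp: phase_op_def ket_def mult_ac)
        finally show "U t (ket n) m = phase_op I E t (ket n) m" .
      qed
    qed
  qed
qed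


section \<open>The number Hamiltonian and rotations of the modes\<close>

lemma hamiltonian_diagonal:
  "hamiltonian J \<phi> \<psi> = (\<lambda>n. complex_of_real (\<Sum>j\<in>J. \<phi> j * real (n j)) * \<psi> n)"
proof
  fix n
  have "creation j (annihilation j \<psi>) n = complex_of_real (real (n j)) * \<psi> n" for j
  \<comment> \<open>For \<open>n j = 0\<close> the truncated subtraction \<open>n j - 1\<close> in
    \<open>creation\<close> does no harm, as the factor \<open>sqrt 0\<close> vanishes; otherwise
    lowering and raising restore \<open>n\<close>.\<close>
  proof (cases "n j = 0")
    case False
    then have "complex_of_real (sqrt (real (n j))) * complex_of_real (sqrt (real (n j))) = complex_of_real (real (n j))"
      by (simp only: of_real_mult[symmetric] real_sqrt_mult_self abs_of_nat)
    moreover have "n(j := n j - 1, j := n j - 1 + 1) = n" "real (n j - 1 + 1) = real (n j)" using False by auto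
    ultimately show ?thesis unfolding creation_def annihilation_def by (simp add: mult.assoc[symmetric])
  qed (simp add: creation_def)
  then show "hamiltonian J \<phi> \<psi> n = complex_of_real (\<Sum>j\<in>J. \<phi> j * real (n j)) * \<psi> n"
    unfolding hamiltonian_def by (simp add: sum_distrib_right mult.assoc)
qed

definition rotate_modes :: "'n::finite set \<Rightarrow> ('n \<Rightarrow> real) \<Rightarrow> real \<Rightarrow> 'n cspace \<Rightarrow> 'n cspace" where
  "rotate_modes J \<phi> t z = (\<chi> i. if i \<in> J then exp (\<i> * complex_of_real (t * \<phi> i)) * z $ i else 0)"

lemma rotate_modes_mem: "rotate_modes J \<phi> t z \<in> coord_space J"
  by (simp add: rotate_modes_def coord_space_def)

lemma rotate_modes_add_time: "rotate_modes J \<phi> s (rotate_modes J \<phi> t z) = rotate_modes J \<phi> (s + t) z"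
  by (auto simp: rotate_modes_def vec_eq_iff exp_add distrib_left distrib_right mult.assoc)

lemma rotate_modes_zero: "z \<in> coord_space J \<Longrightarrow> rotate_modes J \<phi> 0 z = z"
  by (auto simp: rotate_modes_def vec_eq_iff coord_space_def)

lemma rotate_modes_add: "rotate_modes J \<phi> t (z + w) = rotate_modes J \<phi> t z + rotate_modes J \<phi> t w"
  by (auto simp: rotate_modes_def vec_eq_iff distrib_left)

lemma rotate_modes_hprod:
  assumes "z \<in> coord_space J"
  shows "hprod (rotate_modes J \<phi> t z) (rotate_modes J \<phi> t w) = hprod z w"
  unfolding hprod_def
proof (rule sum.cong[OF refl])
  fix i
  have "cnj (exp (\<i> * complex_of_real (t * \<phi> i))) * exp (\<i> * complex_of_real (t * \<phi> i)) = 1"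
    unfolding exp_cnj exp_add[symmetric] by simp
  then show "cnj (rotate_modes J \<phi> t z $ i) * rotate_modes J \<phi> t w $ i = cnj (z $ i) * w $ i"
    using assms by (auto simp: rotate_modes_def coord_space_def)
qed

lemma rotate_modes_norm:
  assumes "z \<in> coord_space J"
  shows "norm (rotate_modes J \<phi> t z) = norm z"
proof -
  have "complex_of_real ((norm (rotate_modes J \<phi> t z))\<^sup>2) = complex_of_real ((norm z)\<^sup>2)"
    unfolding hprod_self[symmetric] by (rule rotate_modes_hprod[OF assms])
  then have "(norm (rotate_modes J \<phi> t z))\<^sup>2 = (norm z)\<^sup>2" using of_real_eq_iff by blast
  then show ?thesis by simp
qed

abbreviation mode_energy :: "'n set \<Rightarrow> ('n \<Rightarrow> real) \<Rightarrow> ('n \<Rightarrow> nat) \<Rightarrow> real" where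
  "mode_energy J \<phi> \<equiv> \<lambda>n. \<Sum>j\<in>J. \<phi> j * real (n j)"

text \<open>Second quantization of a rotation: each power \<open>w $ i ^ n i\<close> absorbs the
  phase of its mode raised to \<open>n i\<close>, and the product of these is the phase of the total
  energy.\<close>

lemma phase_op_exp_vec:
  assumes w: "w \<in> coord_space J"
  shows "phase_op (occ J) (mode_energy J \<phi>) t (exp_vec w) = exp_vec (rotate_modes J \<phi> t w)"
proof
  fix n
  show "phase_op (occ J) (mode_energy J \<phi>) t (exp_vec w) n = exp_vec (rotate_modes J \<phi> t w) n"
  proof (cases "n \<in> occ J")
    case True
    have "exp (\<i> * complex_of_real (t * mode_energy J \<phi> n)) = (\<Prod>i\<in>J. exp (\<i> * complex_of_real (t * \<phi> i)) ^ n i)"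
      by (simp add: sum_distrib_left exp_sum exp_of_nat_mult[symmetric] mult_ac)
    also have "\<dots> = (\<Prod>i\<in>UNIV. if i \<in> J then exp (\<i> * complex_of_real (t * \<phi> i)) ^ n i else 1)"
      by (rule prod.mono_neutral_cong_left) auto
    finally have e: "exp (\<i> * complex_of_real (t * mode_energy J \<phi> n)) = \<dots>" .
    have "exp (\<i> * complex_of_real (t * mode_energy J \<phi> n)) * exp_vec w n = exp_vec (rotate_modes J \<phi> t w) n"
      unfolding e exp_vec_def prod.distrib[symmetric]
      by (rule prod.cong) (use True in \<open>auto simp: rotate_modes_def occ_def power_mult_distrib\<close>)
    then show ?thesis using exp_vec_mem[OF w] by (simp add: phase_op_def)
  next
    case False
    have "phase_op (occ J) (mode_energy J \<phi>) t (exp_vec w) \<in> ell2 (occ J)"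
      by (rule bounded_ops_mem[OF phase_op_bounded exp_vec_mem[OF w]])
    then show ?thesis using ell2_outside[OF _ False] ell2_outside[OF exp_vec_mem[OF rotate_modes_mem] False] by simp
  qed
qed

lemma phase_op_weyl:
  assumes z: "z \<in> coord_space J" and \<psi>: "\<psi> \<in> ell2 (occ J)"
  shows "phase_op (occ J) (mode_energy J \<phi>) t (weyl J z \<psi>) =
    weyl J (rotate_modes J \<phi> t z) (phase_op (occ J) (mode_energy J \<phi>) t \<psi>)"
proof -
  define P where "P = phase_op (occ J) (mode_energy J \<phi>) t"
  have P: "blin (occ J) (occ J) P" using phase_op_bounded unfolding P_def bounded_ops_iff by blast
  have "P (weyl J z \<psi>) = weyl J (rotate_modes J \<phi> t z) (P \<psi>)"
  proof (rule blin_eqI_exp_vecs[OF blin_comp[OF weyl_blin[OF z] P] blin_comp[OF P weyl_blin[OF rotate_modes_mem]] _ \<psi>])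
    fix w :: "'a cspace" assume w: "w \<in> coord_space J"
    have zw: "z + w \<in> coord_space J" using z w by auto
    have Pe: "P (exp_vec x) = exp_vec (rotate_modes J \<phi> t x)" if "x \<in> coord_space J" for x
      unfolding P_def by (rule phase_op_exp_vec[OF that])
    have "P (weyl J z (exp_vec w)) = weyl_exp (rotate_modes J \<phi> t z) (rotate_modes J \<phi> t w)"
      unfolding weyl_exp_vec[OF z w] weyl_exp_def blin_scale[OF P exp_vec_mem[OF zw]] Pe[OF zw]
        rotate_modes_hprod[OF z] rotate_modes_norm[OF z] rotate_modes_add ..
    then show "P (weyl J z (exp_vec w)) = weyl J (rotate_modes J \<phi> t z) (P (exp_vec w))"
      unfolding Pe[OF w] weyl_exp_vec[OF rotate_modes_mem rotate_modes_mem] .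
  qed
  then show ?thesis by (simp only: P_def)
qed

text \<open>Conjugating \<omega> by the group rotates the argument of its characteristic function,
  since Weyl operators are covariant under the rotation. Invariance of that function therefore makes
  \<omega> equal to all its conjugates.\<close>

lemma commutes_with_hamiltonian:
  fixes \<omega> :: "('n::finite \<Rightarrow> nat) oper"
  assumes \<omega>: "\<omega> \<in> density_ops (occ J)"
    and inv: "\<And>t z. z \<in> coord_space J \<Longrightarrow>
      tr (occ J) (\<omega> \<circ> weyl J (rotate_modes J \<phi> t z)) = tr (occ J) (\<omega> \<circ> weyl J z)"
  shows "commutes_with (occ J) \<omega> (hamiltonian J \<phi>)"
proof -
  define U where "U = phase_op (occ J) (mode_energy J \<phi>)"
  have H: "unitary_group (occ J) (hamiltonian J \<phi>) = U"
    unfolding U_def by (rule unitary_group_diagonal[OF hamiltonian_diagonal])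
  obtain v :: "nat \<Rightarrow> ('n \<Rightarrow> nat) vect" where v: "mixture (occ J) v" "\<omega> = mix_op (occ J) v" using density_mixture[OF \<omega>] by blast
  have Uu: "U t \<in> unitary_ops (occ J)" and Ua: "adj_op (occ J) (U t) = U (- t)" for t
    unfolding U_def by (rule phase_op_unitary)+
  have "\<omega> \<circ> U t = U t \<circ> \<omega>" for t
  proof -
    note m = unitary_mixture[OF Uu[of "- t"] v(1)]
    have "\<omega> = mix_op (occ J) (\<lambda>k. U (- t) (v k))"
    proof (rule density_eqI_weyl[OF \<omega> mix_op_density[OF m(1)]])
      fix z :: "'n cspace" assume z: "z \<in> coord_space J"
      have "mix_tr v (\<lambda>\<psi>. U t (weyl J z (U (- t) \<psi>))) = mix_tr v (weyl J (rotate_modes J \<phi> t z))"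
        unfolding mix_tr_def
      proof (rule infsum_cong)
        fix k
        have Uk: "U (- t) (v k) \<in> ell2 (occ J)" by (rule blin_mem[OF unitary_ops_blin[OF Uu] mixture_mem[OF v(1)]])
        have "U t (weyl J z (U (- t) (v k))) = weyl J (rotate_modes J \<phi> t z) (U t (U (- t) (v k)))"
          using phase_op_weyl[OF z Uk] unfolding U_def .
        also have "U t (U (- t) (v k)) = v k"
          using mixture_mem[OF v(1)] by (simp add: U_def phase_op_comp phase_op_zero)
        finally show "cip (v k) (U t (weyl J z (U (- t) (v k)))) = cip (v k) (weyl J (rotate_modes J \<phi> t z) (v k))" by simp
      qed
      then have "mix_tr (\<lambda>k. U (- t) (v k)) (weyl J z) = mix_tr v (weyl J (rotate_modes J \<phi> t z))"
        using m(3)[OF weyl_blin[OF z]] by (simp add: Ua)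
      also have "\<dots> = mix_tr v (weyl J z)"
        using inv[OF z, of t] unfolding v(2) tr_mix_op[OF v(1) weyl_bounded[OF z]] tr_mix_op[OF v(1) weyl_bounded[OF rotate_modes_mem]] .
      finally show "tr (occ J) (\<omega> \<circ> weyl J z) = tr (occ J) (mix_op (occ J) (\<lambda>k. U (- t) (v k)) \<circ> weyl J z)"
        unfolding v(2) tr_mix_op[OF v(1) weyl_bounded[OF z]] tr_mix_op[OF m(1) weyl_bounded[OF z]] by simp
    qed
    then have e: "\<omega> = U (- t) \<circ> \<omega> \<circ> U t" unfolding m(2) by (simp add: v(2) Ua)
    have \<omega>b: "\<omega> \<in> bounded_ops (occ J)" using \<omega> by (simp add: density_ops_def)
    show ?thesis
    proof (rule bounded_ops_eqI[OF bounded_ops_comp[OF \<omega>b unitary_ops_bounded[OF Uu]] bounded_ops_comp[OF unitary_ops_bounded[OF Uu] \<omega>b]])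
      fix \<psi> assume \<psi>: "\<psi> \<in> ell2 (occ J)"
      have "\<omega> (U t \<psi>) \<in> ell2 (occ J)"
        by (rule bounded_ops_mem[OF \<omega>b blin_mem[OF unitary_ops_blin[OF Uu] \<psi>]])
      then have "U t (U (- t) (\<omega> (U t \<psi>))) = \<omega> (U t \<psi>)" by (simp add: U_def phase_op_comp phase_op_zero)
      moreover have "\<omega> \<psi> = U (- t) (\<omega> (U t \<psi>))" using fun_cong[OF e, of \<psi>] by simp
      ultimately show "(\<omega> \<circ> U t) \<psi> = (U t \<circ> \<omega>) \<psi>" by simp
    qed
  qed
  then show ?thesis by (simp add: commutes_with_def H)
qed

text \<open>The state conjugated by the metaplectic unitary is invariant for the representative.
  This provides the state whose partial trace on the decaying modes becomes the Gaussian
  factor.\<close>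

lemma conj_class_invariant:
  fixes T T' :: "'n::finite semigroup"
  assumes T: "qms (occ UNIV) T" and T': "qms (occ UNIV) T'" and c: "T' \<in> conj_class T"
    and inv: "normal_invariant_state (occ UNIV) T \<rho>"
  shows "\<exists>\<rho>'. normal_invariant_state (occ UNIV) T' \<rho>'"
proof -
  obtain M U where U: "metaplectic M U" and TU: "\<And>t x. t \<ge> 0 \<Longrightarrow> x \<in> bounded_ops (occ UNIV) \<Longrightarrow>
      T' t x = U \<circ> T t (adj_op (occ UNIV) U \<circ> x \<circ> U) \<circ> adj_op (occ UNIV) U"
    using c unfolding conj_class_def by blast
  define I where "I = (occ UNIV :: ('n \<Rightarrow> nat) set)"
  have Uu: "U \<in> unitary_ops I" using U by (simp add: metaplectic_def I_def)
  note Ub = unitary_ops_bounded[OF Uu]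
  obtain v :: "nat \<Rightarrow> ('n \<Rightarrow> nat) vect" where v: "mixture I v" "\<rho> = mix_op I v"
    using density_mixture[of \<rho> I] inv unfolding normal_invariant_state_def I_def by blast
  note m = unitary_mixture[OF Uu v(1)]
  have "tr I (mix_op I (\<lambda>k. U (v k)) \<circ> T' t x) = tr I (mix_op I (\<lambda>k. U (v k)) \<circ> x)"
    if t: "t \<ge> 0" and x: "x \<in> bounded_ops I" for t x
  proof -
    define y where "y = adj_op I U \<circ> x \<circ> U"
    have y: "y \<in> bounded_ops I" unfolding y_def by (intro bounded_ops_comp adj_op_bounded Ub x)
    have Ty: "T t y \<in> bounded_ops I" using T t y by (simp add: qms_def linear_map_def I_def)
    have T'x: "T' t x \<in> bounded_ops I" using T' t x by (simp add: qms_def linear_map_def I_def)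
    have e: "adj_op I U (T' t x (U \<psi>)) = T t y \<psi>" if \<psi>: "\<psi> \<in> ell2 I" for \<psi>
    proof -
      have "T' t x (U \<psi>) = U (T t y (adj_op I U (U \<psi>)))"
        using TU[OF t, of x] x by (simp add: y_def I_def)
      also have "\<dots> = U (T t y \<psi>)" by (simp add: unitary_ops_inverse(2)[OF Uu \<psi>])
      finally show ?thesis
        using unitary_ops_inverse(2)[OF Uu bounded_ops_mem[OF Ty \<psi>]] by simp
    qed
    have "tr I (mix_op I (\<lambda>k. U (v k)) \<circ> T' t x) = mix_tr v (\<lambda>\<psi>. adj_op I U (T' t x (U \<psi>)))"
      unfolding tr_mix_op[OF m(1) T'x] using m(3) T'x by (simp add: bounded_ops_iff)
    also have "\<dots> = mix_tr v (T t y)" unfolding mix_tr_def by (simp add: e[OF mixture_mem[OF v(1)]])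
    also have "\<dots> = tr I (\<rho> \<circ> T t y)" unfolding v(2) by (rule tr_mix_op[OF v(1) Ty, symmetric])
    also have "\<dots> = tr I (\<rho> \<circ> y)" using inv t y by (simp add: normal_invariant_state_def I_def)
    also have "\<dots> = mix_tr v y" unfolding v(2) by (rule tr_mix_op[OF v(1) y])
    also have "\<dots> = mix_tr v (\<lambda>\<psi>. adj_op I U (x (U \<psi>)))" by (simp add: y_def o_def)
    also have "\<dots> = tr I (mix_op I (\<lambda>k. U (v k)) \<circ> x)"
      unfolding tr_mix_op[OF m(1) x] using m(3) x by (simp add: bounded_ops_iff)
    finally show ?thesis .
  qed
  then have "normal_invariant_state (occ UNIV) T' (mix_op I (\<lambda>k. U (v k)))"
    unfolding normal_invariant_state_def I_def[symmetric] using mix_op_density[OF m(1)] by blast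
  then show ?thesis by blast
qed

section \<open>Exponential decay of linear flows\<close>

text \<open>The exponential generating function of a sequence. Components of a linear flow have this
  form, with the components of the iterates as coefficients, and differentiation becomes a shift of
  the sequence.\<close>

definition egf :: "(nat \<Rightarrow> complex) \<Rightarrow> real \<Rightarrow> complex" where
  "egf a t = (\<Sum>k. a k / fact k * complex_of_real t ^ k)"

text \<open>At most geometric growth, as for the iterates of a linear map. It makes the generating
  function entire and passes to the shifted sequence.\<close>

definition geom_bounded :: "(nat \<Rightarrow> complex) \<Rightarrow> bool" where
  "geom_bounded a \<longleftrightarrow> (\<exists>C K. \<forall>k. cmod (a k) \<le> C * K ^ k)"

lemma egf_summable:
  assumes "geom_bounded a"
  shows "summable (\<lambda>k. a k / fact k * z ^ k)"
proof -
  obtain C K where CK: "\<And>k. cmod (a k) \<le> C * K ^ k" using assms unfolding geom_bounded_def by blast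
  show ?thesis
  proof (rule summable_comparison_test'[OF summable_mult[OF summable_exp[of "K * cmod z"]], of 0])
    fix k
    have "norm (a k / fact k * z ^ k) = cmod (a k) * (cmod z ^ k / fact k)"
      by (simp add: norm_mult norm_divide norm_power)
    also have "\<dots> \<le> (C * K ^ k) * (cmod z ^ k / fact k)" by (intro mult_right_mono CK) auto
    also have "\<dots> = C * (inverse (fact k) * (K * cmod z) ^ k)" by (simp add: field_simps power_mult_distrib)
    finally show "norm (a k / fact k * z ^ k) \<le> C * (inverse (fact k) * (K * cmod z) ^ k)" .
  qed
qed

lemma geom_bounded_shift:
  assumes "geom_bounded a"
  shows "geom_bounded (\<lambda>k. a (Suc k))"
proof -
  obtain C K where CK: "\<And>k. cmod (a k) \<le> C * K ^ k" using assms unfolding geom_bounded_def by blast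
  then have "cmod (a (Suc k)) \<le> (C * K) * K ^ k" for k using CK[of "Suc k"] by (simp add: mult.assoc)
  then show ?thesis unfolding geom_bounded_def by blast
qed

lemma egf_derivative:
  assumes "geom_bounded a"
  shows "(egf a has_vector_derivative egf (\<lambda>k. a (Suc k)) t) (at t within S)"
proof -
  have "((\<lambda>z. \<Sum>k. a k / fact k * z ^ k) has_field_derivative (\<Sum>k. diffs (\<lambda>k. a k / fact k) k * complex_of_real t ^ k)) (at (complex_of_real t))"
    by (rule termdiffs_strong_converges_everywhere[OF egf_summable[OF assms]])
  moreover have "diffs (\<lambda>k. a k / fact k) k = a (Suc k) / fact k" for k
    by (simp add: diffs_def field_simps del: of_nat_Suc)
  ultimately have "((\<lambda>z. \<Sum>k. a k / fact k * z ^ k) has_field_derivative egf (\<lambda>k. a (Suc k)) t) (at (complex_of_real t))"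
    by (simp add: egf_def)
  from has_vector_derivative_real_field[OF this] show ?thesis by (simp add: egf_def[abs_def])
qed

lemma egf_continuous: "geom_bounded a \<Longrightarrow> continuous_on S (egf a)"
  by (auto simp: continuous_on_eq_continuous_within intro: has_vector_derivative_continuous egf_derivative)

lemma egf_add:
  assumes "geom_bounded a" "geom_bounded b"
  shows "egf (\<lambda>k. a k + c * b k) t = egf a t + c * egf b t"
proof -
  have "(\<lambda>k. (a k + c * b k) / fact k * complex_of_real t ^ k) = (\<lambda>k. a k / fact k * complex_of_real t ^ k + c * (b k / fact k * complex_of_real t ^ k))"
    by (simp add: fun_eq_iff field_simps)
  then show ?thesis unfolding egf_def
    using suminf_add[OF egf_summable[OF assms(1)] summable_mult[OF egf_summable[OF assms(2)], of c]]
      suminf_mult[OF egf_summable[OF assms(2)], of c] by simp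
qed

section \<open>Decaying functions and their integrals over the half line\<close>

definition exp_decay :: "(real \<Rightarrow> 'a::real_normed_vector) \<Rightarrow> bool" where
  "exp_decay f \<longleftrightarrow> (\<exists>C \<delta>. \<delta> > 0 \<and> (\<forall>t\<ge>0. norm (f t) \<le> C * exp (- \<delta> * t)))"

lemma exp_decayE:
  assumes "exp_decay f"
  obtains C \<delta> where "C \<ge> 0" "\<delta> > 0" "\<And>t. t \<ge> 0 \<Longrightarrow> norm (f t) \<le> C * exp (- \<delta> * t)"
proof -
  obtain C \<delta> where C: "\<delta> > 0" "\<And>t. t \<ge> 0 \<Longrightarrow> norm (f t) \<le> C * exp (- \<delta> * t)"
    using assms unfolding exp_decay_def by blast
  have "0 \<le> norm (f 0)" by (rule norm_ge_zero)
  also have "\<dots> \<le> C" using C(2)[of 0] by simp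
  finally show ?thesis using that C by blast
qed

text \<open>Variation of constants: the integrating factor removes the term with \<kappa>, and the
  remaining derivative is compared with that of \<open>C / m * exp (m * s)\<close>.\<close>

lemma exp_decay_ode:
  fixes h :: "real \<Rightarrow> complex"
  assumes h: "\<And>t. (h has_vector_derivative \<kappa> * h t + g t) (at t)"
    and g: "exp_decay g" and \<kappa>: "Re \<kappa> < 0"
  shows "exp_decay h"
proof -
  obtain C \<delta>' where C0: "C \<ge> 0" and C: "\<delta>' > 0" "\<And>t. t \<ge> 0 \<Longrightarrow> norm (g t) \<le> C * exp (- \<delta>' * t)" using exp_decayE[OF g] by blast
  \<comment> \<open>The rate is at most that of \<open>g\<close> and strictly below
    \<open>- Re \<kappa>\<close>, so that \<open>m\<close> is positive even when these two rates
    coincide.\<close>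
  define \<delta> where "\<delta> = min \<delta>' (- Re \<kappa> / 2)"
  have \<delta>: "\<delta> > 0" "\<delta> \<le> \<delta>'" "\<delta> < - Re \<kappa>" using C(1) \<kappa> by (auto simp: \<delta>_def min_def)
  define m where "m = - Re \<kappa> - \<delta>"
  have m: "m > 0" using \<delta> by (simp add: m_def)
  define k where "k s = exp (- \<kappa> * complex_of_real s) * h s" for s
  have dk: "(k has_vector_derivative exp (- \<kappa> * complex_of_real s) * g s) (at s)" for s
  proof -
    have "((\<lambda>z. exp (- \<kappa> * z)) has_field_derivative - \<kappa> * exp (- \<kappa> * complex_of_real s)) (at (complex_of_real s))"
      by (auto intro!: derivative_eq_intros)
    then have e: "((\<lambda>s. exp (- \<kappa> * complex_of_real s)) has_vector_derivative - \<kappa> * exp (- \<kappa> * complex_of_real s)) (at s)"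
      by (rule has_vector_derivative_real_field)
    from has_vector_derivative_mult[OF e h[of s]] show ?thesis
      unfolding k_def[abs_def] by (simp add: algebra_simps)
  qed
  have dphi: "((\<lambda>s. C / m * exp (m * s)) has_vector_derivative C * exp (m * s)) (at s)" for s
    using m by (auto intro!: derivative_eq_intros simp: has_real_derivative_iff_has_vector_derivative[symmetric])
  have cont: "continuous_on S k" "continuous_on S (\<lambda>s. C / m * exp (m * s))" for S
    by (rule continuous_at_imp_continuous_on, use dk in \<open>auto intro: has_vector_derivative_continuous\<close>)
       (intro continuous_intros, use m in simp)
  have "norm (h t) \<le> (norm (h 0) + C / m) * exp (- \<delta> * t)" if t: "t \<ge> 0" for t
  proof -
    have "norm (k t - k 0) \<le> C / m * exp (m * t) - C / m * exp (m * 0)"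
    proof (cases "t = 0")
      case False
      show ?thesis
      proof (rule differentiable_bound_general[OF _ cont dk dphi])
        fix s assume s: "0 < s" "s < t"
        have "norm (exp (- \<kappa> * complex_of_real s) * g s) = exp (- Re \<kappa> * s) * norm (g s)" by (simp add: norm_mult)
        also have "\<dots> \<le> exp (- Re \<kappa> * s) * (C * exp (- \<delta>' * s))" using s C(2)[of s] by (intro mult_left_mono) auto
        also have "\<dots> \<le> exp (- Re \<kappa> * s) * (C * exp (- \<delta> * s))"
          using s \<delta>(2) C0 by (intro mult_left_mono) (auto intro: mult_right_mono)
        also have "\<dots> = C * exp (m * s)" by (simp add: m_def exp_add[symmetric] algebra_simps)
        finally show "norm (exp (- \<kappa> * complex_of_real s) * g s) \<le> C * exp (m * s)" .
      qed (use t False in simp)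
    qed simp
    moreover have "0 \<le> C / m * exp (m * 0)" using C0 m by simp
    ultimately have "norm (k t) \<le> norm (h 0) + C / m * exp (m * t)"
      using norm_triangle_sub[of "k t" "k 0"] by (simp add: k_def)
    then have "exp (Re \<kappa> * t) * norm (k t) \<le> exp (Re \<kappa> * t) * (norm (h 0) + C / m * exp (m * t))" by simp
    moreover have "exp (Re \<kappa> * t) * norm (k t) = norm (h t)"
      by (simp add: k_def norm_mult mult.assoc[symmetric] exp_add[symmetric])
    moreover have "exp (Re \<kappa> * t) * (norm (h 0) + C / m * exp (m * t)) = norm (h 0) * exp (Re \<kappa> * t) + C / m * exp (- \<delta> * t)"
      by (simp add: distrib_left m_def exp_add[symmetric] mult.left_commute[of _ "C / (- Re \<kappa> - \<delta>)"] algebra_simps)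
    moreover have "norm (h 0) * exp (Re \<kappa> * t) \<le> norm (h 0) * exp (- \<delta> * t)"
      using mult_right_mono[of "Re \<kappa>" "- \<delta>" t] \<delta>(3) t by (intro mult_left_mono) auto
    ultimately show ?thesis by (simp add: distrib_right)
  qed
  then show ?thesis using \<delta>(1) unfolding exp_decay_def by blast
qed

lemma exp_decay_add:
  assumes "exp_decay f" "exp_decay g"
  shows "exp_decay (\<lambda>t. f t + g t)"
proof -
  obtain C a where C0: "C \<ge> 0" and C: "a > 0" "\<And>t. t \<ge> 0 \<Longrightarrow> norm (f t) \<le> C * exp (- a * t)" using exp_decayE[OF assms(1)] by blast
  obtain D b where D0: "D \<ge> 0" and D: "b > 0" "\<And>t. t \<ge> 0 \<Longrightarrow> norm (g t) \<le> D * exp (- b * t)" using exp_decayE[OF assms(2)] by blast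
  have "norm (f t + g t) \<le> (C + D) * exp (- min a b * t)" if t: "t \<ge> 0" for t
  proof -
    have "C * exp (- a * t) \<le> C * exp (- min a b * t)" "D * exp (- b * t) \<le> D * exp (- min a b * t)"
      using t C0 D0 by (auto intro!: mult_left_mono mult_right_mono)
    then show ?thesis using norm_triangle_ineq[of "f t" "g t"] C(2)[OF t] D(2)[OF t] unfolding distrib_right by linarith
  qed
  moreover have "min a b > 0" using C D by simp
  ultimately show ?thesis unfolding exp_decay_def by blast
qed

lemma exp_decay_zero: "exp_decay (\<lambda>t. 0)"
  unfolding exp_decay_def by (intro exI[of _ 0] exI[of _ 1]) simp

lemma exp_decay_sum:
  assumes "finite F" "\<And>i. i \<in> F \<Longrightarrow> exp_decay (f i)"
  shows "exp_decay (\<lambda>t. \<Sum>i\<in>F. f i t)"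
  using assms by (induction F rule: finite_induct) (auto intro: exp_decay_add exp_decay_zero)

lemma exp_decay_dominated:
  assumes "exp_decay f" "\<And>t. t \<ge> 0 \<Longrightarrow> norm (g t) \<le> K * norm (f t)" "K \<ge> 0"
  shows "exp_decay g"
proof -
  obtain C a where C0: "C \<ge> 0" and C: "a > 0" "\<And>t. t \<ge> 0 \<Longrightarrow> norm (f t) \<le> C * exp (- a * t)" using exp_decayE[OF assms(1)] by blast
  have "norm (g t) \<le> (K * C) * exp (- a * t)" if "t \<ge> 0" for t
    using assms(2)[OF that] mult_left_mono[OF C(2)[OF that] assms(3)] by (simp add: mult.assoc)
  then show ?thesis unfolding exp_decay_def using C(1) by blast
qed

lemma exp_decay_bounded:
  assumes "exp_decay f"
  shows "\<exists>B. \<forall>t\<ge>0. norm (f t) \<le> B"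
proof -
  obtain C a where C0: "C \<ge> 0" and C: "a > 0" "\<And>t. t \<ge> 0 \<Longrightarrow> norm (f t) \<le> C * exp (- a * t)" using exp_decayE[OF assms] by blast
  have "norm (f t) \<le> C" if "t \<ge> 0" for t
    using C(2)[OF that] C0 C(1) that mult_left_le[of "exp (- a * t)" C] by (auto intro: order_trans)
  then show ?thesis by blast
qed

lemma exp_decay_tendsto:
  assumes "exp_decay f"
  shows "(f \<longlongrightarrow> 0) at_top"
proof -
  obtain C a where C0: "C \<ge> 0" and C: "a > 0" "\<And>t. t \<ge> 0 \<Longrightarrow> norm (f t) \<le> C * exp (- a * t)" using exp_decayE[OF assms] by blast
  have "((\<lambda>t. C * exp (- a * t)) \<longlongrightarrow> C * 0) at_top"
    by (intro tendsto_mult_left filterlim_compose[OF exp_at_bot])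
       (use C(1) in \<open>simp add: filterlim_uminus_at_bot filterlim_tendsto_pos_mult_at_top[OF tendsto_const _ filterlim_ident]\<close>)
  then show ?thesis
    by (intro Lim_null_comparison[OF eventually_mono[OF eventually_ge_at_top[of 0] C(2)]]) auto
qed

text \<open>Domination by an exponential gives integrability, and the integral of that exponential
  from \<open>t\<close> on bounds the error of truncating at \<open>t\<close>.\<close>

lemma exp_decay_integrable:
  fixes f :: "real \<Rightarrow> real"
  assumes "exp_decay f" "continuous_on {0..} f"
  shows "f integrable_on {0..}" "((\<lambda>t. integral {0..t} f) \<longlongrightarrow> integral {0..} f) at_top"
proof -
  obtain C a where C0: "C \<ge> 0" and C: "a > 0" "\<And>t. t \<ge> 0 \<Longrightarrow> norm (f t) \<le> C * exp (- a * t)" using exp_decayE[OF assms(1)] by blast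
  have g: "((\<lambda>s. C * exp (- a * s)) has_integral C * (exp (- a * t) / a)) {t..}" for t
    by (intro has_integral_mult_right has_integral_exp_minus_to_infinity C(1))
  have int: "f integrable_on {t..}" if "t \<ge> 0" for t
  proof (rule measurable_bounded_by_integrable_imp_integrable)
    show "f \<in> borel_measurable (lebesgue_on {t..})"
      by (rule continuous_imp_measurable_on_sets_lebesgue[OF continuous_on_subset[OF assms(2)]]) (use that in auto)
    show "(\<lambda>s. C * exp (- a * s)) integrable_on {t..}" using g by blast
  qed (use C(2) that in auto)
  show "f integrable_on {0..}" by (rule int) simp
  have tail: "norm (integral {0..t} f - integral {0..} f) \<le> C * (exp (- a * t) / a)" if t: "t \<ge> 0" for t
  proof -
    have "f integrable_on {0..t}" by (rule integrable_on_subinterval[OF int[of 0]]) auto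
    then have "((f) has_integral (integral {0..t} f + integral {t..} f)) ({0..t} \<union> {t..})"
      using int[OF t] by (intro has_integral_Un) (auto simp: integrable_integral intro: negligible_subset[of "{t}"])
    moreover have "{0..t} \<union> {t..} = {0..}" using t by auto
    ultimately have "integral {0..} f = integral {0..t} f + integral {t..} f" by (simp add: integral_unique)
    moreover have "norm (integral {t..} f) \<le> integral {t..} (\<lambda>s. C * exp (- a * s))"
      by (rule integral_norm_bound_integral[OF int[OF t]]) (use g C(2) t in auto)
    moreover have "integral {t..} (\<lambda>s. C * exp (- a * s)) = C * (exp (- a * t) / a)" using g by (rule integral_unique)
    ultimately show ?thesis by simp
  qed
  have "exp_decay (\<lambda>t. C * (exp (- a * t) / a))"
    unfolding exp_decay_def by (rule exI[of _ "\<bar>C / a\<bar>"], rule exI[of _ a]) (use C(1) in \<open>auto simp: abs_mult\<close>)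
  from exp_decay_tendsto[OF this]
  have "((\<lambda>t. integral {0..t} f - integral {0..} f) \<longlongrightarrow> 0) at_top"
    by (rule Lim_null_comparison[rotated]) (rule eventually_mono[OF eventually_ge_at_top[of 0] tail])
  then show "((\<lambda>t. integral {0..t} f) \<longlongrightarrow> integral {0..} f) at_top" by (rule LIM_zero_cancel)
qed

section \<open>Iterates of linear maps and annihilating polynomials\<close>

lemma linear_iterate_growth:
  fixes A :: "'a::euclidean_space \<Rightarrow> 'a"
  assumes "linear A"
  shows "\<exists>K\<ge>0. \<forall>k z. norm ((A ^^ k) z) \<le> K ^ k * norm z"
proof -
  obtain K where K: "K > 0" "\<And>x. norm (A x) \<le> K * norm x" using linear_bounded_pos[OF assms] by blast
  have "norm ((A ^^ k) z) \<le> K ^ k * norm z" for k z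
  proof (induction k)
    case (Suc k)
    have "norm ((A ^^ Suc k) z) \<le> K * norm ((A ^^ k) z)" using K(2) by simp
    also have "\<dots> \<le> K * (K ^ k * norm z)" using Suc K(1) by (intro mult_left_mono) auto
    finally show ?case by (simp add: mult.assoc)
  qed simp
  then show ?thesis using K(1) by (intro exI[of _ K]) auto
qed

lemma complex_matrix_linear: "linear ((*v) (M :: complex ^ 'm::finite ^ 'm))"
  by (rule linearI)
     (simp_all add: matrix_vector_right_distrib, simp add: vec_eq_iff matrix_vector_mult_def scaleR_sum_right)

abbreviation mpow :: "complex ^ 'm::finite ^ 'm \<Rightarrow> nat \<Rightarrow> complex ^ 'm \<Rightarrow> complex ^ 'm" where
  "mpow M k \<equiv> ((*v) M) ^^ k"

lemma mpow_geom_bounded: "geom_bounded (\<lambda>k. mpow M k v $ i)"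
proof -
  obtain K where K: "\<And>k z. norm (mpow M k z) \<le> K ^ k * norm z" using linear_iterate_growth[OF complex_matrix_linear] by blast
  have "cmod (mpow M k v $ i) \<le> norm v * K ^ k" for k
    using order_trans[OF Finite_Cartesian_Product.norm_nth_le K[of k v]] by (simp add: mult.commute)
  then show ?thesis unfolding geom_bounded_def by blast
qed

lemma mpow_combine: "mpow M k (x + c *s y) = mpow M k x + c *s mpow M k y"
  by (induction k) (simp_all add: matrix_vector_right_distrib vector_scalar_commute)

definition poly_apply :: "complex ^ 'm::finite ^ 'm \<Rightarrow> complex poly \<Rightarrow> complex ^ 'm \<Rightarrow> complex ^ 'm" where
  "poly_apply M p v = (\<Sum>k\<le>degree p. coeff p k *s mpow M k v)"

lemma poly_apply_eq:
  assumes "degree p \<le> N"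
  shows "poly_apply M p v = (\<Sum>k\<le>N. coeff p k *s mpow M k v)"
  unfolding poly_apply_def
  by (rule sum.mono_neutral_left) (use assms in \<open>auto simp: coeff_eq_0\<close>)

lemma poly_apply_combine: "poly_apply M p (x + c *s y) = poly_apply M p x + c *s poly_apply M p y"
  unfolding poly_apply_def mpow_combine
  by (simp add: vec.scale_right_distrib sum.distrib vec.scale_sum_right mult.commute)

lemma poly_apply_matrix: "poly_apply M p (M *v v) = M *v poly_apply M p v"
proof -
  have "mpow M k (M *v v) = M *v mpow M k v" for k by (simp add: funpow_swap1)
  then show ?thesis unfolding poly_apply_def
    by (simp add: vector_scalar_commute[symmetric] linear_sum[OF complex_matrix_linear])
qed

lemma poly_apply_root:
  "poly_apply M ([:- \<kappa>, 1:] * q) v = M *v poly_apply M q v - \<kappa> *s poly_apply M q v"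
proof -
  define N where "N = Suc (degree q)"
  have d: "degree ([:- \<kappa>, 1:] * q) \<le> N"
    unfolding N_def by (rule order_trans[OF degree_mult_le]) simp
  have c: "coeff ([:- \<kappa>, 1:] * q) k = (case k of 0 \<Rightarrow> 0 | Suc j \<Rightarrow> coeff q j) - \<kappa> * coeff q k" for k
    by (simp add: coeff_pCons split: nat.split)
  have "poly_apply M ([:- \<kappa>, 1:] * q) v = (\<Sum>k\<le>N. (case k of 0 \<Rightarrow> 0 | Suc j \<Rightarrow> coeff q j) *s mpow M k v) - \<kappa> *s (\<Sum>k\<le>N. coeff q k *s mpow M k v)"
    unfolding poly_apply_eq[OF d] c by (simp add: vec.scale_left_diff_distrib sum_subtractf vec.scale_sum_right)
  also have "(\<Sum>k\<le>N. coeff q k *s mpow M k v) = poly_apply M q v"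
    by (rule poly_apply_eq[symmetric]) (simp add: N_def)
  also have "(\<Sum>k\<le>N. (case k of 0 \<Rightarrow> 0 | Suc j \<Rightarrow> coeff q j) *s mpow M k v) = M *v poly_apply M q v"
    unfolding N_def sum.atMost_Suc_shift poly_apply_def
    by (simp add: vector_scalar_commute[symmetric] linear_sum[OF complex_matrix_linear])
  finally show ?thesis .
qed

text \<open>Among the iterates of exponents 0 to \<open>D\<close>, the real dimension, either two
  coincide or there are \<open>D + 1\<close> distinct ones, which are dependent. The cases are
  separate because linear dependence is a property of sets.\<close>

lemma annihilating_poly_exists:
  fixes v :: "complex ^ 'm::finite"
  shows "\<exists>p. p \<noteq> 0 \<and> poly_apply M p v = 0"
proof -
  define D where "D = DIM(complex ^ 'm)"
  show ?thesis
  proof (cases "inj_on (\<lambda>k. mpow M k v) {..D}")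
    case False
    then obtain j k where jk: "j \<le> D" "k \<le> D" "j \<noteq> k" "mpow M j v = mpow M k v" by (auto simp: inj_on_def)
    define p :: "complex poly" where "p = monom 1 j - monom 1 k"
    have "coeff p j = 1" using jk(3) by (simp add: p_def)
    then have "p \<noteq> 0" by auto
    have d: "degree p \<le> D" unfolding p_def using jk
      by (intro degree_diff_le order_trans[OF degree_monom_le])
    have "poly_apply M p v = (\<Sum>i\<le>D. (if i = j then mpow M i v else 0) - (if i = k then mpow M i v else 0))"
      unfolding poly_apply_eq[OF d] by (rule sum.cong) (auto simp: p_def)
    also have "\<dots> = 0" using jk by (simp add: sum_subtractf)
    finally show ?thesis using \<open>p \<noteq> 0\<close> by blast
  next
    case True
    define S where "S = (\<lambda>k. mpow M k v) ` {..D}"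
    have "finite S" "card S > DIM(complex ^ 'm)" using card_image[OF True] by (auto simp: S_def D_def)
    then have "dependent S" by (intro dependent_biggerset)
    then obtain u where u: "\<exists>x\<in>S. u x \<noteq> 0" "(\<Sum>x\<in>S. u x *\<^sub>R x) = 0" using dependent_finite[OF \<open>finite S\<close>] by blast
    define p :: "complex poly" where "p = (\<Sum>k\<le>D. monom (complex_of_real (u (mpow M k v))) k)"
    have c: "coeff p k = (if k \<le> D then complex_of_real (u (mpow M k v)) else 0)" for k
      by (simp add: p_def coeff_sum if_distrib sum.delta cong: if_cong)
    obtain k where "k \<le> D" "u (mpow M k v) \<noteq> 0" using u(1) by (auto simp: S_def)
    then have "coeff p k \<noteq> 0" by (simp add: c)
    then have "p \<noteq> 0" by auto
    have d: "degree p \<le> D" by (rule degree_le) (simp add: c)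
    have "poly_apply M p v = (\<Sum>k\<le>D. u (mpow M k v) *\<^sub>R mpow M k v)"
      unfolding poly_apply_eq[OF d] by (rule sum.cong) (auto simp: c vec_eq_iff scaleR_conv_of_real[symmetric])
    also have "\<dots> = (\<Sum>x\<in>S. u x *\<^sub>R x)" unfolding S_def sum.reindex[OF True] by simp
    finally show ?thesis using u(2) \<open>p \<noteq> 0\<close> by auto
  qed
qed

text \<open>Induction on the degree of a polynomial \<open>p = (X - \<kappa>) q\<close> annihilating \<open>v\<close>: if \<open>q\<close> does not annihilate
  \<open>v\<close>, then \<open>q(M) v\<close> is an eigenvector for \<open>\<kappa>\<close>, the induction hypothesis applies to \<open>(M - \<kappa>) v\<close>, and
  the flow of \<open>v\<close> solves \<open>h' = \<kappa> h + g\<close> with \<open>g\<close> decaying.\<close>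

lemma matrix_exp_decay:
  fixes M :: "complex ^ 'm::finite ^ 'm"
  assumes inv: "\<And>x l. l \<in> L \<Longrightarrow> (M *v x) $ l = 0"
    and spec: "\<And>\<mu> u. u \<noteq> 0 \<Longrightarrow> (\<forall>l\<in>L. u $ l = 0) \<Longrightarrow> M *v u = \<mu> *s u \<Longrightarrow> Re \<mu> < 0"
    and v: "\<forall>l\<in>L. v $ l = 0"
  shows "exp_decay (egf (\<lambda>k. mpow M k v $ i))"
proof -
  \<comment> \<open>\<open>L\<close> consists of coordinates outside the block under study. The
    spectral hypothesis concerns only eigenvectors vanishing there, so this property is propagated
    to the iterates and through them to the eigenvector \<open>u\<close>.\<close>
  have mpowL: "mpow M k x $ l = 0" if "\<forall>l\<in>L. x $ l = 0" "l \<in> L" for k x l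
    using that inv by (cases k) auto
  have claim: "\<forall>i. exp_decay (egf (\<lambda>k. mpow M k v $ i))"
    if "p \<noteq> 0" "poly_apply M p v = 0" "degree p = n" "\<forall>l\<in>L. v $ l = 0" for p v n
    using that
  proof (induction n arbitrary: p v rule: less_induct)
    case (less n)
    show ?case
    proof (cases "n = 0")
      case True
      then have "poly_apply M p v = coeff p 0 *s v" using less.prems by (simp add: poly_apply_def)
      moreover have "coeff p 0 \<noteq> 0" using less.prems True by (metis leading_coeff_0_iff)
      ultimately have "v = 0" using less.prems(2) by simp
      moreover have "mpow M k 0 = 0" for k by (induction k) simp_all
      ultimately have "egf (\<lambda>k. mpow M k v $ i) = (\<lambda>t. 0)" for i by (simp add: egf_def fun_eq_iff)
      then show ?thesis by (simp add: exp_decay_zero)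
    next
      case False
      then have "\<not> constant (poly p)" using less.prems(3) by (simp add: constant_degree)
      then obtain \<kappa> where "poly p \<kappa> = 0" using fundamental_theorem_of_algebra by blast
      then obtain q where q: "p = [:- \<kappa>, 1:] * q" using poly_eq_0_iff_dvd by (metis dvdE)
      have q0: "q \<noteq> 0" using less.prems(1) q by auto
      have dq: "degree q < n" using less.prems(3) q0 unfolding q by (subst (asm) degree_mult_eq) auto
      define u where "u = poly_apply M q v"
      have Mu: "M *v u = \<kappa> *s u" using less.prems(2) unfolding q poly_apply_root u_def by simp
      have uL: "\<forall>l\<in>L. u $ l = 0"
        unfolding u_def poly_apply_def using mpowL[OF less.prems(4)] by simp
      show ?thesis
      proof (cases "u = 0")
        case True
        show ?thesis by (rule less.IH[OF dq q0 _ refl less.prems(4)]) (use True u_def in simp)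
      next
        case nz: False
        have re: "Re \<kappa> < 0" by (rule spec[OF nz uL Mu])
        define w where "w = M *v v + (- \<kappa>) *s v"
        have wL: "\<forall>l\<in>L. w $ l = 0" using less.prems(4) inv by (simp add: w_def)
        have "poly_apply M q w = 0"
          unfolding w_def poly_apply_combine poly_apply_matrix u_def[symmetric] Mu by simp
        then have decay: "exp_decay (egf (\<lambda>k. mpow M k w $ i))" for i
          using less.IH[OF dq q0 _ refl wL] by blast
        show ?thesis
        proof
          fix i
          define a where "a k = mpow M k v $ i" for k
          have a: "geom_bounded a" unfolding a_def by (rule mpow_geom_bounded)
          have "mpow M k w $ i = a (Suc k) + (- \<kappa>) * a k" for k
            unfolding w_def mpow_combine a_def by (simp add: funpow_swap1)
          then have "egf (\<lambda>k. mpow M k w $ i) t = egf (\<lambda>k. a (Suc k)) t + (- \<kappa>) * egf a t" for t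
            using egf_add[OF geom_bounded_shift[OF a] a, of "- \<kappa>" t] by simp
          then have "(egf a has_vector_derivative \<kappa> * egf a t + egf (\<lambda>k. mpow M k w $ i) t) (at t)" for t
            using egf_derivative[OF a, of t UNIV] by simp
          from exp_decay_ode[OF this decay re] show "exp_decay (egf (\<lambda>k. mpow M k v $ i))" by (simp add: a_def[abs_def])
        qed
      qed
    qed
  qed
  obtain p where "p \<noteq> 0" "poly_apply M p v = 0" using annihilating_poly_exists by blast
  then show ?thesis using claim[OF _ _ refl v] by blast
qed

section \<open>The phase space flow\<close>

lemma funpow_linear:
  fixes A :: "'a::real_vector \<Rightarrow> 'a"
  shows "linear A \<Longrightarrow> linear (A ^^ k)"
  by (induction k) (auto simp: linear_id[unfolded id_def] id_def intro: linear_compose)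

lemma lin_exp_summable:
  fixes A :: "'n::finite cspace \<Rightarrow> 'n cspace"
  assumes "linear A"
  shows "summable (\<lambda>k. (t ^ k / fact k) *\<^sub>R (A ^^ k) z)"
proof -
  obtain K where K: "K \<ge> 0" "\<And>k z. norm ((A ^^ k) z) \<le> K ^ k * norm z" using linear_iterate_growth[OF assms] by blast
  show ?thesis
  proof (rule summable_comparison_test'[OF summable_mult2[OF summable_exp[of "\<bar>t\<bar> * K"], of "norm z"], of 0])
    fix k
    have "norm ((t ^ k / fact k) *\<^sub>R (A ^^ k) z) = \<bar>t\<bar> ^ k / fact k * norm ((A ^^ k) z)" by (simp add: power_abs)
    also have "\<dots> \<le> \<bar>t\<bar> ^ k / fact k * (K ^ k * norm z)" by (intro mult_left_mono K(2)) simp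
    also have "\<dots> = inverse (fact k) * (\<bar>t\<bar> * K) ^ k * norm z" by (simp add: power_mult_distrib field_simps)
    finally show "norm ((t ^ k / fact k) *\<^sub>R (A ^^ k) z) \<le> inverse (fact k) * (\<bar>t\<bar> * K) ^ k * norm z" .
  qed
qed

lemma iterate_geom_bounded:
  fixes A :: "'n::finite cspace \<Rightarrow> 'n cspace"
  assumes "linear A"
  shows "geom_bounded (\<lambda>k. (A ^^ k) z $ i)"
proof -
  obtain K where K: "\<And>k z. norm ((A ^^ k) z) \<le> K ^ k * norm z" using linear_iterate_growth[OF assms] by blast
  have "cmod ((A ^^ k) z $ i) \<le> norm z * K ^ k" for k
    using order_trans[OF Finite_Cartesian_Product.norm_nth_le K[of k z]] by (simp add: mult.commute)
  then show ?thesis unfolding geom_bounded_def by blast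
qed

lemma lin_exp_component:
  fixes A :: "'n::finite cspace \<Rightarrow> 'n cspace"
  assumes "linear A"
  shows "lin_exp A t z $ i = egf (\<lambda>k. (A ^^ k) z $ i) t"
proof -
  have "lin_exp A t z $ i = (\<Sum>k. ((t ^ k / fact k) *\<^sub>R (A ^^ k) z) $ i)"
    unfolding lin_exp_def by (rule bounded_linear.suminf[OF bounded_linear_vec_nth lin_exp_summable[OF assms]])
  moreover have "((t ^ k / fact k) *\<^sub>R x) $ i = x $ i / fact k * complex_of_real t ^ k" for k and x :: "'n cspace"
    unfolding vector_scaleR_component by (simp add: scaleR_conv_of_real)
  ultimately show ?thesis unfolding egf_def by simp
qed

lemma lin_exp_add:
  fixes A :: "'n::finite cspace \<Rightarrow> 'n cspace"
  assumes "linear A"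
  shows "lin_exp A t (x + y) = lin_exp A t x + lin_exp A t y"
  unfolding lin_exp_def suminf_add[OF lin_exp_summable[OF assms] lin_exp_summable[OF assms]]
  by (simp add: linear_add[OF funpow_linear[OF assms]] scaleR_add_right)

lemma lin_exp_cong: "(\<And>k. (A ^^ k) z = (B ^^ k) z) \<Longrightarrow> lin_exp A t z = lin_exp B t z"
  by (simp add: lin_exp_def)

lemma lin_exp_kernel:
  fixes A :: "'n::finite cspace \<Rightarrow> 'n cspace"
  assumes "linear A" "A z = 0"
  shows "lin_exp A t z = z"
proof -
  have "(A ^^ Suc k) z = 0" for k by (induction k) (simp_all add: assms linear_0[OF assms(1)])
  then have "(A ^^ k) z = 0" if "k \<noteq> 0" for k using that by (metis not0_implies_Suc)
  then show ?thesis unfolding lin_exp_def by (subst suminf_finite[of "{0}"]) auto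
qed

lemma lin_exp_continuous:
  fixes A :: "'n::finite cspace \<Rightarrow> 'n cspace"
  assumes "linear A"
  shows "continuous_on S (\<lambda>t. lin_exp A t z)"
proof -
  have "continuous_on S (\<lambda>t. \<chi> i. lin_exp A t z $ i)"
    unfolding lin_exp_component[OF assms]
    by (intro continuous_on_vec_lambda egf_continuous iterate_geom_bounded assms)
  then show ?thesis by simp
qed

lemma lin_exp_adjoint:
  fixes A :: "'n::finite cspace \<Rightarrow> 'n cspace"
  assumes A: "linear A"
  shows "lin_exp (adjoint A) t x \<bullet> w = x \<bullet> lin_exp A t w"
proof -
  have "(adjoint A ^^ k) x \<bullet> w = x \<bullet> (A ^^ k) w" for k
  proof (induction k arbitrary: w)
    case (Suc k)
    have "(adjoint A ^^ Suc k) x \<bullet> w = (adjoint A ^^ k) x \<bullet> A w"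
      using adjoint_works[OF A, of w "(adjoint A ^^ k) x"] by (simp add: inner_commute)
    then show ?case using Suc by (simp add: funpow_swap1)
  qed simp
  then have e: "((t ^ k / fact k) *\<^sub>R (adjoint A ^^ k) x) \<bullet> w = x \<bullet> ((t ^ k / fact k) *\<^sub>R (A ^^ k) w)" for k by simp
  have "lin_exp (adjoint A) t x \<bullet> w = (\<Sum>k. ((t ^ k / fact k) *\<^sub>R (adjoint A ^^ k) x) \<bullet> w)"
    unfolding lin_exp_def by (rule bounded_linear.suminf[OF bounded_linear_inner_left lin_exp_summable[OF adjoint_linear[OF A]]])
  also have "\<dots> = x \<bullet> lin_exp A t w"
    unfolding e lin_exp_def by (rule bounded_linear.suminf[OF bounded_linear_inner_right lin_exp_summable[OF A], symmetric])
  finally show ?thesis .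
qed

lemma coord_proj_linear: "linear (coord_proj J)"
  by (rule linearI) (auto simp: coord_proj_def vec_eq_iff)

lemma compress_linear: "linear A \<Longrightarrow> linear (compress J A)"
  unfolding compress_def[abs_def]
  using linear_compose[OF linear_compose[OF coord_proj_linear[of J], of A] coord_proj_linear[of J]] by (simp add: o_def)

lemma compress_mem [simp]: "compress J A z \<in> coord_space J"
  by (simp add: compress_def)

lemma compress_compl: "linear A \<Longrightarrow> z \<in> coord_space (- J) \<Longrightarrow> compress J A z = 0"
  by (simp add: compress_def coord_proj_compl' linear_0 linear_0[OF coord_proj_linear])

lemma coord_space_iterate: "z \<in> coord_space J \<Longrightarrow> (compress J A ^^ k) z \<in> coord_space J"
  by (cases k) auto

lemma inner_coord_compl: "x \<in> coord_space J \<Longrightarrow> y \<in> coord_space (- J) \<Longrightarrow> x \<bullet> y = 0"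
  unfolding inner_vec_def by (rule sum.neutral) (auto simp: coord_space_def, metis inner_zero_left inner_zero_right)

section \<open>Real coordinates and complexification\<close>

lemma to_real_linear: "linear to_real" and of_real_vec_linear: "linear of_real_vec"
  by (rule linearI; simp add: to_real_def of_real_vec_def vec_eq_iff complex_eq_iff split: sum.split)+

lemma of_real_to_real [simp]: "of_real_vec (to_real z) = z"
  by (simp add: to_real_def of_real_vec_def vec_eq_iff)

lemma real_matrix_works:
  assumes "linear A"
  shows "real_matrix A *v to_real z = to_real (A z)"
proof -
  have "linear (to_real \<circ> A \<circ> of_real_vec)"
    by (intro linear_compose of_real_vec_linear to_real_linear assms)
  then show ?thesis unfolding real_matrix_def by (simp add: matrix_works)
qed

definition complexify :: "real ^ 'm \<Rightarrow> complex ^ 'm" where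
  "complexify x = (\<chi> l. complex_of_real (x $ l))"

lemma complexify_matrix: "complex_matrix R *v complexify x = complexify (R *v x)"
  by (simp add: complexify_def complex_matrix_def matrix_vector_mult_def vec_eq_iff)

text \<open>As \<open>A\<close> is only real linear, the flow is followed in the complexification of
  the real coordinates, where the spectrum is defined. A component of the flow is recovered from the
  coordinates \<open>Inl i\<close> and \<open>Inr i\<close> as real part plus \<open>\<i>\<close>
  times imaginary part.\<close>

lemma lin_exp_decay:
  fixes A :: "'n::finite cspace \<Rightarrow> 'n cspace"
  assumes A: "linear A" and spec: "\<forall>\<mu>\<in>spectrum_on J A. Re \<mu> < 0" and z: "z \<in> coord_space J"
  shows "exp_decay (\<lambda>t. lin_exp (compress J A) t z)"
proof -
  define B where "B = compress J A"
  have B: "linear B" unfolding B_def by (rule compress_linear[OF A])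
  define M where "M = complex_matrix (real_matrix B)"
  define L where "L = {l. case l of Inl i \<Rightarrow> i \<notin> J | Inr i \<Rightarrow> i \<notin> J}"
  have row: "real_matrix B $ l $ m = 0" if "l \<in> L" for l m
    using that compress_mem[of J A "of_real_vec (axis m 1)"]
    by (auto simp: real_matrix_def matrix_def to_real_def L_def B_def coord_space_def split: sum.splits)
  have inv: "(M *v x) $ l = 0" if "l \<in> L" for x l
    using row[OF that] by (simp add: M_def complex_matrix_def matrix_vector_mult_def)
  have sp: "Re \<mu> < 0" if "u \<noteq> 0" "\<forall>l\<in>L. u $ l = 0" "M *v u = \<mu> *s u" for \<mu> u
  proof -
    have "\<forall>i. i \<notin> J \<longrightarrow> u $ Inl i = 0 \<and> u $ Inr i = 0" using that(2) by (auto simp: L_def)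
    then have "\<mu> \<in> spectrum_on J A" using that unfolding spectrum_on_def M_def B_def by blast
    then show ?thesis using spec by blast
  qed
  define v where "v = complexify (to_real z)"
  have vL: "\<forall>l\<in>L. v $ l = 0"
    using z by (auto simp: v_def complexify_def to_real_def L_def coord_space_def split: sum.splits)
  have pow: "mpow M k v = complexify (to_real ((B ^^ k) z))" for k
    by (induction k) (simp_all add: v_def M_def complexify_matrix real_matrix_works[OF B])
  have comp: "exp_decay (\<lambda>t. lin_exp B t z $ i)" for i
  proof -
    have "(B ^^ k) z $ i = mpow M k v $ Inl i + \<i> * mpow M k v $ Inr i" for k
      unfolding pow by (simp add: complexify_def to_real_def complex_eq)
    then have "lin_exp B t z $ i = egf (\<lambda>k. mpow M k v $ Inl i) t + \<i> * egf (\<lambda>k. mpow M k v $ Inr i) t" for t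
      unfolding lin_exp_component[OF B] by (simp add: egf_add[OF mpow_geom_bounded mpow_geom_bounded])
    moreover have "exp_decay (\<lambda>t. \<i> * egf (\<lambda>k. mpow M k v $ Inr i) t)"
      by (rule exp_decay_dominated[OF matrix_exp_decay[OF inv sp vL], where K=1]) (auto simp: norm_mult)
    ultimately show ?thesis
      using exp_decay_add[OF matrix_exp_decay[OF inv sp vL]] by simp
  qed
  have "exp_decay (\<lambda>t. \<Sum>i\<in>UNIV. norm (lin_exp B t z $ i))"
    by (rule exp_decay_sum) (auto intro: exp_decay_dominated[OF comp, where K=1])
  then have "exp_decay (\<lambda>t. lin_exp B t z)"
  proof (rule exp_decay_dominated[where K=1])
    fix t
    have "norm (lin_exp B t z) \<le> (\<Sum>i\<in>UNIV. norm (lin_exp B t z $ i))"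
      unfolding norm_vec_def by (rule L2_set_le_sum) simp
    then show "norm (lin_exp B t z) \<le> 1 * norm (\<Sum>i\<in>UNIV. norm (lin_exp B t z $ i))" by simp
  qed simp
  then show ?thesis by (simp add: B_def)
qed

text \<open>The compressed map vanishes on the complementary modes, so its flow is the identity
  there and does not decay. The inner product with \<open>a\<close> does not see this part, which
  makes the decay estimates valid for arbitrary \<open>w\<close>.\<close>

lemma inner_lin_exp_proj:
  fixes A :: "'n::finite cspace \<Rightarrow> 'n cspace"
  assumes A: "linear A" and a: "a \<in> coord_space J"
  shows "a \<bullet> lin_exp (compress J A) t w = a \<bullet> lin_exp (compress J A) t (coord_proj J w)"
proof -
  note B = compress_linear[OF A, of J]
  have "lin_exp (compress J A) t (coord_proj (- J) w) = coord_proj (- J) w"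
    by (rule lin_exp_kernel[OF B]) (simp add: compress_compl[OF A])
  then have "lin_exp (compress J A) t w = lin_exp (compress J A) t (coord_proj J w) + coord_proj (- J) w"
    using lin_exp_add[OF B, of t "coord_proj J w" "coord_proj (- J) w"] by (simp add: coord_proj_sum)
  then show ?thesis using inner_coord_compl[OF a, of "coord_proj (- J) w"] by (simp add: inner_add_right)
qed

lemma inner_lin_exp_decay:
  fixes A :: "'n::finite cspace \<Rightarrow> 'n cspace" and a :: "real \<Rightarrow> 'n cspace"
  assumes A: "linear A" and spec: "\<forall>\<mu>\<in>spectrum_on J A. Re \<mu> < 0"
    and a: "\<And>t. a t \<in> coord_space J" "continuous_on {0..} a" "\<And>t. t \<ge> 0 \<Longrightarrow> norm (a t) \<le> K"
  shows "exp_decay (\<lambda>t. a t \<bullet> lin_exp (compress J A) t w)"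
    and "continuous_on {0..} (\<lambda>t. a t \<bullet> lin_exp (compress J A) t w)"
proof -
  have "norm (a t \<bullet> lin_exp (compress J A) t w) \<le> K * norm (lin_exp (compress J A) t (coord_proj J w))" if "t \<ge> 0" for t
  proof -
    have "norm (a t \<bullet> lin_exp (compress J A) t w) \<le> norm (a t) * norm (lin_exp (compress J A) t (coord_proj J w))"
      by (subst inner_lin_exp_proj[OF A a(1)]) (simp add: Cauchy_Schwarz_ineq2)
    also have "\<dots> \<le> K * norm (lin_exp (compress J A) t (coord_proj J w))"
      by (rule mult_right_mono[OF a(3)[OF that] norm_ge_zero])
    finally show ?thesis .
  qed
  moreover have "K \<ge> 0" using a(3)[of 0] norm_ge_zero[of "a 0"] by linarith
  ultimately show "exp_decay (\<lambda>t. a t \<bullet> lin_exp (compress J A) t w)"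
    by (rule exp_decay_dominated[OF lin_exp_decay[OF A spec coord_proj_mem]])
  show "continuous_on {0..} (\<lambda>t. a t \<bullet> lin_exp (compress J A) t w)"
    by (intro continuous_on_inner a(2) lin_exp_continuous compress_linear[OF A])
qed

text \<open>Reduces the vector integrals that define mean and covariance to scalar ones.
  Integrability is checked componentwise after the adjoint flow has been moved across the inner
  product, so that decay of the flow itself is what is used.\<close>

lemma integral_lin_exp_adjoint:
  fixes A :: "'n::finite cspace \<Rightarrow> 'n cspace" and a :: "real \<Rightarrow> 'n cspace"
  assumes A: "linear A" and spec: "\<forall>\<mu>\<in>spectrum_on J A. Re \<mu> < 0"
    and a: "\<And>t. a t \<in> coord_space J" "continuous_on {0..} a" "\<And>t. t \<ge> 0 \<Longrightarrow> norm (a t) \<le> K"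
  shows "integral {0..} (\<lambda>s. lin_exp (adjoint (compress J A)) s (a s)) \<bullet> w =
    integral {0..} (\<lambda>s. a s \<bullet> lin_exp (compress J A) s w)"
proof -
  note adj = lin_exp_adjoint[OF compress_linear[OF A, of J]]
  have "(\<lambda>s. lin_exp (adjoint (compress J A)) s (a s)) integrable_on {0..}"
    by (rule integrable_componentwise, unfold adj) (rule exp_decay_integrable(1)[OF inner_lin_exp_decay[OF assms]])
  then have "(\<lambda>s. lin_exp (adjoint (compress J A)) s (a s) \<bullet> w) integrable_on {0..} \<and>
    integral {0..} (\<lambda>s. lin_exp (adjoint (compress J A)) s (a s) \<bullet> w) = integral {0..} (\<lambda>s. lin_exp (adjoint (compress J A)) s (a s)) \<bullet> w"
    by (simp add: integral_component_eq integrable_component)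
  then show ?thesis unfolding adj by simp
qed

section \<open>The rotation block and the splitting of the flow\<close>

lemma sum_UNIV_Plus:
  "(\<Sum>l\<in>UNIV. f l) = (\<Sum>i\<in>UNIV. f (Inl i)) + (\<Sum>i\<in>UNIV. f (Inr i))" for f :: "'a::finite + 'b::finite \<Rightarrow> 'c::comm_monoid_add"
  using sum.Plus[of UNIV UNIV f] by (simp add: UNIV_Plus_UNIV o_def)

text \<open>On real and imaginary part the block acts by sending (x, y) to (- \<phi> y, \<phi> x),
  which is multiplication by \<open>\<i> * \<phi> i\<close> in each mode.\<close>

lemma rotation_block:
  assumes "to_real (Z z) = block_matrix 0 (- diag_matrix \<phi>) (diag_matrix \<phi>) 0 *v to_real z"
  shows "Z z $ i = \<i> * complex_of_real (\<phi> i) * z $ i"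
proof -
  have "to_real (Z z) $ Inl i = - \<phi> i * Im (z $ i)" "to_real (Z z) $ Inr i = \<phi> i * Re (z $ i)"
    unfolding assms matrix_vector_mult_def
    by (simp_all add: sum_UNIV_Plus block_matrix_def diag_matrix_def to_real_def if_distrib if_distribR sum.delta sum_negf cong: if_cong)
  then show ?thesis by (simp add: to_real_def complex_eq_iff)
qed

lemma lin_exp_rotation:
  fixes Z :: "'n::finite cspace \<Rightarrow> 'n cspace"
  assumes Z: "linear Z" and rot: "\<And>z i. z \<in> coord_space J \<Longrightarrow> Z z $ i = \<i> * complex_of_real (\<phi> i) * z $ i"
    and z: "z \<in> coord_space J"
  shows "lin_exp Z t z = rotate_modes J \<phi> t z"
proof -
  have "(Z ^^ k) z \<in> coord_space J \<and> (\<forall>i. (Z ^^ k) z $ i = (\<i> * complex_of_real (\<phi> i)) ^ k * z $ i)" for k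
  proof (induction k)
    case (Suc k)
    have "Z ((Z ^^ k) z) $ i = \<i> * complex_of_real (\<phi> i) * (Z ^^ k) z $ i" for i using Suc rot by blast
    then show ?case using Suc by (auto simp: coord_space_def mult.assoc)
  qed (use z in simp)
  then have p: "(Z ^^ k) z $ i = (\<i> * complex_of_real (\<phi> i)) ^ k * z $ i" for k i by blast
  have "lin_exp Z t z $ i = rotate_modes J \<phi> t z $ i" for i
  proof -
    define c where "c = \<i> * complex_of_real (\<phi> i) * complex_of_real t"
    have "(\<lambda>k. c ^ k / fact k) sums exp c"
      using exp_converges[of c] by (simp add: divide_inverse mult.commute scaleR_conv_of_real)
    then have "(\<lambda>k. c ^ k / fact k * z $ i) sums (exp c * z $ i)" by (rule sums_mult2)
    then have "egf (\<lambda>k. (\<i> * complex_of_real (\<phi> i)) ^ k * z $ i) t = exp c * z $ i"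
      unfolding egf_def by (simp add: sums_iff c_def power_mult_distrib mult_ac)
    then show ?thesis using z by (auto simp: lin_exp_component[OF Z] p rotate_modes_def c_def coord_space_def mult_ac)
  qed
  then show ?thesis by (simp add: vec_eq_iff)
qed

lemma lin_exp_compress:
  fixes Z :: "'n::finite cspace \<Rightarrow> 'n cspace"
  assumes Z: "linear Z" and split: "\<And>z. Z z = compress (- J) Z z + compress J Z z" and z: "z \<in> coord_space J"
  shows "lin_exp Z t z = lin_exp (compress J Z) t z"
proof (rule lin_exp_cong)
  show "(Z ^^ k) z = (compress J Z ^^ k) z" for k
  proof (induction k)
    case (Suc k)
    have "compress (- J) Z ((compress J Z ^^ k) z) = 0"
      by (rule compress_compl[OF Z]) (use coord_space_iterate[OF z] in simp)
    then show ?case using Suc split[of "(compress J Z ^^ k) z"] by simp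
  qed simp
qed

lemma tr_scale_op:
  assumes \<rho>: "\<rho> \<in> bounded_ops I" and x: "x \<in> bounded_ops I"
  shows "tr I (\<rho> \<circ> scale_op c x) = c * tr I (\<rho> \<circ> x)"
proof -
  have "(\<rho> \<circ> scale_op c x) (ket n) = (\<lambda>m. c * (\<rho> \<circ> x) (ket n) m)" if "n \<in> I" for n
    using blin_scale[of I I \<rho> "x (ket n)" c] \<rho> bounded_ops_mem[OF x ell2_ket[OF that]]
    by (simp add: bounded_ops_iff scale_op_def)
  then have "tr I (\<rho> \<circ> scale_op c x) = (\<Sum>\<^sub>\<infinity>n\<in>I. c * cip (ket n) ((\<rho> \<circ> x) (ket n)))"
    unfolding tr_def by (intro infsum_cong) simp
  then show ?thesis unfolding tr_def by (simp add: infsum_cmult_right')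
qed

lemma tr_weyl_continuous:
  fixes \<rho> :: "('n::finite \<Rightarrow> nat) oper"
  assumes \<rho>: "\<rho> \<in> density_ops UNIV"
  shows "continuous_on UNIV (\<lambda>z. tr UNIV (\<rho> \<circ> weyl UNIV z))" "tr UNIV (\<rho> \<circ> weyl UNIV 0) = 1"
proof -
  obtain v :: "nat \<Rightarrow> ('n \<Rightarrow> nat) vect" where v: "mixture UNIV v" "\<rho> = mix_op UNIV v" using density_mixture[OF \<rho>] by blast
  have b: "weyl UNIV z \<in> bounded_ops UNIV" for z :: "'n cspace" using weyl_bounded[of z UNIV] by simp
  have "coord_space UNIV = (UNIV :: 'n cspace set)" by (simp add: coord_space_def)
  then show "continuous_on UNIV (\<lambda>z. tr UNIV (\<rho> \<circ> weyl UNIV z))"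
    using mix_tr_weyl_continuous[of UNIV v] v by (simp add: tr_mix_op[OF v(1) b])
  have "weyl UNIV (0 :: 'n cspace) = id_op (occ UNIV)"
  proof (rule bounded_ops_eqI_exp_vecs[where J=UNIV])
    fix w :: "'n cspace"
    show "weyl UNIV 0 (exp_vec w) = id_op (occ UNIV) (exp_vec w)"
      unfolding id_op_apply[OF exp_vec_mem[OF coord_space_UNIV]] by (simp add: weyl_exp_vec weyl_exp_zero)
  qed (use b[of 0] in auto)
  moreover have "tr UNIV (\<rho> \<circ> id_op UNIV) = 1"
    using \<rho> by (simp add: tr_def density_ops_def id_op_apply infsumI)
  ultimately show "tr UNIV (\<rho> \<circ> weyl UNIV 0) = 1" by simp
qed

section \<open>Characteristic functions of invariant states\<close>

text \<open>Where \<open>\<phi> i = 0\<close> the quotient is \<open>0\<close>; there \<open>\<zeta> $ i\<close> vanishes, since \<open>\<zeta>\<close> is orthogonal to the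
  kernel of the rotation generator.\<close>

definition displacement :: "'n::finite set \<Rightarrow> ('n \<Rightarrow> real) \<Rightarrow> 'n cspace \<Rightarrow> 'n cspace" where
  "displacement J \<phi> \<zeta> = (\<chi> i. if i \<in> J then \<zeta> $ i / complex_of_real (2 * \<phi> i) else 0)"

lemma displacement_mem: "displacement J \<phi> \<zeta> \<in> coord_space J"
  by (simp add: displacement_def coord_space_def)

text \<open>Twice the imaginary part of the product of the displacement with the rotated point is an
  antiderivative of the drift: differentiation brings down \<open>2 * \<phi> i\<close>, which
  cancels the denominator in \<open>displacement\<close>. Modes with \<open>\<phi> i = 0\<close>
  contribute nothing to either side.\<close>

lemma rotation_integral:
  fixes \<zeta> :: "'n::finite cspace"
  assumes zero: "\<And>i. i \<in> J \<Longrightarrow> \<phi> i = 0 \<Longrightarrow> \<zeta> $ i = 0" and z: "z \<in> coord_space J" and t: "t \<ge> 0"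
  shows "integral {0..t} (\<lambda>s. \<zeta> \<bullet> rotate_modes J \<phi> s z) =
    2 * Im (hprod (displacement J \<phi> \<zeta>) (rotate_modes J \<phi> t z)) - 2 * Im (hprod (displacement J \<phi> \<zeta>) z)"
proof -
  define u where "u = displacement J \<phi> \<zeta>"
  have dr: "((\<lambda>s. rotate_modes J \<phi> s z $ i) has_vector_derivative \<i> * complex_of_real (\<phi> i) * rotate_modes J \<phi> s z $ i) (at s within S)" for i s S
  proof (cases "i \<in> J")
    case True
    have "((\<lambda>x. exp (\<i> * (x * complex_of_real (\<phi> i))) * z $ i) has_field_derivative
        \<i> * complex_of_real (\<phi> i) * (exp (\<i> * (complex_of_real s * complex_of_real (\<phi> i))) * z $ i)) (at (complex_of_real s))"
      by (auto intro!: derivative_eq_intros)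
    from has_vector_derivative_real_field[OF this] show ?thesis using True by (simp add: rotate_modes_def)
  qed (simp add: rotate_modes_def)
  have dh: "((\<lambda>s. hprod u (rotate_modes J \<phi> s z)) has_vector_derivative
      (\<Sum>i\<in>UNIV. cnj (u $ i) * (\<i> * complex_of_real (\<phi> i) * rotate_modes J \<phi> s z $ i))) (at s within S)" for s S
    unfolding hprod_def by (intro has_vector_derivative_sum has_vector_derivative_mult_right dr)
  have inner: "2 * Im (\<Sum>i\<in>UNIV. cnj (u $ i) * (\<i> * complex_of_real (\<phi> i) * w $ i)) = \<zeta> \<bullet> w" if w: "w \<in> coord_space J" for w
    unfolding inner_vec_def Im_sum sum_distrib_left
  proof (rule sum.cong[OF refl])
    fix i
    show "2 * Im (cnj (u $ i) * (\<i> * complex_of_real (\<phi> i) * w $ i)) = \<zeta> $ i \<bullet> w $ i"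
    proof (cases "i \<in> J")
      case False then show ?thesis using w by (simp add: u_def displacement_def coord_space_def)
    next
      case True
      show ?thesis
      proof (cases "\<phi> i = 0")
        case True with \<open>i \<in> J\<close> show ?thesis using zero by simp
      next
        case False
        then have "2 * (cnj (u $ i) * (\<i> * complex_of_real (\<phi> i) * w $ i)) = \<i> * (cnj (\<zeta> $ i) * w $ i)"
          using \<open>i \<in> J\<close> by (simp add: u_def displacement_def)
        from arg_cong[OF this, of Im] show ?thesis by (simp add: inner_complex_def)
      qed
    qed
  qed
  have "((\<lambda>s. 2 * Im (hprod u (rotate_modes J \<phi> s z))) has_vector_derivative \<zeta> \<bullet> rotate_modes J \<phi> s z) (at s within {0..t})" for s
    unfolding inner[OF rotate_modes_mem, symmetric]
    by (intro has_vector_derivative_mult_right bounded_linear.has_vector_derivative[OF bounded_linear_Im] dh)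
  then have "((\<lambda>s. \<zeta> \<bullet> rotate_modes J \<phi> s z) has_integral
      2 * Im (hprod u (rotate_modes J \<phi> t z)) - 2 * Im (hprod u (rotate_modes J \<phi> 0 z))) {0..t}"
    by (intro fundamental_theorem_of_calculus t)
  then show ?thesis by (simp add: integral_unique rotate_modes_zero[OF z] u_def)
qed

text \<open>A Weyl operator evolves into a multiple of another one, so invariance becomes a
  functional equation for the characteristic function. The first conclusion is this equation on the
  rotating modes, the second its limit for large times, the third the second at
  \<open>z = 0\<close>.\<close>

lemma invariant_state_char:
  fixes T :: "'n::finite semigroup" and J :: "'n set"
  defines "\<gamma> \<equiv> \<lambda>Z C \<zeta> w. exp (- complex_of_real (integral {0..} (\<lambda>s. lin_exp (compress (- J) Z) s w \<bullet> C (lin_exp (compress (- J) Z) s w)) / 2)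
      + \<i> * complex_of_real (integral {0..} (\<lambda>s. coord_proj (- J) \<zeta> \<bullet> lin_exp (compress (- J) Z) s w)))"
  assumes G: "gaussian_qms T Z C \<zeta>"
    and Zs: "\<And>z. Z z = compress J Z z + compress (- J) Z z"
    and Cs: "\<And>z. C z = compress (- J) C z"
    and rot: "\<And>z. z \<in> coord_space J \<Longrightarrow> to_real (Z z) = block_matrix 0 (- diag_matrix \<phi>) (diag_matrix \<phi>) 0 *v to_real z"
    and spec: "\<forall>\<mu>\<in>spectrum_on (- J) Z. Re \<mu> < 0"
    and ker: "\<And>z. z \<in> coord_space J \<Longrightarrow> Z z = 0 \<Longrightarrow> coord_proj J \<zeta> \<bullet> z = 0"
    and inv: "normal_invariant_state UNIV T \<rho>"
  defines "\<chi>' \<equiv> \<lambda>z. tr UNIV (\<rho> \<circ> weyl UNIV z)"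
    and "u \<equiv> displacement J \<phi> \<zeta>"
  shows "\<And>z t. z \<in> coord_space J \<Longrightarrow>
      exp (2 * \<i> * complex_of_real (Im (hprod u (rotate_modes J \<phi> t z)))) * \<chi>' (rotate_modes J \<phi> t z) =
      exp (2 * \<i> * complex_of_real (Im (hprod u z))) * \<chi>' z"
    and "\<And>z w. z \<in> coord_space J \<Longrightarrow> w \<in> coord_space (- J) \<Longrightarrow> \<chi>' (z + w) = \<chi>' z * \<gamma> Z C \<zeta> w"
    and "\<And>w. w \<in> coord_space (- J) \<Longrightarrow> \<chi>' w = \<gamma> Z C \<zeta> w"
proof -
  have qms: "qms (occ UNIV) T" and Z: "linear Z" and C: "linear C"
    and TW: "\<And>t z. t \<ge> 0 \<Longrightarrow> T t (weyl UNIV z) =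
        scale_op (exp (- complex_of_real (integral {0..t} (\<lambda>s. lin_exp Z s z \<bullet> C (lin_exp Z s z)) / 2)
             + \<i> * complex_of_real (integral {0..t} (\<lambda>s. \<zeta> \<bullet> lin_exp Z s z)))) (weyl UNIV (lin_exp Z t z))"
    using G unfolding gaussian_qms_def by blast+
  have \<rho>: "\<rho> \<in> density_ops UNIV" using inv by (simp add: normal_invariant_state_def)
  define B where "B = compress (- J) Z"
  have B: "linear B" unfolding B_def by (rule compress_linear[OF Z])
  have wb: "weyl UNIV z \<in> bounded_ops UNIV" for z :: "'n cspace" using weyl_bounded[of z UNIV] by simp
  have rot': "Z z $ i = \<i> * complex_of_real (\<phi> i) * z $ i" if "z \<in> coord_space J" for z i
    using rotation_block[of Z z \<phi> i] rot[OF that] by simp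
  have z0: "lin_exp Z t z = rotate_modes J \<phi> t z" if "z \<in> coord_space J" for t z
    by (rule lin_exp_rotation[OF Z rot' that])
  have z1: "lin_exp Z t w = lin_exp B t w" if "w \<in> coord_space (- J)" for t w
    unfolding B_def by (rule lin_exp_compress[OF Z _ that]) (use Zs in simp)
  have Bm: "lin_exp B t w \<in> coord_space (- J)" if w: "w \<in> coord_space (- J)" for t w
  proof -
    have "lin_exp B t w $ i = 0" if "i \<notin> - J" for i
    proof -
      have "(B ^^ k) w $ i = 0" for k
        using coord_space_iterate[OF w, where A=Z and k=k] that by (simp add: B_def coord_space_def)
      then show ?thesis unfolding lin_exp_component[OF B] by (simp add: egf_def)
    qed
    then show ?thesis by (simp add: coord_space_def)
  qed
  \<comment> \<open>The kernel condition is tested on the vector whose single component is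
    \<open>\<zeta> $ i\<close>; the rotation generator kills it when
    \<open>\<phi> i = 0\<close>.\<close>
  have zero: "\<zeta> $ i = 0" if i: "i \<in> J" "\<phi> i = 0" for i
  proof -
    define x where "x = (axis i (\<zeta> $ i) :: 'n cspace)"
    have x: "x \<in> coord_space J" using i by (auto simp: x_def coord_space_def axis_def)
    have "Z x = 0" using rot'[OF x] i by (auto simp: vec_eq_iff x_def axis_def)
    then have "coord_proj J \<zeta> \<bullet> x = 0" using ker[OF x] by simp
    moreover have "coord_proj J \<zeta> \<bullet> x = \<zeta> $ i \<bullet> \<zeta> $ i"
      using i by (simp add: x_def inner_axis coord_proj_def)
    ultimately show ?thesis by simp
  qed
  define a where "a w s = lin_exp B s w \<bullet> C (lin_exp B s w)" for w s
  define b where "b w s = coord_proj (- J) \<zeta> \<bullet> lin_exp B s w" for w s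
  \<comment> \<open>The phase that turns the exponential of the drift integral along the rotation
    into a quotient of its values at the two ends.\<close>
  define \<eta> where "\<eta> z = exp (2 * \<i> * complex_of_real (Im (hprod u z)))" for z
  \<comment> \<open>Cross terms between the two groups of modes vanish: \<open>C\<close> kills the
    rotating modes and maps into the others, and the two coordinate spaces are orthogonal.\<close>
  have flow: "\<chi>' (z + w) * \<eta> z = exp (- complex_of_real (integral {0..t} (a w) / 2) + \<i> * complex_of_real (integral {0..t} (b w))) *
      (\<eta> (rotate_modes J \<phi> t z) * \<chi>' (rotate_modes J \<phi> t z + lin_exp B t w))"
    if z: "z \<in> coord_space J" and w: "w \<in> coord_space (- J)" and t: "t \<ge> 0" for z w t
  proof -
    have e: "lin_exp Z s (z + w) = rotate_modes J \<phi> s z + lin_exp B s w" for s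
      by (simp add: lin_exp_add[OF Z] z0[OF z] z1[OF w])
    have ra: "lin_exp Z s (z + w) \<bullet> C (lin_exp Z s (z + w)) = a w s" for s
    proof -
      have "C (rotate_modes J \<phi> s z) = 0"
        using Cs compress_compl[OF C, of "rotate_modes J \<phi> s z" "- J"] rotate_modes_mem[of J \<phi> s z] by simp
      then have "C (lin_exp Z s (z + w)) = C (lin_exp B s w)" unfolding e by (simp add: linear_add[OF C])
      moreover have "C (lin_exp B s w) \<in> coord_space (- J)" using Cs compress_mem by metis
      ultimately show ?thesis unfolding e a_def
        using inner_coord_compl[OF rotate_modes_mem[of J \<phi> s z]] by (simp add: inner_add_left)
    qed
    have rb: "\<zeta> \<bullet> lin_exp Z s (z + w) = \<zeta> \<bullet> rotate_modes J \<phi> s z + b w s" for s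
    proof -
      have "coord_proj J \<zeta> \<bullet> lin_exp B s w = 0" by (rule inner_coord_compl[OF coord_proj_mem Bm[OF w]])
      then have "\<zeta> \<bullet> lin_exp B s w = b w s"
        unfolding b_def using coord_proj_sum[of J \<zeta>] inner_add_left[of "coord_proj J \<zeta>" "coord_proj (- J) \<zeta>" "lin_exp B s w"] by simp
      then show ?thesis unfolding e by (simp add: inner_add_right)
    qed
    have cb: "continuous_on {0..t} (b w)" unfolding b_def[abs_def] by (intro continuous_intros lin_exp_continuous B)
    have cr: "continuous_on {0..t} (\<lambda>s. \<zeta> \<bullet> rotate_modes J \<phi> s z)"
      unfolding z0[OF z, symmetric] by (intro continuous_intros lin_exp_continuous Z)
    have ib: "integral {0..t} (\<lambda>s. \<zeta> \<bullet> rotate_modes J \<phi> s z + b w s) =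
        2 * Im (hprod u (rotate_modes J \<phi> t z)) - 2 * Im (hprod u z) + integral {0..t} (b w)"
      using Henstock_Kurzweil_Integration.integral_add[OF integrable_continuous_interval[OF cr] integrable_continuous_interval[OF cb]]
        rotation_integral[OF zero z t] by (simp add: u_def)
    have "\<chi>' (z + w) = tr UNIV (\<rho> \<circ> T t (weyl UNIV (z + w)))"
      using inv t wb unfolding normal_invariant_state_def \<chi>'_def by simp
    also have "\<dots> = exp (- complex_of_real (integral {0..t} (a w) / 2) + \<i> * complex_of_real (2 * Im (hprod u (rotate_modes J \<phi> t z)) - 2 * Im (hprod u z) + integral {0..t} (b w)))
        * \<chi>' (rotate_modes J \<phi> t z + lin_exp B t w)"
      unfolding TW[OF t] ra rb ib unfolding e \<chi>'_def
      by (rule tr_scale_op[OF _ wb]) (use \<rho> in \<open>simp add: density_ops_def\<close>)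
    also have "- complex_of_real (integral {0..t} (a w) / 2) + \<i> * complex_of_real (2 * Im (hprod u (rotate_modes J \<phi> t z)) - 2 * Im (hprod u z) + integral {0..t} (b w))
      = (- complex_of_real (integral {0..t} (a w) / 2) + \<i> * complex_of_real (integral {0..t} (b w))) +
        (2 * \<i> * complex_of_real (Im (hprod u (rotate_modes J \<phi> t z))) + - (2 * \<i> * complex_of_real (Im (hprod u z))))"
      by (simp add: algebra_simps)
    finally have "\<chi>' (z + w) = exp (- complex_of_real (integral {0..t} (a w) / 2) + \<i> * complex_of_real (integral {0..t} (b w))) *
        (\<eta> (rotate_modes J \<phi> t z) * inverse (\<eta> z)) * \<chi>' (rotate_modes J \<phi> t z + lin_exp B t w)"
      unfolding exp_add exp_minus \<eta>_def .
    moreover have "\<eta> z \<noteq> 0" by (simp add: \<eta>_def)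
    ultimately show ?thesis by simp
  qed
  have B0: "lin_exp B t 0 = 0" for t by (rule lin_exp_kernel[OF B linear_0[OF B]])
  have stat: "\<eta> (rotate_modes J \<phi> t z) * \<chi>' (rotate_modes J \<phi> t z) = \<eta> z * \<chi>' z"
    if z: "z \<in> coord_space J" and t: "t \<ge> 0" for z t
  proof -
    have "a 0 = (\<lambda>s. 0)" "b 0 = (\<lambda>s. 0)" by (auto simp: a_def b_def B0)
    then show ?thesis using flow[OF z _ t, of 0] by (simp add: B0 mult.commute)
  qed
  \<comment> \<open>For negative \<open>t\<close> the identity at time \<open>- t\<close> is applied
    to the rotated point.\<close>
  have phase: "\<eta> (rotate_modes J \<phi> t z) * \<chi>' (rotate_modes J \<phi> t z) = \<eta> z * \<chi>' z"
    if z: "z \<in> coord_space J" for z t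
  proof (cases "t \<ge> 0")
    case True then show ?thesis by (rule stat[OF z])
  next
    case False
    then show ?thesis
      using stat[OF rotate_modes_mem, of "- t" \<phi> t z] by (simp add: rotate_modes_add_time rotate_modes_zero[OF z])
  qed
  then show "\<And>z t. z \<in> coord_space J \<Longrightarrow>
      exp (2 * \<i> * complex_of_real (Im (hprod u (rotate_modes J \<phi> t z)))) * \<chi>' (rotate_modes J \<phi> t z) =
      exp (2 * \<i> * complex_of_real (Im (hprod u z))) * \<chi>' z"
    by (simp add: \<eta>_def)
  have fact: "\<chi>' (z + w) = \<chi>' z * \<gamma> Z C \<zeta> w" if z: "z \<in> coord_space J" and w: "w \<in> coord_space (- J)" for z w
  proof -
    have dec: "exp_decay (\<lambda>t. lin_exp B t w)" unfolding B_def by (rule lin_exp_decay[OF Z spec w])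
    obtain K where K: "\<And>t. t \<ge> 0 \<Longrightarrow> norm (lin_exp B t w) \<le> K" using exp_decay_bounded[OF dec] by blast
    have Cm: "C x \<in> coord_space (- J)" for x using Cs compress_mem by metis
    obtain M where M: "M > 0" "\<And>x. norm (C x) \<le> M * norm x" using linear_bounded_pos[OF C] by blast
    have a': "a w s = C (lin_exp B s w) \<bullet> lin_exp B s w" for s by (simp add: a_def inner_commute)
    have CK: "norm (C (lin_exp B t w)) \<le> M * K" if "t \<ge> 0" for t
      using M(2)[of "lin_exp B t w"] mult_left_mono[OF K[OF that], of M] M(1) by linarith
    have Cc: "continuous_on {0..} (\<lambda>t. C (lin_exp B t w))"
      by (rule continuous_on_compose2[OF linear_continuous_on[OF linear_conv_bounded_linear[THEN iffD1, OF C]] lin_exp_continuous[OF B]]) auto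
    have ia: "((\<lambda>t. integral {0..t} (a w)) \<longlongrightarrow> integral {0..} (a w)) at_top"
      using exp_decay_integrable(2)[OF inner_lin_exp_decay[OF Z spec, of "\<lambda>s. C (lin_exp B s w)" "M * K" w]] Cm Cc CK
      by (simp add: a'[abs_def] B_def)
    have ib: "((\<lambda>t. integral {0..t} (b w)) \<longlongrightarrow> integral {0..} (b w)) at_top"
      unfolding b_def[abs_def] B_def
      by (rule exp_decay_integrable(2)[OF inner_lin_exp_decay[OF Z spec, where K="norm (coord_proj (- J) \<zeta>)"]]) auto
    have "((\<lambda>t. exp (- complex_of_real (integral {0..t} (a w) / 2) + \<i> * complex_of_real (integral {0..t} (b w)))) \<longlongrightarrow>
        exp (- complex_of_real (integral {0..} (a w) / 2) + \<i> * complex_of_real (integral {0..} (b w)))) at_top"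
      by (intro tendsto_intros ia ib) simp
    then have g: "((\<lambda>t. exp (- complex_of_real (integral {0..t} (a w) / 2) + \<i> * complex_of_real (integral {0..t} (b w)))) \<longlongrightarrow> \<gamma> Z C \<zeta> w) at_top"
      by (simp add: \<gamma>_def a_def[abs_def] b_def[abs_def] B_def)
    \<comment> \<open>The rotated point keeps the norm of \<open>z\<close> but need not converge.
      Both arguments stay in one compact ball, where a small \<open>lin_exp B t w\<close> changes
      the value by little, uniformly in the rotated point.\<close>
    have "uniformly_continuous_on (cball 0 (norm z + K)) \<chi>'"
      unfolding \<chi>'_def by (intro compact_uniformly_continuous continuous_on_subset[OF tr_weyl_continuous(1)[OF \<rho>]]) auto
    then have lim: "((\<lambda>t. \<chi>' (rotate_modes J \<phi> t z + lin_exp B t w) - \<chi>' (rotate_modes J \<phi> t z)) \<longlongrightarrow> 0) at_top"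
    proof -
      assume uc: "uniformly_continuous_on (cball 0 (norm z + K)) \<chi>'"
      have K0: "K \<ge> 0" using K[of 0] norm_ge_zero[of "lin_exp B 0 w"] by linarith
      show ?thesis
      proof (rule tendstoI)
        fix e :: real assume "e > 0"
        then obtain d where d: "d > 0" "\<And>x y. x \<in> cball 0 (norm z + K) \<Longrightarrow> y \<in> cball 0 (norm z + K) \<Longrightarrow> dist y x < d \<Longrightarrow> dist (\<chi>' y) (\<chi>' x) < e"
          using uc unfolding uniformly_continuous_on_def by metis
        have "\<forall>\<^sub>F t in at_top. dist (lin_exp B t w) 0 < d" by (rule tendstoD[OF exp_decay_tendsto[OF dec] d(1)])
        moreover have "\<forall>\<^sub>F t in at_top. (0::real) \<le> t" by (rule eventually_ge_at_top)
        ultimately show "\<forall>\<^sub>F t in at_top. dist (\<chi>' (rotate_modes J \<phi> t z + lin_exp B t w) - \<chi>' (rotate_modes J \<phi> t z)) 0 < e"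
        proof eventually_elim
          case (elim t)
          have "dist (\<chi>' (rotate_modes J \<phi> t z + lin_exp B t w)) (\<chi>' (rotate_modes J \<phi> t z)) < e"
          proof (rule d(2))
            show "rotate_modes J \<phi> t z \<in> cball 0 (norm z + K)" using K0 by (simp add: rotate_modes_norm[OF z])
            show "rotate_modes J \<phi> t z + lin_exp B t w \<in> cball 0 (norm z + K)"
              using K[OF elim(2)] norm_triangle_ineq[of "rotate_modes J \<phi> t z" "lin_exp B t w"] by (simp add: rotate_modes_norm[OF z])
            show "dist (rotate_modes J \<phi> t z + lin_exp B t w) (rotate_modes J \<phi> t z) < d" using elim(1) by (simp add: dist_norm)
          qed
          then show ?case by (simp add: dist_norm)
        qed
      qed
    qed
    have eta1: "norm (\<eta> x) = 1" for x
      unfolding \<eta>_def using norm_exp_i_times[of "2 * Im (hprod u x)"] by (simp add: mult.left_commute mult.assoc)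
    have "((\<lambda>t. \<eta> (rotate_modes J \<phi> t z) * (\<chi>' (rotate_modes J \<phi> t z + lin_exp B t w) - \<chi>' (rotate_modes J \<phi> t z))) \<longlongrightarrow> 0) at_top"
      by (rule Lim_null_comparison[OF _ tendsto_norm_zero[OF lim]]) (simp add: norm_mult eta1)
    \<comment> \<open>By \<open>phase\<close> the subtracted product is constant in time, so the
      remaining product has a limit although its two factors need not have one.\<close>
    moreover have "\<eta> (rotate_modes J \<phi> t z) * (\<chi>' (rotate_modes J \<phi> t z + lin_exp B t w) - \<chi>' (rotate_modes J \<phi> t z)) + \<eta> z * \<chi>' z =
        \<eta> (rotate_modes J \<phi> t z) * \<chi>' (rotate_modes J \<phi> t z + lin_exp B t w)" for t
      by (simp only: right_diff_distrib phase[OF z] diff_add_cancel)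
    ultimately
    have "((\<lambda>t. \<eta> (rotate_modes J \<phi> t z) * \<chi>' (rotate_modes J \<phi> t z + lin_exp B t w)) \<longlongrightarrow> \<eta> z * \<chi>' z) at_top"
      using tendsto_add[OF _ tendsto_const[of "\<eta> z * \<chi>' z"], of _ 0 at_top] by fastforce
    note lim_flow = tendsto_mult[OF g this]
    have "\<forall>\<^sub>F t in at_top. exp (- complex_of_real (integral {0..t} (a w) / 2) + \<i> * complex_of_real (integral {0..t} (b w))) *
      (\<eta> (rotate_modes J \<phi> t z) * \<chi>' (rotate_modes J \<phi> t z + lin_exp B t w)) = \<chi>' (z + w) * \<eta> z"
      using eventually_ge_at_top[of "0::real"] by eventually_elim (rule flow[OF z w, symmetric])
    from Lim_transform_eventually[OF lim_flow this]
    have "((\<lambda>t::real. \<chi>' (z + w) * \<eta> z) \<longlongrightarrow> \<gamma> Z C \<zeta> w * (\<eta> z * \<chi>' z)) at_top" .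
    then have "\<chi>' (z + w) * \<eta> z = \<gamma> Z C \<zeta> w * (\<eta> z * \<chi>' z)"
      by (simp add: tendsto_const_iff)
    moreover have "\<eta> z \<noteq> 0" by (simp add: \<eta>_def)
    ultimately show ?thesis by (simp add: mult_ac)
  qed
  then show "\<And>z w. z \<in> coord_space J \<Longrightarrow> w \<in> coord_space (- J) \<Longrightarrow> \<chi>' (z + w) = \<chi>' z * \<gamma> Z C \<zeta> w" .
  show "\<chi>' w = \<gamma> Z C \<zeta> w" if "w \<in> coord_space (- J)" for w
    using fact[of 0 w] that tr_weyl_continuous(2)[OF \<rho>] by (simp add: \<chi>'_def)
qed

text \<open>Conjugating a Weyl operator uses the commutation relations twice, so the phase of
  \<open>u\<close> appears doubled; this is the origin of the factor 2 in
  \<open>displacement\<close>. The state \<omega> is \<sigma> moved by \<open>weyl J u\<close>,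
  which conjugation with the adjoint on the left undoes.\<close>

lemma weyl_conj_density:
  fixes \<sigma> :: "('n::finite \<Rightarrow> nat) oper"
  assumes \<sigma>: "\<sigma> \<in> density_ops (occ J)" and u: "u \<in> coord_space J"
  shows "\<exists>\<omega>\<in>density_ops (occ J). adj_op (occ J) (weyl J u) \<circ> \<omega> \<circ> weyl J u = \<sigma> \<and>
    (\<forall>z\<in>coord_space J. tr (occ J) (\<omega> \<circ> weyl J z) =
      exp (2 * \<i> * complex_of_real (Im (hprod u z))) * tr (occ J) (\<sigma> \<circ> weyl J z))"
proof -
  obtain v :: "nat \<Rightarrow> ('n \<Rightarrow> nat) vect" where v: "mixture (occ J) v" "\<sigma> = mix_op (occ J) v" using density_mixture[OF \<sigma>] by blast
  define W where "W = weyl J u"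
  have W: "W \<in> unitary_ops (occ J)" unfolding W_def by (rule weyl_unitary[OF u])
  note m = unitary_mixture[OF W v(1)]
  define \<omega> where "\<omega> = mix_op (occ J) (\<lambda>k. W (v k))"
  have \<omega>: "\<omega> \<in> density_ops (occ J)" unfolding \<omega>_def by (rule mix_op_density[OF m(1)])
  have \<sigma>b: "\<sigma> \<in> bounded_ops (occ J)" using \<sigma> by (simp add: density_ops_def)
  note Wb = unitary_ops_bounded[OF W]
  have "adj_op (occ J) W \<circ> \<omega> \<circ> W = \<sigma>"
  proof (rule bounded_ops_eqI)
    show "adj_op (occ J) W \<circ> \<omega> \<circ> W \<in> bounded_ops (occ J)"
      using \<omega> by (intro bounded_ops_comp adj_op_bounded Wb) (simp add: density_ops_def)
    fix \<psi> assume \<psi>: "\<psi> \<in> ell2 (occ J)"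
    show "(adj_op (occ J) W \<circ> \<omega> \<circ> W) \<psi> = \<sigma> \<psi>"
      unfolding \<omega>_def m(2) v(2)[symmetric]
      using unitary_ops_inverse(2)[OF W \<psi>] unitary_ops_inverse(2)[OF W bounded_ops_mem[OF \<sigma>b \<psi>]] by simp
  qed (rule \<sigma>b)
  moreover have "tr (occ J) (\<omega> \<circ> weyl J z) =
      exp (2 * \<i> * complex_of_real (Im (hprod u z))) * tr (occ J) (\<sigma> \<circ> weyl J z)"
    if z: "z \<in> coord_space J" for z
  proof -
    define c where "c = exp (2 * \<i> * complex_of_real (Im (hprod u z)))"
    have mu: "- u \<in> coord_space J" and zu: "z + u \<in> coord_space J" using u z by auto
    have conj: "adj_op (occ J) W (weyl J z (W \<psi>)) = (\<lambda>n. c * weyl J z \<psi> n)" if \<psi>: "\<psi> \<in> ell2 (occ J)" for \<psi>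
    proof -
      have "adj_op (occ J) W (weyl J z (W \<psi>)) = (\<lambda>n. exp (- \<i> * complex_of_real (Im (hprod z u))) *
          (exp (- \<i> * complex_of_real (Im (hprod (- u) (z + u)))) * weyl J (- u + (z + u)) \<psi> n))"
        unfolding W_def weyl_adj[OF u] weyl_comp[OF z u \<psi>]
          blin_scale[OF weyl_blin[OF mu] blin_mem[OF weyl_blin[OF zu] \<psi>]] weyl_comp[OF mu zu \<psi>] ..
      also have "\<dots> = (\<lambda>n. c * weyl J z \<psi> n)"
      proof -
        have "Im (hprod z u) = - Im (hprod u z)" using arg_cong[OF hprod_cnj[of z u], of Im] by simp
        moreover have "Im (hprod u u) = 0" by (simp add: hprod_self)
        ultimately have "exp (- \<i> * complex_of_real (Im (hprod z u))) * exp (- \<i> * complex_of_real (Im (hprod (- u) (z + u)))) = c"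
          unfolding c_def exp_add[symmetric] by (simp add: hprod_minus_left hprod_add_right mult.assoc)
        then show ?thesis by (simp add: mult.assoc[symmetric])
      qed
      finally show ?thesis .
    qed
    have "tr (occ J) (\<omega> \<circ> weyl J z) = mix_tr v (\<lambda>\<psi>. adj_op (occ J) W (weyl J z (W \<psi>)))"
      unfolding \<omega>_def tr_mix_op[OF m(1) weyl_bounded[OF z]] by (rule m(3)[OF weyl_blin[OF z]])
    also have "\<dots> = c * mix_tr v (weyl J z)"
      unfolding mix_tr_def conj[OF mixture_mem[OF v(1)]] cip_scale_right by (rule infsum_cmult_right')
    finally show ?thesis unfolding v(2) tr_mix_op[OF v(1) weyl_bounded[OF z]] c_def .
  qed
  ultimately show ?thesis using \<omega> unfolding W_def by blast
qed

theorem theorem13: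
  fixes T T' :: "'n::{finite,linorder} semigroup"
    and Z C Z' C' :: "'n cspace \<Rightarrow> 'n cspace"
    and \<zeta> \<zeta>' :: "'n cspace"
    and d0 :: nat
    and \<phi> :: "'n \<Rightarrow> real"
  assumes gaussian: "gaussian_qms T Z C \<zeta>"
    and invariant: "\<exists>\<rho>. normal_invariant_state (occ UNIV) T \<rho>"
    and representative: "T' \<in> conj_class T"
    and normal_form: "normal_form T' d0 \<phi> Z' C' \<zeta>'"
  defines "J0 \<equiv> first_modes d0"
    and "J1 \<equiv> - first_modes d0"
  defines "Zm \<equiv> compress J1 Z'"
    and "Cm \<equiv> compress J1 C'"
    and "\<zeta>m \<equiv> coord_proj J1 \<zeta>'"
  defines "m_inf \<equiv> - integral {0..} (\<lambda>s. lin_exp (adjoint Zm) s \<zeta>m)"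
    and "\<Sigma>_inf \<equiv> (\<lambda>z. integral {0..} (\<lambda>s. lin_exp (adjoint Zm) s (Cm (lin_exp Zm s z))))"
  shows "\<exists>u\<in>coord_space J0. \<exists>\<rho>_inf.
           gaussian_state J1 m_inf \<Sigma>_inf \<rho>_inf \<and>
           (\<forall>\<rho>. normal_invariant_state (occ UNIV) T' \<rho> \<longrightarrow>
              (\<exists>\<omega>\<in>density_ops (occ J0).
                 commutes_with (occ J0) \<omega> (hamiltonian J0 \<phi>) \<and>
                 \<rho> = tensor_op J0 (adj_op (occ J0) (weyl J0 u) \<circ> \<omega> \<circ> weyl J0 u) \<rho>_inf))"
proof -
  have J1: "J1 = - J0" by (simp add: J0_def J1_def)
  have G: "gaussian_qms T' Z' C' \<zeta>'"
    and Zs: "\<And>z. Z' z = compress J0 Z' z + compress (- J0) Z' z"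
    and Cs: "\<And>z. C' z = compress (- J0) C' z"
    and rot: "\<And>z. z \<in> coord_space J0 \<Longrightarrow> to_real (Z' z) = block_matrix 0 (- diag_matrix \<phi>) (diag_matrix \<phi>) 0 *v to_real z"
    and spec: "\<forall>\<mu>\<in>spectrum_on (- J0) Z'. Re \<mu> < 0"
    and ker: "\<And>z. z \<in> coord_space J0 \<Longrightarrow> Z' z = 0 \<Longrightarrow> coord_proj J0 \<zeta>' \<bullet> z = 0"
    using normal_form unfolding normal_form_def Let_def J0_def[symmetric] by blast+
  have Zl: "linear Z'" and Cl: "linear C'" using G by (auto simp: gaussian_qms_def)
  note char = invariant_state_char[OF G Zs Cs rot spec ker]
  \<comment> \<open>The displacement is read off from the normal form before any state is
    considered, so one Weyl operator serves all invariant states.\<close>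
  define u where "u = displacement J0 \<phi> \<zeta>'"
  have u: "u \<in> coord_space J0" unfolding u_def by (rule displacement_mem)
  \<comment> \<open>One invariant state of the representative is fixed in order to exhibit the
    Gaussian factor as its partial trace.\<close>
  obtain \<rho>1 where \<rho>1: "normal_invariant_state (occ UNIV) T' \<rho>1"
    using invariant conj_class_invariant[OF _ _ representative] gaussian G unfolding gaussian_qms_def by blast
  have \<rho>1d: "\<rho>1 \<in> density_ops UNIV" and \<rho>1U: "normal_invariant_state UNIV T' \<rho>1" using \<rho>1 by (simp_all add: normal_invariant_state_def)
  obtain \<rho>_inf where \<rho>_inf: "\<rho>_inf \<in> density_ops (occ (- J0))"
    "\<And>w. w \<in> coord_space (- J0) \<Longrightarrow> tr (occ (- J0)) (\<rho>_inf \<circ> weyl (- J0) w) = tr UNIV (\<rho>1 \<circ> weyl UNIV w)"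
    using partial_trace[OF \<rho>1d] by blast
  define \<gamma> where "\<gamma> w = exp (- complex_of_real (integral {0..} (\<lambda>s. lin_exp (compress (- J0) Z') s w \<bullet> C' (lin_exp (compress (- J0) Z') s w)) / 2)
      + \<i> * complex_of_real (integral {0..} (\<lambda>s. coord_proj (- J0) \<zeta>' \<bullet> lin_exp (compress (- J0) Z') s w)))" for w
  have inf_char: "tr (occ (- J0)) (\<rho>_inf \<circ> weyl (- J0) w) = \<gamma> w" if "w \<in> coord_space (- J0)" for w
    unfolding \<rho>_inf(2)[OF that] \<gamma>_def by (rule char(3)[OF _ _ _ \<rho>1U that])
  have "gaussian_state J1 m_inf \<Sigma>_inf \<rho>_inf"
    unfolding gaussian_state_def J1
  proof (intro conjI ballI \<rho>_inf(1))
    fix w assume w: "w \<in> coord_space (- J0)"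
    \<comment> \<open>The mean enters the exponent of a Gaussian state with a minus sign, the drift
      enters the evolution with a plus sign; hence the sign of \<open>m_inf\<close>.\<close>
    have mean: "m_inf \<bullet> w = - integral {0..} (\<lambda>s. \<zeta>m \<bullet> lin_exp Zm s w)"
      using integral_lin_exp_adjoint[OF Zl spec, of "\<lambda>_. \<zeta>m" "norm \<zeta>m" w]
      by (simp add: m_inf_def Zm_def J1 \<zeta>m_def)
    have dec: "exp_decay (\<lambda>t. lin_exp Zm t w)" unfolding Zm_def J1 by (rule lin_exp_decay[OF Zl spec w])
    obtain K where K: "\<And>t. t \<ge> 0 \<Longrightarrow> norm (lin_exp Zm t w) \<le> K" using exp_decay_bounded[OF dec] by blast
    obtain M where M: "M > 0" "\<And>x. norm (C' x) \<le> M * norm x" using linear_bounded_pos[OF Cl] by blast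
    have CC: "Cm = C'" using Cs by (auto simp: Cm_def J1)
    have CK: "norm (C' (lin_exp Zm t w)) \<le> M * K" if "t \<ge> 0" for t
      using M(2)[of "lin_exp Zm t w"] mult_left_mono[OF K[OF that], of M] M(1) by linarith
    have Zml: "linear Zm" unfolding Zm_def by (rule compress_linear[OF Zl])
    have Cc: "continuous_on {0..} (\<lambda>t. C' (lin_exp Zm t w))"
      by (rule continuous_on_compose2[OF linear_continuous_on[OF linear_conv_bounded_linear[THEN iffD1, OF Cl]] lin_exp_continuous[OF Zml]]) auto
    have Cmem: "C' x \<in> coord_space (- J0)" for x using Cs compress_mem by metis
    have "w \<bullet> \<Sigma>_inf w = integral {0..} (\<lambda>s. C' (lin_exp Zm s w) \<bullet> lin_exp Zm s w)"
      using integral_lin_exp_adjoint[OF Zl spec, of "\<lambda>s. C' (lin_exp Zm s w)" "M * K" w] Cmem Cc CK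
      by (simp add: \<Sigma>_inf_def CC Zm_def J1 inner_commute)
    then have cov: "w \<bullet> \<Sigma>_inf w = integral {0..} (\<lambda>s. lin_exp Zm s w \<bullet> C' (lin_exp Zm s w))"
      by (simp add: inner_commute)
    show "tr (occ (- J0)) (\<rho>_inf \<circ> weyl (- J0) w) = exp (- \<i> * complex_of_real (m_inf \<bullet> w) - complex_of_real (w \<bullet> \<Sigma>_inf w / 2))"
      unfolding inf_char[OF w] \<gamma>_def mean cov by (simp add: Zm_def \<zeta>m_def J1)
  qed
  moreover have "\<exists>\<omega>\<in>density_ops (occ J0). commutes_with (occ J0) \<omega> (hamiltonian J0 \<phi>) \<and>
      \<rho> = tensor_op J0 (adj_op (occ J0) (weyl J0 u) \<circ> \<omega> \<circ> weyl J0 u) \<rho>_inf"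
    if \<rho>: "normal_invariant_state (occ UNIV) T' \<rho>" for \<rho>
  proof -
    have \<rho>d: "\<rho> \<in> density_ops UNIV" and \<rho>U: "normal_invariant_state UNIV T' \<rho>" using \<rho> by (simp_all add: normal_invariant_state_def)
    obtain \<sigma> where \<sigma>: "\<sigma> \<in> density_ops (occ J0)"
      "\<And>z. z \<in> coord_space J0 \<Longrightarrow> tr (occ J0) (\<sigma> \<circ> weyl J0 z) = tr UNIV (\<rho> \<circ> weyl UNIV z)"
      using partial_trace[OF \<rho>d] by blast
    obtain \<omega> where \<omega>: "\<omega> \<in> density_ops (occ J0)" "adj_op (occ J0) (weyl J0 u) \<circ> \<omega> \<circ> weyl J0 u = \<sigma>"
      "\<And>z. z \<in> coord_space J0 \<Longrightarrow> tr (occ J0) (\<omega> \<circ> weyl J0 z) = exp (2 * \<i> * complex_of_real (Im (hprod u z))) * tr (occ J0) (\<sigma> \<circ> weyl J0 z)"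
      using weyl_conj_density[OF \<sigma>(1) u] by blast
    \<comment> \<open>Displacing \<sigma> by \<open>u\<close> adds exactly the phase with which the
      characteristic function is constant along the rotation.\<close>
    have "commutes_with (occ J0) \<omega> (hamiltonian J0 \<phi>)"
    proof (rule commutes_with_hamiltonian[OF \<omega>(1)])
      show "tr (occ J0) (\<omega> \<circ> weyl J0 (rotate_modes J0 \<phi> t z)) = tr (occ J0) (\<omega> \<circ> weyl J0 z)" if z: "z \<in> coord_space J0" for t z
        unfolding \<omega>(3)[OF z] \<omega>(3)[OF rotate_modes_mem] \<sigma>(2)[OF z] \<sigma>(2)[OF rotate_modes_mem] u_def
        by (rule char(1)[OF _ _ _ \<rho>U z])
    qed
    \<comment> \<open>The factor on the decaying modes is the same for every invariant state,
      because its characteristic function \<open>\<gamma>\<close> depends on the normal form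
      only.\<close>
    moreover have "\<rho> = tensor_op J0 \<sigma> \<rho>_inf"
    proof (rule density_eq_tensor_op[OF \<rho>d \<sigma>(1) \<rho>_inf(1)])
      fix z w :: "'n cspace" assume z: "z \<in> coord_space J0" and w: "w \<in> coord_space (- J0)"
      show "tr UNIV (\<rho> \<circ> weyl UNIV (z + w)) = tr (occ J0) (\<sigma> \<circ> weyl J0 z) * tr (occ (- J0)) (\<rho>_inf \<circ> weyl (- J0) w)"
        unfolding \<sigma>(2)[OF z] inf_char[OF w] \<gamma>_def by (rule char(2)[OF _ _ _ \<rho>U z w])
    qed
    ultimately show ?thesis using \<omega>(1,2) by metis
  qed
  ultimately show ?thesis using u by blast
qed

end
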